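(* Let $(R,\mathfrak m)$ be a Cohen-Macaulay local ring with $\dim R=1$ possessing a canonical module, let $I$ be a canonical ideal of $R$ containing a parameter ideal $(a)$ as a reduction, and set $K=\frac{I}{a}=\{x/a\mid x\in I\}\subseteq\mathrm Q(R)$, $S=R[K]$ and $\mathfrak c=R:S$. Let $n\ge1$ be an integer and set $L=S\times K$. Then the following conditions are equivalent. (1) $R$ is an $n$-Goto ring and $\mu_R(K^2/K)=1$. (2) The fiber product $A=R\times_{R/\mathfrak c}R$ is an $n$-Goto ring and $\mu_A(L^2/L)=1$. (3) The idealization $A=R\ltimes\mathfrak c$ is an $n$-Goto ring and $\mu_A(L^2/L)=1$.
   Context: $\mathrm Q(R)$ is the total ring of fractions of $R$; $X:Y=\{z\in\mathrm Q(R)\mid zY\subseteq X\}$. $\mu$ denotes the minimal number of generators. A canonical ideal is an ideal $I\neq R$ isomorphic to the canonical module $\mathrm K_R$; $(a)\subseteq I$ is a reduction of $I$ if $I^{r+1}=aI^r$ for some $r\ge 0$. Quasi-trivial extensions: for a commutative ring $C$, a $C$-module $N$ which is an ideal of $C$ (or $N=C$), and $\alpha\in C$, $C\overset{\alpha}{\ltimes}N$ is the additive group $C\oplus N$ with multiplication $(b,x)(c,y)=(bc,\,by+cx+\alpha xy)$. For $\alpha=0$ this is the idealization $C\ltimes N$; for $\alpha=1$ one has $C\overset{1}{\ltimes}N\cong C\times_{C/N}C$ (fiber product of two copies of the canonical surjection $C\to C/N$) via $(b,x)\mapsto(b,b+x)$. For $\alpha\in\{0,1\}$ the ring $R\overset{\alpha}{\ltimes}\mathfrak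 c$ is a subring of $S\overset{\alpha}{\ltimes}S$, and $L=S\times K$ is regarded as an $(R\overset{\alpha}{\ltimes}\mathfrak c)$-submodule of $S\overset{\alpha}{\ltimes}S$; $L^2$ is computed in $S\overset{\alpha}{\ltimes}S$. In (3) one takes $\alpha=0$ and in (2) $\alpha=1$, identifying $R\times_{R/\mathfrak c}R$ with $R\overset{1}{\ltimes}\mathfrak c$. For $n\ge0$, a one-dimensional Cohen-Macaulay local ring $A$ with a canonical ideal $I_A$ is an $n$-Goto ring if there is a parameter ideal $(b)$ with $b\in I_A$, $I_A^3=bI_A^2$ and $\ell_A(I_A^2/bI_A)=n$; this does not depend on the choice of $I_A$ or of $b$. ($n$-Goto rings are local by definition.) *)

theory Defs
  imports "HOL-Algebra.Module" "HOL-Algebra.Ideal_Product" "HOL-Algebra.Generated_Rings"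
    "HOL-Algebra.Ring_Divisibility" "HOL-Algebra.Chinese_Remainder" "HOL-Library.Extended_Nat"
begin

section \<open>Modules: subquotients, length, number of generators\<close>

text \<open>
  The record type \<^type>\<open>module\<close> extends that of rings; the fields \<open>mult\<close> and \<open>one\<close> play no role for
  modules and are left \<^term>\<open>undefined\<close> below whenever there is no natural choice for them.

  \<open>self_module B\<close> is \<open>B\<close> acting on itself by multiplication. It also serves as the \<open>A\<close>-module \<open>B\<close>
  for a subring \<open>A\<close> of \<open>B\<close>: the scalar ring is a separate argument of everything below.
\<close>

definition self_module :: "('a, 'm) ring_scheme \<Rightarrow> ('a, 'a) module" where
  "self_module B = \<lparr> carrier = carrier B, monoid.mult = monoid.mult B, one = one B,
                     ring.zero = ring.zero B, ring.add = ring.add B, smult = monoid.mult B \<rparr>"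

definition quot_mod :: "('a, 'b) module \<Rightarrow> 'b set \<Rightarrow> ('a, 'b set) module" where
  "quot_mod M N = \<lparr> carrier = a_rcosets\<^bsub>M\<^esub> N, monoid.mult = undefined, one = undefined,
                    ring.zero = N, ring.add = (\<lambda>X Y. X <+>\<^bsub>M\<^esub> Y),
                    smult = (\<lambda>a X. N <+>\<^bsub>M\<^esub> ((\<lambda>x. a \<odot>\<^bsub>M\<^esub> x) ` X)) \<rparr>"

text \<open>\<open>X/Y\<close> for subsets \<open>Y \<subseteq> X\<close> of a ring \<open>B\<close> that are submodules over a subring of \<open>B\<close>.\<close>

definition subquot :: "('a, 'm) ring_scheme \<Rightarrow> 'a set \<Rightarrow> 'a set \<Rightarrow> ('a, 'a set) module" where
  "subquot B X Y = quot_mod ((self_module B)\<lparr>carrier := X\<rparr>) Y"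

definition restrict_scalars :: "('c \<Rightarrow> 'a) \<Rightarrow> ('a, 'b) module \<Rightarrow> ('c, 'b) module" where
  "restrict_scalars \<phi> M = \<lparr> carrier = carrier M, monoid.mult = monoid.mult M, one = one M,
                            ring.zero = ring.zero M, ring.add = ring.add M, smult = (\<lambda>c. smult M (\<phi> c)) \<rparr>"

definition mod_span :: "('a, 'm) ring_scheme \<Rightarrow> ('a, 'b) module \<Rightarrow> 'b set \<Rightarrow> 'b set" where
  "mod_span R M X = \<Inter> {N. submodule N R M \<and> X \<subseteq> N}"

definition fin_gen :: "('a, 'm) ring_scheme \<Rightarrow> ('a, 'b) module \<Rightarrow> bool" where
  "fin_gen R M \<longleftrightarrow> (\<exists>X. finite X \<and> X \<subseteq> carrier M \<and> mod_span R M X = carrier M)"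

definition min_gens :: "('a, 'm) ring_scheme \<Rightarrow> ('a, 'b) module \<Rightarrow> enat" where
  "min_gens R M = Inf {enat (card X) | X. finite X \<and> X \<subseteq> carrier M \<and> mod_span R M X = carrier M}"

definition mod_length :: "('a, 'm) ring_scheme \<Rightarrow> ('a, 'b) module \<Rightarrow> enat" where
  "mod_length R M =
     Sup {enat k | k. \<exists>N. (\<forall>i\<le>k. submodule (N i) R M) \<and> (\<forall>i<k. N i \<subset> N (Suc i))}"


section \<open>Cohen-Macaulay local rings and depth\<close>

definition noetherian_local_ring :: "('a, 'm) ring_scheme \<Rightarrow> bool" where
  "noetherian_local_ring R \<longleftrightarrow> cring R \<and> noetherian_ring R \<and> (\<exists>!m. maximalideal m R)"

definition max_ideal :: "('a, 'm) ring_scheme \<Rightarrow> 'a set" where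
  "max_ideal R = (THE m. maximalideal m R)"

definition krull_dim :: "('a, 'm) ring_scheme \<Rightarrow> enat" where
  "krull_dim R =
     Sup {enat k | k. \<exists>p. (\<forall>i\<le>k. primeideal (p i) R) \<and> (\<forall>i<k. p i \<subset> p (Suc i))}"

text \<open>The submodule \<open>(x\<^sub>1, \<dots>, x\<^sub>k)M\<close>.\<close>

definition list_smult :: "('a, 'm) ring_scheme \<Rightarrow> 'a list \<Rightarrow> ('a, 'b) module \<Rightarrow> 'b set" where
  "list_smult R xs M = mod_span R M {x \<odot>\<^bsub>M\<^esub> v | x v. x \<in> set xs \<and> v \<in> carrier M}"

text \<open>\<open>x\<^sub>k\<^sub>+\<^sub>1\<close> is a nonzerodivisor on \<open>M/(x\<^sub>1, \<dots>, x\<^sub>k)M\<close> for all \<open>k\<close>, and \<open>M/(x\<^sub>1, \<dots>, x\<^sub>l)M \<noteq> 0\<close>.\<close>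

definition regular_sequence :: "('a, 'm) ring_scheme \<Rightarrow> ('a, 'b) module \<Rightarrow> 'a list \<Rightarrow> bool" where
  "regular_sequence R M xs \<longleftrightarrow>
     set xs \<subseteq> carrier R \<and>
     (\<forall>k<length xs. \<forall>v\<in>carrier M.
        (xs ! k) \<odot>\<^bsub>M\<^esub> v \<in> list_smult R (take k xs) M \<longrightarrow> v \<in> list_smult R (take k xs) M) \<and>
     list_smult R xs M \<noteq> carrier M"

definition depth :: "('a, 'm) ring_scheme \<Rightarrow> ('a, 'b) module \<Rightarrow> enat" where
  "depth R M = Sup {enat (length xs) | xs. set xs \<subseteq> max_ideal R \<and> regular_sequence R M xs}"

definition cohen_macaulay_local :: "('a, 'm) ring_scheme \<Rightarrow> bool" where
  "cohen_macaulay_local R \<longleftrightarrow> noetherian_local_ring R \<and> depth R (self_module R) = krull_dim R"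


section \<open>Ext and canonical modules\<close>

definition mod_hom ::
    "('a, 'm) ring_scheme \<Rightarrow> ('a, 'b) module \<Rightarrow> ('a, 'c) module \<Rightarrow> ('b \<Rightarrow> 'c) set" where
  "mod_hom R M N =
     {h \<in> carrier M \<rightarrow> carrier N.
        (\<forall>x\<in>carrier M. \<forall>y\<in>carrier M. h (x \<oplus>\<^bsub>M\<^esub> y) = h x \<oplus>\<^bsub>N\<^esub> h y) \<and>
        (\<forall>a\<in>carrier R. \<forall>x\<in>carrier M. h (a \<odot>\<^bsub>M\<^esub> x) = a \<odot>\<^bsub>N\<^esub> h x)}"

definition hom_module ::
    "('a, 'm) ring_scheme \<Rightarrow> ('a, 'b) module \<Rightarrow> ('a, 'c) module \<Rightarrow> ('a, 'b \<Rightarrow> 'c) module" where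
  "hom_module R M N =
     \<lparr> carrier = mod_hom R M N \<inter> extensional (carrier M), monoid.mult = undefined, one = undefined,
       ring.zero = (\<lambda>x\<in>carrier M. \<zero>\<^bsub>N\<^esub>),
       ring.add = (\<lambda>f g. \<lambda>x\<in>carrier M. f x \<oplus>\<^bsub>N\<^esub> g x),
       smult = (\<lambda>a f. \<lambda>x\<in>carrier M. a \<odot>\<^bsub>N\<^esub> f x) \<rparr>"

definition free_mod :: "('a, 'm) ring_scheme \<Rightarrow> nat \<Rightarrow> ('a, nat \<Rightarrow> 'a) module" where
  "free_mod R n =
     \<lparr> carrier = {..<n} \<rightarrow>\<^sub>E carrier R, monoid.mult = undefined, one = undefined,
       ring.zero = (\<lambda>i\<in>{..<n}. \<zero>\<^bsub>R\<^esub>),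
       ring.add = (\<lambda>f g. \<lambda>i\<in>{..<n}. f i \<oplus>\<^bsub>R\<^esub> g i),
       smult = (\<lambda>a f. \<lambda>i\<in>{..<n}. a \<otimes>\<^bsub>R\<^esub> f i) \<rparr>"

text \<open>
  A resolution of \<open>N\<close> by free modules of finite ranks \<open>r 0, r 1, \<dots>\<close>, with differentials
  \<open>d i : R^(r (i + 1)) \<rightarrow> R^(r i)\<close> and augmentation \<open>e : R^(r 0) \<rightarrow> N\<close>. Over a noetherian ring every
  finitely generated module has one.
\<close>

definition free_resolution ::
    "('a, 'm) ring_scheme \<Rightarrow> ('a, 'b) module \<Rightarrow> (nat \<Rightarrow> nat) \<Rightarrow>
     (nat \<Rightarrow> (nat \<Rightarrow> 'a) \<Rightarrow> (nat \<Rightarrow> 'a)) \<Rightarrow> ((nat \<Rightarrow> 'a) \<Rightarrow> 'b) \<Rightarrow> bool" where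
  "free_resolution R N r d e \<longleftrightarrow>
     e \<in> mod_hom R (free_mod R (r 0)) N \<and>
     (\<forall>i. d i \<in> mod_hom R (free_mod R (r (Suc i))) (free_mod R (r i))) \<and>
     e ` carrier (free_mod R (r 0)) = carrier N \<and>
     d 0 ` carrier (free_mod R (r 1)) = {x \<in> carrier (free_mod R (r 0)). e x = \<zero>\<^bsub>N\<^esub>} \<and>
     (\<forall>i. d (Suc i) ` carrier (free_mod R (r (Suc (Suc i)))) =
          {x \<in> carrier (free_mod R (r (Suc i))). d i x = \<zero>\<^bsub>free_mod R (r i)\<^esub>})"

text \<open>
  \<open>Ext R r d M i\<close> is the \<open>i\<close>-th cohomology module of the complex \<open>Hom\<^sub>R(R^(r \<bullet>), M)\<close>, that is
  \<open>Ext\<^sup>i\<^sub>R(N, M)\<close> computed from a free resolution \<open>(r, d, e)\<close> of \<open>N\<close>. Up to isomorphism it does not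
  depend on the resolution, so properties of \<open>Ext\<^sup>i\<^sub>R(N, M)\<close> are stated for all resolutions of \<open>N\<close>.
\<close>

definition Ext_cocycles ::
    "('a, 'm) ring_scheme \<Rightarrow> (nat \<Rightarrow> nat) \<Rightarrow> (nat \<Rightarrow> (nat \<Rightarrow> 'a) \<Rightarrow> (nat \<Rightarrow> 'a)) \<Rightarrow>
     ('a, 'b) module \<Rightarrow> nat \<Rightarrow> ((nat \<Rightarrow> 'a) \<Rightarrow> 'b) set" where
  "Ext_cocycles R r d M i =
     {f \<in> carrier (hom_module R (free_mod R (r i)) M).
        compose (carrier (free_mod R (r (Suc i)))) f (d i) =
          \<zero>\<^bsub>hom_module R (free_mod R (r (Suc i))) M\<^esub>}"

definition Ext_coboundaries ::
    "('a, 'm) ring_scheme \<Rightarrow> (nat \<Rightarrow> nat) \<Rightarrow> (nat \<Rightarrow> (nat \<Rightarrow> 'a) \<Rightarrow> (nat \<Rightarrow> 'a)) \<Rightarrow>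
     ('a, 'b) module \<Rightarrow> nat \<Rightarrow> ((nat \<Rightarrow> 'a) \<Rightarrow> 'b) set" where
  "Ext_coboundaries R r d M i =
     (case i of
        0 \<Rightarrow> {\<zero>\<^bsub>hom_module R (free_mod R (r 0)) M\<^esub>}
      | Suc j \<Rightarrow> (\<lambda>f. compose (carrier (free_mod R (r i))) f (d j)) `
                   carrier (hom_module R (free_mod R (r j)) M))"

definition Ext ::
    "('a, 'm) ring_scheme \<Rightarrow> (nat \<Rightarrow> nat) \<Rightarrow> (nat \<Rightarrow> (nat \<Rightarrow> 'a) \<Rightarrow> (nat \<Rightarrow> 'a)) \<Rightarrow>
     ('a, 'b) module \<Rightarrow> nat \<Rightarrow> ('a, ((nat \<Rightarrow> 'a) \<Rightarrow> 'b) set) module" where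
  "Ext R r d M i =
     quot_mod ((hom_module R (free_mod R (r i)) M)\<lparr>carrier := Ext_cocycles R r d M i\<rparr>)
              (Ext_coboundaries R r d M i)"

text \<open>
  \<open>Ext\<^sup>i\<^sub>R(N, M) = 0\<close> for all finitely generated \<open>N\<close> and all large \<open>i\<close>. The carrier type chosen for \<open>N\<close>
  accommodates all modules \<open>R^n/U\<close>, hence every finitely generated module up to isomorphism. An
  injective resolution would have to be sought among modules over types not known in advance.
\<close>

definition finite_injective_dimension :: "('a, 'm) ring_scheme \<Rightarrow> ('a, 'b) module \<Rightarrow> bool" where
  "finite_injective_dimension R M \<longleftrightarrow>
     (\<exists>t. \<forall>i>t. \<forall>(N :: ('a, (nat \<Rightarrow> 'a) set) module) r d e.
        module R N \<and> fin_gen R N \<and> free_resolution R N r d e \<longrightarrow>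
        carrier (Ext R r d M i) = {\<zero>\<^bsub>Ext R r d M i\<^esub>})"

definition residue_module :: "('a, 'm) ring_scheme \<Rightarrow> ('a, 'a set) module" where
  "residue_module R = quot_mod (self_module R) (max_ideal R)"

text \<open>
  The type of \<open>M\<close> is the dimension of \<open>Ext\<^sup>t\<^sub>R(k, M)\<close> over the residue field \<open>k\<close>, for \<open>t = depth M\<close>. This
  is the \<open>R\<close>-length, as the maximal ideal annihilates \<open>Ext\<^sup>t\<^sub>R(k, M)\<close>.
\<close>

definition has_type :: "('a, 'm) ring_scheme \<Rightarrow> ('a, 'b) module \<Rightarrow> enat \<Rightarrow> bool" where
  "has_type R M s \<longleftrightarrow>
     (\<forall>r d e. free_resolution R (residue_module R) r d e \<longrightarrow>
        mod_length R (Ext R r d M (the_enat (depth R M))) = s)"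

text \<open>
  A maximal Cohen-Macaulay module of finite injective dimension and of type one (Bruns and Herzog,
  Cohen-Macaulay Rings, Definition 3.3.1).
\<close>

definition canonical_module :: "('a, 'm) ring_scheme \<Rightarrow> ('a, 'b) module \<Rightarrow> bool" where
  "canonical_module R M \<longleftrightarrow>
     cohen_macaulay_local R \<and> module R M \<and> fin_gen R M \<and> depth R M = krull_dim R \<and>
     finite_injective_dimension R M \<and> has_type R M 1"

text \<open>
  Canonical modules are unique up to isomorphism, and a module isomorphic to one is again one; so
  an ideal is isomorphic to \<open>K\<^sub>R\<close> precisely when it is itself a canonical module.
\<close>

definition canonical_ideal :: "('a, 'm) ring_scheme \<Rightarrow> 'a set \<Rightarrow> bool" where
  "canonical_ideal R I \<longleftrightarrow>
     ideal I R \<and> I \<noteq> carrier R \<and> canonical_module R ((self_module R)\<lparr>carrier := I\<rparr>)"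


section \<open>Reductions and \<open>n\<close>-Goto rings\<close>

primrec ideal_power :: "('a, 'm) ring_scheme \<Rightarrow> 'a set \<Rightarrow> nat \<Rightarrow> 'a set" where
  "ideal_power R I 0 = carrier R"
| "ideal_power R I (Suc k) = ideal_prod R I (ideal_power R I k)"

text \<open>
  For a one-dimensional noetherian local ring \<open>R\<close> with maximal ideal \<open>m\<close>: \<open>(b)\<close> is a parameter ideal,
  that is, \<open>b \<in> m\<close> and \<open>(b)\<close> is \<open>m\<close>-primary.
\<close>

definition is_parameter :: "('a, 'm) ring_scheme \<Rightarrow> 'a \<Rightarrow> bool" where
  "is_parameter R b \<longleftrightarrow>
     b \<in> max_ideal R \<and> (\<forall>x\<in>max_ideal R. \<exists>k::nat. x [^]\<^bsub>R\<^esub> k \<in> PIdl\<^bsub>R\<^esub> b)"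

definition is_reduction :: "('a, 'm) ring_scheme \<Rightarrow> 'a \<Rightarrow> 'a set \<Rightarrow> bool" where
  "is_reduction R a I \<longleftrightarrow>
     PIdl\<^bsub>R\<^esub> a \<subseteq> I \<and>
     (\<exists>r. ideal_power R I (Suc r) = ideal_prod R (PIdl\<^bsub>R\<^esub> a) (ideal_power R I r))"

definition n_goto :: "nat \<Rightarrow> ('a, 'm) ring_scheme \<Rightarrow> bool" where
  "n_goto n A \<longleftrightarrow>
     cohen_macaulay_local A \<and> krull_dim A = 1 \<and>
     (\<exists>I b. canonical_ideal A I \<and> is_parameter A b \<and> b \<in> I \<and>
        ideal_power A I 3 = ideal_prod A (PIdl\<^bsub>A\<^esub> b) (ideal_power A I 2) \<and>
        mod_length A (subquot A (ideal_power A I 2) (ideal_prod A (PIdl\<^bsub>A\<^esub> b) I)) = enat n)"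


section \<open>Total rings of fractions\<close>

definition regular_element :: "('a, 'm) ring_scheme \<Rightarrow> 'a \<Rightarrow> bool" where
  "regular_element R s \<longleftrightarrow>
     s \<in> carrier R \<and> (\<forall>x\<in>carrier R. s \<otimes>\<^bsub>R\<^esub> x = \<zero>\<^bsub>R\<^esub> \<longrightarrow> x = \<zero>\<^bsub>R\<^esub>)"

text \<open>
  \<open>Q\<close> is the total ring of fractions of \<open>R\<close>, where \<open>R\<close> is identified with its image in \<open>Q\<close>:
  \<^term>\<open>id \<in> ring_hom R Q\<close> says that \<open>R\<close> is a subring of \<open>Q\<close>.
\<close>

definition total_ring_of_fractions :: "('a, 'm) ring_scheme \<Rightarrow> ('a, 'n) ring_scheme \<Rightarrow> bool" where
  "total_ring_of_fractions R Q \<longleftrightarrow>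
     cring R \<and> cring Q \<and> id \<in> ring_hom R Q \<and>
     (\<forall>s. regular_element R s \<longrightarrow> s \<in> Units Q) \<and>
     (\<forall>q\<in>carrier Q. \<exists>x s. x \<in> carrier R \<and> regular_element R s \<and> q = x \<otimes>\<^bsub>Q\<^esub> inv\<^bsub>Q\<^esub> s)"

definition colon :: "('a, 'm) ring_scheme \<Rightarrow> 'a set \<Rightarrow> 'a set \<Rightarrow> 'a set" where
  "colon Q X Y = {z \<in> carrier Q. \<forall>y\<in>Y. z \<otimes>\<^bsub>Q\<^esub> y \<in> X}"


section \<open>Quasi-trivial extensions and fiber products\<close>

definition quasi_trivial_extension :: "('a, 'm) ring_scheme \<Rightarrow> 'a \<Rightarrow> 'a set \<Rightarrow> ('a \<times> 'a) ring" where
  "quasi_trivial_extension C \<alpha> N =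
     \<lparr> carrier = carrier C \<times> N,
       monoid.mult = (\<lambda>(b, x) (c, y).
         (b \<otimes>\<^bsub>C\<^esub> c, b \<otimes>\<^bsub>C\<^esub> y \<oplus>\<^bsub>C\<^esub> c \<otimes>\<^bsub>C\<^esub> x \<oplus>\<^bsub>C\<^esub> \<alpha> \<otimes>\<^bsub>C\<^esub> (x \<otimes>\<^bsub>C\<^esub> y))),
       one = (\<one>\<^bsub>C\<^esub>, \<zero>\<^bsub>C\<^esub>),
       ring.zero = (\<zero>\<^bsub>C\<^esub>, \<zero>\<^bsub>C\<^esub>),
       ring.add = (\<lambda>(b, x) (c, y). (b \<oplus>\<^bsub>C\<^esub> c, x \<oplus>\<^bsub>C\<^esub> y)) \<rparr>"

definition idealization :: "('a, 'm) ring_scheme \<Rightarrow> 'a set \<Rightarrow> ('a \<times> 'a) ring" where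
  "idealization C N = quasi_trivial_extension C \<zero>\<^bsub>C\<^esub> N"

definition fiber_product ::
    "('a, 'm) ring_scheme \<Rightarrow> ('a \<Rightarrow> 'c) \<Rightarrow> ('b, 'n) ring_scheme \<Rightarrow> ('b \<Rightarrow> 'c) \<Rightarrow> ('a \<times> 'b) ring" where
  "fiber_product B f C g =
     (RDirProd B C)\<lparr>carrier := {(x, y). x \<in> carrier B \<and> y \<in> carrier C \<and> f x = g y}\<rparr>"

text \<open>\<open>C \<times>\<^bsub>C/N\<^esub> C\<close>, formed with two copies of the canonical surjection \<open>C \<rightarrow> C/N\<close>.\<close>

definition double_fiber_product :: "('a, 'm) ring_scheme \<Rightarrow> 'a set \<Rightarrow> ('a \<times> 'a) ring" where
  "double_fiber_product C N = fiber_product C (\<lambda>x. N +>\<^bsub>C\<^esub> x) C (\<lambda>x. N +>\<^bsub>C\<^esub> x)"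

text \<open>The identification of \<open>C \<times>\<^bsub>C/N\<^esub> C\<close> with the quasi-trivial extension for \<open>\<alpha> = 1\<close>.\<close>

definition fiber_to_quasi :: "('a, 'm) ring_scheme \<Rightarrow> 'a \<times> 'a \<Rightarrow> 'a \<times> 'a" where
  "fiber_to_quasi C = (\<lambda>(x, y). (x, y \<ominus>\<^bsub>C\<^esub> x))"

lemma fiber_to_quasi_iso:
  assumes "cring C" "ideal N C"
  shows "fiber_to_quasi C \<in> ring_iso (double_fiber_product C N) (quasi_trivial_extension C \<one>\<^bsub>C\<^esub> N)"
    (is "_ \<in> ring_iso ?F ?T")
proof -
  interpret C: cring C by fact
  interpret N: ideal N C by fact
  have carr: "carrier ?F = {(x, y). x \<in> carrier C \<and> y \<in> carrier C \<and> y \<ominus>\<^bsub>C\<^esub> x \<in> N}"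
    unfolding double_fiber_product_def fiber_product_def
    using C.quotient_eq_iff_same_a_r_cos[OF assms(2)] by (auto; metis)
  have ops: "x \<otimes>\<^bsub>?F\<^esub> y = (fst x \<otimes>\<^bsub>C\<^esub> fst y, snd x \<otimes>\<^bsub>C\<^esub> snd y)"
    "x \<oplus>\<^bsub>?F\<^esub> y = (fst x \<oplus>\<^bsub>C\<^esub> fst y, snd x \<oplus>\<^bsub>C\<^esub> snd y)" "\<one>\<^bsub>?F\<^esub> = (\<one>\<^bsub>C\<^esub>, \<one>\<^bsub>C\<^esub>)" for x y
    unfolding double_fiber_product_def fiber_product_def RDirProd_def DirProd_def
    by (auto simp: monoid.defs case_prod_beta)
  have tcarr: "carrier ?T = carrier C \<times> N"
    by (simp add: quasi_trivial_extension_def)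
  have "fiber_to_quasi C \<in> ring_hom ?F ?T"
  proof (rule ring_hom_memI)
    fix p assume "p \<in> carrier ?F"
    then show "fiber_to_quasi C p \<in> carrier ?T"
      unfolding carr tcarr by (auto simp: fiber_to_quasi_def)
  next
    fix p q assume "p \<in> carrier ?F" "q \<in> carrier ?F"
    then obtain x y u v where pq: "p = (x, y)" "q = (u, v)"
      and mem: "x \<in> carrier C" "y \<in> carrier C" "u \<in> carrier C" "v \<in> carrier C"
      unfolding carr by auto
    have "y \<otimes>\<^bsub>C\<^esub> v \<ominus>\<^bsub>C\<^esub> x \<otimes>\<^bsub>C\<^esub> u = x \<otimes>\<^bsub>C\<^esub> (v \<ominus>\<^bsub>C\<^esub> u) \<oplus>\<^bsub>C\<^esub> u \<otimes>\<^bsub>C\<^esub> (y \<ominus>\<^bsub>C\<^esub> x)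
        \<oplus>\<^bsub>C\<^esub> \<one>\<^bsub>C\<^esub> \<otimes>\<^bsub>C\<^esub> ((y \<ominus>\<^bsub>C\<^esub> x) \<otimes>\<^bsub>C\<^esub> (v \<ominus>\<^bsub>C\<^esub> u))"
      using mem by algebra
    then show "fiber_to_quasi C (p \<otimes>\<^bsub>?F\<^esub> q) = fiber_to_quasi C p \<otimes>\<^bsub>?T\<^esub> fiber_to_quasi C q"
      by (simp add: ops pq fiber_to_quasi_def quasi_trivial_extension_def)
    have "(y \<oplus>\<^bsub>C\<^esub> v) \<ominus>\<^bsub>C\<^esub> (x \<oplus>\<^bsub>C\<^esub> u) = (y \<ominus>\<^bsub>C\<^esub> x) \<oplus>\<^bsub>C\<^esub> (v \<ominus>\<^bsub>C\<^esub> u)"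
      using mem by algebra
    then show "fiber_to_quasi C (p \<oplus>\<^bsub>?F\<^esub> q) = fiber_to_quasi C p \<oplus>\<^bsub>?T\<^esub> fiber_to_quasi C q"
      by (simp add: ops pq fiber_to_quasi_def quasi_trivial_extension_def)
  next
    have "\<one>\<^bsub>C\<^esub> \<ominus>\<^bsub>C\<^esub> \<one>\<^bsub>C\<^esub> = \<zero>\<^bsub>C\<^esub>" by algebra
    then show "fiber_to_quasi C \<one>\<^bsub>?F\<^esub> = \<one>\<^bsub>?T\<^esub>"
      by (simp add: ops fiber_to_quasi_def quasi_trivial_extension_def)
  qed
  moreover have "bij_betw (fiber_to_quasi C) (carrier ?F) (carrier ?T)"
  proof (rule bij_betw_byWitness[where f' = "\<lambda>(x, z). (x, x \<oplus>\<^bsub>C\<^esub> z)"])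
    have 1: "x \<oplus>\<^bsub>C\<^esub> (y \<ominus>\<^bsub>C\<^esub> x) = y" if "x \<in> carrier C" "y \<in> carrier C" for x y
      using that by algebra
    have 2: "x \<oplus>\<^bsub>C\<^esub> z \<ominus>\<^bsub>C\<^esub> x = z" if "x \<in> carrier C" "z \<in> carrier C" for x z
      using that by algebra
    show "\<forall>p\<in>carrier ?F. (case fiber_to_quasi C p of (x, z) \<Rightarrow> (x, x \<oplus>\<^bsub>C\<^esub> z)) = p"
      unfolding carr fiber_to_quasi_def using 1 by auto
    show "\<forall>p\<in>carrier ?T. fiber_to_quasi C (case p of (x, z) \<Rightarrow> (x, x \<oplus>\<^bsub>C\<^esub> z)) = p"
      unfolding tcarr fiber_to_quasi_def using 2 N.Icarr by auto
    show "fiber_to_quasi C ` carrier ?F \<subseteq> carrier ?T"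
      unfolding carr tcarr fiber_to_quasi_def by auto
    show "(\<lambda>(x, z). (x, x \<oplus>\<^bsub>C\<^esub> z)) ` carrier ?T \<subseteq> carrier ?F"
      unfolding carr tcarr using 2 N.Icarr by auto
  qed
  ultimately show ?thesis unfolding ring_iso_def by blast
qed

end

theory Submission
  imports Defs
begin

text \<open>
  All rings live inside total rings of fractions. Over a one-dimensional Cohen-Macaulay local ring, an
  ideal \<open>J\<close> containing a parameter is canonical iff the socle \<open>(J : \<mm>)/J\<close> is simple. Such a \<open>J\<close> makes
  \<open>X \<mapsto> J : X\<close> a duality on fractional ideals, so that canonical fractional ideals agree up to units of
  \<open>Q(R)\<close>, and \<open>R\<close> is \<open>n\<close>-Goto iff \<open>K\<^sup>3 = K\<^sup>2\<close> and \<open>\<ell>(K\<^sup>2/K) = n\<close> for one canonical fractional ideal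
  \<open>K \<ni> 1\<close> with bounded powers.

  If \<open>S \<noteq> K\<close>, then \<open>S = K : \<cc>\<close> shows that \<open>L = S \<times> K\<close> is a canonical fractional ideal of the extension of \<open>R\<close>
  by \<open>\<cc>\<close>; moreover \<open>L\<^sup>3 = L\<^sup>2 = S \<times> S\<close>, and the submodules between \<open>L\<close> and \<open>L\<^sup>2\<close> are the \<open>S \<times> X\<close> with
  \<open>K \<subseteq> X \<subseteq> S\<close>. Hence (2) and (3) both say that \<open>S/K\<close> is nonzero and cyclic of length \<open>n\<close>. So does (1): \<open>K\<^sup>3 = K\<^sup>2\<close>
  forces \<open>K\<^sup>2 = S\<close>, and conversely \<open>K\<^sup>2 = S\<close> holds whenever \<open>S/K\<close> is nonzero and cyclic.
\<close>

section \<open>Submodules, lengths and generators\<close>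

text \<open>Canonical ideals are specified through Ext over arbitrary free resolutions, so the
  passage to a simple socle is built from chain conditions and Nakayama's lemma. Two facts carry it:
  a homomorphism into E/J from a suitable subquotient of A^n is induced by a vector, found by
  correction in simple steps; and Ext^1(k, J) is the socle of E/J, because \<open>a\<close> is
  invertible on E and annihilates k.

  The Goto condition asks for some canonical ideal and some parameter. Comparing two choices
  produces a unit q of Q(R) with K' = qK; boundedness of the powers of K, which the reduction
  supplies, forces q to fix K'^2.

  The duality theory is stated for any overring in which a parameter becomes invertible, so that it
  can be used twice: for R in Q(R), and for the extension ring inside Q x Q or inside the
  idealization of Q by itself. The case S = K is special: then \<open>\<cc>\<close> = R, and the
  fiber product is R x R, which is not local. Asking for exactly one generator rules it out, since
  L^2/L and K^2/K are then zero.\<close>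

lemma (in module) submodule_iff:
  "submodule H R M \<longleftrightarrow> H \<subseteq> carrier M \<and> \<zero>\<^bsub>M\<^esub> \<in> H \<and> (\<forall>x\<in>H. \<forall>y\<in>H. x \<oplus>\<^bsub>M\<^esub> y \<in> H) \<and>
     (\<forall>r\<in>carrier R. \<forall>x\<in>H. r \<odot>\<^bsub>M\<^esub> x \<in> H)" (is "_ \<longleftrightarrow> ?P")
proof
  assume H: "submodule H R M"
  then interpret S: submodule H R M .
  show ?P
    using submoduleE[OF H] S.subgroup_axioms S.one_closed by auto
next
  assume P: ?P
  show "submodule H R M"
  proof (rule submoduleI)
    fix x assume x: "x \<in> H"
    have "(\<ominus>\<^bsub>R\<^esub> \<one>\<^bsub>R\<^esub>) \<odot>\<^bsub>M\<^esub> x \<in> H" using P x by auto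
    moreover have "(\<ominus>\<^bsub>R\<^esub> \<one>\<^bsub>R\<^esub>) \<odot>\<^bsub>M\<^esub> x = \<ominus>\<^bsub>M\<^esub> x"
      using P x smult_l_minus[of "\<one>\<^bsub>R\<^esub>" x] by auto
    ultimately show "\<ominus>\<^bsub>M\<^esub> x \<in> H" by simp
  qed (use P in auto)
qed

context module
begin

text \<open>The one-step enlargement N + Rx behind the maximality arguments: a submodule maximal
  with some property is shown to be everything by adjoining one more element.\<close>

definition adjoin :: "'c set \<Rightarrow> 'c \<Rightarrow> 'c set" where
  "adjoin N x = {n \<oplus>\<^bsub>M\<^esub> r \<odot>\<^bsub>M\<^esub> x | n r. n \<in> N \<and> r \<in> carrier R}"

lemma submodule_adjoin:
  assumes "submodule N R M" "x \<in> carrier M"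
  shows "submodule (adjoin N x) R M" "N \<subseteq> adjoin N x" "x \<in> adjoin N x"
proof -
  note N = assms(1)[unfolded submodule_iff]
  have c: "n \<in> N \<Longrightarrow> n \<in> carrier M" for n using N by auto
  show 1: "N \<subseteq> adjoin N x"
  proof
    fix n assume n: "n \<in> N"
    then have "n = n \<oplus>\<^bsub>M\<^esub> \<zero>\<^bsub>R\<^esub> \<odot>\<^bsub>M\<^esub> x" using assms(2) c by simp
    then show "n \<in> adjoin N x" unfolding adjoin_def using n by blast
  qed
  have "x = \<zero>\<^bsub>M\<^esub> \<oplus>\<^bsub>M\<^esub> \<one>\<^bsub>R\<^esub> \<odot>\<^bsub>M\<^esub> x" using assms(2) by simp
  then show "x \<in> adjoin N x" unfolding adjoin_def using N R.one_closed by blast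
  show "submodule (adjoin N x) R M" unfolding submodule_iff
  proof (intro conjI ballI)
    show "adjoin N x \<subseteq> carrier M" unfolding adjoin_def using c assms(2) by auto
    show "\<zero>\<^bsub>M\<^esub> \<in> adjoin N x" using 1 N by auto
  next
    fix u v assume "u \<in> adjoin N x" "v \<in> adjoin N x"
    then obtain n r n' r' where *: "u = n \<oplus>\<^bsub>M\<^esub> r \<odot>\<^bsub>M\<^esub> x" "v = n' \<oplus>\<^bsub>M\<^esub> r' \<odot>\<^bsub>M\<^esub> x" "n \<in> N" "n' \<in> N"
      "r \<in> carrier R" "r' \<in> carrier R" unfolding adjoin_def by blast
    then have "u \<oplus>\<^bsub>M\<^esub> v = (n \<oplus>\<^bsub>M\<^esub> n') \<oplus>\<^bsub>M\<^esub> (r \<oplus>\<^bsub>R\<^esub> r') \<odot>\<^bsub>M\<^esub> x"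
      using c assms(2) by (simp add: smult_l_distr M.a_ac)
    then show "u \<oplus>\<^bsub>M\<^esub> v \<in> adjoin N x" unfolding adjoin_def using * N R.a_closed by blast
  next
    fix s u assume "s \<in> carrier R" "u \<in> adjoin N x"
    then obtain n r where *: "u = n \<oplus>\<^bsub>M\<^esub> r \<odot>\<^bsub>M\<^esub> x" "n \<in> N" "r \<in> carrier R" unfolding adjoin_def by blast
    then have "s \<odot>\<^bsub>M\<^esub> u = s \<odot>\<^bsub>M\<^esub> n \<oplus>\<^bsub>M\<^esub> (s \<otimes>\<^bsub>R\<^esub> r) \<odot>\<^bsub>M\<^esub> x"
      using c assms(2) \<open>s \<in> carrier R\<close> by (simp add: smult_r_distr smult_assoc1)
    then show "s \<odot>\<^bsub>M\<^esub> u \<in> adjoin N x" unfolding adjoin_def using * N R.m_closed \<open>s \<in> carrier R\<close> by blast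
  qed
qed

lemma adjoin_subset:
  assumes "submodule H R M" "N \<subseteq> H" "x \<in> H"
  shows "adjoin N x \<subseteq> H"
  using assms unfolding submodule_iff adjoin_def by auto

end

text \<open>Module length and Krull dimension are both suprema of lengths of strictly increasing
  chains, of submodules and of prime ideals respectively. Keeping only the family of sets lets a map
  of families transport either invariant.\<close>

definition chain_len :: "'a set set \<Rightarrow> enat" where
  "chain_len \<S> = Sup {enat k | k. \<exists>N. (\<forall>i\<le>k. N i \<in> \<S>) \<and> (\<forall>i<k. N i \<subset> N (Suc i))}"

lemma mod_length_eq: "mod_length R M = chain_len {N. submodule N R M}"
  unfolding mod_length_def chain_len_def by simp

lemma krull_dim_eq: "krull_dim R = chain_len {p. primeideal p R}"
  unfolding krull_dim_def chain_len_def by simp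

lemma chain_len_mono:
  assumes "\<And>X. X \<in> \<S> \<Longrightarrow> f X \<in> \<T>"
    and "\<And>X Y. X \<in> \<S> \<Longrightarrow> Y \<in> \<S> \<Longrightarrow> X \<subset> Y \<Longrightarrow> f X \<subset> f Y"
  shows "chain_len \<S> \<le> chain_len \<T>"
  unfolding chain_len_def
proof (rule Sup_subset_mono, clarify)
  fix k N assume N: "\<forall>i\<le>k. N i \<in> \<S>" "\<forall>i<k. N i \<subset> N (Suc i)"
  show "\<exists>k'. enat k = enat k' \<and> (\<exists>N. (\<forall>i\<le>k'. N i \<in> \<T>) \<and> (\<forall>i<k'. N i \<subset> N (Suc i)))"
    using N assms by (intro exI[of _ k] conjI refl exI[of _ "\<lambda>i. f (N i)"]) auto
qed

lemma chain_len_bij: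
  assumes "bij_betw f \<S> \<T>" and "\<And>X Y. X \<in> \<S> \<Longrightarrow> Y \<in> \<S> \<Longrightarrow> f X \<subseteq> f Y \<longleftrightarrow> X \<subseteq> Y"
  shows "chain_len \<S> = chain_len \<T>"
proof (rule antisym)
  show "chain_len \<S> \<le> chain_len \<T>"
    using assms by (intro chain_len_mono[where f = f]) (auto simp: bij_betw_def less_le_not_le)
  let ?g = "inv_into \<S> f"
  have g: "?g Y \<in> \<S>" "f (?g Y) = Y" if "Y \<in> \<T>" for Y
    using that assms(1) by (auto simp: bij_betw_def inv_into_into f_inv_into_f)
  show "chain_len \<T> \<le> chain_len \<S>"
  proof (rule chain_len_mono[where f = ?g])
    fix X Y assume XY: "X \<in> \<T>" "Y \<in> \<T>" "X \<subset> Y"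
    then show "?g X \<subset> ?g Y"
      unfolding less_le_not_le using XY(3) assms(2)[OF g(1)[OF XY(1)] g(1)[OF XY(2)]]
        assms(2)[OF g(1)[OF XY(2)] g(1)[OF XY(1)]] unfolding g(2)[OF XY(1)] g(2)[OF XY(2)] by blast
  qed (use g in auto)
qed

lemma chain_len_ge1:
  assumes "X \<in> \<S>" "Y \<in> \<S>" "X \<subset> Y"
  shows "chain_len \<S> \<ge> 1"
proof -
  have "enat 1 \<in> {enat k | k. \<exists>N. (\<forall>i\<le>k. N i \<in> \<S>) \<and> (\<forall>i<k. N i \<subset> N (Suc i))}"
    using assms by (intro CollectI exI[of _ 1] conjI refl exI[of _ "\<lambda>i::nat. if i = 0 then X else Y"]) auto
  then have "enat 1 \<le> chain_len \<S>" unfolding chain_len_def by (rule Sup_upper)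
  then show ?thesis by (simp add: one_enat_def)
qed

text \<open>With a least member X and a greatest member Y, a third member would refine X < Y to a
  chain with two steps. For submodules this describes simple quotients, the form in which type one
  enters.\<close>

lemma chain_len_eq1_iff:
  assumes "X \<in> \<S>" "Y \<in> \<S>" "\<And>Z. Z \<in> \<S> \<Longrightarrow> X \<subseteq> Z \<and> Z \<subseteq> Y"
  shows "chain_len \<S> = 1 \<longleftrightarrow> X \<noteq> Y \<and> \<S> = {X, Y}"
proof
  assume 1: "chain_len \<S> = 1"
  have "X \<noteq> Y"
  proof
    assume "X = Y"
    then have S: "\<S> = {X}" using assms by auto
    have "chain_len \<S> \<le> 0" unfolding chain_len_def
    proof (rule Sup_least, clarify)
      fix k N assume "\<forall>i\<le>k. N i \<in> \<S>" "\<forall>i<k. N i \<subset> N (Suc i)"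
      then show "enat k \<le> 0" unfolding S by (cases k) (auto simp: zero_enat_def)
    qed
    with 1 show False by simp
  qed
  moreover have "Z = X \<or> Z = Y" if Z: "Z \<in> \<S>" for Z
  proof (rule ccontr)
    assume "\<not> ?thesis"
    then have "X \<subset> Z" "Z \<subset> Y" using assms(3)[OF Z] by auto
    then have "enat 2 \<in> {enat k | k. \<exists>N. (\<forall>i\<le>k. N i \<in> \<S>) \<and> (\<forall>i<k. N i \<subset> N (Suc i))}"
      using assms Z
      by (intro CollectI exI[of _ 2] conjI refl exI[of _ "\<lambda>i::nat. if i = 0 then X else if i = 1 then Z else Y"])
        (auto simp: less_Suc_eq numeral_2_eq_2)
    then have "enat 2 \<le> chain_len \<S>" unfolding chain_len_def by (rule Sup_upper)
    with 1 show False by (simp add: one_enat_def)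
  qed
  ultimately show "X \<noteq> Y \<and> \<S> = {X, Y}" using assms by auto
next
  assume *: "X \<noteq> Y \<and> \<S> = {X, Y}"
  then have XY: "X \<subset> Y" using assms by blast
  have "chain_len \<S> \<le> 1" unfolding chain_len_def
  proof (rule Sup_least, clarify)
    fix k N assume N: "\<forall>i\<le>k. N i \<in> \<S>" "\<forall>i<k. N i \<subset> N (Suc i)"
    show "enat k \<le> 1"
    proof (rule ccontr)
      assume "\<not> enat k \<le> 1"
      then have "k \<ge> 2" by (simp add: one_enat_def)
      then have "N 0 \<subset> N 1" "N 1 \<subset> N 2" "N 0 \<in> {X,Y}" "N 1 \<in> {X,Y}" "N 2 \<in> {X,Y}"
        using N * by (auto simp: numeral_2_eq_2)
      with XY show False by auto
    qed
  qed
  with chain_len_ge1[OF assms(1,2) XY] show "chain_len \<S> = 1" by simp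
qed

text \<open>For the family of submodules between Y and X this says that X/Y is generated by one
  element. Only the members of the family and membership in them are mentioned, so the notion can be
  compared over different ground rings.\<close>

definition cyclic_over :: "'a set set \<Rightarrow> 'a set \<Rightarrow> bool" where
  "cyclic_over \<S> X \<longleftrightarrow> (\<exists>x\<in>X. \<forall>H\<in>\<S>. x \<in> H \<longrightarrow> H = X)"

lemma Inf_enat_eq_1_iff: "Inf G = (1::enat) \<longleftrightarrow> 1 \<in> G \<and> 0 \<notin> G"
proof
  assume I: "Inf G = 1"
  then have "G \<noteq> {}" by (auto simp: top_enat_def)
  then have "Inf G \<in> G" by (auto simp: Inf_enat_def intro: LeastI)
  moreover have "0 \<notin> G" using I Inf_lower[of 0 G] by auto
  ultimately show "1 \<in> G \<and> 0 \<notin> G" using I by simp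
next
  assume *: "1 \<in> G \<and> 0 \<notin> G"
  have "1 \<le> y" if "y \<in> G" for y
    using * that by (cases "y = 0") (auto simp: ileI1 one_eSuc zero_less_iff_neq_zero)
  then have "1 \<le> Inf G" by (rule Inf_greatest)
  moreover have "Inf G \<le> 1" using * by (intro Inf_lower) simp
  ultimately show "Inf G = 1" by simp
qed

text \<open>The first conjunct says that the empty set does not generate, that is, that the module
  is nonzero. It is the source of the condition that S differs from K, on which the treatment of the
  extension rings depends.\<close>

lemma min_gens_eq_1_iff:
  "min_gens R M = 1 \<longleftrightarrow> mod_span R M {} \<noteq> carrier M \<and> (\<exists>x\<in>carrier M. mod_span R M {x} = carrier M)"
proof -
  let ?G = "{enat (card X) | X. finite X \<and> X \<subseteq> carrier M \<and> mod_span R M X = carrier M}"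
  have 0: "0 \<in> ?G \<longleftrightarrow> mod_span R M {} = carrier M"
    by (auto simp: zero_enat_def card_eq_0_iff intro!: exI[of _ "{}"])
  have 1: "1 \<in> ?G \<longleftrightarrow> (\<exists>x\<in>carrier M. mod_span R M {x} = carrier M)"
  proof
    assume "1 \<in> ?G"
    then obtain X where X: "enat (card X) = 1" "X \<subseteq> carrier M" "mod_span R M X = carrier M" by auto
    then obtain x where "X = {x}" by (auto simp: one_enat_def card_1_singleton_iff)
    with X show "\<exists>x\<in>carrier M. mod_span R M {x} = carrier M" by auto
  next
    assume "\<exists>x\<in>carrier M. mod_span R M {x} = carrier M"
    then obtain x where "x \<in> carrier M" "mod_span R M {x} = carrier M" by blast
    then have "1 = enat (card {x}) \<and> finite {x} \<and> {x} \<subseteq> carrier M \<and> mod_span R M {x} = carrier M"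
      by (simp add: one_enat_def)
    then show "1 \<in> ?G" by blast
  qed
  show ?thesis unfolding min_gens_def Inf_enat_eq_1_iff using 0 1 by blast
qed

section \<open>Submodules of a quotient module\<close>

locale quotient_module = module R M for R :: "('a, 'm) ring_scheme" and M :: "('a, 'c) module" (structure) + fixes N
  assumes N: "submodule N R M"
begin

sublocale N: abelian_subgroup N M
  using submodule.axioms(1)[OF N] by (intro abelian_subgroupI3 additive_subgroupI) (auto intro: abelian_group_axioms)

lemma quot_carrier: "carrier (quot_mod M N) = (\<lambda>x. N +> x) ` carrier M"
  by (auto simp: quot_mod_def A_RCOSETS_def')

lemma quot_add:
  "x \<in> carrier M \<Longrightarrow> y \<in> carrier M \<Longrightarrow> (N +> x) \<oplus>\<^bsub>quot_mod M N\<^esub> (N +> y) = N +> (x \<oplus> y)"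
  by (simp add: quot_mod_def N.a_rcos_sum)

lemma quot_zero: "\<zero>\<^bsub>quot_mod M N\<^esub> = N" "\<zero>\<^bsub>quot_mod M N\<^esub> = N +> \<zero>"
  by (simp_all add: quot_mod_def N.a_subset)

lemma coset_eq_iff:
  assumes "x \<in> carrier M" "y \<in> carrier M"
  shows "N +> x = N +> y \<longleftrightarrow> x \<ominus> y \<in> N"
  using assms N.a_rcos_module[of y x] N.a_rcos_self[of x] N.a_repr_independence'[of x y]
  unfolding a_minus_def by metis

text \<open>A scalar maps a coset of N into a coset, but in general not onto it; the summand N in
  the scalar multiplication of \<open>quot_mod\<close> fills it up.\<close>

lemma quot_smult:
  assumes "a \<in> carrier R" "x \<in> carrier M"
  shows "a \<odot>\<^bsub>quot_mod M N\<^esub> (N +> x) = N +> a \<odot> x"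
proof -
  note Ns = N[unfolded submodule_iff]
  have "N <+>\<^bsub>M\<^esub> (\<lambda>u. a \<odot> u) ` (N +> x) = N +> a \<odot> x"
  proof (intro subset_antisym subsetI)
    fix z assume "z \<in> N <+>\<^bsub>M\<^esub> (\<lambda>u. a \<odot> u) ` (N +> x)"
    then obtain n m where nm: "n \<in> N" "m \<in> N" "z = n \<oplus> a \<odot> (m \<oplus> x)"
      by (auto simp: set_add_def' a_r_coset_def')
    then have "z = (n \<oplus> a \<odot> m) \<oplus> a \<odot> x" using Ns assms
      by (simp add: smult_r_distr M.a_assoc subset_iff)
    moreover have "n \<oplus> a \<odot> m \<in> N" using nm Ns assms by auto
    ultimately show "z \<in> N +> a \<odot> x" by (auto simp: a_r_coset_def')
  next
    fix z assume "z \<in> N +> a \<odot> x"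
    then obtain n where n: "n \<in> N" "z = n \<oplus> a \<odot> x" by (auto simp: a_r_coset_def')
    moreover have "x \<in> N +> x" using N.a_rcos_self assms by blast
    ultimately show "z \<in> N <+>\<^bsub>M\<^esub> (\<lambda>u. a \<odot> u) ` (N +> x)" by (auto simp: set_add_def')
  qed
  then show ?thesis by (simp add: quot_mod_def)
qed

lemma quot_abelian_group: "abelian_group (quot_mod M N)"
proof (rule abelian_groupI)
  fix X Y Z assume "X \<in> carrier (quot_mod M N)" "Y \<in> carrier (quot_mod M N)" "Z \<in> carrier (quot_mod M N)"
  then show "X \<oplus>\<^bsub>quot_mod M N\<^esub> Y \<oplus>\<^bsub>quot_mod M N\<^esub> Z = X \<oplus>\<^bsub>quot_mod M N\<^esub> (Y \<oplus>\<^bsub>quot_mod M N\<^esub> Z)"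
    by (auto simp: quot_carrier quot_add M.a_assoc)
next
  fix X Y assume "X \<in> carrier (quot_mod M N)" "Y \<in> carrier (quot_mod M N)"
  then show "X \<oplus>\<^bsub>quot_mod M N\<^esub> Y = Y \<oplus>\<^bsub>quot_mod M N\<^esub> X"
    by (auto simp: quot_carrier quot_add M.a_comm)
next
  fix X assume "X \<in> carrier (quot_mod M N)"
  then obtain x where x: "x \<in> carrier M" "X = N +> x" by (auto simp: quot_carrier)
  then have "(N +> \<ominus> x) \<oplus>\<^bsub>quot_mod M N\<^esub> X = \<zero>\<^bsub>quot_mod M N\<^esub>"
    by (simp add: quot_add quot_zero(2) M.l_neg)
  with x show "\<exists>Y\<in>carrier (quot_mod M N). Y \<oplus>\<^bsub>quot_mod M N\<^esub> X = \<zero>\<^bsub>quot_mod M N\<^esub>"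
    by (auto simp: quot_carrier)
qed (auto simp: quot_carrier quot_add quot_zero(2))

lemma quot_module: "module R (quot_mod M N)"
proof (rule moduleI)
  show "cring R" by (rule R.is_cring)
  show "abelian_group (quot_mod M N)" by (rule quot_abelian_group)
qed (auto simp: quot_carrier quot_smult quot_add smult_l_distr smult_r_distr smult_assoc1)

definition lift :: "'c set set \<Rightarrow> 'c set" where
  "lift P = {x \<in> carrier M. N +> x \<in> P}"

lemma submodule_quot_image:
  assumes H: "submodule H R M"
  shows "submodule ((\<lambda>x. N +> x) ` H) R (quot_mod M N)"
proof -
  note Hs = H[unfolded submodule_iff]
  have c: "x \<in> H \<Longrightarrow> x \<in> carrier M" for x using Hs by auto
  show ?thesis unfolding module.submodule_iff[OF quot_module]
    using Hs by (auto simp: quot_carrier quot_add quot_smult c quot_zero(2))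
qed

lemma submodule_lift:
  assumes P: "submodule P R (quot_mod M N)"
  shows "submodule (lift P) R M" "N \<subseteq> lift P" "(\<lambda>x. N +> x) ` lift P = P"
proof -
  note Ps = P[unfolded module.submodule_iff[OF quot_module]]
  show "submodule (lift P) R M" unfolding submodule_iff lift_def
    using Ps by (auto simp: quot_carrier quot_zero(2)) (metis quot_add, metis quot_smult)
  show "N \<subseteq> lift P"
  proof
    fix n assume n: "n \<in> N"
    then have "N +> n = N" using N.a_rcos_const by blast
    then show "n \<in> lift P" using Ps n N.a_Hcarr by (auto simp: lift_def quot_zero)
  qed
  show "(\<lambda>x. N +> x) ` lift P = P"
    using Ps by (auto simp: quot_carrier lift_def)
qed

lemma lift_image:
  assumes H: "submodule H R M" "N \<subseteq> H"
  shows "lift ((\<lambda>x. N +> x) ` H) = H"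
proof -
  note Hs = H(1)[unfolded submodule_iff]
  have "x \<in> H" if "x \<in> carrier M" "y \<in> H" "N +> x = N +> y" for x y
  proof -
    have y: "y \<in> carrier M" using Hs that by auto
    have "x \<ominus> y \<in> H" using coset_eq_iff[OF that(1) y] that H by auto
    then have "(x \<ominus> y) \<oplus> y \<in> H" using Hs that by auto
    moreover have "(x \<ominus> y) \<oplus> y = x" using that y by (simp add: a_minus_def M.a_assoc M.l_neg)
    ultimately show ?thesis by simp
  qed
  then show ?thesis using Hs by (auto simp: lift_def)
qed

text \<open>The correspondence theorem: \<open>lift\<close> is an order isomorphism from the
  submodules of the quotient onto the submodules that contain N.\<close>

lemma mod_length_quot: "mod_length R (quot_mod M N) = chain_len {H. submodule H R M \<and> N \<subseteq> H}"
  unfolding mod_length_eq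
proof (rule chain_len_bij[where f = lift])
  show "bij_betw lift {P. submodule P R (quot_mod M N)} {H. submodule H R M \<and> N \<subseteq> H}"
    by (rule bij_betw_byWitness[where f' = "\<lambda>H. (\<lambda>x. N +> x) ` H"])
      (use submodule_lift lift_image submodule_quot_image in auto)
next
  fix X Y assume "X \<in> {P. submodule P R (quot_mod M N)}" "Y \<in> {P. submodule P R (quot_mod M N)}"
  then have "(\<lambda>x. N +> x) ` lift X = X" "(\<lambda>x. N +> x) ` lift Y = Y" using submodule_lift(3) by auto
  then have "X \<subseteq> Y" if "lift X \<subseteq> lift Y" using image_mono[OF that, of "\<lambda>x. N +> x"] by simp
  then show "lift X \<subseteq> lift Y \<longleftrightarrow> X \<subseteq> Y" by (auto simp: lift_def)
qed

text \<open>The same correspondence: the coset of x generates the quotient iff no proper submodule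
  contains both N and x, and the empty set generates it iff the zero submodule, whose preimage is N,
  is everything.\<close>

lemma min_gens_quot:
  "min_gens R (quot_mod M N) = 1 \<longleftrightarrow>
     N \<noteq> carrier M \<and> cyclic_over {H. submodule H R M \<and> N \<subseteq> H} (carrier M)"
proof -
  let ?C = "carrier (quot_mod M N)"
  have lC: "P = ?C \<longleftrightarrow> lift P = carrier M" if "submodule P R (quot_mod M N)" for P
    using submodule_lift(3)[OF that] by (auto simp: quot_carrier lift_def)
  have c: "submodule ?C R (quot_mod M N)" by (rule module.carrier_is_submodule[OF quot_module])
  have span: "mod_span R (quot_mod M N) X = ?C \<longleftrightarrow>
      (\<forall>P. submodule P R (quot_mod M N) \<and> X \<subseteq> P \<longrightarrow> P = ?C)" if X: "X \<subseteq> ?C" for X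
  proof
    assume *: "mod_span R (quot_mod M N) X = ?C"
    show "\<forall>P. submodule P R (quot_mod M N) \<and> X \<subseteq> P \<longrightarrow> P = ?C"
    proof (intro allI impI)
      fix P assume P: "submodule P R (quot_mod M N) \<and> X \<subseteq> P"
      then have "?C \<subseteq> P" unfolding *[symmetric] mod_span_def by auto
      moreover have "P \<subseteq> ?C" using P module.submoduleE(1)[OF quot_module] by auto
      ultimately show "P = ?C" by auto
    qed
  next
    assume *: "\<forall>P. submodule P R (quot_mod M N) \<and> X \<subseteq> P \<longrightarrow> P = ?C"
    then have "{P. submodule P R (quot_mod M N) \<and> X \<subseteq> P} = {?C}" using c X by blast
    then show "mod_span R (quot_mod M N) X = ?C" unfolding mod_span_def by simp
  qed
  have im: "(\<lambda>x. N +> x) ` N = {N}" using N.a_rcos_const by (auto intro!: image_eqI[of _ _ "\<zero>"])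
  have N': "submodule {N} R (quot_mod M N)"
    using submodule_quot_image[OF N] unfolding im .
  have "mod_span R (quot_mod M N) {} = ?C \<longleftrightarrow> N = carrier M"
  proof -
    have "lift {N} = N"
      using lift_image[OF N order_refl] unfolding im .
    then have 1: "{N} = ?C \<longleftrightarrow> N = carrier M" using lC[OF N'] by simp
    have 2: "{N} \<subseteq> P" if "submodule P R (quot_mod M N)" for P
      using that quot_zero(1) module.submodule_iff[OF quot_module] by auto
    show ?thesis unfolding span[OF empty_subsetI]
    proof (intro iffI allI impI)
      assume *: "\<forall>P. submodule P R (quot_mod M N) \<and> {} \<subseteq> P \<longrightarrow> P = ?C"
      show "N = carrier M" using *[rule_format, of "{N}"] N' 1 by simp
    next
      fix P assume "N = carrier M" and P: "submodule P R (quot_mod M N) \<and> {} \<subseteq> P"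
      then show "P = ?C" using 1 2[of P] module.submoduleE(1)[OF quot_module, of P] by auto
    qed
  qed
  moreover have "(\<exists>X\<in>?C. mod_span R (quot_mod M N) {X} = ?C) \<longleftrightarrow>
      cyclic_over {H. submodule H R M \<and> N \<subseteq> H} (carrier M)"
  proof -
    have "mod_span R (quot_mod M N) {N +> x} = ?C \<longleftrightarrow> 
        (\<forall>H. submodule H R M \<and> N \<subseteq> H \<longrightarrow> x \<in> H \<longrightarrow> H = carrier M)" if x: "x \<in> carrier M" for x
    proof -
      have "{N +> x} \<subseteq> ?C" using x quot_carrier by auto
      show ?thesis unfolding span[OF \<open>{N +> x} \<subseteq> ?C\<close>]
      proof (intro iffI allI impI)
        fix H assume *: "\<forall>P. submodule P R (quot_mod M N) \<and> {N +> x} \<subseteq> P \<longrightarrow> P = ?C"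
          and H: "submodule H R M \<and> N \<subseteq> H" "x \<in> H"
        have "(\<lambda>x. N +> x) ` H = ?C" using * submodule_quot_image[of H] H by auto
        then show "H = carrier M" using lift_image[of H] H lC[OF c] by simp
      next
        fix P assume *: "\<forall>H. submodule H R M \<and> N \<subseteq> H \<longrightarrow> x \<in> H \<longrightarrow> H = carrier M"
          and P: "submodule P R (quot_mod M N) \<and> {N +> x} \<subseteq> P"
        have "x \<in> lift P" using P x by (simp add: lift_def)
        moreover have "submodule (lift P) R M" "N \<subseteq> lift P" using submodule_lift P by auto
        ultimately have "lift P = carrier M" using * by simp
        then show "P = ?C" using lC[of P] P by simp
      qed
    qed
    then show ?thesis unfolding cyclic_over_def by (simp add: quot_carrier)
  qed
  ultimately show ?thesis unfolding min_gens_eq_1_iff by blast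
qed

end

lemma submodule_restrict_carrier:
  assumes "module R M" "submodule X R M"
  shows "submodule H R (M\<lparr>carrier := X\<rparr>) \<longleftrightarrow> submodule H R M \<and> H \<subseteq> X"
proof -
  have "X \<subseteq> carrier M" by (rule module.submoduleE(1)[OF assms])
  then show ?thesis
    unfolding module.submodule_iff[OF submodule.submodule_is_module[OF assms(2,1)]]
      module.submodule_iff[OF assms(1)] by auto
qed

lemma quotient_module_restrict:
  assumes "module R M" "submodule X R M" "submodule Y R M" "Y \<subseteq> X"
  shows "quotient_module R (M\<lparr>carrier := X\<rparr>) Y"
  using submodule.submodule_is_module[OF assms(2,1)] submodule_restrict_carrier[OF assms(1,2)] assms(3,4)
  by (simp add: quotient_module_def quotient_module_axioms_def)

definition between :: "('a, 'm) ring_scheme \<Rightarrow> ('a, 'b) module \<Rightarrow> 'b set \<Rightarrow> 'b set \<Rightarrow> 'b set set" where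
  "between R M Y X = {H. submodule H R M \<and> Y \<subseteq> H \<and> H \<subseteq> X}"

lemma mod_length_quot_restrict:
  assumes "module R M" "submodule X R M" "submodule Y R M" "Y \<subseteq> X"
  shows "mod_length R (quot_mod (M\<lparr>carrier := X\<rparr>) Y) = chain_len (between R M Y X)"
  unfolding quotient_module.mod_length_quot[OF quotient_module_restrict[OF assms]]
    submodule_restrict_carrier[OF assms(1,2)] between_def
  by (rule arg_cong[where f = chain_len]) auto

lemma min_gens_quot_restrict:
  assumes "module R M" "submodule X R M" "submodule Y R M" "Y \<subseteq> X"
  shows "min_gens R (quot_mod (M\<lparr>carrier := X\<rparr>) Y) = 1 \<longleftrightarrow> Y \<noteq> X \<and> cyclic_over (between R M Y X) X"
proof -
  have "{H. (submodule H R M \<and> H \<subseteq> X) \<and> Y \<subseteq> H} = between R M Y X" by (auto simp: between_def)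
  then show ?thesis
    unfolding quotient_module.min_gens_quot[OF quotient_module_restrict[OF assms]]
      submodule_restrict_carrier[OF assms(1,2)] by simp
qed

section \<open>Noetherian modules and local rings\<close>

text \<open>The chain condition is attached to a subset N of M, and N may be any set: it will be A^n
  inside E^n, or an increasing union of fractional ideals. Only chains lying inside N are tested, so
  the condition passes to subsets.\<close>

definition noeth :: "('a, 'm) ring_scheme \<Rightarrow> ('a, 'b) module \<Rightarrow> 'b set \<Rightarrow> bool" where
  "noeth R M N \<longleftrightarrow>
     (\<forall>f::nat \<Rightarrow> 'b set. (\<forall>t. submodule (f t) R M \<and> f t \<subseteq> N \<and> f t \<subseteq> f (Suc t)) \<longrightarrow>
        (\<exists>T. \<forall>t\<ge>T. f t = f T))"

lemma noeth_subset: "noeth R M N \<Longrightarrow> N' \<subseteq> N \<Longrightarrow> noeth R M N'"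
  unfolding noeth_def by (meson subset_trans)

lemma noethD:
  assumes "noeth R M N" "\<And>t::nat. submodule (f t) R M" "\<And>t. f t \<subseteq> N" "\<And>t. f t \<subseteq> f (Suc t)"
  shows "\<exists>T. \<forall>t\<ge>T. f t = f T"
  using assms(1)[unfolded noeth_def, rule_format, of f] assms(2-4) by simp

lemma noeth_maximal:
  assumes "noeth R M N" "\<F> \<noteq> {}" and \<F>: "\<And>X. X \<in> \<F> \<Longrightarrow> submodule X R M \<and> X \<subseteq> N"
  shows "\<exists>X\<in>\<F>. \<forall>Y\<in>\<F>. X \<subseteq> Y \<longrightarrow> Y = X"
proof (rule ccontr)
  assume n: "\<not> ?thesis"
  have *: "\<exists>Y. Y \<in> \<F> \<and> X \<subset> Y" if X: "X \<in> \<F>" for X using n X by auto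
  have "\<exists>f. \<forall>t::nat. f t \<in> \<F> \<and> f t \<subset> f (Suc t)"
  proof (rule dependent_nat_choice)
    show "\<exists>X. X \<in> \<F>" using \<open>\<F> \<noteq> {}\<close> by auto
  qed (rule *)
  then obtain f where f: "\<forall>t::nat. f t \<in> \<F> \<and> f t \<subset> f (Suc t)" by blast
  have "\<exists>T. \<forall>t\<ge>T. f t = f T"
  proof (rule noethD[OF assms(1)])
    show "submodule (f t) R M" "f t \<subseteq> N" for t using \<F>[of "f t"] f by auto
    show "f t \<subseteq> f (Suc t)" for t using f by (simp add: less_imp_le)
  qed
  then obtain T where T: "\<forall>t\<ge>T. f t = f T" by blast
  have "f (Suc T) = f T" by (rule T[rule_format]) simp
  with f[rule_format, of T] show False by simp
qed

lemma self_module_simps [simp]: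
  "carrier (self_module B) = carrier B" "\<zero>\<^bsub>self_module B\<^esub> = \<zero>\<^bsub>B\<^esub>"
  "x \<oplus>\<^bsub>self_module B\<^esub> y = x \<oplus>\<^bsub>B\<^esub> y" "r \<odot>\<^bsub>self_module B\<^esub> x = r \<otimes>\<^bsub>B\<^esub> x"
  by (simp_all add: self_module_def)

lemma self_module_carrier: "(self_module B)\<lparr>carrier := carrier B\<rparr> = self_module B"
  by (simp add: self_module_def)

text \<open>A is a subring of E by the identity map, so the two rings share their elements and
  fractional ideals are plain subsets of E. The instance E = A recovers ordinary ideals and is used
  alongside the general one.\<close>

locale overring = A: cring A + E: cring E for A :: "('a, 'm) ring_scheme" and E :: "('a, 'n) ring_scheme" (structure) +
  assumes sub: "id \<in> ring_hom A E"
begin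

lemma A_sub [simp, intro]: "x \<in> carrier A \<Longrightarrow> x \<in> carrier E"
  using ring_hom_closed[OF sub, of x] by simp

lemma A_ops:
  "x \<in> carrier A \<Longrightarrow> y \<in> carrier A \<Longrightarrow> x \<otimes>\<^bsub>A\<^esub> y = x \<otimes> y"
  "x \<in> carrier A \<Longrightarrow> y \<in> carrier A \<Longrightarrow> x \<oplus>\<^bsub>A\<^esub> y = x \<oplus> y"
  "\<one>\<^bsub>A\<^esub> = \<one>"
  using ring_hom_mult[OF sub, of x y] ring_hom_add[OF sub, of x y] ring_hom_one[OF sub] by simp_all

lemma A_zero: "\<zero>\<^bsub>A\<^esub> = \<zero>"
proof -
  have "\<zero>\<^bsub>A\<^esub> \<oplus> \<zero>\<^bsub>A\<^esub> = \<zero>\<^bsub>A\<^esub>" using A_ops(2)[of "\<zero>\<^bsub>A\<^esub>" "\<zero>\<^bsub>A\<^esub>"] by simp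
  then show ?thesis by (metis A.zero_closed A_sub E.add.l_cancel_one')
qed

lemma A_uminus:
  assumes "x \<in> carrier A" shows "\<ominus>\<^bsub>A\<^esub> x = \<ominus> x"
proof -
  have "(\<ominus>\<^bsub>A\<^esub> x) \<oplus> x = \<zero>" using A_ops(2)[of "\<ominus>\<^bsub>A\<^esub> x" x] assms A_zero by (simp add: A.l_neg)
  then show ?thesis using assms by (intro E.minus_equality[symmetric]) auto
qed

lemma A_closed [intro]:
  "x \<in> carrier A \<Longrightarrow> y \<in> carrier A \<Longrightarrow> x \<otimes> y \<in> carrier A"
  "x \<in> carrier A \<Longrightarrow> y \<in> carrier A \<Longrightarrow> x \<oplus> y \<in> carrier A"
  "x \<in> carrier A \<Longrightarrow> \<ominus> x \<in> carrier A"
  "x \<in> carrier A \<Longrightarrow> y \<in> carrier A \<Longrightarrow> x \<ominus> y \<in> carrier A"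
  "\<zero> \<in> carrier A" "\<one> \<in> carrier A"
  using A_ops(1,2)[of x y] A_ops(3) A_zero A_uminus[of x] A_uminus[of y] A_ops(2)[of x "\<ominus> y"]
    A.m_closed[of x y] A.a_closed[of x y] A.a_inv_closed[of x] A.a_inv_closed[of y]
    A.zero_closed A.one_closed A.a_closed[of x "\<ominus> y"]
  by (auto simp: a_minus_def)

lemma A_pow: "x \<in> carrier A \<Longrightarrow> x [^]\<^bsub>A\<^esub> (k::nat) = x [^] k"
proof (induction k)
  case (Suc k)
  then have "x [^]\<^bsub>A\<^esub> Suc k = (x [^]\<^bsub>A\<^esub> k) \<otimes> x" using A_ops(1)[OF A.nat_pow_closed[of x k], of x] by simp
  then show ?case using Suc by simp
qed (simp add: A_ops)

lemma A_pow_closed [intro]: "x \<in> carrier A \<Longrightarrow> x [^] (k::nat) \<in> carrier A"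
  using A_pow A.nat_pow_closed by metis

lemma Emod: "module A (self_module E)"
proof (rule moduleI)
  show "abelian_group (self_module E)"
    by (rule abelian_groupI) (auto simp: E.a_ac intro!: bexI[of _ "\<ominus> x" for x] E.l_neg)
qed (auto simp: A_ops E.l_distr E.r_distr E.m_assoc A.is_cring)

definition smod :: "'a set \<Rightarrow> bool" where "smod X \<longleftrightarrow> submodule X A (self_module E)"

lemma smod_iff:
  "smod X \<longleftrightarrow> X \<subseteq> carrier E \<and> \<zero> \<in> X \<and> (\<forall>x\<in>X. \<forall>y\<in>X. x \<oplus> y \<in> X) \<and>
     (\<forall>r\<in>carrier A. \<forall>x\<in>X. r \<otimes> x \<in> X)"
  unfolding smod_def module.submodule_iff[OF Emod] by simp

lemma smodI:
  assumes "X \<subseteq> carrier E" "\<zero> \<in> X" "\<And>x y. x \<in> X \<Longrightarrow> y \<in> X \<Longrightarrow> x \<oplus> y \<in> X"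
    "\<And>r x. r \<in> carrier A \<Longrightarrow> x \<in> X \<Longrightarrow> r \<otimes> x \<in> X"
  shows "smod X"
  using assms unfolding smod_iff by blast

lemma smodD:
  assumes "smod X"
  shows "x \<in> X \<Longrightarrow> x \<in> carrier E" "\<zero> \<in> X" "x \<in> X \<Longrightarrow> y \<in> X \<Longrightarrow> x \<oplus> y \<in> X"
    "r \<in> carrier A \<Longrightarrow> x \<in> X \<Longrightarrow> r \<otimes> x \<in> X" "x \<in> X \<Longrightarrow> \<ominus> x \<in> X"
    "x \<in> X \<Longrightarrow> y \<in> X \<Longrightarrow> x \<ominus> y \<in> X"
proof -
  show 1: "x \<in> X \<Longrightarrow> x \<in> carrier E" and "\<zero> \<in> X" and 2: "x \<in> X \<Longrightarrow> y \<in> X \<Longrightarrow> x \<oplus> y \<in> X"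
    and "r \<in> carrier A \<Longrightarrow> x \<in> X \<Longrightarrow> r \<otimes> x \<in> X" for x y r
    using assms unfolding smod_iff by auto
  show 3: "\<ominus> x \<in> X" if "x \<in> X" for x
  proof -
    have "(\<ominus> \<one>) \<otimes> x \<in> X" using assms that unfolding smod_iff by blast
    then show ?thesis using 1[OF that] by (simp add: E.l_minus)
  qed
  show "x \<in> X \<Longrightarrow> y \<in> X \<Longrightarrow> x \<ominus> y \<in> X" unfolding a_minus_def using 2 3 by blast
qed

lemma smod_A: "smod (carrier A)"
  by (rule smodI) auto

lemma submodule_A_iff: "submodule X A (self_module A) \<longleftrightarrow> smod X \<and> X \<subseteq> carrier A"
proof -
  interpret AA: overring A A by unfold_locales (simp add: ring_hom_def)
  show ?thesis unfolding AA.smod_def[symmetric] AA.smod_iff smod_iff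
    by (auto simp: A_ops A_zero subset_iff)
qed

lemma ideal_iff: "ideal X A \<longleftrightarrow> smod X \<and> X \<subseteq> carrier A"
proof
  assume "ideal X A"
  then interpret ideal X A .
  show "smod X \<and> X \<subseteq> carrier A"
    using a_closed I_l_closed zero_closed Icarr by (auto intro!: smodI simp: A_ops[symmetric] A_zero[symmetric])
next
  assume X: "smod X \<and> X \<subseteq> carrier A"
  then have c: "x \<in> carrier A" if "x \<in> X" for x using that by auto
  have Xs: "smod X" using X by simp
  show "ideal X A"
  proof (rule idealI)
    show "subgroup X (add_monoid A)"
    proof (rule A.add.subgroupI)
      show "X \<noteq> {}" using smodD(2)[OF Xs] by auto
      show "\<ominus>\<^bsub>A\<^esub> x \<in> X" if "x \<in> X" for x
        using smodD(5)[OF Xs that] A_uminus[OF c[OF that]] by simp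
      show "x \<oplus>\<^bsub>A\<^esub> y \<in> X" if "x \<in> X" "y \<in> X" for x y
        using smodD(3)[OF Xs that] A_ops(2)[OF c[OF that(1)] c[OF that(2)]] by simp
    qed (use X in auto)
  next
    fix x y assume *: "x \<in> X" "y \<in> carrier A"
    show "y \<otimes>\<^bsub>A\<^esub> x \<in> X" using smodD(4)[OF Xs *(2,1)] A_ops(1)[OF *(2) c[OF *(1)]] by simp
    then show "x \<otimes>\<^bsub>A\<^esub> y \<in> X" using A.m_comm[OF c[OF *(1)] *(2)] by simp
  qed (rule A.ring_axioms)
qed

definition scal :: "'a \<Rightarrow> 'a set \<Rightarrow> 'a set" where "scal q X = (\<lambda>x. q \<otimes> x) ` X"

lemma smod_scal:
  assumes "smod X" "q \<in> carrier E" shows "smod (scal q X)"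
proof (rule smodI)
  note X = smodD[OF assms(1)]
  show "scal q X \<subseteq> carrier E" using X assms by (auto simp: scal_def)
  show "\<zero> \<in> scal q X" using X(2) assms by (auto simp: scal_def intro!: image_eqI[of _ _ \<zero>])
  fix x y assume "x \<in> scal q X" "y \<in> scal q X"
  then obtain x' y' where "x = q \<otimes> x'" "y = q \<otimes> y'" "x' \<in> X" "y' \<in> X" by (auto simp: scal_def)
  then show "x \<oplus> y \<in> scal q X" using X assms by (auto simp: scal_def E.r_distr intro!: image_eqI[of _ _ "x' \<oplus> y'"])
next
  note X = smodD[OF assms(1)]
  fix r x assume "r \<in> carrier A" "x \<in> scal q X"
  then obtain x' where "x = q \<otimes> x'" "x' \<in> X" by (auto simp: scal_def)
  then show "r \<otimes> x \<in> scal q X" using X assms \<open>r \<in> carrier A\<close>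
    by (auto simp: scal_def E.m_lcomm intro!: image_eqI[of _ _ "r \<otimes> x'"])
qed

lemma scal_scal: "p \<in> carrier E \<Longrightarrow> q \<in> carrier E \<Longrightarrow> X \<subseteq> carrier E \<Longrightarrow> scal p (scal q X) = scal (p \<otimes> q) X"
  unfolding scal_def image_image by (rule image_cong) (auto simp: E.m_assoc)

lemma scal_one: "X \<subseteq> carrier E \<Longrightarrow> scal \<one> X = X"
  unfolding scal_def by (auto intro!: image_eqI)

lemma scal_mono: "X \<subseteq> Y \<Longrightarrow> scal q X \<subseteq> scal q Y"
  unfolding scal_def by auto

lemma smod_adjoin:
  assumes "smod N" "x \<in> carrier E"
  shows "smod {n \<oplus> r \<otimes> x | n r. n \<in> N \<and> r \<in> carrier A}" "N \<subseteq> {n \<oplus> r \<otimes> x | n r. n \<in> N \<and> r \<in> carrier A}"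
    "x \<in> {n \<oplus> r \<otimes> x | n r. n \<in> N \<and> r \<in> carrier A}"
  using module.submodule_adjoin[OF Emod, of N x] assms
  unfolding smod_def module.adjoin_def[OF Emod] by simp_all

end

locale noeth_local = A: cring A for A :: "('a, 'm) ring_scheme" (structure) +
  assumes local: "noetherian_local_ring A"
begin

abbreviation \<mm> :: "'a set" where "\<mm> \<equiv> max_ideal A"

lemma maximal: "maximalideal \<mm> A" and maximal_unique: "maximalideal J A \<Longrightarrow> J = \<mm>"
proof -
  have *: "\<exists>!m. maximalideal m A" using local by (simp add: noetherian_local_ring_def)
  show "maximalideal \<mm> A" unfolding max_ideal_def using theI'[OF *] .
  then show "maximalideal J A \<Longrightarrow> J = \<mm>" using * by auto
qed

sublocale m: maximalideal "\<mm>" A by (rule maximal)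

sublocale AA: overring A A by unfold_locales (simp add: ring_hom_def)

lemma noeth_A: "noeth A (self_module A) (carrier A)"
  unfolding noeth_def
proof (intro allI impI)
  fix f :: "nat \<Rightarrow> 'a set"
  assume f: "\<forall>t. submodule (f t) A (self_module A) \<and> f t \<subseteq> carrier A \<and> f t \<subseteq> f (Suc t)"
  interpret noetherian_ring A using local by (simp add: noetherian_local_ring_def)
  have mono: "mono f" using f by (intro incseq_SucI) auto
  have "ideal (f t) A" for t unfolding AA.ideal_iff AA.smod_def using f by auto
  moreover have "f i \<subseteq> f j \<or> f j \<subseteq> f i" for i j
    using monoD[OF mono, of i j] monoD[OF mono, of j i] by linarith
  ultimately have "subset.chain {I. ideal I A} (range f)"
    by (auto simp: subset_chain_def)
  then have "\<Union> (range f) \<in> range f" by (intro ideal_chain_is_trivial) auto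
  then obtain T where T: "\<Union> (range f) = f T" by auto
  have "f t = f T" if "t \<ge> T" for t
    using monoD[OF mono that] T by auto
  then show "\<exists>T. \<forall>t\<ge>T. f t = f T" by blast
qed

lemma one_notin_m: "\<one> \<notin> \<mm>"
  using m.I_notcarr m.one_imp_carrier by auto

lemma proper_ideal_le_m:
  assumes "ideal I A" "I \<noteq> carrier A" shows "I \<subseteq> \<mm>"
proof -
  define F where "F = {J. ideal J A \<and> J \<noteq> carrier A \<and> I \<subseteq> J}"
  have "\<exists>J\<in>F. \<forall>J'\<in>F. J \<subseteq> J' \<longrightarrow> J' = J"
  proof (rule noeth_maximal[OF noeth_A])
    show "F \<noteq> {}" using assms by (auto simp: F_def)
  qed (auto simp: F_def AA.ideal_iff AA.smod_def)
  then obtain J where J: "J \<in> F" "\<And>J'. J' \<in> F \<Longrightarrow> J \<subseteq> J' \<Longrightarrow> J' = J" by blast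
  have "maximalideal J A"
  proof (rule maximalidealI)
    fix J' assume J': "ideal J' A" "J \<subseteq> J'" "J' \<subseteq> carrier A"
    show "J' = J \<or> J' = carrier A" using J(1) J(2)[of J'] J' by (auto simp: F_def)
  qed (use J(1) in \<open>auto simp: F_def\<close>)
  then show ?thesis using maximal_unique J(1) by (auto simp: F_def)
qed

lemma unit_iff: "x \<in> carrier A \<Longrightarrow> x \<in> Units A \<longleftrightarrow> x \<notin> \<mm>"
proof
  assume "x \<in> Units A"
  then have "inv x \<otimes> x = \<one>" "inv x \<in> carrier A" by auto
  then show "x \<notin> \<mm>" using one_notin_m m.I_l_closed[of x "inv x"] by auto
next
  assume x: "x \<in> carrier A" "x \<notin> \<mm>"
  have "PIdl x = carrier A"
    using proper_ideal_le_m[OF A.cgenideal_ideal[OF x(1)]] A.cgenideal_self[OF x(1)] x(2) by auto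
  then have "\<one> \<in> PIdl x" by simp
  then obtain y where "y \<in> carrier A" "\<one> = y \<otimes> x" by (auto simp: cgenideal_def)
  then show "x \<in> Units A" using x A.m_comm[of x y] by (auto simp: Units_def)
qed

text \<open>Nakayama's lemma: a proper submodule N of D lies in a proper submodule H that contains
  \<open>\<mm>\<close>D. Take H maximal among the proper ones above N. If rx were outside H, then D
  = H + A rx by maximality, so (1 - sr)x would lie in H for some s; as 1 - sr is a unit, x and with
  it rx would lie in H.\<close>

lemma nakayama:
  assumes M: "module A M" and D: "noeth A M D" "submodule D A M" and N: "submodule N A M" "N \<subseteq> D" "N \<noteq> D"
  obtains H where "submodule H A M" "N \<subseteq> H" "H \<subseteq> D" "H \<noteq> D"
    "\<And>r d. r \<in> \<mm> \<Longrightarrow> d \<in> D \<Longrightarrow> r \<odot>\<^bsub>M\<^esub> d \<in> H"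
proof -
  interpret M: module A M by fact
  define F where "F = {H. submodule H A M \<and> N \<subseteq> H \<and> H \<subseteq> D \<and> H \<noteq> D}"
  have "\<exists>H\<in>F. \<forall>H'\<in>F. H \<subseteq> H' \<longrightarrow> H' = H"
    by (rule noeth_maximal[OF D(1)]) (use N in \<open>auto simp: F_def\<close>)
  then obtain H where HF: "H \<in> F" and H2: "\<And>H'. H' \<in> F \<Longrightarrow> H \<subseteq> H' \<Longrightarrow> H' = H" by blast
  have H: "submodule H A M \<and> N \<subseteq> H \<and> H \<subseteq> D \<and> H \<noteq> D" using HF by (simp add: F_def)
  then have Hs: "submodule H A M" by simp
  note HS = Hs[unfolded M.submodule_iff]
  note DS = D(2)[unfolded M.submodule_iff]
  have mem: "x \<in> H" if rx: "r \<in> \<mm>" "x \<in> D" "r \<odot>\<^bsub>M\<^esub> x \<notin> H" for r x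
  proof -
    have r: "r \<in> carrier A" and x: "x \<in> carrier M" using that m.Icarr DS by auto
    have rxD: "r \<odot>\<^bsub>M\<^esub> x \<in> D" using DS that r by auto
    let ?H' = "M.adjoin H (r \<odot>\<^bsub>M\<^esub> x)"
    note ad = M.submodule_adjoin[OF Hs, of "r \<odot>\<^bsub>M\<^esub> x"]
    have HD: "?H' \<subseteq> D" using M.adjoin_subset[OF D(2) _ rxD, of H] H by auto
    have ne: "?H' \<noteq> H" using ad(3) r x that by auto
    have "?H' = D"
    proof (rule ccontr)
      assume "?H' \<noteq> D"
      then have "?H' \<in> F" using HD ad(1,2) H r x by (auto simp: F_def)
      then show False using H2[of ?H'] ad(2) ne r x by auto
    qed
    then obtain h s where hs: "x = h \<oplus>\<^bsub>M\<^esub> s \<odot>\<^bsub>M\<^esub> (r \<odot>\<^bsub>M\<^esub> x)" "h \<in> H" "s \<in> carrier A"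
      using rx(2) unfolding M.adjoin_def by auto
    have hc: "h \<in> carrier M" using HS hs by auto
    have u: "\<one> \<ominus> s \<otimes> r \<in> Units A"
    proof -
      have sr: "s \<otimes> r \<in> \<mm>" using that hs m.I_l_closed by auto
      have "\<one> \<ominus> s \<otimes> r \<notin> \<mm>"
      proof
        assume "\<one> \<ominus> s \<otimes> r \<in> \<mm>"
        then have "(\<one> \<ominus> s \<otimes> r) \<oplus> s \<otimes> r \<in> \<mm>" using sr by auto
        moreover have "(\<one> \<ominus> s \<otimes> r) \<oplus> s \<otimes> r = \<one>" using r hs by algebra
        ultimately show False using one_notin_m by simp
      qed
      then show ?thesis using unit_iff r hs by auto
    qed
    have "(\<one> \<ominus> s \<otimes> r) \<odot>\<^bsub>M\<^esub> x = x \<ominus>\<^bsub>M\<^esub> (s \<otimes> r) \<odot>\<^bsub>M\<^esub> x"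
      using r x hs(3) by (simp add: a_minus_def M.smult_l_distr M.smult_l_minus)
    also have "\<dots> = h"
    proof -
      have sx: "(s \<otimes> r) \<odot>\<^bsub>M\<^esub> x \<in> carrier M" using r x hs by auto
      have "x = h \<oplus>\<^bsub>M\<^esub> (s \<otimes> r) \<odot>\<^bsub>M\<^esub> x" using hs r x by (simp add: M.smult_assoc1)
      then have "x \<ominus>\<^bsub>M\<^esub> (s \<otimes> r) \<odot>\<^bsub>M\<^esub> x = (h \<oplus>\<^bsub>M\<^esub> (s \<otimes> r) \<odot>\<^bsub>M\<^esub> x) \<ominus>\<^bsub>M\<^esub> (s \<otimes> r) \<odot>\<^bsub>M\<^esub> x" by metis
      also have "\<dots> = h" using hc sx by (simp add: a_minus_def M.M.a_assoc M.M.r_neg)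
      finally show ?thesis .
    qed
    finally have "inv (\<one> \<ominus> s \<otimes> r) \<odot>\<^bsub>M\<^esub> ((\<one> \<ominus> s \<otimes> r) \<odot>\<^bsub>M\<^esub> x) \<in> H" using HS hs u by auto
    moreover have "inv (\<one> \<ominus> s \<otimes> r) \<odot>\<^bsub>M\<^esub> ((\<one> \<ominus> s \<otimes> r) \<odot>\<^bsub>M\<^esub> x) = x"
      using u x r hs(3) by (simp add: M.smult_assoc1[symmetric])
    ultimately show "x \<in> H" by simp
  qed
  show ?thesis
  proof (rule that[of H])
    fix r d assume rd: "r \<in> \<mm>" "d \<in> D"
    have "r \<in> carrier A" using rd m.Icarr by auto
    show "r \<odot>\<^bsub>M\<^esub> d \<in> H"
    proof (rule ccontr)
      assume n: "r \<odot>\<^bsub>M\<^esub> d \<notin> H"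
      then have "d \<in> H" by (rule mem[OF rd])
      then show False using n HS \<open>r \<in> carrier A\<close> by simp
    qed
  qed (use H in simp_all)
qed

text \<open>Among the elements of X outside Y choose x with the largest annihilator modulo Y. If rx
  were not in Y for some r in \<open>\<mm>\<close>, then rx would have the same annihilator, and by
  induction no power of r would carry x into Y, against the nilpotency hypothesis.\<close>

lemma simple_step:
  assumes M: "module A M" and Y: "submodule Y A M" and X: "X \<subseteq> carrier M" "Y \<subseteq> X" "Y \<noteq> X"
    and X_smult: "\<And>r x. r \<in> carrier A \<Longrightarrow> x \<in> X \<Longrightarrow> r \<odot>\<^bsub>M\<^esub> x \<in> X"
    and nil: "\<And>r x. r \<in> \<mm> \<Longrightarrow> x \<in> X \<Longrightarrow> \<exists>k::nat. (r [^] k) \<odot>\<^bsub>M\<^esub> x \<in> Y"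
  obtains x where "x \<in> X" "x \<notin> Y" "\<And>r. r \<in> \<mm> \<Longrightarrow> r \<odot>\<^bsub>M\<^esub> x \<in> Y"
proof -
  interpret M: module A M by fact
  note YS = Y[unfolded M.submodule_iff]
  let ?ann = "\<lambda>x. {r \<in> carrier A. r \<odot>\<^bsub>M\<^esub> x \<in> Y}"
  define F where "F = ?ann ` (X - Y)"
  have sub: "submodule (?ann x) A (self_module A)" if "x \<in> X" for x
    unfolding module.submodule_iff[OF AA.Emod]
    using YS that X by (auto simp: M.smult_l_distr M.smult_assoc1)
  have "\<exists>P\<in>F. \<forall>P'\<in>F. P \<subseteq> P' \<longrightarrow> P' = P"
    by (rule noeth_maximal[OF noeth_A]) (use sub X in \<open>auto simp: F_def\<close>)
  then obtain P where P: "P \<in> F" "\<And>P'. P' \<in> F \<Longrightarrow> P \<subseteq> P' \<Longrightarrow> P' = P" by blast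
  from P(1) obtain x where x: "x \<in> X" "x \<notin> Y" "P = ?ann x" by (auto simp: F_def)
  have xc: "x \<in> carrier M" using x X by auto
  show ?thesis
  proof (rule that[OF x(1,2)])
    fix r assume r: "r \<in> \<mm>"
    then have rc: "r \<in> carrier A" using m.Icarr by auto
    show "r \<odot>\<^bsub>M\<^esub> x \<in> Y"
    proof (rule ccontr)
      assume n: "r \<odot>\<^bsub>M\<^esub> x \<notin> Y"
      have "?ann x \<subseteq> ?ann (r \<odot>\<^bsub>M\<^esub> x)"
      proof clarify
        fix s assume s: "s \<in> carrier A" "s \<odot>\<^bsub>M\<^esub> x \<in> Y"
        have "s \<odot>\<^bsub>M\<^esub> (r \<odot>\<^bsub>M\<^esub> x) = r \<odot>\<^bsub>M\<^esub> (s \<odot>\<^bsub>M\<^esub> x)"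
          using s rc xc by (simp add: M.smult_assoc1[symmetric] A.m_comm)
        then show "s \<odot>\<^bsub>M\<^esub> (r \<odot>\<^bsub>M\<^esub> x) \<in> Y" using YS s rc by auto
      qed
      moreover have "?ann (r \<odot>\<^bsub>M\<^esub> x) \<in> F" using n X_smult[OF rc x(1)] by (auto simp: F_def)
      ultimately have e: "?ann (r \<odot>\<^bsub>M\<^esub> x) = ?ann x" using P(2)[of "?ann (r \<odot>\<^bsub>M\<^esub> x)"] x(3) by simp
      have "(r [^] k) \<odot>\<^bsub>M\<^esub> x \<notin> Y" for k :: nat
      proof (induction k)
        case 0 then show ?case using x(2) xc by simp
      next
        case (Suc k)
        have "r [^] k \<notin> ?ann x" using Suc by auto
        then have "(r [^] k) \<odot>\<^bsub>M\<^esub> (r \<odot>\<^bsub>M\<^esub> x) \<notin> Y" using e rc by auto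
        then show ?case using rc xc by (simp add: M.smult_assoc1)
      qed
      with nil[OF r x(1)] show False by blast
    qed
  qed
qed

end

section \<open>Duality into a submodule with simple socle\<close>

text \<open>The common setting for R inside Q(R) and for the extension rings inside overrings built
  from Q(R). Invertibility of a allows passing between ideals and fractional ideals by powers of a,
  and the last assumption makes every quotient killed by a power of a torsion for each element of
  \<open>\<mm>\<close>.\<close>

locale param_overring = overring A E + noeth_local A
  for A :: "('a, 'm) ring_scheme" and E :: "('a, 'n) ring_scheme" (structure) +
  fixes a
  assumes a_m: "a \<in> max_ideal A" and a_unit: "a \<in> Units E"
    and a_param: "\<And>x. x \<in> max_ideal A \<Longrightarrow> \<exists>k::nat. x [^]\<^bsub>A\<^esub> k \<in> PIdl\<^bsub>A\<^esub> a"
begin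

lemma unit_cancel:
  assumes "q \<in> Units E" "x \<in> carrier E"
  shows "inv q \<otimes> (q \<otimes> x) = x" "q \<otimes> (inv q \<otimes> x) = x"
  using assms E.m_assoc[of "inv q" q x] E.m_assoc[of q "inv q" x] by auto

lemma A_neg_one: "\<ominus>\<^bsub>A\<^esub> \<one>\<^bsub>A\<^esub> = \<ominus> \<one>"
  using A_uminus[OF A.one_closed] by (simp add: A_ops(3))

lemma m_A [intro]: "r \<in> \<mm> \<Longrightarrow> r \<in> carrier A"
  using m.Icarr by auto

lemma a_A [simp, intro]: "a \<in> carrier A" "a \<in> carrier E"
  using a_m by auto

lemma pow_unit: "a [^] (k::nat) \<in> Units E"
  using a_unit by (rule E.Units_pow_closed)

lemma pow_A [simp, intro]: "a [^] (k::nat) \<in> carrier A" "a [^] (k::nat) \<in> carrier E"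
  by auto

lemma pow_inv [simp]: "x \<in> carrier E \<Longrightarrow> a [^] (k::nat) \<otimes> (inv (a [^] k) \<otimes> x) = x"
  "x \<in> carrier E \<Longrightarrow> inv (a [^] k) \<otimes> (a [^] k \<otimes> x) = x" "inv (a [^] k) \<in> carrier E"
  using pow_unit[of k] by (simp_all add: E.m_assoc[symmetric])

text \<open>If r^l = sa, then r^(lk) x = s^k (a^k x) lies in X.\<close>

lemma nilpotent_mod:
  assumes M: "module A M" and X: "submodule X A M" and x: "x \<in> carrier M" "a [^]\<^bsub>A\<^esub> (k::nat) \<odot>\<^bsub>M\<^esub> x \<in> X"
    and r: "r \<in> \<mm>"
  shows "\<exists>j::nat. (r [^]\<^bsub>A\<^esub> j) \<odot>\<^bsub>M\<^esub> x \<in> X"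
proof -
  interpret M: module A M by fact
  obtain l :: nat where "r [^]\<^bsub>A\<^esub> l \<in> PIdl\<^bsub>A\<^esub> a" using a_param[OF r] by blast
  then obtain s where s: "s \<in> carrier A" "r [^]\<^bsub>A\<^esub> l = s \<otimes>\<^bsub>A\<^esub> a" by (auto simp: cgenideal_def)
  have "r [^]\<^bsub>A\<^esub> (l * k) = (s [^]\<^bsub>A\<^esub> k) \<otimes>\<^bsub>A\<^esub> (a [^]\<^bsub>A\<^esub> k)"
    using r s A.nat_pow_pow[of r l k] A.nat_pow_distrib[of s a k] by auto
  then have "(r [^]\<^bsub>A\<^esub> (l * k)) \<odot>\<^bsub>M\<^esub> x = (s [^]\<^bsub>A\<^esub> k) \<odot>\<^bsub>M\<^esub> (a [^]\<^bsub>A\<^esub> k \<odot>\<^bsub>M\<^esub> x)"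
    using s x by (simp add: M.smult_assoc1)
  also have "\<dots> \<in> X" using X[unfolded M.submodule_iff] s x by auto
  finally show ?thesis by blast
qed

text \<open>The quotient of this set by J is the socle Hom(k, E/J) of E/J, with k the residue field.
  It is also Ext^1(k, J), since a is invertible on E and kills k.\<close>

definition soc :: "'a set \<Rightarrow> 'a set" where
  "soc J = {z \<in> carrier E. \<forall>r\<in>\<mm>. r \<otimes> z \<in> J}"

text \<open>The socle of E/J is one-dimensional over the residue field: it is nonzero, and each of
  its nonzero elements generates it. Generation over A stands in for dimension over the residue
  field.\<close>

definition type1 :: "'a set \<Rightarrow> bool" where
  "type1 J \<longleftrightarrow> smod J \<and> (\<exists>z\<in>soc J. z \<notin> J) \<and>
     (\<forall>z\<in>soc J. \<forall>w\<in>soc J. z \<notin> J \<longrightarrow> (\<exists>r\<in>carrier A. w \<ominus> r \<otimes> z \<in> J))"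

text \<open>Multiplication by the unit q is an automorphism of the A-module E that carries J to qJ,
  and hence one socle to the other.\<close>

lemma type1_scal:
  assumes J: "type1 J" and q: "q \<in> Units E"
  shows "type1 (scal q J)"
proof -
  have Js: "smod J" using J by (simp add: type1_def)
  note Jc = smodD(1)[OF Js]
  have qc: "q \<in> carrier E" "inv q \<in> carrier E" using q by auto
  have mem: "x \<in> scal q J \<longleftrightarrow> inv q \<otimes> x \<in> J" if "x \<in> carrier E" for x
  proof
    assume "x \<in> scal q J"
    then obtain j where "x = q \<otimes> j" "j \<in> J" by (auto simp: scal_def)
    then show "inv q \<otimes> x \<in> J" using unit_cancel[OF q] Jc by simp
  next
    assume "inv q \<otimes> x \<in> J"
    moreover have "x = q \<otimes> (inv q \<otimes> x)" using unit_cancel[OF q that] by simp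
    ultimately show "x \<in> scal q J" unfolding scal_def by blast
  qed
  have socm: "x \<in> soc (scal q J) \<longleftrightarrow> inv q \<otimes> x \<in> soc J" if x: "x \<in> carrier E" for x
  proof -
    have "r \<otimes> x \<in> scal q J \<longleftrightarrow> r \<otimes> (inv q \<otimes> x) \<in> J" if "r \<in> \<mm>" for r
      using mem[of "r \<otimes> x"] that x qc m_A[OF that] by (simp add: E.m_lcomm)
    then show ?thesis using x qc by (simp add: soc_def)
  qed
  show ?thesis unfolding type1_def
  proof (intro conjI ballI impI)
    show "smod (scal q J)" using Js qc by (intro smod_scal)
    obtain z where z: "z \<in> soc J" "z \<notin> J" using J by (auto simp: type1_def)
    then have "z \<in> carrier E" by (simp add: soc_def)
    then have e: "inv q \<otimes> (q \<otimes> z) = z" using unit_cancel[OF q] by simp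
    then show "\<exists>z\<in>soc (scal q J). z \<notin> scal q J"
      using z mem[of "q \<otimes> z"] socm[of "q \<otimes> z"] qc \<open>z \<in> carrier E\<close> by auto
  next
    fix z w assume zw: "z \<in> soc (scal q J)" "w \<in> soc (scal q J)" "z \<notin> scal q J"
    have c: "z \<in> carrier E" "w \<in> carrier E" using zw by (auto simp: soc_def)
    obtain r where r: "r \<in> carrier A" "inv q \<otimes> w \<ominus> r \<otimes> (inv q \<otimes> z) \<in> J"
      using J zw socm[OF c(1)] socm[OF c(2)] mem[OF c(1)] by (auto simp: type1_def)
    have "inv q \<otimes> w \<ominus> r \<otimes> (inv q \<otimes> z) = inv q \<otimes> (w \<ominus> r \<otimes> z)"
      using r c qc by (simp add: a_minus_def E.r_distr E.r_minus E.m_lcomm)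
    then show "\<exists>r\<in>carrier A. w \<ominus> r \<otimes> z \<in> scal q J"
      using r c mem[of "w \<ominus> r \<otimes> z"] by (intro bexI[of _ r]) auto
  qed
qed

end

text \<open>The pairing is abstract because two instances are wanted: multiplication on E, which
  gives the duality of fractional ideals, and the dot product on E^n, which describes homomorphisms
  into E/J.\<close>

locale dual_pairing = param_overring A E a + P: module A P
  for A :: "('a, 'm) ring_scheme" and E :: "('a, 'n) ring_scheme" (structure) and a
    and P :: "('a, 'p) module" +
  fixes \<beta> :: "'p \<Rightarrow> 'p \<Rightarrow> 'a" and J :: "'a set"
  assumes \<beta>_closed: "x \<in> carrier P \<Longrightarrow> y \<in> carrier P \<Longrightarrow> \<beta> x y \<in> carrier E"
    and \<beta>_add1: "x \<in> carrier P \<Longrightarrow> x' \<in> carrier P \<Longrightarrow> y \<in> carrier P \<Longrightarrow> \<beta> (x \<oplus>\<^bsub>P\<^esub> x') y = \<beta> x y \<oplus> \<beta> x' y"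
    and \<beta>_add2: "x \<in> carrier P \<Longrightarrow> y \<in> carrier P \<Longrightarrow> y' \<in> carrier P \<Longrightarrow> \<beta> x (y \<oplus>\<^bsub>P\<^esub> y') = \<beta> x y \<oplus> \<beta> x y'"
    and \<beta>_smult1: "r \<in> carrier A \<Longrightarrow> x \<in> carrier P \<Longrightarrow> y \<in> carrier P \<Longrightarrow> \<beta> (r \<odot>\<^bsub>P\<^esub> x) y = r \<otimes> \<beta> x y"
    and \<beta>_smult2: "r \<in> carrier A \<Longrightarrow> x \<in> carrier P \<Longrightarrow> y \<in> carrier P \<Longrightarrow> \<beta> x (r \<odot>\<^bsub>P\<^esub> y) = r \<otimes> \<beta> x y"
    and J: "type1 J"
begin

lemma Js: "smod J" using J by (simp add: type1_def)

definition perp :: "'p set \<Rightarrow> 'p set" where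
  "perp X = {y \<in> carrier P. \<forall>x\<in>X. \<beta> x y \<in> J}"

text \<open>The nontrivial half of the equality of X with its double perpendicular, where
  perpendicular means pairing into J.\<close>

definition dual_closed :: "'p set \<Rightarrow> bool" where
  "dual_closed X \<longleftrightarrow> (\<forall>p\<in>carrier P. (\<forall>y\<in>perp X. \<beta> p y \<in> J) \<longrightarrow> p \<in> X)"

lemma \<beta>_minus1: "x \<in> carrier P \<Longrightarrow> x' \<in> carrier P \<Longrightarrow> y \<in> carrier P \<Longrightarrow> \<beta> (x \<ominus>\<^bsub>P\<^esub> x') y = \<beta> x y \<ominus> \<beta> x' y"
proof -
  assume *: "x \<in> carrier P" "x' \<in> carrier P" "y \<in> carrier P"
  have "\<ominus>\<^bsub>P\<^esub> x' = (\<ominus>\<^bsub>A\<^esub> \<one>\<^bsub>A\<^esub>) \<odot>\<^bsub>P\<^esub> x'" using * by (simp add: P.smult_l_minus)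
  then have "\<beta> (\<ominus>\<^bsub>P\<^esub> x') y = (\<ominus>\<^bsub>A\<^esub> \<one>\<^bsub>A\<^esub>) \<otimes> \<beta> x' y" using * by (simp add: \<beta>_smult1)
  also have "\<dots> = \<ominus> \<beta> x' y" using * \<beta>_closed by (simp add: A_neg_one E.l_minus)
  finally show ?thesis using * by (simp add: a_minus_def \<beta>_add1)
qed

lemma \<beta>_minus2: "x \<in> carrier P \<Longrightarrow> y \<in> carrier P \<Longrightarrow> y' \<in> carrier P \<Longrightarrow> \<beta> x (y \<ominus>\<^bsub>P\<^esub> y') = \<beta> x y \<ominus> \<beta> x y'"
proof -
  assume *: "x \<in> carrier P" "y \<in> carrier P" "y' \<in> carrier P"
  have "\<ominus>\<^bsub>P\<^esub> y' = (\<ominus>\<^bsub>A\<^esub> \<one>\<^bsub>A\<^esub>) \<odot>\<^bsub>P\<^esub> y'" using * by (simp add: P.smult_l_minus)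
  then have "\<beta> x (\<ominus>\<^bsub>P\<^esub> y') = (\<ominus>\<^bsub>A\<^esub> \<one>\<^bsub>A\<^esub>) \<otimes> \<beta> x y'" using * by (simp add: \<beta>_smult2)
  also have "\<dots> = \<ominus> \<beta> x y'" using * \<beta>_closed by (simp add: A_neg_one E.l_minus)
  finally show ?thesis using * by (simp add: a_minus_def \<beta>_add2)
qed

text \<open>This is where the socle of E/J has to be simple. Some y0 perpendicular to X has
  \<beta>(x0, y0) in the socle but not in J, so every other socle value is a multiple of this one
  modulo J. Two multiples are removed: s x0 from p, and t y0 from a vector y perpendicular to X.
  What remains pairs into J, whence p - s x0 lies in X.\<close>

lemma dual_closed_step:
  assumes X: "submodule X A P" "dual_closed X" and x0: "x0 \<in> carrier P" "x0 \<notin> X"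
    "\<And>r. r \<in> \<mm> \<Longrightarrow> r \<odot>\<^bsub>P\<^esub> x0 \<in> X"
  shows "dual_closed (P.adjoin X x0)"
  unfolding dual_closed_def
proof (intro ballI impI)
  fix p assume p: "p \<in> carrier P" "\<forall>y\<in>perp (P.adjoin X x0). \<beta> p y \<in> J"
  note XS = X(1)[unfolded P.submodule_iff]
  note JD = smodD[OF Js]
  have Xc: "x \<in> carrier P" if "x \<in> X" for x using XS that by auto
  have ad: "y \<in> perp (P.adjoin X x0)" if y: "y \<in> perp X" "\<beta> x0 y \<in> J" for y
  proof -
    have yc: "y \<in> carrier P" "\<And>x. x \<in> X \<Longrightarrow> \<beta> x y \<in> J" using y by (auto simp: perp_def)
    have "\<beta> (x \<oplus>\<^bsub>P\<^esub> r \<odot>\<^bsub>P\<^esub> x0) y \<in> J" if "x \<in> X" "r \<in> carrier A" for x r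
      using that yc y(2) Xc x0 JD by (simp add: \<beta>_add1 \<beta>_smult1)
    then show ?thesis using yc(1) by (auto simp: perp_def P.adjoin_def)
  qed
  obtain y0 where y0: "y0 \<in> perp X" "\<beta> x0 y0 \<notin> J"
    using X(2) x0 by (auto simp: dual_closed_def)
  have y0c: "y0 \<in> carrier P" using y0 by (simp add: perp_def)
  have s0: "\<beta> x0 y0 \<in> soc J"
  proof -
    have "r \<otimes> \<beta> x0 y0 \<in> J" if "r \<in> \<mm>" for r
      using x0(3)[OF that] y0 x0(1) y0c \<beta>_smult1[OF m_A[OF that] x0(1) y0c] by (auto simp: perp_def)
    then show ?thesis using \<beta>_closed x0 y0c by (simp add: soc_def)
  qed
  \<comment> \<open>For r in \<open>\<mm>\<close> the vector r y0 is perpendicular to the enlarged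
    submodule, because \<beta>(x0, y0) is in the socle; hence p pairs into J with it.\<close>
  have "r \<otimes> \<beta> p y0 \<in> J" if r: "r \<in> \<mm>" for r
  proof -
    have "r \<odot>\<^bsub>P\<^esub> y0 \<in> perp (P.adjoin X x0)"
    proof (rule ad)
      show "r \<odot>\<^bsub>P\<^esub> y0 \<in> perp X" using y0(1) y0c m_A[OF r] JD Xc by (auto simp: perp_def \<beta>_smult2)
      show "\<beta> x0 (r \<odot>\<^bsub>P\<^esub> y0) \<in> J" using s0 r x0 y0c m_A[OF r] by (simp add: \<beta>_smult2 soc_def)
    qed
    then have "\<beta> p (r \<odot>\<^bsub>P\<^esub> y0) \<in> J" using p by blast
    then show ?thesis using p y0c m_A[OF r] by (simp add: \<beta>_smult2)
  qed
  then have sp: "\<beta> p y0 \<in> soc J" using \<beta>_closed p y0c by (simp add: soc_def)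
  obtain s where s: "s \<in> carrier A" "\<beta> p y0 \<ominus> s \<otimes> \<beta> x0 y0 \<in> J"
    using J s0 sp y0(2) by (auto simp: type1_def)
  let ?q = "p \<ominus>\<^bsub>P\<^esub> s \<odot>\<^bsub>P\<^esub> x0"
  have qc: "?q \<in> carrier P" using p s x0 by simp
  have q0: "\<beta> ?q y0 \<in> J" using s p x0 y0c by (simp add: \<beta>_minus1 \<beta>_smult1)
  have "\<beta> ?q y \<in> J" if y: "y \<in> perp X" for y
  proof -
    have yc: "y \<in> carrier P" using y by (simp add: perp_def)
    have "\<beta> x0 y \<in> soc J"
    proof -
      have "r \<otimes> \<beta> x0 y \<in> J" if "r \<in> \<mm>" for r
        using x0(3)[OF that] y x0(1) yc \<beta>_smult1[OF m_A[OF that] x0(1) yc] by (auto simp: perp_def)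
      then show ?thesis using \<beta>_closed x0 yc by (simp add: soc_def)
    qed
    then obtain t where t: "t \<in> carrier A" "\<beta> x0 y \<ominus> t \<otimes> \<beta> x0 y0 \<in> J"
      using J s0 y0(2) by (auto simp: type1_def)
    let ?y' = "y \<ominus>\<^bsub>P\<^esub> t \<odot>\<^bsub>P\<^esub> y0"
    have y'c: "?y' \<in> carrier P" using yc t y0c by simp
    have "?y' \<in> perp (P.adjoin X x0)"
    proof (rule ad)
      show "?y' \<in> perp X" using y y0(1) t yc y0c JD Xc y'c by (auto simp: perp_def \<beta>_minus2 \<beta>_smult2)
      show "\<beta> x0 ?y' \<in> J" using t x0 yc y0c by (simp add: \<beta>_minus2 \<beta>_smult2)
    qed
    then have "\<beta> p ?y' \<in> J" "\<beta> x0 ?y' \<in> J" using p P.submodule_adjoin(3)[OF X(1) x0(1)] by (auto simp: perp_def)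
    then have "\<beta> ?q ?y' \<in> J" using p x0 s y'c JD by (simp add: \<beta>_minus1 \<beta>_smult1)
    moreover have "\<beta> ?q (t \<odot>\<^bsub>P\<^esub> y0) \<in> J" using q0 t y0c qc JD by (simp add: \<beta>_smult2)
    ultimately have "\<beta> ?q ?y' \<oplus> \<beta> ?q (t \<odot>\<^bsub>P\<^esub> y0) \<in> J" using JD by blast
    moreover have "?y' \<oplus>\<^bsub>P\<^esub> t \<odot>\<^bsub>P\<^esub> y0 = y"
      using yc t y0c by (simp add: a_minus_def P.M.a_assoc P.M.l_neg)
    ultimately show ?thesis using \<beta>_add2[OF qc y'c, of "t \<odot>\<^bsub>P\<^esub> y0"] t y0c by simp
  qed
  then have "?q \<in> X" using X(2) qc by (auto simp: dual_closed_def)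
  moreover have "p = ?q \<oplus>\<^bsub>P\<^esub> s \<odot>\<^bsub>P\<^esub> x0"
    using p s x0 by (simp add: a_minus_def P.M.a_assoc P.M.l_neg)
  ultimately show "p \<in> P.adjoin X x0" using s unfolding P.adjoin_def by blast
qed

text \<open>The quotient of Y0 by X0 is killed by a power of a, so from a closed submodule properly
  below Y0 \<open>simple_step\<close> always allows one more application of
  \<open>dual_closed_step\<close>; the chain condition makes the climb end at Y0.\<close>

lemma dual_closed_all:
  assumes X0: "submodule X0 A P" "dual_closed X0" and Y0: "submodule Y0 A P" "X0 \<subseteq> Y0" "noeth A P Y0"
    and k: "\<And>x. x \<in> Y0 \<Longrightarrow> a [^]\<^bsub>A\<^esub> (k::nat) \<odot>\<^bsub>P\<^esub> x \<in> X0"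
  shows "dual_closed Y0"
proof -
  define F where "F = {X. submodule X A P \<and> X0 \<subseteq> X \<and> X \<subseteq> Y0 \<and> dual_closed X}"
  have "\<exists>X\<in>F. \<forall>X'\<in>F. X \<subseteq> X' \<longrightarrow> X' = X"
    by (rule noeth_maximal[OF Y0(3)]) (use X0 Y0 in \<open>auto simp: F_def\<close>)
  then obtain X where XF: "X \<in> F" and mx: "\<And>X'. X' \<in> F \<Longrightarrow> X \<subseteq> X' \<Longrightarrow> X' = X" by blast
  have X: "submodule X A P" "X0 \<subseteq> X" "X \<subseteq> Y0" "dual_closed X" using XF by (auto simp: F_def)
  note YS = Y0(1)[unfolded P.submodule_iff]
  have "X = Y0"
  proof (rule ccontr)
    assume ne: "X \<noteq> Y0"
    obtain x where x: "x \<in> Y0" "x \<notin> X" "\<And>r. r \<in> \<mm> \<Longrightarrow> r \<odot>\<^bsub>P\<^esub> x \<in> X"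
    proof (rule simple_step[OF P.module_axioms X(1) _ X(3) ne])
      show "Y0 \<subseteq> carrier P" using YS by auto
      show "r \<odot>\<^bsub>P\<^esub> x \<in> Y0" if "r \<in> carrier A" "x \<in> Y0" for r x using YS that by auto
      show "\<exists>j::nat. (r [^]\<^bsub>A\<^esub> j) \<odot>\<^bsub>P\<^esub> x \<in> X" if "r \<in> \<mm>" "x \<in> Y0" for r x
        by (rule nilpotent_mod[OF P.module_axioms X(1) _ _ that(1), of x k]) (use YS k X that in auto)
    qed blast
    have xc: "x \<in> carrier P" using x YS by auto
    have "dual_closed (P.adjoin X x)" by (rule dual_closed_step[OF X(1,4) xc x(2,3)])
    moreover have "P.adjoin X x \<subseteq> Y0" using P.adjoin_subset[OF Y0(1) X(3) x(1)] .
    moreover note ad = P.submodule_adjoin[OF X(1) xc]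
    ultimately have "P.adjoin X x \<in> F" using X ad by (auto simp: F_def)
    then have "P.adjoin X x = X" using mx ad by auto
    then show False using ad x by auto
  qed
  then show ?thesis using X by simp
qed

end

section \<open>Fractional ideals of type one\<close>

context param_overring
begin

text \<open>One exponent serves both bounds. By \<open>fracD\<close> every larger exponent does so
  as well, which allows adding the exponents of several fractional ideals.\<close>

definition frac :: "'a set \<Rightarrow> bool" where
  "frac X \<longleftrightarrow> smod X \<and> (\<exists>k::nat. a [^] k \<in> X \<and> (\<forall>x\<in>X. a [^] k \<otimes> x \<in> carrier A))"

lemma pow_add: "a [^] (i + j :: nat) = a [^] i \<otimes> a [^] j"
  using E.nat_pow_mult[of a i j] by simp

lemma fracD:
  assumes "frac X"
  obtains k :: nat where "\<And>j. j \<ge> k \<Longrightarrow> a [^] j \<in> X" "\<And>j x. j \<ge> k \<Longrightarrow> x \<in> X \<Longrightarrow> a [^] j \<otimes> x \<in> carrier A"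
proof -
  have X: "smod X" using assms by (simp add: frac_def)
  note XD = smodD[OF X]
  obtain k :: nat where k: "a [^] k \<in> X" "\<forall>x\<in>X. a [^] k \<otimes> x \<in> carrier A" using assms by (auto simp: frac_def)
  have e: "a [^] j = a [^] (j - k) \<otimes> a [^] k" if "j \<ge> k" for j
    using that pow_add[of "j - k" k] by simp
  show ?thesis
  proof (rule that[of k])
    fix j assume j: "j \<ge> k"
    show "a [^] j \<in> X" unfolding e[OF j] using XD(4) k(1) by blast
    fix x assume x: "x \<in> X"
    then have "a [^] (j - k) \<otimes> (a [^] k \<otimes> x) \<in> carrier A" using k by blast
    then show "a [^] j \<otimes> x \<in> carrier A" unfolding e[OF j] using XD(1)[OF x] by (simp add: E.m_assoc)
  qed
qed

text \<open>Multiplication by a^k is injective on E and carries chains inside X to chains of ideals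
  of A.\<close>

lemma noeth_bounded:
  assumes "X \<subseteq> carrier E" "\<And>x. x \<in> X \<Longrightarrow> a [^] (k::nat) \<otimes> x \<in> carrier A"
  shows "noeth A (self_module E) X"
  unfolding noeth_def
proof (intro allI impI)
  fix f :: "nat \<Rightarrow> 'a set"
  assume f: "\<forall>t. submodule (f t) A (self_module E) \<and> f t \<subseteq> X \<and> f t \<subseteq> f (Suc t)"
  have fs: "smod (f t)" "f t \<subseteq> carrier E" for t using f assms(1) by (auto simp: smod_def)
  have "\<exists>T. \<forall>t\<ge>T. scal (a [^] k) (f t) = scal (a [^] k) (f T)"
  proof (rule noethD[OF noeth_A])
    show "scal (a [^] k) (f t) \<subseteq> carrier A" for t using f assms(2) by (auto simp: scal_def)
    then show "submodule (scal (a [^] k) (f t)) A (self_module A)" for t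
      unfolding submodule_A_iff using fs by (auto intro: smod_scal)
    show "scal (a [^] k) (f t) \<subseteq> scal (a [^] k) (f (Suc t))" for t using f by (simp add: scal_mono)
  qed
  then obtain T where T: "\<forall>t\<ge>T. scal (a [^] k) (f t) = scal (a [^] k) (f T)" by blast
  have inv: "scal (inv (a [^] k)) (scal (a [^] k) (f t)) = f t" for t
    using fs pow_unit[of k] by (simp add: scal_scal scal_one)
  have "f t = f T" if "t \<ge> T" for t
  proof -
    have "f t = scal (inv (a [^] k)) (scal (a [^] k) (f T))"
      unfolding T[rule_format, OF that, symmetric] by (rule inv[symmetric])
    also have "\<dots> = f T" by (rule inv)
    finally show ?thesis .
  qed
  then show "\<exists>T. \<forall>t\<ge>T. f t = f T" by blast
qed

lemma noeth_frac: assumes "frac X" shows "noeth A (self_module E) X"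
proof -
  obtain k :: nat where "\<And>j x. j \<ge> k \<Longrightarrow> x \<in> X \<Longrightarrow> a [^] j \<otimes> x \<in> carrier A" using fracD[OF assms] by metis
  then show ?thesis using smodD(1)[of X] assms by (intro noeth_bounded[of X k]) (auto simp: frac_def)
qed

text \<open>The identity J : (J : X) = X. The climb starts at the multiple a^(2K) J, which is closed
  for an elementary reason: a^(-2K) is perpendicular to it, and multiplication by this one element
  already detects membership.\<close>

lemma double_dual:
  assumes J: "type1 J" "frac J" and X: "frac X" and p: "p \<in> carrier E"
    and *: "\<And>y. y \<in> carrier E \<Longrightarrow> (\<And>x. x \<in> X \<Longrightarrow> x \<otimes> y \<in> J) \<Longrightarrow> p \<otimes> y \<in> J"
  shows "p \<in> X"
proof -
  interpret D: dual_pairing A E a "self_module E" "\<lambda>x y. x \<otimes> y" J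
    by (intro dual_pairing.intro param_overring_axioms Emod dual_pairing_axioms.intro J(1))
      (auto simp: E.l_distr E.r_distr E.m_assoc E.m_lcomm)
  obtain k1 :: nat where k1: "\<And>j. j \<ge> k1 \<Longrightarrow> a [^] j \<in> J" "\<And>j x. j \<ge> k1 \<Longrightarrow> x \<in> J \<Longrightarrow> a [^] j \<otimes> x \<in> carrier A"
    by (rule fracD[OF J(2)]) (rule that)
  obtain k2 :: nat where k2: "\<And>j. j \<ge> k2 \<Longrightarrow> a [^] j \<in> X" "\<And>j x. j \<ge> k2 \<Longrightarrow> x \<in> X \<Longrightarrow> a [^] j \<otimes> x \<in> carrier A"
    by (rule fracD[OF X]) (rule that)
  define K where "K = k1 + k2"
  have Js: "smod J" and Xs: "smod X" using J X by (auto simp: frac_def)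
  note JD = smodD[OF Js] and XD = smodD[OF Xs]
  \<comment> \<open>One factor a^K moves J into A and the other is an element of X, so
    \<open>?q\<close> J lies in X. In the other direction the square of \<open>?q\<close> moves X
    into \<open>?q\<close> J.\<close>
  let ?q = "a [^] (K + K)"
  define X0 where "X0 = scal ?q J"
  have X0s: "smod X0" unfolding X0_def by (rule smod_scal[OF Js]) simp
  have X0X: "X0 \<subseteq> X"
  proof
    fix x assume "x \<in> X0"
    then obtain j where j: "x = ?q \<otimes> j" "j \<in> J" by (auto simp: X0_def scal_def)
    then have "x = (a [^] K \<otimes> j) \<otimes> a [^] K" using JD(1) by (simp add: pow_add E.m_ac)
    then show "x \<in> X" using XD(4)[of "a [^] K \<otimes> j" "a [^] K"] k1(2)[of K j] k2(1)[of K] j by (simp add: K_def)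
  qed
  have "D.dual_closed X0" unfolding D.dual_closed_def D.perp_def
  proof (intro ballI impI)
    fix p assume p: "p \<in> carrier (self_module E)" "\<forall>y\<in>{y \<in> carrier (self_module E). \<forall>x\<in>X0. x \<otimes> y \<in> J}. p \<otimes> y \<in> J"
    have "x \<otimes> inv ?q \<in> J" if x: "x \<in> X0" for x
    proof -
      obtain j where j: "x = ?q \<otimes> j" "j \<in> J" using x by (auto simp: X0_def scal_def)
      then have "x \<otimes> inv ?q = j" using JD(1)[OF j(2)] E.m_comm[of "?q \<otimes> j" "inv ?q"] by simp
      then show ?thesis using j by simp
    qed
    then have "p \<otimes> inv ?q \<in> J" using p by simp
    moreover have "p = ?q \<otimes> (p \<otimes> inv ?q)" using p E.m_comm[of p "inv ?q"] by simp
    ultimately show "p \<in> X0" unfolding X0_def scal_def by blast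
  qed
  then have "D.dual_closed X"
  proof (rule D.dual_closed_all[OF X0s[unfolded smod_def] _ Xs[unfolded smod_def] X0X noeth_frac[OF X], where k = "K + K + (K + K)"])
    fix x assume x: "x \<in> X"
    have xc: "x \<in> carrier E" using XD x by auto
    have "(a [^] K \<otimes> x) \<otimes> a [^] K \<in> J" using JD(4)[of "a [^] K \<otimes> x" "a [^] K"] k2(2)[of K x] k1(1)[of K] x by (simp add: K_def)
    then have "?q \<otimes> ((a [^] K \<otimes> x) \<otimes> a [^] K) \<in> X0" unfolding X0_def scal_def by blast
    moreover have "?q \<otimes> ((a [^] K \<otimes> x) \<otimes> a [^] K) = a [^] (K + K + (K + K)) \<otimes> x"
      using xc by (simp add: pow_add E.m_ac)
    ultimately show "a [^]\<^bsub>A\<^esub> (K + K + (K + K)) \<odot>\<^bsub>self_module E\<^esub> x \<in> X0" by (simp add: A_pow)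
  qed
  then show ?thesis using p * by (auto simp: D.dual_closed_def D.perp_def)
qed

text \<open>The unit is obtained as a generator q of D = J1 : J2. By Nakayama's lemma any q in D
  whose product with a socle element z0 of J2 leaves J1 generates D, and then J2 = J1 : D gives J2 =
  q^(-1) J1.\<close>

theorem type1_unique:
  assumes J1: "type1 J1" "frac J1" and J2: "type1 J2" "frac J2"
  shows "\<exists>q\<in>Units E. J2 = scal q J1"
proof -
  have J1s: "smod J1" and J2s: "smod J2" using J1 J2 by (auto simp: frac_def)
  note J1D = smodD[OF J1s] and J2D = smodD[OF J2s]
  obtain k1 :: nat where k1: "\<And>j. j \<ge> k1 \<Longrightarrow> a [^] j \<in> J1" "\<And>j x. j \<ge> k1 \<Longrightarrow> x \<in> J1 \<Longrightarrow> a [^] j \<otimes> x \<in> carrier A"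
    by (rule fracD[OF J1(2)]) (rule that)
  obtain k2 :: nat where k2: "\<And>j. j \<ge> k2 \<Longrightarrow> a [^] j \<in> J2" "\<And>j x. j \<ge> k2 \<Longrightarrow> x \<in> J2 \<Longrightarrow> a [^] j \<otimes> x \<in> carrier A"
    by (rule fracD[OF J2(2)]) (rule that)
  define K where "K = k1 + k2"
  define D where "D = {d \<in> carrier E. \<forall>x\<in>J2. x \<otimes> d \<in> J1}"
  have Ds: "smod D" using J1D J2D(1) by (intro smodI) (auto simp: D_def E.r_distr E.m_lcomm)
  note DD = smodD[OF Ds]
  have aD: "a [^] (K + K) \<in> D"
  proof -
    have "x \<otimes> a [^] (K + K) \<in> J1" if x: "x \<in> J2" for x
    proof -
      have "x \<otimes> a [^] (K + K) = (a [^] K \<otimes> x) \<otimes> a [^] K" using J2D(1)[OF x] by (simp add: pow_add E.m_ac)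
      then show ?thesis using J1D(4)[of "a [^] K \<otimes> x" "a [^] K"] k2(2)[of K x] k1(1)[of K] x by (simp add: K_def)
    qed
    then show ?thesis by (simp add: D_def)
  qed
  have Db: "a [^] (K + K) \<otimes> d \<in> carrier A" if d: "d \<in> D" for d
  proof -
    have dc: "d \<in> carrier E" using d by (simp add: D_def)
    have "a [^] K \<otimes> d \<in> J1" using d k2(1)[of K] by (simp add: D_def K_def)
    then have "a [^] K \<otimes> (a [^] K \<otimes> d) \<in> carrier A" using k1(2)[of K] by (simp add: K_def)
    then show ?thesis using dc by (simp add: pow_add E.m_assoc)
  qed
  have Df: "frac D" using Ds aD Db by (auto simp: frac_def)
  have D_dual: "p \<in> J2" if "p \<in> carrier E" "\<And>d. d \<in> D \<Longrightarrow> p \<otimes> d \<in> J1" for p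
    by (rule double_dual[OF J1 J2(2) that(1)]) (use that(2) in \<open>auto simp: D_def\<close>)
  obtain z0 where z0: "z0 \<in> soc J2" "z0 \<notin> J2" using J2(1) by (auto simp: type1_def)
  have z0c: "z0 \<in> carrier E" using z0 by (simp add: soc_def)
  have socD: "y \<otimes> d \<in> soc J1" if y: "y \<in> soc J2" and d: "d \<in> D" for y d
  proof -
    have c: "y \<in> carrier E" "d \<in> carrier E" using y d by (auto simp: soc_def D_def)
    have "r \<otimes> (y \<otimes> d) \<in> J1" if r: "r \<in> \<mm>" for r
    proof -
      have "(r \<otimes> y) \<otimes> d \<in> J1" using y d r by (auto simp: soc_def D_def)
      then show ?thesis using c m_A[OF r] by (simp add: E.m_assoc)
    qed
    then show ?thesis using c by (simp add: soc_def)
  qed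
  \<comment> \<open>As J2 = J1 : D and z0 is not in J2, some element of D does not multiply z0 into
    J1.\<close>
  obtain q where q: "q \<in> D" "z0 \<otimes> q \<notin> J1" using D_dual[OF z0c] z0(2) by blast
  have qc: "q \<in> carrier E" using q DD by auto
  define N where "N = scal q (carrier A)"
  have Ns: "smod N" unfolding N_def by (rule smod_scal[OF smod_A qc])
  have ND: "N \<subseteq> D"
  proof
    fix x assume "x \<in> N"
    then obtain r where r: "r \<in> carrier A" "x = q \<otimes> r" by (auto simp: N_def scal_def)
    then have "x = r \<otimes> q" using qc by (simp add: E.m_comm)
    then show "x \<in> D" using DD(4) r q by simp
  qed
  have "N = D"
  proof (rule ccontr)
    assume ne: "N \<noteq> D"
    obtain H where H: "submodule H A (self_module E)" "N \<subseteq> H" "H \<subseteq> D" "H \<noteq> D"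
      "\<And>r d. r \<in> \<mm> \<Longrightarrow> d \<in> D \<Longrightarrow> r \<odot>\<^bsub>self_module E\<^esub> d \<in> H"
      by (rule nakayama[OF Emod noeth_frac[OF Df] Ds[unfolded smod_def] Ns[unfolded smod_def] ND ne]) blast
    have Hs: "smod H" using H(1) by (simp add: smod_def)
    note HD = smodD[OF Hs]
    have H5: "r \<otimes> d \<in> H" if "r \<in> \<mm>" "d \<in> D" for r d using H(5)[OF that] by simp
    have Hf: "frac H"
    proof -
      have "a \<otimes> a [^] (K + K) \<in> H" using H5[OF a_m aD] .
      then have 1: "a [^] (K + K + 1) \<in> H" using pow_add[of "K + K" 1] by (simp add: E.m_comm)
      have 2: "a [^] (K + K + 1) \<otimes> x \<in> carrier A" if "x \<in> H" for x
      proof -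
        have "x \<in> D" using that H by auto
        then have "a \<otimes> (a [^] (K + K) \<otimes> x) \<in> carrier A" using Db by blast
        moreover have "a [^] (K + K + 1) \<otimes> x = a \<otimes> (a [^] (K + K) \<otimes> x)"
          using pow_add[of "K + K" 1] HD(1)[OF that] by (simp add: E.m_ac)
        ultimately show ?thesis by simp
      qed
      show ?thesis unfolding frac_def
        by (intro conjI Hs exI[of _ "K + K + 1"] 1 ballI 2)
    qed
    have "d \<in> H" if d: "d \<in> D" for d
    proof -
      have dc: "d \<in> carrier E" using d DD by auto
      obtain r where r: "r \<in> carrier A" "z0 \<otimes> d \<ominus> r \<otimes> (z0 \<otimes> q) \<in> J1"
        using J1(1) socD[OF z0(1) q(1)] socD[OF z0(1) d] q(2) by (auto simp: type1_def)
      \<comment> \<open>Both z0 d and z0 q represent elements of the simple socle of E/J1, so a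
        multiple of q can be subtracted from d to bring z0 d into J1. That d0 lies in H is then
        proved by duality for H.\<close>
      define d0 where "d0 = d \<ominus> r \<otimes> q"
      have d0D: "d0 \<in> D" using DD(4,6) d r q by (simp add: d0_def)
      have d0c: "d0 \<in> carrier E" using d0D DD by auto
      have "z0 \<otimes> d0 = z0 \<otimes> d \<ominus> r \<otimes> (z0 \<otimes> q)"
        using z0c dc qc r by (simp add: d0_def a_minus_def E.r_distr E.r_minus E.m_lcomm)
      then have zd0: "z0 \<otimes> d0 \<in> J1" using r by simp
      have "d0 \<in> H"
      proof (rule double_dual[OF J1 Hf d0c])
        fix y assume y: "y \<in> carrier E" "\<And>x. x \<in> H \<Longrightarrow> x \<otimes> y \<in> J1"
        \<comment> \<open>H contains \<open>\<mm>\<close>D, so sy multiplies D into J1, that is, sy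
          lies in J1 : D = J2. Hence y is a socle element for J2 and thus a multiple of z0 modulo
          J2.\<close>
        have "s \<otimes> y \<in> J2" if s: "s \<in> \<mm>" for s
        proof (rule D_dual)
          show "s \<otimes> y \<in> carrier E" using s y by auto
          fix w assume w: "w \<in> D"
          have "(s \<otimes> w) \<otimes> y \<in> J1" using y(2) H5[OF s w] by blast
          then show "s \<otimes> y \<otimes> w \<in> J1" using m_A[OF s] w y DD(1)[OF w] by (simp add: E.m_ac)
        qed
        then have ys: "y \<in> soc J2" using y by (simp add: soc_def)
        then obtain t where t: "t \<in> carrier A" "y \<ominus> t \<otimes> z0 \<in> J2" using J2(1) z0 by (auto simp: type1_def)
        have "(y \<ominus> t \<otimes> z0) \<otimes> d0 \<in> J1" using d0D t by (simp add: D_def)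
        moreover have "t \<otimes> (z0 \<otimes> d0) \<in> J1" using zd0 t J1D by blast
        ultimately have "(y \<ominus> t \<otimes> z0) \<otimes> d0 \<oplus> t \<otimes> (z0 \<otimes> d0) \<in> J1" using J1D by blast
        moreover have "(y \<ominus> t \<otimes> z0) \<otimes> d0 \<oplus> t \<otimes> (z0 \<otimes> d0) = d0 \<otimes> y"
        proof -
          have tc: "t \<in> carrier E" using t by auto
          show ?thesis using y(1) tc z0c d0c by algebra
        qed
        ultimately show "d0 \<otimes> y \<in> J1" by simp
      qed
      moreover have "r \<otimes> q \<in> H"
      proof -
        have "q \<otimes> r \<in> N" using r by (auto simp: N_def scal_def)
        then show ?thesis using H(2) qc r by (auto simp: E.m_comm)
      qed
      ultimately have "d0 \<oplus> r \<otimes> q \<in> H" using HD by blast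
      moreover have "d0 \<oplus> r \<otimes> q = d" using dc r qc by (simp add: d0_def a_minus_def E.a_assoc E.l_neg)
      ultimately show ?thesis by simp
    qed
    then show False using H by auto
  qed
  \<comment> \<open>D contains a power of a, which is a unit of E, so the generator q of D divides a
    unit.\<close>
  then obtain r where r: "r \<in> carrier A" "a [^] (K + K) = q \<otimes> r" using aD by (auto simp: N_def scal_def)
  have qu: "q \<in> Units E"
  proof -
    have rc: "r \<in> carrier E" using r by auto
    have "q \<otimes> (r \<otimes> inv (a [^] (K + K))) = \<one>"
      using pow_unit[of "K + K"] qc rc r(2)[symmetric] by (simp add: E.m_assoc[symmetric])
    moreover have "r \<otimes> inv (a [^] (K + K)) \<in> carrier E" using rc by simp
    ultimately show ?thesis using qc E.m_comm[of q] unfolding Units_def by fastforce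
  qed
  have "J2 = scal (inv q) J1"
  proof (intro subset_antisym subsetI)
    fix x assume x: "x \<in> J2"
    then have "x \<otimes> q \<in> J1" using q by (simp add: D_def)
    moreover have "inv q \<otimes> (x \<otimes> q) = x" using unit_cancel(1)[OF qu, of x] J2D(1)[OF x] qc by (simp add: E.m_comm)
    ultimately show "x \<in> scal (inv q) J1" unfolding scal_def by (metis image_eqI)
  next
    fix x assume "x \<in> scal (inv q) J1"
    then obtain j where j: "x = inv q \<otimes> j" "j \<in> J1" by (auto simp: scal_def)
    have jc: "j \<in> carrier E" using j J1D by auto
    show "x \<in> J2"
    proof (rule D_dual)
      show "x \<in> carrier E" using j jc qu by simp
      fix d assume "d \<in> D"
      then obtain s where s: "s \<in> carrier A" "d = q \<otimes> s" using \<open>N = D\<close> by (auto simp: N_def scal_def)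
      have sc: "s \<in> carrier E" using s by auto
      have "x \<otimes> d = inv q \<otimes> (q \<otimes> (s \<otimes> j))" using j s jc qc qu sc by (simp add: E.m_ac)
      also have "\<dots> = s \<otimes> j" using unit_cancel(1)[OF qu] sc jc by simp
      finally show "x \<otimes> d \<in> J1" using J1D(4) s j by simp
    qed
  qed
  then show ?thesis using qu by blast
qed

end

section \<open>Extending homomorphisms into a submodule with simple socle\<close>

context dual_pairing
begin

text \<open>Injectivity of E/J with respect to subquotients killed by a power of a. The homomorphism
  is a relation \<Gamma> because its values matter only modulo J; the hypotheses make it total on D,
  linear, and single-valued modulo J. The representing z is improved along a chain of submodules: at
  each simple step the defect lies in the socle of E/J and is removed by a multiple of a vector
  perpendicular to the submodule reached so far.\<close>

lemma extension:
  assumes D: "submodule D A P" "noeth A P D" and Y0: "submodule Y0 A P" "Y0 \<subseteq> D"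
    and k: "\<And>x. x \<in> D \<Longrightarrow> a [^]\<^bsub>A\<^esub> (k::nat) \<odot>\<^bsub>P\<^esub> x \<in> Y0"
    and closed: "\<And>Y. submodule Y A P \<Longrightarrow> Y0 \<subseteq> Y \<Longrightarrow> Y \<subseteq> D \<Longrightarrow> dual_closed Y"
    and \<Gamma>c: "\<And>u c. (u, c) \<in> \<Gamma> \<Longrightarrow> u \<in> D \<and> c \<in> carrier E"
    and \<Gamma>D: "\<And>u. u \<in> D \<Longrightarrow> \<exists>c. (u, c) \<in> \<Gamma>"
    and \<Gamma>add: "\<And>u c u' c'. (u, c) \<in> \<Gamma> \<Longrightarrow> (u', c') \<in> \<Gamma> \<Longrightarrow> (u \<oplus>\<^bsub>P\<^esub> u', c \<oplus> c') \<in> \<Gamma>"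
    and \<Gamma>smult: "\<And>r u c. r \<in> carrier A \<Longrightarrow> (u, c) \<in> \<Gamma> \<Longrightarrow> (r \<odot>\<^bsub>P\<^esub> u, r \<otimes> c) \<in> \<Gamma>"
    and \<Gamma>0: "\<And>u c. (u, c) \<in> \<Gamma> \<Longrightarrow> u \<in> Y0 \<Longrightarrow> c \<in> J"
  shows "\<exists>z\<in>carrier P. \<forall>(u, c)\<in>\<Gamma>. c \<ominus> \<beta> u z \<in> J"
proof -
  note DS = D(1)[unfolded P.submodule_iff]
  note JD = smodD[OF Js]
  have Dc: "u \<in> carrier P" if "u \<in> D" for u using DS that by auto
  define good where "good Y z \<longleftrightarrow> (\<forall>u c. u \<in> Y \<longrightarrow> (u, c) \<in> \<Gamma> \<longrightarrow> c \<ominus> \<beta> u z \<in> J)" for Y z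
  define F where "F = {Y. submodule Y A P \<and> Y0 \<subseteq> Y \<and> Y \<subseteq> D \<and> (\<exists>z\<in>carrier P. good Y z)}"
  have \<beta>0: "\<beta> u \<zero>\<^bsub>P\<^esub> = \<zero>" if "u \<in> carrier P" for u
    using \<beta>_smult2[of "\<zero>\<^bsub>A\<^esub>" u "\<zero>\<^bsub>P\<^esub>"] that \<beta>_closed[of u "\<zero>\<^bsub>P\<^esub>"] A_closed(5) by (simp add: A_zero)
  have "good Y0 \<zero>\<^bsub>P\<^esub>" unfolding good_def
  proof (intro allI impI)
    fix u c assume uc: "u \<in> Y0" "(u, c) \<in> \<Gamma>"
    then have "c \<in> J" "u \<in> carrier P" using \<Gamma>0[OF uc(2,1)] \<Gamma>c[OF uc(2)] Dc by auto
    then show "c \<ominus> \<beta> u \<zero>\<^bsub>P\<^esub> \<in> J" using JD by (simp add: \<beta>0)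
  qed
  then have F0: "Y0 \<in> F" using Y0 by (auto simp: F_def)
  have "\<exists>Y\<in>F. \<forall>Y'\<in>F. Y \<subseteq> Y' \<longrightarrow> Y' = Y"
    by (rule noeth_maximal[OF D(2)]) (use F0 in \<open>auto simp: F_def\<close>)
  then obtain Y where YF: "Y \<in> F" and mx: "\<And>Y'. Y' \<in> F \<Longrightarrow> Y \<subseteq> Y' \<Longrightarrow> Y' = Y" by blast
  from YF have Y: "submodule Y A P" "Y0 \<subseteq> Y" "Y \<subseteq> D" by (auto simp: F_def)
  obtain z where z: "z \<in> carrier P" "good Y z" using YF by (auto simp: F_def)
  have "Y = D"
  proof (rule ccontr)
    assume ne: "Y \<noteq> D"
    obtain x where x: "x \<in> D" "x \<notin> Y" "\<And>r. r \<in> \<mm> \<Longrightarrow> r \<odot>\<^bsub>P\<^esub> x \<in> Y"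
    proof (rule simple_step[OF P.module_axioms Y(1) _ Y(3) ne])
      show "D \<subseteq> carrier P" using DS by auto
      show "r \<odot>\<^bsub>P\<^esub> x \<in> D" if "r \<in> carrier A" "x \<in> D" for r x using DS that by auto
      show "\<exists>j::nat. (r [^]\<^bsub>A\<^esub> j) \<odot>\<^bsub>P\<^esub> x \<in> Y" if "r \<in> \<mm>" "x \<in> D" for r x
        by (rule nilpotent_mod[OF P.module_axioms Y(1) _ _ that(1), of x k]) (use Dc k Y that in auto)
    qed (rule that)
    have xc: "x \<in> carrier P" using x Dc by auto
    obtain c where c: "(x, c) \<in> \<Gamma>" using \<Gamma>D[OF x(1)] by blast
    have cc: "c \<in> carrier E" using \<Gamma>c[OF c] by simp
    have s0: "c \<ominus> \<beta> x z \<in> soc J"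
    proof -
      have "r \<otimes> (c \<ominus> \<beta> x z) \<in> J" if r: "r \<in> \<mm>" for r
      proof -
        have "r \<otimes> c \<ominus> \<beta> (r \<odot>\<^bsub>P\<^esub> x) z \<in> J"
          using z(2) x(3)[OF r] \<Gamma>smult[OF m_A[OF r] c] by (simp add: good_def)
        moreover have "r \<otimes> c \<ominus> \<beta> (r \<odot>\<^bsub>P\<^esub> x) z = r \<otimes> (c \<ominus> \<beta> x z)"
          using m_A[OF r] cc z(1) xc \<beta>_closed[OF xc z(1)] by (simp add: \<beta>_smult1 a_minus_def E.r_distr E.r_minus)
        ultimately show ?thesis by simp
      qed
      then show ?thesis using cc \<beta>_closed[OF xc z(1)] by (simp add: soc_def)
    qed
    obtain y where y: "y \<in> perp Y" "\<beta> x y \<notin> J"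
      using closed[OF Y] xc x(2) by (auto simp: dual_closed_def)
    have yc: "y \<in> carrier P" using y by (simp add: perp_def)
    have "\<beta> x y \<in> soc J"
    proof -
      have "r \<otimes> \<beta> x y \<in> J" if "r \<in> \<mm>" for r
        using x(3)[OF that] y xc yc \<beta>_smult1[OF m_A[OF that] xc yc] by (auto simp: perp_def)
      then show ?thesis using \<beta>_closed[OF xc yc] by (simp add: soc_def)
    qed
    then obtain t where t: "t \<in> carrier A" "(c \<ominus> \<beta> x z) \<ominus> t \<otimes> \<beta> x y \<in> J"
      using J s0 y(2) by (auto simp: type1_def)
    \<comment> \<open>Adding t y changes no value on Y modulo J, since y is perpendicular to Y, and
      t is chosen to correct the value at x.\<close>
    define z' where "z' = z \<oplus>\<^bsub>P\<^esub> t \<odot>\<^bsub>P\<^esub> y"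
    have z'c: "z' \<in> carrier P" using z yc t by (simp add: z'_def)
    note ad = P.submodule_adjoin[OF Y(1) xc]
    have "good (P.adjoin Y x) z'" unfolding good_def
    proof (intro allI impI)
      fix u' c' assume u': "u' \<in> P.adjoin Y x" "(u', c') \<in> \<Gamma>"
      then obtain u r where u: "u' = u \<oplus>\<^bsub>P\<^esub> r \<odot>\<^bsub>P\<^esub> x" "u \<in> Y" "r \<in> carrier A"
        unfolding P.adjoin_def by blast
      have uc: "u \<in> carrier P" using u Y Dc by auto
      have c'c: "c' \<in> carrier E" using \<Gamma>c[OF u'(2)] by simp
      have rc: "r \<in> carrier E" "t \<in> carrier E" using u t by auto
      have "(u' \<oplus>\<^bsub>P\<^esub> (\<ominus>\<^bsub>A\<^esub> r) \<odot>\<^bsub>P\<^esub> x, c' \<oplus> (\<ominus>\<^bsub>A\<^esub> r) \<otimes> c) \<in> \<Gamma>"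
        using u' c u by (intro \<Gamma>add \<Gamma>smult) auto
      moreover have "u' \<oplus>\<^bsub>P\<^esub> (\<ominus>\<^bsub>A\<^esub> r) \<odot>\<^bsub>P\<^esub> x = u"
        unfolding u(1) using uc u(3) xc by (simp add: P.smult_l_minus P.M.a_assoc P.M.r_neg)
      ultimately have f1: "(c' \<oplus> (\<ominus> r) \<otimes> c) \<ominus> \<beta> u z \<in> J"
        using z(2) u by (simp add: good_def A_uminus)
      have f2: "r \<otimes> ((c \<ominus> \<beta> x z) \<ominus> t \<otimes> \<beta> x y) \<in> J" using JD(4) t u by blast
      have f3: "t \<otimes> \<beta> u y \<in> J" using JD(4) t y(1) u by (simp add: perp_def)
      note sum = JD(6)[OF JD(3)[OF f1 f2] f3]
      have e: "\<beta> u' w = \<beta> u w \<oplus> r \<otimes> \<beta> x w" if "w \<in> carrier P" for w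
        unfolding u(1) using uc xc u(3) that \<beta>_add1[OF uc _ that, of "r \<odot>\<^bsub>P\<^esub> x"] \<beta>_smult1[OF u(3) xc that] by simp
      have u'c: "u' \<in> carrier P" unfolding u(1) using uc xc u(3) by simp
      have "\<beta> u' z' = \<beta> u' z \<oplus> t \<otimes> \<beta> u' y"
        unfolding z'_def using \<beta>_add2[OF u'c z(1), of "t \<odot>\<^bsub>P\<^esub> y"] \<beta>_smult2[OF t(1) u'c yc] t(1) yc by simp
      then have e2: "\<beta> u' z' = (\<beta> u z \<oplus> r \<otimes> \<beta> x z) \<oplus> t \<otimes> (\<beta> u y \<oplus> r \<otimes> \<beta> x y)"
        unfolding e[OF z(1)] e[OF yc] .
      have "((c' \<oplus> (\<ominus> r) \<otimes> c) \<ominus> buz) \<oplus> r \<otimes> ((c \<ominus> bxz) \<ominus> t \<otimes> bxy) \<ominus> t \<otimes> buy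
          = c' \<ominus> ((buz \<oplus> r \<otimes> bxz) \<oplus> t \<otimes> (buy \<oplus> r \<otimes> bxy))"
        if "buz \<in> carrier E" "bxz \<in> carrier E" "buy \<in> carrier E" "bxy \<in> carrier E" for buz bxz buy bxy
        using that rc cc c'c by algebra
      note this[OF \<beta>_closed[OF uc z(1)] \<beta>_closed[OF xc z(1)] \<beta>_closed[OF uc yc] \<beta>_closed[OF xc yc], folded e2]
      with sum show "c' \<ominus> \<beta> u' z' \<in> J" by simp
    qed
    moreover have "P.adjoin Y x \<subseteq> D" using P.adjoin_subset[OF D(1) Y(3) x(1)] .
    ultimately have "P.adjoin Y x \<in> F" using ad Y z'c by (auto simp: F_def)
    then have "P.adjoin Y x = Y" using mx ad by auto
    then show False using ad x by auto
  qed
  have "\<forall>(u, c)\<in>\<Gamma>. c \<ominus> \<beta> u z \<in> J"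
    using z(2) \<Gamma>c unfolding good_def \<open>Y = D\<close> by auto
  then show ?thesis using z(1) by blast
qed

end

section \<open>Free modules of finite rank and the dot product\<close>

lemma free_mod_simps [simp]:
  "carrier (free_mod R n) = {..<n} \<rightarrow>\<^sub>E carrier R"
  "\<zero>\<^bsub>free_mod R n\<^esub> = (\<lambda>i\<in>{..<n}. \<zero>\<^bsub>R\<^esub>)"
  "x \<oplus>\<^bsub>free_mod R n\<^esub> y = (\<lambda>i\<in>{..<n}. x i \<oplus>\<^bsub>R\<^esub> y i)"
  "r \<odot>\<^bsub>free_mod R n\<^esub> x = (\<lambda>i\<in>{..<n}. r \<otimes>\<^bsub>R\<^esub> x i)"
  by (simp_all add: free_mod_def)

lemma vec_eqI:
  assumes "x \<in> {..<n} \<rightarrow>\<^sub>E B" "y \<in> {..<n} \<rightarrow>\<^sub>E C" "\<And>i::nat. i < n \<Longrightarrow> x i = y i"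
  shows "x = y"
  using assms by (intro ext) (metis PiE_arb lessThan_iff)

lemma vec_mem: "x \<in> {..<n} \<rightarrow>\<^sub>E B \<Longrightarrow> i < n \<Longrightarrow> x i \<in> B"
  by (rule PiE_mem) auto

definition unit_vec :: "('a, 'm) ring_scheme \<Rightarrow> nat \<Rightarrow> nat \<Rightarrow> nat \<Rightarrow> 'a" where
  "unit_vec R n i = (\<lambda>j\<in>{..<n}. if i = j then \<one>\<^bsub>R\<^esub> else \<zero>\<^bsub>R\<^esub>)"

context overring
begin

lemma free_module: "module A (free_mod E n)"
proof (rule moduleI)
  show "abelian_group (free_mod E n)"
  proof (rule abelian_groupI)
    fix x assume "x \<in> carrier (free_mod E n)"
    then have x: "x \<in> {..<n} \<rightarrow>\<^sub>E carrier E" by simp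
    note xi = vec_mem[OF x]
    show "\<zero>\<^bsub>free_mod E n\<^esub> \<oplus>\<^bsub>free_mod E n\<^esub> x = x"
      by (rule vec_eqI[where B = "carrier E", OF _ x]) (simp_all add: xi)
    have "(\<lambda>i\<in>{..<n}. \<ominus> x i) \<oplus>\<^bsub>free_mod E n\<^esub> x = \<zero>\<^bsub>free_mod E n\<^esub>"
      unfolding free_mod_simps by (intro restrict_ext) (simp add: xi E.l_neg)
    moreover have "(\<lambda>i\<in>{..<n}. \<ominus> x i) \<in> carrier (free_mod E n)" by (simp add: xi)
    ultimately show "\<exists>y\<in>carrier (free_mod E n). y \<oplus>\<^bsub>free_mod E n\<^esub> x = \<zero>\<^bsub>free_mod E n\<^esub>" by blast
  next
    fix x y z assume "x \<in> carrier (free_mod E n)" "y \<in> carrier (free_mod E n)" "z \<in> carrier (free_mod E n)"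
    then have "i < n \<Longrightarrow> x i \<in> carrier E \<and> y i \<in> carrier E \<and> z i \<in> carrier E" for i by (auto intro: vec_mem)
    then show "x \<oplus>\<^bsub>free_mod E n\<^esub> y \<oplus>\<^bsub>free_mod E n\<^esub> z = x \<oplus>\<^bsub>free_mod E n\<^esub> (y \<oplus>\<^bsub>free_mod E n\<^esub> z)"
      unfolding free_mod_simps by (intro restrict_ext) (simp add: E.a_assoc)
  next
    fix x y assume "x \<in> carrier (free_mod E n)" "y \<in> carrier (free_mod E n)"
    then have *: "i < n \<Longrightarrow> x i \<in> carrier E \<and> y i \<in> carrier E" for i by (auto intro: vec_mem)
    show "x \<oplus>\<^bsub>free_mod E n\<^esub> y = y \<oplus>\<^bsub>free_mod E n\<^esub> x"
      unfolding free_mod_simps by (intro restrict_ext) (simp add: * E.a_comm)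
    show "x \<oplus>\<^bsub>free_mod E n\<^esub> y \<in> carrier (free_mod E n)" using * by simp
  qed simp
next
  fix r s x y
  assume rs: "r \<in> carrier A" "s \<in> carrier A" and "x \<in> carrier (free_mod E n)" "y \<in> carrier (free_mod E n)"
  then have *: "i < n \<Longrightarrow> x i \<in> carrier E \<and> y i \<in> carrier E" for i by (auto intro: vec_mem)
  show "(r \<oplus>\<^bsub>A\<^esub> s) \<odot>\<^bsub>free_mod E n\<^esub> x = r \<odot>\<^bsub>free_mod E n\<^esub> x \<oplus>\<^bsub>free_mod E n\<^esub> s \<odot>\<^bsub>free_mod E n\<^esub> x"
    using rs * unfolding free_mod_simps by (intro restrict_ext) (simp add: A_ops E.l_distr)
  show "r \<odot>\<^bsub>free_mod E n\<^esub> (x \<oplus>\<^bsub>free_mod E n\<^esub> y) = r \<odot>\<^bsub>free_mod E n\<^esub> x \<oplus>\<^bsub>free_mod E n\<^esub> r \<odot>\<^bsub>free_mod E n\<^esub> y"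
    using rs * unfolding free_mod_simps by (intro restrict_ext) (simp add: E.r_distr)
  show "(r \<otimes>\<^bsub>A\<^esub> s) \<odot>\<^bsub>free_mod E n\<^esub> x = r \<odot>\<^bsub>free_mod E n\<^esub> (s \<odot>\<^bsub>free_mod E n\<^esub> x)"
    using rs * unfolding free_mod_simps by (intro restrict_ext) (simp add: A_ops E.m_assoc)
next
  fix x assume "x \<in> carrier (free_mod E n)"
  then have x: "x \<in> {..<n} \<rightarrow>\<^sub>E carrier E" by simp
  show "\<one>\<^bsub>A\<^esub> \<odot>\<^bsub>free_mod E n\<^esub> x = x"
    by (rule vec_eqI[where B = "carrier E", OF _ x]) (simp_all add: vec_mem[OF x] A_ops(3))
  fix r assume "r \<in> carrier A"
  then show "r \<odot>\<^bsub>free_mod E n\<^esub> x \<in> carrier (free_mod E n)" using vec_mem[OF x] by auto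
qed (rule A.is_cring)

definition dot :: "nat \<Rightarrow> (nat \<Rightarrow> 'a) \<Rightarrow> (nat \<Rightarrow> 'a) \<Rightarrow> 'a" where
  "dot n x y = (\<Oplus>i\<in>{..<n}. x i \<otimes> y i)"

lemma dot_closed: 
  assumes "x \<in> {..<n} \<rightarrow>\<^sub>E carrier E" "y \<in> {..<n} \<rightarrow>\<^sub>E carrier E" shows "dot n x y \<in> carrier E"
  unfolding dot_def by (rule E.finsum_closed) (simp add: assms[THEN vec_mem])

lemma dot_cong:
  "(\<And>i. i < n \<Longrightarrow> f i \<in> carrier E \<and> x i \<otimes> y i = f i) \<Longrightarrow> dot n x y = (\<Oplus>i\<in>{..<n}. f i)"
  unfolding dot_def by (intro E.finsum_cong') auto

lemma dot_add1:
  assumes "x \<in> {..<n} \<rightarrow>\<^sub>E carrier E" "x' \<in> {..<n} \<rightarrow>\<^sub>E carrier E" "y \<in> {..<n} \<rightarrow>\<^sub>E carrier E"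
  shows "dot n (\<lambda>i\<in>{..<n}. x i \<oplus> x' i) y = dot n x y \<oplus> dot n x' y"
proof -
  have "dot n (\<lambda>i\<in>{..<n}. x i \<oplus> x' i) y = (\<Oplus>i\<in>{..<n}. x i \<otimes> y i \<oplus> x' i \<otimes> y i)"
    by (rule dot_cong) (simp add: assms[THEN vec_mem] E.l_distr)
  also have "\<dots> = dot n x y \<oplus> dot n x' y"
    unfolding dot_def by (rule E.finsum_addf) (simp_all add: assms[THEN vec_mem])
  finally show ?thesis .
qed

lemma dot_comm:
  assumes "x \<in> {..<n} \<rightarrow>\<^sub>E carrier E" "y \<in> {..<n} \<rightarrow>\<^sub>E carrier E"
  shows "dot n x y = dot n y x"
  unfolding dot_def[of n y x] by (rule dot_cong) (simp add: assms[THEN vec_mem] E.m_comm)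

lemma dot_smult1:
  assumes "r \<in> carrier E" "x \<in> {..<n} \<rightarrow>\<^sub>E carrier E" "y \<in> {..<n} \<rightarrow>\<^sub>E carrier E"
  shows "dot n (\<lambda>i\<in>{..<n}. r \<otimes> x i) y = r \<otimes> dot n x y"
proof -
  have "dot n (\<lambda>i\<in>{..<n}. r \<otimes> x i) y = (\<Oplus>i\<in>{..<n}. r \<otimes> (x i \<otimes> y i))"
    by (rule dot_cong) (simp add: assms(1) assms(2,3)[THEN vec_mem] E.m_assoc)
  also have "\<dots> = r \<otimes> dot n x y"
    unfolding dot_def by (rule E.finsum_rdistr[symmetric]) (simp_all add: assms(1) assms(2,3)[THEN vec_mem])
  finally show ?thesis .
qed

lemma vec_closed:
  "x \<in> {..<n} \<rightarrow>\<^sub>E carrier E \<Longrightarrow> y \<in> {..<n} \<rightarrow>\<^sub>E carrier E \<Longrightarrow> (\<lambda>i\<in>{..<n}. x i \<oplus> y i) \<in> {..<n} \<rightarrow>\<^sub>E carrier E"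
  "r \<in> carrier E \<Longrightarrow> x \<in> {..<n} \<rightarrow>\<^sub>E carrier E \<Longrightarrow> (\<lambda>i\<in>{..<n}. r \<otimes> x i) \<in> {..<n} \<rightarrow>\<^sub>E carrier E"
  using vec_mem[of x n "carrier E"] vec_mem[of y n "carrier E"] by simp_all

lemma dot_add2:
  assumes "x \<in> {..<n} \<rightarrow>\<^sub>E carrier E" "y \<in> {..<n} \<rightarrow>\<^sub>E carrier E" "y' \<in> {..<n} \<rightarrow>\<^sub>E carrier E"
  shows "dot n x (\<lambda>i\<in>{..<n}. y i \<oplus> y' i) = dot n x y \<oplus> dot n x y'"
  using dot_add1[OF assms(2,3,1)] assms dot_comm vec_closed(1)[OF assms(2,3)] by metis

lemma dot_smult2:
  assumes "r \<in> carrier E" "x \<in> {..<n} \<rightarrow>\<^sub>E carrier E" "y \<in> {..<n} \<rightarrow>\<^sub>E carrier E"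
  shows "dot n x (\<lambda>i\<in>{..<n}. r \<otimes> y i) = r \<otimes> dot n x y"
  using dot_smult1[OF assms(1,3,2)] assms dot_comm vec_closed(2)[OF assms(1,3)] by metis

lemma unit_vec_closed: "unit_vec E n i \<in> {..<n} \<rightarrow>\<^sub>E carrier A"
  unfolding unit_vec_def by auto

lemma dot_unit:
  assumes "x \<in> {..<n} \<rightarrow>\<^sub>E carrier E" "i < n"
  shows "dot n x (unit_vec E n i) = x i"
proof -
  have "dot n x (unit_vec E n i) = (\<Oplus>j\<in>{..<n}. if i = j then x j else \<zero>)"
    by (rule dot_cong) (simp add: assms(1)[THEN vec_mem] unit_vec_def)
  also have "\<dots> = x i" by (rule E.finsum_singleton) (simp_all add: assms(2) assms(1)[THEN vec_mem])
  finally show ?thesis .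
qed

lemma dot_smod:
  assumes "smod J" "x \<in> {..<n} \<rightarrow>\<^sub>E carrier A" "y \<in> {..<n} \<rightarrow>\<^sub>E J"
  shows "dot n x y \<in> J"
proof -
  note JD = smodD[OF assms(1)]
  have "(\<Oplus>i\<in>I. x i \<otimes> y i) \<in> J" if "finite I" "I \<subseteq> {..<n}" for I
    using that
  proof (induction I rule: finite_induct)
    case empty then show ?case using JD by simp
  next
    case (insert j I)
    have "i < n \<Longrightarrow> x i \<otimes> y i \<in> J" for i using JD(4) assms(2,3)[THEN vec_mem] by simp
    then have *: "i \<in> insert j I \<Longrightarrow> x i \<otimes> y i \<in> J" for i using insert by auto
    then have "i \<in> insert j I \<Longrightarrow> x i \<otimes> y i \<in> carrier E" for i by (intro JD(1))
    then have "(\<Oplus>i\<in>insert j I. x i \<otimes> y i) = x j \<otimes> y j \<oplus> (\<Oplus>i\<in>I. x i \<otimes> y i)"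
      using insert by (intro E.finsum_insert) auto
    then show ?case using * insert JD by auto
  qed
  then show ?thesis unfolding dot_def by auto
qed

end

text \<open>The induction is on a bound m beyond which all coordinates vanish; splitting off the
  multiple of a unit vector at the last admissible coordinate lowers the bound.\<close>

lemma free_hom_eqI:
  assumes R: "cring R" and N: "module R N"
    and f: "f \<in> mod_hom R (free_mod R n) N" and g: "g \<in> mod_hom R (free_mod R n) N"
    and eq: "\<And>i. i < n \<Longrightarrow> f (unit_vec R n i) = g (unit_vec R n i)"
    and x: "x \<in> {..<n} \<rightarrow>\<^sub>E carrier R"
  shows "f x = g x"
proof -
  interpret R: cring R by fact
  interpret N: module R N by fact
  have add: "h (u \<oplus>\<^bsub>free_mod R n\<^esub> v) = h u \<oplus>\<^bsub>N\<^esub> h v"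
    if "h \<in> mod_hom R (free_mod R n) N" "u \<in> {..<n} \<rightarrow>\<^sub>E carrier R" "v \<in> {..<n} \<rightarrow>\<^sub>E carrier R" for h u v
    using that by (simp add: mod_hom_def)
  have sm: "h (r \<odot>\<^bsub>free_mod R n\<^esub> u) = r \<odot>\<^bsub>N\<^esub> h u"
    if "h \<in> mod_hom R (free_mod R n) N" "r \<in> carrier R" "u \<in> {..<n} \<rightarrow>\<^sub>E carrier R" for h u r
    using that by (simp add: mod_hom_def)
  have hc: "h u \<in> carrier N" if "h \<in> mod_hom R (free_mod R n) N" "u \<in> {..<n} \<rightarrow>\<^sub>E carrier R" for h u
    using that by (auto simp: mod_hom_def)
  have *: "f x = g x" if "x \<in> {..<n} \<rightarrow>\<^sub>E carrier R" "\<And>i. m \<le> i \<Longrightarrow> i < n \<Longrightarrow> x i = \<zero>\<^bsub>R\<^esub>" "m \<le> n" for m x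
    using that
  proof (induction m arbitrary: x)
    case 0
    have "(\<lambda>i\<in>{..<n}. \<zero>\<^bsub>R\<^esub> \<otimes>\<^bsub>R\<^esub> x i) \<in> {..<n} \<rightarrow>\<^sub>E carrier R"
      using vec_mem[OF 0(1)] by simp
    then have x: "x = \<zero>\<^bsub>R\<^esub> \<odot>\<^bsub>free_mod R n\<^esub> x"
      using 0(2) vec_mem[OF 0(1)] unfolding free_mod_simps by (intro vec_eqI[OF 0(1), where C = "carrier R"]) simp_all
    have h0: "h x = \<zero>\<^bsub>N\<^esub>" if h: "h \<in> mod_hom R (free_mod R n) N" for h
    proof -
      have "h x = h (\<zero>\<^bsub>R\<^esub> \<odot>\<^bsub>free_mod R n\<^esub> x)" by (rule arg_cong[OF x])
      also have "\<dots> = \<zero>\<^bsub>R\<^esub> \<odot>\<^bsub>N\<^esub> h x" by (rule sm[OF h R.zero_closed 0(1)])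
      also have "\<dots> = \<zero>\<^bsub>N\<^esub>" by (rule N.smult_l_null[OF hc[OF h 0(1)]])
      finally show ?thesis .
    qed
    show ?case by (simp only: h0[OF f] h0[OF g])
  next
    case (Suc m)
    note xi = vec_mem[OF Suc.prems(1)]
    let ?e = "unit_vec R n m"
    let ?x' = "(\<lambda>i\<in>{..<n}. if i = m then \<zero>\<^bsub>R\<^esub> else x i)"
    have m: "m < n" using Suc.prems(3) by simp
    have e: "?e \<in> {..<n} \<rightarrow>\<^sub>E carrier R" by (simp add: unit_vec_def)
    have x': "?x' \<in> {..<n} \<rightarrow>\<^sub>E carrier R" using xi by simp
    have re: "x m \<odot>\<^bsub>free_mod R n\<^esub> ?e \<in> {..<n} \<rightarrow>\<^sub>E carrier R" using xi m by (simp add: unit_vec_def)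
    have IH: "f ?x' = g ?x'"
    proof (rule Suc.IH[OF x'])
      fix i assume "m \<le> i" "i < n"
      then show "?x' i = \<zero>\<^bsub>R\<^esub>" using Suc.prems(2)[of i] by (cases "i = m") auto
    qed (use m in simp)
    have dec: "x = ?x' \<oplus>\<^bsub>free_mod R n\<^esub> x m \<odot>\<^bsub>free_mod R n\<^esub> ?e"
      by (rule vec_eqI[where B = "carrier R" and C = "carrier R", OF Suc.prems(1)])
        (use xi m in \<open>simp_all add: unit_vec_def\<close>)
    have hdec: "h x = h ?x' \<oplus>\<^bsub>N\<^esub> x m \<odot>\<^bsub>N\<^esub> h ?e" if h: "h \<in> mod_hom R (free_mod R n) N" for h
    proof -
      have "h x = h (?x' \<oplus>\<^bsub>free_mod R n\<^esub> x m \<odot>\<^bsub>free_mod R n\<^esub> ?e)" by (rule arg_cong[OF dec])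
      also have "\<dots> = h ?x' \<oplus>\<^bsub>N\<^esub> h (x m \<odot>\<^bsub>free_mod R n\<^esub> ?e)" by (rule add[OF h x' re])
      also have "\<dots> = h ?x' \<oplus>\<^bsub>N\<^esub> x m \<odot>\<^bsub>N\<^esub> h ?e" by (simp only: sm[OF h xi[OF m] e])
      finally show ?thesis .
    qed
    show ?case by (simp only: hdec[OF f] hdec[OF g] IH eq[OF m])
  qed
  show ?thesis by (rule *[OF x, of n]) auto
qed

context overring
begin

lemma unit_vec_A: "unit_vec A n i = unit_vec E n i"
  by (auto simp: unit_vec_def A_ops A_zero)

lemma vec_A_E: "x \<in> {..<n} \<rightarrow>\<^sub>E carrier A \<Longrightarrow> x \<in> {..<n} \<rightarrow>\<^sub>E carrier E"
  using PiE_mono[of "{..<n}" "\<lambda>_. carrier A" "\<lambda>_. carrier E"] by auto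

lemma vec_ops_A:
  assumes "x \<in> {..<n} \<rightarrow>\<^sub>E carrier A" "y \<in> {..<n} \<rightarrow>\<^sub>E carrier A" "r \<in> carrier A"
  shows "x \<oplus>\<^bsub>free_mod A n\<^esub> y = x \<oplus>\<^bsub>free_mod E n\<^esub> y" "r \<odot>\<^bsub>free_mod A n\<^esub> x = r \<odot>\<^bsub>free_mod E n\<^esub> x"
  unfolding free_mod_simps
  by (rule restrict_ext, simp add: A_ops assms(3) assms(1,2)[THEN vec_mem])+

lemma dot_hom:
  assumes "y \<in> {..<n} \<rightarrow>\<^sub>E carrier E"
  shows "(\<lambda>x. dot n x y) \<in> mod_hom A (free_mod A n) (self_module E)"
proof -
  have "dot n (x \<oplus>\<^bsub>free_mod A n\<^esub> x') y = dot n x y \<oplus> dot n x' y"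
    if "x \<in> {..<n} \<rightarrow>\<^sub>E carrier A" "x' \<in> {..<n} \<rightarrow>\<^sub>E carrier A" for x x'
    unfolding vec_ops_A(1)[OF that A.one_closed] using dot_add1[OF that[THEN vec_A_E] assms] by simp
  moreover have "dot n (r \<odot>\<^bsub>free_mod A n\<^esub> x) y = r \<otimes> dot n x y"
    if "x \<in> {..<n} \<rightarrow>\<^sub>E carrier A" "r \<in> carrier A" for x r
    unfolding vec_ops_A(2)[OF that(1,1,2)] using dot_smult1[OF A_sub[OF that(2)] vec_A_E[OF that(1)] assms] by simp
  moreover have "dot n x y \<in> carrier E" if "x \<in> {..<n} \<rightarrow>\<^sub>E carrier A" for x
    by (rule dot_closed[OF vec_A_E[OF that] assms])
  ultimately show ?thesis unfolding mod_hom_def by (simp del: free_mod_simps(2-))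
qed

text \<open>Represents a homomorphism from A^n to E by a vector, which turns questions about
  Hom(A^n, J) into questions about E^n.\<close>

lemma hom_eq_dot:
  assumes f: "f \<in> mod_hom A (free_mod A n) (self_module E)" and x: "x \<in> {..<n} \<rightarrow>\<^sub>E carrier A"
  shows "f x = dot n x (\<lambda>i\<in>{..<n}. f (unit_vec A n i))"
proof -
  have y: "(\<lambda>i\<in>{..<n}. f (unit_vec A n i)) \<in> {..<n} \<rightarrow>\<^sub>E carrier E"
  proof -
    have "f \<in> ({..<n} \<rightarrow>\<^sub>E carrier A) \<rightarrow> carrier E" using f by (simp add: mod_hom_def)
    from funcset_mem[OF this unit_vec_closed] show ?thesis by (simp add: unit_vec_A)
  qed
  show ?thesis
  proof (rule free_hom_eqI[OF A.is_cring Emod f dot_hom[OF y] _ x])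
    fix i assume i: "i < n"
    show "f (unit_vec A n i) = dot n (unit_vec A n i) (\<lambda>i\<in>{..<n}. f (unit_vec A n i))"
      unfolding unit_vec_A using dot_comm[OF vec_A_E[OF unit_vec_closed] y, of i] dot_unit[OF y i] i
      by (simp add: unit_vec_A)
  qed
qed

end

context param_overring
begin

text \<open>For a chain of submodules \<open>f t\<close> let \<open>I j t\<close> be the ideal of
  j-th coordinates of those members whose earlier coordinates vanish. Once these n chains of ideals
  are constant, so is the original chain: a vector is reduced to zero by subtracting, coordinate by
  coordinate, members of the earlier submodule.\<close>

lemma noeth_vec: "noeth A (free_mod E n) ({..<n} \<rightarrow>\<^sub>E carrier A)"
  unfolding noeth_def
proof (intro allI impI)
  fix f :: "nat \<Rightarrow> (nat \<Rightarrow> 'a) set"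
  assume f: "\<forall>t. submodule (f t) A (free_mod E n) \<and> f t \<subseteq> ({..<n} \<rightarrow>\<^sub>E carrier A) \<and> f t \<subseteq> f (Suc t)"
  interpret F: module A "free_mod E n" by (rule free_module)
  have fs: "submodule (f t) A (free_mod E n)" and fA: "\<And>x. x \<in> f t \<Longrightarrow> x \<in> {..<n} \<rightarrow>\<^sub>E carrier A" for t using f by auto
  note fS = fs[unfolded F.submodule_iff]
  have mono: "mono f" using f by (intro incseq_SucI) auto
  have fadd: "(\<lambda>i\<in>{..<n}. x i \<oplus> y i) \<in> f t" if "x \<in> f t" "y \<in> f t" for x y t using fS[of t] that by simp
  have fsm: "(\<lambda>i\<in>{..<n}. r \<otimes> x i) \<in> f t" if "r \<in> carrier A" "x \<in> f t" for x r t using fS[of t] that by simp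
  have f0: "(\<lambda>i\<in>{..<n}. \<zero>) \<in> f t" for t using fS[of t] by simp
  define I where "I j t = {x j | x. x \<in> f t \<and> (\<forall>i<j. x i = \<zero>)}" for j t
  have "\<exists>T. \<forall>t\<ge>T. I j t = I j T" if j: "j < n" for j
  proof (rule noethD[OF noeth_A])
    fix t
    show IA: "I j t \<subseteq> carrier A" unfolding I_def using fA[of _ t, THEN vec_mem] j by auto
    show "I j t \<subseteq> I j (Suc t)" unfolding I_def using f by blast
    have "smod (I j t)"
    proof (rule smodI)
      show "I j t \<subseteq> carrier E" using IA by auto
      show "\<zero> \<in> I j t" unfolding I_def using f0[of t] j by (intro CollectI exI[of _ "\<lambda>i\<in>{..<n}. \<zero>"]) auto
    next
      fix u v assume "u \<in> I j t" "v \<in> I j t"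
      then obtain x y where "u = x j" "v = y j" "x \<in> f t" "y \<in> f t" "\<forall>i<j. x i = \<zero>" "\<forall>i<j. y i = \<zero>"
        unfolding I_def by blast
      then show "u \<oplus> v \<in> I j t" unfolding I_def using fadd[of x t y] j
        by (intro CollectI exI[of _ "\<lambda>i\<in>{..<n}. x i \<oplus> y i"]) simp
    next
      fix r u assume "r \<in> carrier A" "u \<in> I j t"
      then obtain x where "u = x j" "x \<in> f t" "\<forall>i<j. x i = \<zero>" unfolding I_def by blast
      then show "r \<otimes> u \<in> I j t" unfolding I_def using fsm[of r x t] j \<open>r \<in> carrier A\<close>
        by (intro CollectI exI[of _ "\<lambda>i\<in>{..<n}. r \<otimes> x i"]) simp
    qed
    then show "submodule (I j t) A (self_module A)" unfolding submodule_A_iff using IA by simp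
  qed
  then obtain T where T: "\<And>j t. j < n \<Longrightarrow> t \<ge> T j \<Longrightarrow> I j t = I j (T j)" by metis
  define T0 where "T0 = (\<Sum>j<n. T j)"
  have T0: "T j \<le> T0" if "j < n" for j unfolding T0_def using that by (intro member_le_sum) auto
  \<comment> \<open>Here m bounds the number of coordinates that may still be nonzero, counted from
    the end.\<close>
  have main: "x \<in> f T0" if "t \<ge> T0" "x \<in> f t" "\<And>i. i < n - m \<Longrightarrow> x i = \<zero>" "m \<le> n" for t x m
    using that
  proof (induction m arbitrary: x)
    case 0
    have "x = (\<lambda>i\<in>{..<n}. \<zero>)"
      by (rule vec_eqI[OF fA[OF 0(2)], where C = "carrier E"]) (use 0 in auto)
    then show ?case by (simp only: f0)
  next
    case (Suc m)
    define j where "j = n - Suc m"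
    have j: "j < n" "n - m = Suc j" using Suc.prems by (auto simp: j_def)
    have xi: "x i \<in> carrier E" if "i < n" for i using vec_mem[OF fA[OF Suc.prems(2)] that] by auto
    have "x j \<in> I j t" unfolding I_def using Suc.prems by (auto simp: j_def)
    moreover have "I j t = I j T0" using T[OF j(1), of t] T[OF j(1), of T0] T0[OF j(1)] Suc.prems(1) by simp
    \<comment> \<open>The vector w agrees with x in coordinate j and vanishes before it, so x - w
      has one more leading zero.\<close>
    ultimately obtain w where w: "w \<in> f T0" "\<forall>i<j. w i = \<zero>" "w j = x j" unfolding I_def by auto
    have wi: "w i \<in> carrier E" if "i < n" for i using vec_mem[OF fA[OF w(1)] that] by auto
    have wt: "w \<in> f t" using monoD[OF mono Suc.prems(1)] w by auto
    let ?u = "\<lambda>i\<in>{..<n}. x i \<oplus> (\<lambda>i\<in>{..<n}. (\<ominus> \<one>) \<otimes> w i) i"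
    have u: "?u \<in> f t" by (intro fadd fsm Suc.prems wt) auto
    have "?u \<in> f T0"
    proof (rule Suc.IH[OF Suc.prems(1) u])
      fix i assume i: "i < n - m"
      then have "i < n" "i < j \<or> i = j" using j by auto
      then show "?u i = \<zero>" using w Suc.prems(3)[of i] xi[of i] by (auto simp: j_def[symmetric] E.l_minus E.r_neg)
    qed (use Suc.prems in simp)
    then have "(\<lambda>i\<in>{..<n}. ?u i \<oplus> w i) \<in> f T0" by (rule fadd[OF _ w(1)])
    moreover have "(\<lambda>i\<in>{..<n}. ?u i \<oplus> w i) = x"
      by (rule vec_eqI[OF _ fA[OF Suc.prems(2)], where B = "carrier E"])
        (use xi wi in \<open>simp_all add: E.l_minus E.a_assoc E.l_neg\<close>)
    ultimately show ?case by simp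
  qed
  have "f t = f T0" if t: "t \<ge> T0" for t
  proof
    show "f T0 \<subseteq> f t" using monoD[OF mono t] .
    show "f t \<subseteq> f T0" using main[OF t, of _ n] by auto
  qed
  then show "\<exists>T. \<forall>t\<ge>T. f t = f T" by blast
qed

lemma dot_dual_pairing:
  assumes "type1 J" shows "dual_pairing A E a (free_mod E n) (dot n) J"
  by (intro dual_pairing.intro param_overring_axioms free_module dual_pairing_axioms.intro assms)
    (simp_all add: dot_closed dot_add1 dot_add2 dot_smult1 dot_smult2)

text \<open>The instance of \<open>extension\<close> for the dot product, with D between aA^n and
  A^n. All submodules between aA^n and D are closed, by climbing from the closed submodule
  (qJ)^n.\<close>

lemma vec_extension:
  assumes J: "type1 J" "frac J" and D: "submodule D A (free_mod E n)" "D \<subseteq> {..<n} \<rightarrow>\<^sub>E carrier A"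
    and aD: "\<And>v. v \<in> {..<n} \<rightarrow>\<^sub>E carrier A \<Longrightarrow> (\<lambda>i\<in>{..<n}. a \<otimes> v i) \<in> D"
    and \<Gamma>c: "\<And>u c. (u, c) \<in> \<Gamma> \<Longrightarrow> u \<in> D \<and> c \<in> carrier E"
    and \<Gamma>D: "\<And>u. u \<in> D \<Longrightarrow> \<exists>c. (u, c) \<in> \<Gamma>"
    and \<Gamma>add: "\<And>u c u' c'. (u, c) \<in> \<Gamma> \<Longrightarrow> (u', c') \<in> \<Gamma> \<Longrightarrow> ((\<lambda>i\<in>{..<n}. u i \<oplus> u' i), c \<oplus> c') \<in> \<Gamma>"
    and \<Gamma>smult: "\<And>r u c. r \<in> carrier A \<Longrightarrow> (u, c) \<in> \<Gamma> \<Longrightarrow> ((\<lambda>i\<in>{..<n}. r \<otimes> u i), r \<otimes> c) \<in> \<Gamma>"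
    and \<Gamma>0: "\<And>v c. v \<in> {..<n} \<rightarrow>\<^sub>E carrier A \<Longrightarrow> ((\<lambda>i\<in>{..<n}. a \<otimes> v i), c) \<in> \<Gamma> \<Longrightarrow> c \<in> J"
  shows "\<exists>z\<in>{..<n} \<rightarrow>\<^sub>E carrier E. \<forall>(u, c)\<in>\<Gamma>. c \<ominus> dot n u z \<in> J"
proof -
  interpret DP: dual_pairing A E a "free_mod E n" "dot n" J by (rule dot_dual_pairing[OF J(1)])
  note JD = smodD[OF DP.Js]
  obtain k :: nat where k: "\<And>j. j \<ge> k \<Longrightarrow> a [^] j \<in> J" "\<And>j x. j \<ge> k \<Longrightarrow> x \<in> J \<Longrightarrow> a [^] j \<otimes> x \<in> carrier A"
    by (rule fracD[OF J(2)]) (rule that)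
  \<comment> \<open>The factor a^k moves J into A, and the additional factor a puts qJ inside aA, so
    that \<open>X0\<close> lies in \<open>Y0\<close>.\<close>
  define q where "q = a [^] (k + 1)"
  have qu: "q \<in> Units E" and q_eq: "q = a [^] k \<otimes> a" and qc: "q \<in> carrier E" "inv q \<in> carrier E"
    using pow_unit[of "k + 1"] by (auto simp: q_def)
  let ?F = "{..<n} \<rightarrow>\<^sub>E carrier A"
  define Y0 where "Y0 = (\<lambda>v. \<lambda>i\<in>{..<n}. a \<otimes> v i) ` ?F"
  define X0 where "X0 = ({..<n} \<rightarrow>\<^sub>E scal q J)"
  have qs: "smod (scal q J)" by (rule smod_scal[OF DP.Js qc(1)])
  note qD = smodD[OF qs]
  have Y0: "submodule Y0 A (free_mod E n)" unfolding DP.P.submodule_iff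
  proof (intro conjI ballI)
    show "Y0 \<subseteq> carrier (free_mod E n)" 
    proof
      fix x assume "x \<in> Y0"
      then obtain u where u: "u \<in> ?F" "x = (\<lambda>i\<in>{..<n}. a \<otimes> u i)" unfolding Y0_def by blast
      show "x \<in> carrier (free_mod E n)" unfolding u(2) using vec_mem[OF u(1)] by simp
    qed
    have "(\<lambda>i\<in>{..<n}. a \<otimes> (\<lambda>i\<in>{..<n}. \<zero>) i) \<in> Y0" unfolding Y0_def
      by (rule imageI, unfold restrict_PiE_iff) (simp add: A_closed)
    moreover have "(\<lambda>i\<in>{..<n}. a \<otimes> (\<lambda>i\<in>{..<n}. \<zero>) i) = \<zero>\<^bsub>free_mod E n\<^esub>"
      unfolding free_mod_simps by (rule restrict_ext) simp
    ultimately show "\<zero>\<^bsub>free_mod E n\<^esub> \<in> Y0" by simp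
  next
    fix x y assume "x \<in> Y0" "y \<in> Y0"
    then obtain u v where uv: "u \<in> ?F" "v \<in> ?F" "x = (\<lambda>i\<in>{..<n}. a \<otimes> u i)" "y = (\<lambda>i\<in>{..<n}. a \<otimes> v i)"
      unfolding Y0_def by blast
    have "(\<lambda>i\<in>{..<n}. a \<otimes> (\<lambda>i\<in>{..<n}. u i \<oplus> v i) i) \<in> Y0"
      unfolding Y0_def by (rule imageI, unfold restrict_PiE_iff) (simp add: A_closed uv(1,2)[THEN vec_mem])
    moreover have "(\<lambda>i\<in>{..<n}. a \<otimes> (\<lambda>i\<in>{..<n}. u i \<oplus> v i) i) = x \<oplus>\<^bsub>free_mod E n\<^esub> y"
      unfolding free_mod_simps uv(3,4) by (rule restrict_ext) (simp add: E.r_distr uv(1,2)[THEN vec_mem])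
    ultimately show "x \<oplus>\<^bsub>free_mod E n\<^esub> y \<in> Y0" by simp
  next
    fix r x assume r: "r \<in> carrier A" and "x \<in> Y0"
    then obtain u where u: "u \<in> ?F" "x = (\<lambda>i\<in>{..<n}. a \<otimes> u i)" unfolding Y0_def by blast
    have "(\<lambda>i\<in>{..<n}. a \<otimes> (\<lambda>i\<in>{..<n}. r \<otimes> u i) i) \<in> Y0"
      unfolding Y0_def by (rule imageI, unfold restrict_PiE_iff) (simp add: A_closed vec_mem[OF u(1)] r)
    moreover have "(\<lambda>i\<in>{..<n}. a \<otimes> (\<lambda>i\<in>{..<n}. r \<otimes> u i) i) = r \<odot>\<^bsub>free_mod E n\<^esub> x"
      unfolding free_mod_simps u(2) by (rule restrict_ext) (simp add: E.m_lcomm r vec_mem[OF u(1)])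
    ultimately show "r \<odot>\<^bsub>free_mod E n\<^esub> x \<in> Y0" by simp
  qed
  have X0: "submodule X0 A (free_mod E n)" unfolding DP.P.submodule_iff
  proof (intro conjI ballI)
    show "X0 \<subseteq> carrier (free_mod E n)" unfolding X0_def free_mod_simps by (intro PiE_mono subsetI qD(1))
    show "\<zero>\<^bsub>free_mod E n\<^esub> \<in> X0" unfolding X0_def using qD(2) by simp
    fix x assume "x \<in> X0"
    then have x: "i < n \<Longrightarrow> x i \<in> scal q J" for i using vec_mem unfolding X0_def by metis
    show "r \<odot>\<^bsub>free_mod E n\<^esub> x \<in> X0" if "r \<in> carrier A" for r
      unfolding X0_def free_mod_simps restrict_PiE_iff using qD(4)[OF that x] by simp
    fix y assume "y \<in> X0"
    then have y: "i < n \<Longrightarrow> y i \<in> scal q J" for i using vec_mem unfolding X0_def by metis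
    show "x \<oplus>\<^bsub>free_mod E n\<^esub> y \<in> X0"
      unfolding X0_def free_mod_simps restrict_PiE_iff using qD(3)[OF x y] by simp
  qed
  have X0Y0: "X0 \<subseteq> Y0"
  proof
    fix x assume x: "x \<in> X0"
    then have "\<exists>j\<in>J. x i = q \<otimes> j" if "i < n" for i using vec_mem[of x n "scal q J" i] that by (auto simp: X0_def scal_def)
    then obtain j where j: "\<And>i. i < n \<Longrightarrow> j i \<in> J \<and> x i = q \<otimes> j i" by metis
    let ?v = "\<lambda>i\<in>{..<n}. a [^] k \<otimes> j i"
    have v: "?v \<in> ?F" using j k by auto
    have "x = (\<lambda>i\<in>{..<n}. a \<otimes> ?v i)"
    proof (rule vec_eqI[OF x[unfolded X0_def], where C = "carrier E"])
      fix i assume i: "i < n"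
      then show "x i = (\<lambda>i\<in>{..<n}. a \<otimes> ?v i) i" using j[OF i] JD(1)[of "j i"] by (simp add: q_eq E.m_ac)
    qed (use vec_mem[OF v] in auto)
    then show "x \<in> Y0" using v unfolding Y0_def by blast
  qed
  have Y0D: "Y0 \<subseteq> D" using aD unfolding Y0_def by auto
  have cl0: "DP.dual_closed X0" unfolding DP.dual_closed_def
  proof (intro ballI impI)
    fix p assume p: "p \<in> carrier (free_mod E n)" "\<forall>y\<in>DP.perp X0. dot n p y \<in> J"
    then have pE: "p \<in> {..<n} \<rightarrow>\<^sub>E carrier E" by simp
    have "p i \<in> scal q J" if i: "i < n" for i
    proof -
      \<comment> \<open>The dot product with q^(-1) e_i reads off the i-th coordinate divided by q.
        These vectors are perpendicular to \<open>X0\<close>, and together they test membership in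
        it.\<close>
      let ?y = "\<lambda>j\<in>{..<n}. inv q \<otimes> unit_vec E n i j"
      note ue = vec_A_E[OF unit_vec_closed, of n i]
      have dy: "dot n x ?y = inv q \<otimes> x i" if x: "x \<in> {..<n} \<rightarrow>\<^sub>E carrier E" for x
        using dot_smult2[OF qc(2) x ue] dot_unit[OF x i] by simp
      have "?y \<in> DP.perp X0" unfolding DP.perp_def
      proof (intro CollectI conjI ballI)
        show "?y \<in> carrier (free_mod E n)" using vec_mem[OF ue] qc by simp
        fix x assume x: "x \<in> X0"
        then have xE: "x \<in> {..<n} \<rightarrow>\<^sub>E carrier E" using X0[unfolded DP.P.submodule_iff] by auto
        obtain j where "j \<in> J" "x i = q \<otimes> j" using vec_mem[OF x[unfolded X0_def] i] by (auto simp: scal_def)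
        then show "dot n x ?y \<in> J" unfolding dy[OF xE] using JD(1)[of j] unit_cancel(1)[OF qu] by simp
      qed
      then have "inv q \<otimes> p i \<in> J" using p dy[OF pE] by auto
      moreover have "p i = q \<otimes> (inv q \<otimes> p i)" using unit_cancel(2)[OF qu vec_mem[OF pE i]] by simp
      ultimately show ?thesis unfolding scal_def by blast
    qed
    then show "p \<in> X0" using pE unfolding X0_def by (auto simp: PiE_iff)
  qed
  \<comment> \<open>Of the factors, k + 1 make up q, and the k others move A into J.\<close>
  have Db: "a [^]\<^bsub>A\<^esub> (k + 1 + k) \<odot>\<^bsub>free_mod E n\<^esub> x \<in> X0" if x: "x \<in> D" for x
  proof -
    have xA: "x \<in> ?F" using x D by auto
    have "a [^] (k + 1 + k) \<otimes> x i \<in> scal q J" if i: "i < n" for i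
    proof -
      have "x i \<in> carrier A" using vec_mem[OF xA i] .
      then have "x i \<otimes> a [^] k \<in> J" using JD(4) k(1)[of k] by simp
      moreover have "a [^] (k + 1 + k) \<otimes> x i = q \<otimes> (x i \<otimes> a [^] k)"
        unfolding pow_add[of "k + 1" k] q_def[symmetric] using qc \<open>x i \<in> carrier A\<close> by (simp add: E.m_ac)
      ultimately show ?thesis unfolding scal_def by blast
    qed
    then show ?thesis unfolding X0_def A_pow[OF a_A(1)] free_mod_simps by auto
  qed
  have "\<exists>z\<in>carrier (free_mod E n). \<forall>(u, c)\<in>\<Gamma>. c \<ominus> dot n u z \<in> J"
  proof (rule DP.extension[OF D(1) noeth_subset[OF noeth_vec D(2)] Y0 Y0D, where k = "k + 1 + k"])
    show "a [^]\<^bsub>A\<^esub> (k + 1 + k) \<odot>\<^bsub>free_mod E n\<^esub> x \<in> Y0" if "x \<in> D" for x using Db[OF that] X0Y0 by auto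
    show "DP.dual_closed Y" if "submodule Y A (free_mod E n)" "Y0 \<subseteq> Y" "Y \<subseteq> D" for Y
    proof (rule DP.dual_closed_all[OF X0 cl0 that(1)])
      show "X0 \<subseteq> Y" using X0Y0 that by auto
      show "noeth A (free_mod E n) Y" by (rule noeth_subset[OF noeth_vec]) (use D that in auto)
      show "a [^]\<^bsub>A\<^esub> (k + 1 + k) \<odot>\<^bsub>free_mod E n\<^esub> x \<in> X0" if "x \<in> Y" for x
        by (rule Db) (use that \<open>Y \<subseteq> D\<close> in auto)
    qed
    show "u \<in> D \<and> c \<in> carrier E" if "(u, c) \<in> \<Gamma>" for u c using \<Gamma>c[OF that] .
    show "\<exists>c. (u, c) \<in> \<Gamma>" if "u \<in> D" for u using \<Gamma>D[OF that] .
    show "(u \<oplus>\<^bsub>free_mod E n\<^esub> u', c \<oplus> c') \<in> \<Gamma>" if "(u, c) \<in> \<Gamma>" "(u', c') \<in> \<Gamma>" for u c u' c'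
      using \<Gamma>add[OF that] by simp
    show "(r \<odot>\<^bsub>free_mod E n\<^esub> u, r \<otimes> c) \<in> \<Gamma>" if "r \<in> carrier A" "(u, c) \<in> \<Gamma>" for r u c
      using \<Gamma>smult[OF that] by simp
    show "c \<in> J" if "(u, c) \<in> \<Gamma>" "u \<in> Y0" for u c using that \<Gamma>0 unfolding Y0_def by auto
  qed
  then show ?thesis by simp
qed

end

section \<open>Ext and the canonical module condition\<close>

text \<open>A nonzero quotient is simple iff each of its nonzero elements generates it; this brings
  length one into the form of the last clause of \<open>type1\<close>.\<close>

lemma simple_between_iff:
  assumes M: "module R M" and N: "submodule N R M" "N \<subseteq> X" and X: "submodule X R M"
  shows "chain_len (between R M N X) = 1 \<longleftrightarrow>
    N \<noteq> X \<and> (\<forall>z\<in>X. z \<notin> N \<longrightarrow> (\<forall>w\<in>X. \<exists>r\<in>carrier R. w \<ominus>\<^bsub>M\<^esub> r \<odot>\<^bsub>M\<^esub> z \<in> N))"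
proof -
  interpret M: module R M by fact
  note NS = N(1)[unfolded M.submodule_iff] and XS = X[unfolded M.submodule_iff]
  have c: "x \<in> carrier M" if "x \<in> X" for x using XS that by auto
  have "chain_len (between R M N X) = 1 \<longleftrightarrow> N \<noteq> X \<and> between R M N X = {N, X}"
    by (rule chain_len_eq1_iff) (use N X in \<open>auto simp: between_def\<close>)
  also have "\<dots> \<longleftrightarrow> N \<noteq> X \<and> (\<forall>z\<in>X. z \<notin> N \<longrightarrow> (\<forall>w\<in>X. \<exists>r\<in>carrier R. w \<ominus>\<^bsub>M\<^esub> r \<odot>\<^bsub>M\<^esub> z \<in> N))"
  proof (intro conj_cong refl iffI ballI impI)
    fix z w assume b: "between R M N X = {N, X}" and z: "z \<in> X" "z \<notin> N" and w: "w \<in> X"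
    note ad = M.submodule_adjoin[OF N(1) c[OF z(1)]]
    have "M.adjoin N z \<in> between R M N X"
      unfolding between_def using ad M.adjoin_subset[OF X N(2) z(1)] by simp
    then have "M.adjoin N z = X" using b ad(3) z by auto
    then obtain n r where nr: "w = n \<oplus>\<^bsub>M\<^esub> r \<odot>\<^bsub>M\<^esub> z" "n \<in> N" "r \<in> carrier R"
      using w unfolding M.adjoin_def by blast
    have "n \<in> carrier M" "r \<odot>\<^bsub>M\<^esub> z \<in> carrier M" using nr N c z by auto
    then have "w \<ominus>\<^bsub>M\<^esub> r \<odot>\<^bsub>M\<^esub> z = n" unfolding nr(1) by (simp add: a_minus_def M.M.a_assoc M.M.r_neg)
    then show "\<exists>r\<in>carrier R. w \<ominus>\<^bsub>M\<^esub> r \<odot>\<^bsub>M\<^esub> z \<in> N" using nr by (intro bexI[of _ r]) simp_all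
  next
    assume *: "\<forall>z\<in>X. z \<notin> N \<longrightarrow> (\<forall>w\<in>X. \<exists>r\<in>carrier R. w \<ominus>\<^bsub>M\<^esub> r \<odot>\<^bsub>M\<^esub> z \<in> N)"
    have "H = X" if H: "submodule H R M" "N \<subseteq> H" "H \<subseteq> X" "H \<noteq> N" for H
    proof -
      note HS = H(1)[unfolded M.submodule_iff]
      obtain z where z: "z \<in> H" "z \<notin> N" using H by auto
      have "w \<in> H" if w: "w \<in> X" for w
      proof -
        obtain r where r: "r \<in> carrier R" "w \<ominus>\<^bsub>M\<^esub> r \<odot>\<^bsub>M\<^esub> z \<in> N" using * z H w by blast
        have zc: "r \<odot>\<^bsub>M\<^esub> z \<in> carrier M" using z H c r by auto
        have "(w \<ominus>\<^bsub>M\<^esub> r \<odot>\<^bsub>M\<^esub> z) \<oplus>\<^bsub>M\<^esub> r \<odot>\<^bsub>M\<^esub> z \<in> H" using HS r H(2) z by blast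
        moreover have "(w \<ominus>\<^bsub>M\<^esub> r \<odot>\<^bsub>M\<^esub> z) \<oplus>\<^bsub>M\<^esub> r \<odot>\<^bsub>M\<^esub> z = w"
          using c[OF w] zc by (simp add: a_minus_def M.M.a_assoc M.M.l_neg)
        ultimately show ?thesis by simp
      qed
      then show ?thesis using H by auto
    qed
    then show "between R M N X = {N, X}" using N X by (auto simp: between_def)
  qed
  finally show ?thesis .
qed

lemma hom_module_simps:
  "carrier (hom_module R M N) = mod_hom R M N \<inter> extensional (carrier M)"
  "\<zero>\<^bsub>hom_module R M N\<^esub> = (\<lambda>x\<in>carrier M. \<zero>\<^bsub>N\<^esub>)"
  "f \<oplus>\<^bsub>hom_module R M N\<^esub> g = (\<lambda>x\<in>carrier M. f x \<oplus>\<^bsub>N\<^esub> g x)"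
  "a \<odot>\<^bsub>hom_module R M N\<^esub> f = (\<lambda>x\<in>carrier M. a \<odot>\<^bsub>N\<^esub> f x)"
  by (simp_all add: hom_module_def)

lemma mod_homD:
  assumes "h \<in> mod_hom R M N"
  shows "x \<in> carrier M \<Longrightarrow> h x \<in> carrier N"
    "x \<in> carrier M \<Longrightarrow> y \<in> carrier M \<Longrightarrow> h (x \<oplus>\<^bsub>M\<^esub> y) = h x \<oplus>\<^bsub>N\<^esub> h y"
    "r \<in> carrier R \<Longrightarrow> x \<in> carrier M \<Longrightarrow> h (r \<odot>\<^bsub>M\<^esub> x) = r \<odot>\<^bsub>N\<^esub> h x"
  using assms by (auto simp: mod_hom_def)

lemma mod_homI:
  assumes "\<And>x. x \<in> carrier M \<Longrightarrow> h x \<in> carrier N"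
    "\<And>x y. x \<in> carrier M \<Longrightarrow> y \<in> carrier M \<Longrightarrow> h (x \<oplus>\<^bsub>M\<^esub> y) = h x \<oplus>\<^bsub>N\<^esub> h y"
    "\<And>r x. r \<in> carrier R \<Longrightarrow> x \<in> carrier M \<Longrightarrow> h (r \<odot>\<^bsub>M\<^esub> x) = r \<odot>\<^bsub>N\<^esub> h x"
  shows "h \<in> mod_hom R M N"
  using assms by (auto simp: mod_hom_def)

lemma mod_hom_restrictI:
  assumes "module R M"
    and "\<And>x. x \<in> carrier M \<Longrightarrow> h x \<in> carrier N"
    "\<And>x y. x \<in> carrier M \<Longrightarrow> y \<in> carrier M \<Longrightarrow> h (x \<oplus>\<^bsub>M\<^esub> y) = h x \<oplus>\<^bsub>N\<^esub> h y"
    "\<And>r x. r \<in> carrier R \<Longrightarrow> x \<in> carrier M \<Longrightarrow> h (r \<odot>\<^bsub>M\<^esub> x) = r \<odot>\<^bsub>N\<^esub> h x"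
  shows "(\<lambda>x\<in>carrier M. h x) \<in> carrier (hom_module R M N)"
proof -
  interpret M: module R M by fact
  have "(\<lambda>x\<in>carrier M. h x) \<in> mod_hom R M N" by (rule mod_homI) (simp_all add: assms(2-4))
  then show ?thesis by (simp add: hom_module_simps)
qed

lemma mod_hom_zero:
  assumes "module R M" "module R N" "h \<in> mod_hom R M N"
  shows "h \<zero>\<^bsub>M\<^esub> = \<zero>\<^bsub>N\<^esub>"
proof -
  interpret M: module R M by fact
  interpret N: module R N by fact
  have "h (\<zero>\<^bsub>R\<^esub> \<odot>\<^bsub>M\<^esub> \<zero>\<^bsub>M\<^esub>) = \<zero>\<^bsub>R\<^esub> \<odot>\<^bsub>N\<^esub> h \<zero>\<^bsub>M\<^esub>" by (rule mod_homD(3)[OF assms(3)]) simp_all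
  then show ?thesis using mod_homD(1)[OF assms(3), of "\<zero>\<^bsub>M\<^esub>"] by simp
qed

lemma hom_module_module:
  assumes M: "module R M" and N: "module R N"
  shows "module R (hom_module R M N)"
proof -
  interpret M: module R M by fact
  interpret N: module R N by fact
  let ?H = "hom_module R M N"
  have hD: "x \<in> carrier M \<Longrightarrow> h x \<in> carrier N"
    "x \<in> carrier M \<Longrightarrow> y \<in> carrier M \<Longrightarrow> h (x \<oplus>\<^bsub>M\<^esub> y) = h x \<oplus>\<^bsub>N\<^esub> h y"
    "r \<in> carrier R \<Longrightarrow> x \<in> carrier M \<Longrightarrow> h (r \<odot>\<^bsub>M\<^esub> x) = r \<odot>\<^bsub>N\<^esub> h x"
    "(\<lambda>x\<in>carrier M. h x) = h" if "h \<in> carrier ?H" for h x y r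
    using that mod_homD[of h R M N] by (auto simp: hom_module_simps extensional_restrict)
  show ?thesis
  proof (rule moduleI)
    show "abelian_group ?H"
    proof (rule abelian_groupI)
      fix f assume f: "f \<in> carrier ?H"
      note fD = hD[OF f]
      show "\<zero>\<^bsub>?H\<^esub> \<oplus>\<^bsub>?H\<^esub> f = f"
      proof -
        have "\<zero>\<^bsub>?H\<^esub> \<oplus>\<^bsub>?H\<^esub> f = (\<lambda>x\<in>carrier M. f x)"
          unfolding hom_module_simps by (rule restrict_ext) (simp add: fD)
        then show ?thesis by (simp add: fD(4))
      qed
      have "(\<lambda>x\<in>carrier M. \<ominus>\<^bsub>N\<^esub> f x) \<in> carrier ?H"
        by (rule mod_hom_restrictI[OF M]) (simp_all add: fD N.M.minus_add N.smult_r_minus)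
      moreover have "(\<lambda>x\<in>carrier M. \<ominus>\<^bsub>N\<^esub> f x) \<oplus>\<^bsub>?H\<^esub> f = \<zero>\<^bsub>?H\<^esub>"
        unfolding hom_module_simps by (rule restrict_ext) (simp add: fD N.M.l_neg)
      ultimately show "\<exists>g\<in>carrier ?H. g \<oplus>\<^bsub>?H\<^esub> f = \<zero>\<^bsub>?H\<^esub>" by blast
    next
      fix f g assume f: "f \<in> carrier ?H" and g: "g \<in> carrier ?H"
      show "f \<oplus>\<^bsub>?H\<^esub> g = g \<oplus>\<^bsub>?H\<^esub> f"
        unfolding hom_module_simps by (rule restrict_ext) (simp add: hD[OF f] hD[OF g] N.M.a_comm)
      show "f \<oplus>\<^bsub>?H\<^esub> g \<in> carrier ?H" unfolding hom_module_simps(3)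
        by (rule mod_hom_restrictI[OF M]) (simp_all add: hD[OF f] hD[OF g] N.M.a_ac N.smult_r_distr)
      fix h assume h: "h \<in> carrier ?H"
      show "f \<oplus>\<^bsub>?H\<^esub> g \<oplus>\<^bsub>?H\<^esub> h = f \<oplus>\<^bsub>?H\<^esub> (g \<oplus>\<^bsub>?H\<^esub> h)"
        unfolding hom_module_simps by (rule restrict_ext) (simp add: hD[OF f] hD[OF g] hD[OF h] N.M.a_assoc)
    next
      show "\<zero>\<^bsub>?H\<^esub> \<in> carrier ?H" unfolding hom_module_simps(2)
        by (rule mod_hom_restrictI[OF M]) simp_all
    qed
  next
    fix r s f assume rs: "r \<in> carrier R" "s \<in> carrier R" and f: "f \<in> carrier ?H"
    show "(r \<oplus>\<^bsub>R\<^esub> s) \<odot>\<^bsub>?H\<^esub> f = r \<odot>\<^bsub>?H\<^esub> f \<oplus>\<^bsub>?H\<^esub> s \<odot>\<^bsub>?H\<^esub> f"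
      unfolding hom_module_simps by (rule restrict_ext) (simp add: hD[OF f] rs N.smult_l_distr)
    show "(r \<otimes>\<^bsub>R\<^esub> s) \<odot>\<^bsub>?H\<^esub> f = r \<odot>\<^bsub>?H\<^esub> (s \<odot>\<^bsub>?H\<^esub> f)"
      unfolding hom_module_simps by (rule restrict_ext) (simp add: hD[OF f] rs N.smult_assoc1)
  next
    fix r f g assume r: "r \<in> carrier R" and f: "f \<in> carrier ?H" and g: "g \<in> carrier ?H"
    show "r \<odot>\<^bsub>?H\<^esub> (f \<oplus>\<^bsub>?H\<^esub> g) = r \<odot>\<^bsub>?H\<^esub> f \<oplus>\<^bsub>?H\<^esub> r \<odot>\<^bsub>?H\<^esub> g"
      unfolding hom_module_simps by (rule restrict_ext) (simp add: hD[OF f] hD[OF g] r N.smult_r_distr)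
  next
    fix r f assume r: "r \<in> carrier R" and f: "f \<in> carrier ?H"
    show "r \<odot>\<^bsub>?H\<^esub> f \<in> carrier ?H" unfolding hom_module_simps(4)
      by (rule mod_hom_restrictI[OF M])
        (simp_all add: hD[OF f] r N.smult_r_distr N.smult_assoc1[symmetric] M.R.m_comm)
  next
    fix f assume f: "f \<in> carrier ?H"
    have "\<one>\<^bsub>R\<^esub> \<odot>\<^bsub>?H\<^esub> f = (\<lambda>x\<in>carrier M. f x)"
      unfolding hom_module_simps by (rule restrict_ext) (simp add: hD[OF f])
    then show "\<one>\<^bsub>R\<^esub> \<odot>\<^bsub>?H\<^esub> f = f" by (simp add: hD(4)[OF f])
  qed (rule M.R.is_cring)
qed

section \<open>Cocycles, coboundaries and the length of Ext\<close>

context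
  fixes R :: "('a, 'm) ring_scheme" and M :: "('a, 'b) module" and N :: "('a, 'c) module" and r d e
  assumes R: "cring R" and M: "module R M" and N: "module R N" and res: "free_resolution R N r d e"
begin

private lemma fm: "module R (free_mod R n)"
proof -
  interpret R: cring R by (rule R)
  interpret overring R R by unfold_locales (simp add: ring_hom_def)
  show ?thesis by (rule free_module)
qed

private lemma d_hom: "d i \<in> mod_hom R (free_mod R (r (Suc i))) (free_mod R (r i))"
  using res by (simp add: free_resolution_def)

lemma resolution_compl: "w \<in> carrier (free_mod R (r (Suc (Suc i)))) \<Longrightarrow> d i (d (Suc i) w) = \<zero>\<^bsub>free_mod R (r i)\<^esub>"
  using res unfolding free_resolution_def by blast

lemma Ext_cocycles_iff:
  "f \<in> Ext_cocycles R r d M i \<longleftrightarrow> f \<in> carrier (hom_module R (free_mod R (r i)) M) \<and>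
     (\<forall>w\<in>carrier (free_mod R (r (Suc i))). f (d i w) = \<zero>\<^bsub>M\<^esub>)"
proof -
  have "compose X f (d i) = (\<lambda>x\<in>X. \<zero>\<^bsub>M\<^esub>) \<longleftrightarrow> (\<forall>w\<in>X. f (d i w) = \<zero>\<^bsub>M\<^esub>)" for X
    by (auto simp: compose_def restrict_def fun_eq_iff)
  then show ?thesis unfolding Ext_cocycles_def hom_module_simps(2) by blast
qed

lemma Ext_coboundaries_iff:
  "f \<in> Ext_coboundaries R r d M (Suc j) \<longleftrightarrow> f \<in> extensional (carrier (free_mod R (r (Suc j)))) \<and>
     (\<exists>g\<in>carrier (hom_module R (free_mod R (r j)) M). \<forall>w\<in>carrier (free_mod R (r (Suc j))). f w = g (d j w))"
proof -
  have "f = compose X g (d j) \<longleftrightarrow> f \<in> extensional X \<and> (\<forall>w\<in>X. f w = g (d j w))" for X g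
    by (auto simp: compose_def restrict_def extensional_def fun_eq_iff)
  then show ?thesis unfolding Ext_coboundaries_def nat.case image_iff by blast
qed

lemma Ext_submodules:
  fixes j :: nat defines "H \<equiv> hom_module R (free_mod R (r (Suc j))) M"
  shows "module R H" "submodule (Ext_cocycles R r d M (Suc j)) R H"
    "submodule (Ext_coboundaries R r d M (Suc j)) R H"
    "Ext_coboundaries R r d M (Suc j) \<subseteq> Ext_cocycles R r d M (Suc j)"
proof -
  let ?F = "free_mod R (r (Suc j))" and ?G = "free_mod R (r j)"
  interpret M: module R M by (rule M)
  show Hm: "module R H" unfolding H_def by (rule hom_module_module[OF fm M])
  interpret H: module R H by (rule Hm)
  interpret H': module R "hom_module R (free_mod R (r j)) M" by (rule hom_module_module[OF fm M])
  have dF: "w \<in> carrier (free_mod R (r (Suc i))) \<Longrightarrow> d i w \<in> carrier (free_mod R (r i))" for w i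
    by (rule mod_homD(1)[OF d_hom])
  show "submodule (Ext_cocycles R r d M (Suc j)) R H"
    unfolding H.submodule_iff
  proof (intro conjI ballI)
    show "Ext_cocycles R r d M (Suc j) \<subseteq> carrier H" unfolding H_def Ext_cocycles_def by blast
    show "\<zero>\<^bsub>H\<^esub> \<in> Ext_cocycles R r d M (Suc j)" unfolding Ext_cocycles_iff
      using H.M.zero_closed dF by (simp add: H_def hom_module_simps(2) del: free_mod_simps)
    fix f assume f: "f \<in> Ext_cocycles R r d M (Suc j)"
    then have fH: "f \<in> carrier H" by (simp add: Ext_cocycles_iff H_def)
    show "s \<odot>\<^bsub>H\<^esub> f \<in> Ext_cocycles R r d M (Suc j)" if s: "s \<in> carrier R" for s
      unfolding Ext_cocycles_iff
      using H.smult_closed[OF s fH] dF[of _ "Suc j"] f[unfolded Ext_cocycles_iff] s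
      by (simp add: H_def hom_module_simps(4) del: free_mod_simps)
    fix g assume g: "g \<in> Ext_cocycles R r d M (Suc j)"
    then have gH: "g \<in> carrier H" by (simp add: Ext_cocycles_iff H_def)
    show "f \<oplus>\<^bsub>H\<^esub> g \<in> Ext_cocycles R r d M (Suc j)"
      unfolding Ext_cocycles_iff
      using H.M.a_closed[OF fH gH] dF[of _ "Suc j"] f[unfolded Ext_cocycles_iff] g[unfolded Ext_cocycles_iff]
      by (simp add: H_def hom_module_simps(3) del: free_mod_simps)
  qed
  have Bhom: "f \<in> carrier H" if f: "f \<in> Ext_coboundaries R r d M (Suc j)" for f
  proof -
    obtain g where g: "g \<in> mod_hom R ?G M" "\<forall>w\<in>carrier ?F. f w = g (d j w)"
      using f unfolding Ext_coboundaries_iff hom_module_simps by blast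
    have fe: "f = (\<lambda>w\<in>carrier ?F. g (d j w))"
      using f g by (intro extensionalityI[of f "carrier ?F"]) (auto simp: Ext_coboundaries_iff simp del: free_mod_simps)
    show ?thesis unfolding fe H_def
      by (rule mod_hom_restrictI[OF fm])
        (simp_all only: mod_homD[OF g(1)] mod_homD[OF d_hom[of j]] dF)
  qed
  show "submodule (Ext_coboundaries R r d M (Suc j)) R H"
    unfolding H.submodule_iff
  proof (intro conjI ballI)
    show "Ext_coboundaries R r d M (Suc j) \<subseteq> carrier H" using Bhom by blast
    show "\<zero>\<^bsub>H\<^esub> \<in> Ext_coboundaries R r d M (Suc j)" unfolding Ext_coboundaries_iff
    proof (intro conjI bexI ballI)
      show "\<zero>\<^bsub>hom_module R ?G M\<^esub> \<in> carrier (hom_module R ?G M)" by (rule H'.M.zero_closed)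
    qed (simp_all add: H_def hom_module_simps(2) dF del: free_mod_simps)
    fix f assume f: "f \<in> Ext_coboundaries R r d M (Suc j)"
    obtain g where g: "g \<in> carrier (hom_module R ?G M)" "\<forall>w\<in>carrier ?F. f w = g (d j w)"
      using f unfolding Ext_coboundaries_iff by blast
    show "s \<odot>\<^bsub>H\<^esub> f \<in> Ext_coboundaries R r d M (Suc j)" if s: "s \<in> carrier R" for s
      unfolding Ext_coboundaries_iff
    proof (intro conjI bexI ballI)
      show "s \<odot>\<^bsub>hom_module R ?G M\<^esub> g \<in> carrier (hom_module R ?G M)" by (rule H'.smult_closed[OF s g(1)])
    qed (simp_all add: H_def hom_module_simps(4) dF g(2) del: free_mod_simps)
    fix f' assume f': "f' \<in> Ext_coboundaries R r d M (Suc j)"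
    obtain g' where g': "g' \<in> carrier (hom_module R ?G M)" "\<forall>w\<in>carrier ?F. f' w = g' (d j w)"
      using f' unfolding Ext_coboundaries_iff by blast
    show "f \<oplus>\<^bsub>H\<^esub> f' \<in> Ext_coboundaries R r d M (Suc j)"
      unfolding Ext_coboundaries_iff
    proof (intro conjI bexI ballI)
      show "g \<oplus>\<^bsub>hom_module R ?G M\<^esub> g' \<in> carrier (hom_module R ?G M)" by (rule H'.M.a_closed[OF g(1) g'(1)])
    qed (simp_all add: H_def hom_module_simps(3) dF g(2) g'(2) del: free_mod_simps)
  qed
  show "Ext_coboundaries R r d M (Suc j) \<subseteq> Ext_cocycles R r d M (Suc j)"
  proof
    fix f assume f: "f \<in> Ext_coboundaries R r d M (Suc j)"
    obtain g where g: "g \<in> mod_hom R ?G M" "\<forall>w\<in>carrier ?F. f w = g (d j w)"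
      using f unfolding Ext_coboundaries_iff hom_module_simps by blast
    have "f (d (Suc j) w) = \<zero>\<^bsub>M\<^esub>" if w: "w \<in> carrier (free_mod R (r (Suc (Suc j))))" for w
      using g(2)[rule_format, OF dF[OF w]] resolution_compl[OF w] mod_hom_zero[OF fm M g(1)] by metis
    then show "f \<in> Ext_cocycles R r d M (Suc j)" using Bhom[OF f] unfolding Ext_cocycles_iff H_def by blast
  qed
qed

lemma Ext_length:
  "mod_length R (Ext R r d M (Suc j)) =
     chain_len (between R (hom_module R (free_mod R (r (Suc j))) M)
       (Ext_coboundaries R r d M (Suc j)) (Ext_cocycles R r d M (Suc j)))"
  unfolding Ext_def by (rule mod_length_quot_restrict) (rule Ext_submodules)+

lemma Ext_trivial:
  assumes "Ext_cocycles R r d M (Suc j) \<subseteq> Ext_coboundaries R r d M (Suc j)"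
  shows "carrier (Ext R r d M (Suc j)) = {\<zero>\<^bsub>Ext R r d M (Suc j)\<^esub>}"
proof -
  let ?H = "hom_module R (free_mod R (r (Suc j))) M"
  have eq: "Ext_cocycles R r d M (Suc j) = Ext_coboundaries R r d M (Suc j)"
    using assms Ext_submodules(4) by blast
  interpret Q: quotient_module R "?H\<lparr>carrier := Ext_cocycles R r d M (Suc j)\<rparr>" "Ext_coboundaries R r d M (Suc j)"
    by (rule quotient_module_restrict) (rule Ext_submodules)+
  show ?thesis unfolding Ext_def Q.quot_carrier Q.quot_zero(1)
    using Q.N.a_rcos_const Q.N.zero_closed unfolding eq by auto
qed

end

lemma image_submodule:
  assumes M: "module R M" and N: "module R N" and h: "h \<in> mod_hom R M N"
  shows "submodule (h ` carrier M) R N"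
proof -
  interpret M: module R M by fact
  interpret N: module R N by fact
  note hD = mod_homD[OF h]
  show ?thesis unfolding N.submodule_iff
  proof (intro conjI ballI)
    show "h ` carrier M \<subseteq> carrier N" using hD(1) by blast
    show "\<zero>\<^bsub>N\<^esub> \<in> h ` carrier M" using mod_hom_zero[OF M N h] by (metis M.M.zero_closed image_eqI)
    fix x assume "x \<in> h ` carrier M"
    then obtain u where u: "x = h u" "u \<in> carrier M" by blast
    show "r \<odot>\<^bsub>N\<^esub> x \<in> h ` carrier M" if "r \<in> carrier R" for r
      unfolding u(1) hD(3)[OF that u(2), symmetric] using that u(2) by simp
    fix y assume "y \<in> h ` carrier M"
    then obtain v where v: "y = h v" "v \<in> carrier M" by blast
    show "x \<oplus>\<^bsub>N\<^esub> y \<in> h ` carrier M"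
      unfolding u(1) v(1) hD(2)[OF u(2) v(2), symmetric] using u(2) v(2) by simp
  qed
qed

section \<open>Free covers and free resolutions\<close>

context noeth_local
begin

text \<open>Among the images of finite free modules inside D there is a maximal one; if it missed an
  element x of D, sending one more basis vector to x would enlarge it.\<close>

lemma free_cover:
  assumes M: "module A M" and D: "noeth A M D" "submodule D A M"
  shows "\<exists>m d. d \<in> mod_hom A (free_mod A m) M \<and> d ` carrier (free_mod A m) = D"
proof -
  interpret M: module A M by fact
  have fm: "module A (free_mod A m)" for m by (rule AA.free_module)
  note DS = D(2)[unfolded M.submodule_iff]
  define F where "F = {X. X \<subseteq> D \<and> (\<exists>m d. d \<in> mod_hom A (free_mod A m) M \<and> d ` carrier (free_mod A m) = X)}"
  have Fs: "submodule X A M \<and> X \<subseteq> D" if "X \<in> F" for X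
    using that image_submodule[OF fm M] unfolding F_def by blast
  have "(\<lambda>_. \<zero>\<^bsub>M\<^esub>) \<in> mod_hom A (free_mod A 0) M" by (rule mod_homI) simp_all
  moreover have "(\<lambda>_. \<zero>\<^bsub>M\<^esub>) ` carrier (free_mod A 0) \<subseteq> D" using DS by auto
  ultimately have ne: "F \<noteq> {}" unfolding F_def by blast
  have "\<exists>X\<in>F. \<forall>X'\<in>F. X \<subseteq> X' \<longrightarrow> X' = X" by (rule noeth_maximal[OF D(1) ne Fs])
  then obtain X where X: "X \<in> F" and mx: "\<And>X'. X' \<in> F \<Longrightarrow> X \<subseteq> X' \<Longrightarrow> X' = X" by blast
  obtain m d where d: "d \<in> mod_hom A (free_mod A m) M" "d ` carrier (free_mod A m) = X" "X \<subseteq> D"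
    using X unfolding F_def by blast
  have "X = D"
  proof (rule ccontr)
    assume "X \<noteq> D"
    then obtain x where x: "x \<in> D" "x \<notin> X" using d by auto
    have xc: "x \<in> carrier M" using x DS by auto
    let ?d = "\<lambda>v. d (restrict v {..<m}) \<oplus>\<^bsub>M\<^esub> v m \<odot>\<^bsub>M\<^esub> x"
    have rc: "restrict v {..<m} \<in> carrier (free_mod A m)" "v m \<in> carrier A"
      if "v \<in> carrier (free_mod A (Suc m))" for v
      using vec_mem[of v "Suc m" "carrier A"] that by simp_all
    note dD = mod_homD[OF d(1)]
    have dh: "?d \<in> mod_hom A (free_mod A (Suc m)) M"
    proof (rule mod_homI)
      fix v assume v: "v \<in> carrier (free_mod A (Suc m))"
      show "?d v \<in> carrier M" using dD(1)[OF rc(1)[OF v]] rc(2)[OF v] xc by simp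
      show "?d (r \<odot>\<^bsub>free_mod A (Suc m)\<^esub> v) = r \<odot>\<^bsub>M\<^esub> ?d v" if r: "r \<in> carrier A" for r
      proof -
        have "restrict (r \<odot>\<^bsub>free_mod A (Suc m)\<^esub> v) {..<m} = r \<odot>\<^bsub>free_mod A m\<^esub> restrict v {..<m}"
          unfolding free_mod_simps restrict_restrict by (auto simp: restrict_def fun_eq_iff)
        moreover have "(r \<odot>\<^bsub>free_mod A (Suc m)\<^esub> v) m = r \<otimes> v m" by simp
        ultimately show ?thesis
          using dD(3)[OF r rc(1)[OF v]] dD(1)[OF rc(1)[OF v]] rc(2)[OF v] xc r
          by (simp add: M.smult_r_distr M.smult_assoc1 del: free_mod_simps)
      qed
      fix w assume w: "w \<in> carrier (free_mod A (Suc m))"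
      have "restrict (v \<oplus>\<^bsub>free_mod A (Suc m)\<^esub> w) {..<m} = restrict v {..<m} \<oplus>\<^bsub>free_mod A m\<^esub> restrict w {..<m}"
        unfolding free_mod_simps restrict_restrict by (auto simp: restrict_def fun_eq_iff)
      moreover have "(v \<oplus>\<^bsub>free_mod A (Suc m)\<^esub> w) m = v m \<oplus> w m" by simp
      ultimately show "?d (v \<oplus>\<^bsub>free_mod A (Suc m)\<^esub> w) = ?d v \<oplus>\<^bsub>M\<^esub> ?d w"
        using dD(2)[OF rc(1)[OF v] rc(1)[OF w]] dD(1)[OF rc(1)[OF v]] dD(1)[OF rc(1)[OF w]] rc(2)[OF v] rc(2)[OF w] xc
        by (simp add: M.smult_l_distr M.M.a_ac del: free_mod_simps)
    qed
    have im: "?d ` carrier (free_mod A (Suc m)) \<subseteq> D"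
    proof clarify
      fix v assume v: "v \<in> carrier (free_mod A (Suc m))"
      have "d (restrict v {..<m}) \<in> D" using d rc(1)[OF v] by blast
      moreover have "v m \<odot>\<^bsub>M\<^esub> x \<in> D" using DS x(1) rc(2)[OF v] by blast
      ultimately show "?d v \<in> D" using DS by blast
    qed
    have "X \<subseteq> ?d ` carrier (free_mod A (Suc m))"
    proof
      fix y assume "y \<in> X"
      then obtain u where u: "u \<in> {..<m} \<rightarrow>\<^sub>E carrier A" "y = d u" using d(2) by auto
      let ?v = "\<lambda>i\<in>{..<Suc m}. if i = m then \<zero> else u i"
      have vc: "?v \<in> carrier (free_mod A (Suc m))"
        unfolding free_mod_simps restrict_PiE_iff using vec_mem[OF u(1)] by simp
      have rv: "restrict ?v {..<m} \<in> {..<m} \<rightarrow>\<^sub>E carrier A"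
        unfolding restrict_PiE_iff using vec_mem[OF u(1)] by simp
      have vr: "restrict ?v {..<m} = u" by (rule vec_eqI[OF rv u(1)]) simp
      have vm: "?v m = \<zero>" by simp
      have "?d ?v = d u \<oplus>\<^bsub>M\<^esub> \<zero> \<odot>\<^bsub>M\<^esub> x" by (simp only: vr vm)
      also have "\<dots> = y" using u xc dD(1)[of u] by simp
      finally show "y \<in> ?d ` carrier (free_mod A (Suc m))" using vc by (intro image_eqI[OF _ vc]) (rule sym)
    qed
    moreover have "?d ` carrier (free_mod A (Suc m)) \<in> F" unfolding F_def using dh im by blast
    ultimately have eq: "?d ` carrier (free_mod A (Suc m)) = X" using mx by blast
    have xin: "x \<in> ?d ` carrier (free_mod A (Suc m))"
    proof (rule image_eqI)
      let ?v = "\<lambda>i\<in>{..<Suc m}. if i = m then \<one> else \<zero>"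
      show "?v \<in> carrier (free_mod A (Suc m))" unfolding free_mod_simps restrict_PiE_iff by simp
      have vr: "restrict ?v {..<m} = \<zero>\<^bsub>free_mod A m\<^esub>"
        unfolding free_mod_simps by (auto simp: restrict_def fun_eq_iff)
      have vm: "?v m = \<one>" by simp
      have "?d ?v = d \<zero>\<^bsub>free_mod A m\<^esub> \<oplus>\<^bsub>M\<^esub> \<one> \<odot>\<^bsub>M\<^esub> x" by (simp only: vr vm)
      also have "\<dots> = x" unfolding mod_hom_zero[OF fm M d(1)] using xc by simp
      finally show "x = ?d ?v" by (rule sym)
    qed
    then show False using eq x by blast
  qed
  then show ?thesis using d by blast
qed

text \<open>Kernels of maps between finite free modules are again images of finite free modules, so
  the differentials can be chosen one after the other. The dependent choice runs over triples (n,
  n', d) with d from A^n' to A^n, because the next kernel involves both ranks.\<close>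

lemma resolution_exists:
  assumes noeth_free: "\<And>n. noeth A (free_mod A n) (carrier (free_mod A n))"
    and N: "module A N" and e: "e \<in> mod_hom A (free_mod A n0) N" "e ` carrier (free_mod A n0) = carrier N"
  shows "\<exists>r d. free_resolution A N r d e"
proof -
  have fm: "module A (free_mod A m)" for m by (rule AA.free_module)
  have ker: "submodule {x \<in> carrier M. h x = \<zero>\<^bsub>P\<^esub>} A M" if M: "module A M" and P: "module A P" and h: "h \<in> mod_hom A M P" for M P h
  proof -
    interpret M: module A M by fact
    interpret P: module A P by fact
    show ?thesis unfolding M.submodule_iff
      using mod_homD[OF h] mod_hom_zero[OF M P h] by simp
  qed
  have cover: "\<exists>m d. d \<in> mod_hom A (free_mod A m) (free_mod A n) \<and> d ` carrier (free_mod A m) = U"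
    if "submodule U A (free_mod A n)" for U n
    using free_cover[OF fm noeth_subset[OF noeth_free module.submoduleE(1)[OF fm that]] that] .
  define P where "P i s = (case s of (n, n', d) \<Rightarrow> d \<in> mod_hom A (free_mod A n') (free_mod A n) \<and>
      (i = 0 \<longrightarrow> n = n0 \<and> d ` carrier (free_mod A n') = {x \<in> carrier (free_mod A n0). e x = \<zero>\<^bsub>N\<^esub>}))" for i :: nat and s
  define Q where "Q s t = (case s of (n, n', d) \<Rightarrow> case t of (l, l', d') \<Rightarrow> l = n' \<and>
      d' ` carrier (free_mod A l') = {x \<in> carrier (free_mod A n'). d x = \<zero>\<^bsub>free_mod A n\<^esub>})" for s t
  have "\<exists>f. \<forall>i. P i (f i) \<and> Q (f i) (f (Suc i))"
  proof (rule dependent_nat_choice)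
    obtain m d where "d \<in> mod_hom A (free_mod A m) (free_mod A n0)"
      "d ` carrier (free_mod A m) = {x \<in> carrier (free_mod A n0). e x = \<zero>\<^bsub>N\<^esub>}"
      using cover[OF ker[OF fm N e(1)]] by blast
    then show "\<exists>s. P 0 s" unfolding P_def by (intro exI[of _ "(n0, m, d)"]) simp
  next
    fix s and i :: nat assume s: "P i s"
    obtain n n' d where s_eq: "s = (n, n', d)" by (cases s)
    have d: "d \<in> mod_hom A (free_mod A n') (free_mod A n)" using s unfolding P_def s_eq by simp
    obtain m d' where "d' \<in> mod_hom A (free_mod A m) (free_mod A n')"
      "d' ` carrier (free_mod A m) = {x \<in> carrier (free_mod A n'). d x = \<zero>\<^bsub>free_mod A n\<^esub>}"
      using cover[OF ker[OF fm fm d]] by blast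
    then show "\<exists>t. P (Suc i) t \<and> Q s t" unfolding P_def Q_def s_eq by (intro exI[of _ "(n', m, d')"]) simp
  qed
  then obtain f where f: "\<And>i. P i (f i)" "\<And>i. Q (f i) (f (Suc i))" by blast
  define r where "r i = fst (f i)" for i
  define d where "d i = snd (snd (f i))" for i
  have r': "fst (snd (f i)) = r (Suc i)" for i using f(2)[of i] by (auto simp: Q_def r_def split: prod.splits)
  have fi: "f i = (r i, r (Suc i), d i)" for i by (simp add: r_def d_def r'[of i, unfolded r_def, symmetric])
  have r0: "r 0 = n0" using f(1)[of 0] by (simp add: fi P_def)
  have "free_resolution A N r d e" unfolding free_resolution_def
  proof (intro conjI allI)
    show "e \<in> mod_hom A (free_mod A (r 0)) N" "e ` carrier (free_mod A (r 0)) = carrier N" using e r0 by simp_all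
    show "d i \<in> mod_hom A (free_mod A (r (Suc i))) (free_mod A (r i))" for i
      using f(1)[of i] by (simp add: fi P_def del: free_mod_simps)
    show "d 0 ` carrier (free_mod A (r 1)) = {x \<in> carrier (free_mod A (r 0)). e x = \<zero>\<^bsub>N\<^esub>}"
      using f(1)[of 0] by (simp add: fi P_def r0 del: free_mod_simps)
    show "d (Suc i) ` carrier (free_mod A (r (Suc (Suc i)))) =
        {x \<in> carrier (free_mod A (r (Suc i))). d i x = \<zero>\<^bsub>free_mod A (r i)\<^esub>}" for i
      using f(2)[of i] by (simp add: fi Q_def del: free_mod_simps)
  qed
  then show ?thesis by blast
qed

end

context param_overring
begin

text \<open>The operations of A^n are those of E^n restricted to vectors over A, so the chain
  condition transfers from \<open>noeth_vec\<close>.\<close>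

lemma noeth_free_A: "noeth A (free_mod A n) (carrier (free_mod A n))"
proof -
  have "submodule X A (free_mod E n)" if X: "submodule X A (free_mod A n)" for X
  proof -
    note XS = X[unfolded module.submodule_iff[OF AA.free_module]]
    have c: "x \<in> {..<n} \<rightarrow>\<^sub>E carrier A" if "x \<in> X" for x using XS that by auto
    show ?thesis unfolding module.submodule_iff[OF free_module]
    proof (intro conjI ballI)
      show "X \<subseteq> carrier (free_mod E n)" using vec_A_E[OF c] by auto
      have "\<zero>\<^bsub>free_mod E n\<^esub> = \<zero>\<^bsub>free_mod A n\<^esub>" by (simp only: free_mod_simps A_zero)
      then show "\<zero>\<^bsub>free_mod E n\<^esub> \<in> X" using XS by (simp only:)
      fix x assume x: "x \<in> X"
      show "r \<odot>\<^bsub>free_mod E n\<^esub> x \<in> X" if "r \<in> carrier A" for r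
        using vec_ops_A(2)[OF c[OF x] c[OF x] that] XS x that by metis
      fix y assume y: "y \<in> X"
      show "x \<oplus>\<^bsub>free_mod E n\<^esub> y \<in> X" using vec_ops_A(1)[OF c[OF x] c[OF y] A.one_closed] XS x y by metis
    qed
  qed
  note sub = this
  show ?thesis unfolding noeth_def
  proof (intro allI impI)
    fix f :: "nat \<Rightarrow> (nat \<Rightarrow> 'a) set"
    assume "\<forall>t. submodule (f t) A (free_mod A n) \<and> f t \<subseteq> carrier (free_mod A n) \<and> f t \<subseteq> f (Suc t)"
    then show "\<exists>T. \<forall>t\<ge>T. f t = f T"
      by (intro noethD[OF noeth_vec[of n]] sub) (simp_all only: free_mod_simps(1))
  qed
qed

abbreviation (input) resid where "resid \<equiv> residue_module A"

lemma resid_quotient: "quotient_module A (self_module A) \<mm>"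
proof -
  have "submodule \<mm> A (self_module A)"
    using m.is_ideal unfolding ideal_iff submodule_A_iff .
  then show ?thesis by (simp add: quotient_module_def quotient_module_axioms_def AA.Emod)
qed

text \<open>The property \<open>has_type\<close> quantifies over all resolutions of the residue
  field; existence of one keeps it from being vacuous, so that information can be drawn from
  it.\<close>

lemma residue_resolution_exists: "\<exists>r d e. free_resolution A resid r d e"
proof -
  interpret Q: quotient_module A "self_module A" \<mm> by (rule resid_quotient)
  let ?e = "\<lambda>v. \<mm> +>\<^bsub>self_module A\<^esub> (v (0::nat))"
  have c: "v 0 \<in> carrier A" if "v \<in> carrier (free_mod A 1)" for v
    using vec_mem[of v 1 "carrier A" 0] that by simp
  have "?e \<in> mod_hom A (free_mod A 1) resid" unfolding residue_module_def
  proof (rule mod_homI)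
    fix x assume x: "x \<in> carrier (free_mod A 1)"
    show "?e x \<in> carrier (quot_mod (self_module A) \<mm>)" using c[OF x] unfolding Q.quot_carrier by simp
    show "?e (r \<odot>\<^bsub>free_mod A 1\<^esub> x) = r \<odot>\<^bsub>quot_mod (self_module A) \<mm>\<^esub> ?e x" if "r \<in> carrier A" for r
      using Q.quot_smult[of r "x 0"] c[OF x] that by simp
    fix y assume y: "y \<in> carrier (free_mod A 1)"
    show "?e (x \<oplus>\<^bsub>free_mod A 1\<^esub> y) = ?e x \<oplus>\<^bsub>quot_mod (self_module A) \<mm>\<^esub> ?e y"
      using Q.quot_add[of "x 0" "y 0"] c[OF x] c[OF y] by simp
  qed
  moreover have "?e ` carrier (free_mod A 1) = carrier resid"
  proof -
    have "X \<in> ?e ` carrier (free_mod A 1)" if "X \<in> carrier resid" for X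
    proof -
      obtain s where s: "X = \<mm> +>\<^bsub>self_module A\<^esub> s" "s \<in> carrier A"
        using \<open>X \<in> carrier resid\<close> unfolding residue_module_def Q.quot_carrier by auto
      show ?thesis by (rule image_eqI[of _ _ "\<lambda>i\<in>{..<1}. s"]) (use s in auto)
    qed
    moreover have "?e v \<in> carrier resid" if "v \<in> carrier (free_mod A 1)" for v
      unfolding residue_module_def Q.quot_carrier using c[OF that] by simp
    ultimately show ?thesis by blast
  qed
  ultimately show ?thesis
    using resolution_exists[OF noeth_free_A _ , of resid ?e 1] Q.quot_module unfolding residue_module_def by blast
qed

end

section \<open>Homomorphisms that vanish on the kernel of a differential\<close>

context param_overring
begin

abbreviation ideal_mod :: "'a set \<Rightarrow> ('a, 'a) module" where
  "ideal_mod J \<equiv> (self_module A)\<lparr>carrier := J\<rparr>"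

lemma ideal_mod_module:
  assumes "smod J" "J \<subseteq> carrier A" shows "module A (ideal_mod J)"
  using assms submodule.submodule_is_module[OF _ AA.Emod] submodule_A_iff by blast

lemma hom_ideal_iff:
  assumes J: "smod J" "J \<subseteq> carrier A"
  shows "f \<in> mod_hom A M (ideal_mod J) \<longleftrightarrow> f \<in> mod_hom A M (self_module E) \<and> (\<forall>x\<in>carrier M. f x \<in> J)"
proof -
  have ops: "r \<otimes>\<^bsub>A\<^esub> x = r \<otimes> x" "x \<oplus>\<^bsub>A\<^esub> y = x \<oplus> y" "x \<in> carrier E"
    if "r \<in> carrier A" "x \<in> J" "y \<in> J" for r x y
    using that J(2) A_ops(1)[of r x] A_ops(2)[of x y] by auto
  show ?thesis
  proof
    assume f: "f \<in> mod_hom A M (ideal_mod J)"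
    have fJ: "f x \<in> J" if "x \<in> carrier M" for x using mod_homD(1)[OF f that] by simp
    have "f \<in> mod_hom A M (self_module E)"
    proof (rule mod_homI)
      fix x assume x: "x \<in> carrier M"
      show "f x \<in> carrier (self_module E)" using ops(3)[OF A.one_closed fJ[OF x] fJ[OF x]] by simp
      show "f (r \<odot>\<^bsub>M\<^esub> x) = r \<odot>\<^bsub>self_module E\<^esub> f x" if r: "r \<in> carrier A" for r
        using mod_homD(3)[OF f r x] ops(1)[OF r fJ[OF x] fJ[OF x]] by simp
      fix y assume y: "y \<in> carrier M"
      show "f (x \<oplus>\<^bsub>M\<^esub> y) = f x \<oplus>\<^bsub>self_module E\<^esub> f y"
        using mod_homD(2)[OF f x y] ops(2)[OF A.one_closed fJ[OF x] fJ[OF y]] by simp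
    qed
    then show "f \<in> mod_hom A M (self_module E) \<and> (\<forall>x\<in>carrier M. f x \<in> J)" using fJ by blast
  next
    assume f: "f \<in> mod_hom A M (self_module E) \<and> (\<forall>x\<in>carrier M. f x \<in> J)"
    then have fJ: "f x \<in> J" if "x \<in> carrier M" for x using that by blast
    have fE: "f \<in> mod_hom A M (self_module E)" using f by blast
    show "f \<in> mod_hom A M (ideal_mod J)"
    proof (rule mod_homI)
      fix x assume x: "x \<in> carrier M"
      show "f x \<in> carrier (ideal_mod J)" using fJ[OF x] by simp
      show "f (r \<odot>\<^bsub>M\<^esub> x) = r \<odot>\<^bsub>ideal_mod J\<^esub> f x" if r: "r \<in> carrier A" for r
        using mod_homD(3)[OF fE r x] ops(1)[OF r fJ[OF x] fJ[OF x]] by simp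
      fix y assume y: "y \<in> carrier M"
      show "f (x \<oplus>\<^bsub>M\<^esub> y) = f x \<oplus>\<^bsub>ideal_mod J\<^esub> f y"
        using mod_homD(2)[OF fE x y] ops(2)[OF A.one_closed fJ[OF x] fJ[OF y]] by simp
    qed
  qed
qed

lemma hom_free_E:
  assumes d: "d \<in> mod_hom A (free_mod A m) (free_mod A n)"
  shows "w \<in> {..<m} \<rightarrow>\<^sub>E carrier A \<Longrightarrow> d w \<in> {..<n} \<rightarrow>\<^sub>E carrier A"
    "w \<in> {..<m} \<rightarrow>\<^sub>E carrier A \<Longrightarrow> v \<in> {..<m} \<rightarrow>\<^sub>E carrier A \<Longrightarrow>
      d (\<lambda>i\<in>{..<m}. w i \<oplus> v i) = (\<lambda>i\<in>{..<n}. d w i \<oplus> d v i)"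
    "r \<in> carrier A \<Longrightarrow> w \<in> {..<m} \<rightarrow>\<^sub>E carrier A \<Longrightarrow> d (\<lambda>i\<in>{..<m}. r \<otimes> w i) = (\<lambda>i\<in>{..<n}. r \<otimes> d w i)"
proof -
  show c: "d w \<in> {..<n} \<rightarrow>\<^sub>E carrier A" if "w \<in> {..<m} \<rightarrow>\<^sub>E carrier A" for w
    using mod_homD(1)[OF d, of w] that by simp
  show "d (\<lambda>i\<in>{..<m}. w i \<oplus> v i) = (\<lambda>i\<in>{..<n}. d w i \<oplus> d v i)"
    if w: "w \<in> {..<m} \<rightarrow>\<^sub>E carrier A" and v: "v \<in> {..<m} \<rightarrow>\<^sub>E carrier A"
    using mod_homD(2)[OF d, of w v] w v vec_ops_A(1)[OF w v A.one_closed] vec_ops_A(1)[OF c[OF w] c[OF v] A.one_closed]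
    unfolding free_mod_simps by simp
  show "d (\<lambda>i\<in>{..<m}. r \<otimes> w i) = (\<lambda>i\<in>{..<n}. r \<otimes> d w i)"
    if r: "r \<in> carrier A" and w: "w \<in> {..<m} \<rightarrow>\<^sub>E carrier A"
    using mod_homD(3)[OF d, of r w] w r vec_ops_A(2)[OF w w r] vec_ops_A(2)[OF c[OF w] c[OF w] r]
    unfolding free_mod_simps by simp
qed

lemma dot_zero: "z \<in> {..<n} \<rightarrow>\<^sub>E carrier E \<Longrightarrow> dot n (\<lambda>i\<in>{..<n}. \<zero>) z = \<zero>"
  using dot_smult1[OF E.zero_closed _ , of z n z] dot_closed[of z n z] vec_mem[of z n "carrier E"]
  by (simp cong: restrict_cong)

lemma A_vec_closed:
  "w \<in> {..<n} \<rightarrow>\<^sub>E carrier A \<Longrightarrow> v \<in> {..<n} \<rightarrow>\<^sub>E carrier A \<Longrightarrow> (\<lambda>i\<in>{..<n}. w i \<oplus> v i) \<in> {..<n} \<rightarrow>\<^sub>E carrier A"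
  "r \<in> carrier A \<Longrightarrow> w \<in> {..<n} \<rightarrow>\<^sub>E carrier A \<Longrightarrow> (\<lambda>i\<in>{..<n}. r \<otimes> w i) \<in> {..<n} \<rightarrow>\<^sub>E carrier A"
  unfolding restrict_PiE_iff using vec_mem[of w n "carrier A"] vec_mem[of v n "carrier A"] by (simp_all add: A_closed)

text \<open>
  Extension modulo \<open>a\<close> combined with Nakayama's lemma: the cokernel of restricting homomorphisms to
  the image of \<open>d\<close> equals \<open>a\<close> times itself.
\<close>

lemma ext_core:
  assumes J: "type1 J" "frac J" "J \<subseteq> carrier A"
    and d: "d \<in> mod_hom A (free_mod A m) (free_mod A n)"
    and d': "d' \<in> mod_hom A (free_mod A n) (free_mod A p)"
    and exact: "d ` carrier (free_mod A m) = {x \<in> carrier (free_mod A n). d' x = \<zero>\<^bsub>free_mod A p\<^esub>}"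
    and y: "y \<in> {..<m} \<rightarrow>\<^sub>E J"
    and ker: "\<And>w. w \<in> {..<m} \<rightarrow>\<^sub>E carrier A \<Longrightarrow> d w = (\<lambda>i\<in>{..<n}. \<zero>) \<Longrightarrow> dot m w y = \<zero>"
  shows "\<exists>z\<in>{..<n} \<rightarrow>\<^sub>E J. \<forall>w\<in>{..<m} \<rightarrow>\<^sub>E carrier A. dot m w y = dot n (d w) z"
proof -
  let ?W = "{..<m} \<rightarrow>\<^sub>E carrier A" and ?V = "{..<n} \<rightarrow>\<^sub>E carrier A"
  have Js: "smod J" using J by (simp add: type1_def)
  note JD = smodD[OF Js]
  note dE = hom_free_E[OF d] and d'E = hom_free_E[OF d']
  interpret Fm: module A "free_mod E m" by (rule free_module)
  interpret Fn: module A "free_mod E n" by (rule free_module)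
  have vecJ: "x \<in> {..<l} \<rightarrow>\<^sub>E J \<Longrightarrow> x \<in> {..<l} \<rightarrow>\<^sub>E carrier A" for x l
    using PiE_mono[of "{..<l}" "\<lambda>_. J" "\<lambda>_. carrier A"] J(3) by auto
  have vecJE: "x \<in> {..<l} \<rightarrow>\<^sub>E J \<Longrightarrow> x \<in> {..<l} \<rightarrow>\<^sub>E carrier E" for x l
    using vecJ vec_A_E by blast
  have Jadd: "(\<lambda>i\<in>{..<l}. x i \<oplus> y i) \<in> {..<l} \<rightarrow>\<^sub>E J" if "x \<in> {..<l} \<rightarrow>\<^sub>E J" "y \<in> {..<l} \<rightarrow>\<^sub>E J" for x y l
    unfolding restrict_PiE_iff using JD(3) that[THEN vec_mem] by simp
  have Jsm: "(\<lambda>i\<in>{..<l}. r \<otimes> x i) \<in> {..<l} \<rightarrow>\<^sub>E J" if "r \<in> carrier A" "x \<in> {..<l} \<rightarrow>\<^sub>E J" for x r l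
    unfolding restrict_PiE_iff using JD(4)[OF that(1)] that(2)[THEN vec_mem] by simp
  have J0: "(\<lambda>i\<in>{..<l}. \<zero>) \<in> {..<l} \<rightarrow>\<^sub>E J" for l unfolding restrict_PiE_iff using JD(2) by simp
  \<comment> \<open>Vectors in J^m stand for homomorphisms from A^m to J. Those in \<open>Z\<close>
    vanish on the kernel of d, those in \<open>B\<close> factor through d, and the claim is that the
    two sets agree.\<close>
  define Z where "Z = {y \<in> {..<m} \<rightarrow>\<^sub>E J. \<forall>w\<in>?W. d w = (\<lambda>i\<in>{..<n}. \<zero>) \<longrightarrow> dot m w y = \<zero>}"
  define B where "B = {y \<in> {..<m} \<rightarrow>\<^sub>E J. \<exists>z\<in>{..<n} \<rightarrow>\<^sub>E J. \<forall>w\<in>?W. dot m w y = dot n (d w) z}"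
  have ZA: "Z \<subseteq> ?W" unfolding Z_def using vecJ by blast
  have Zs: "submodule Z A (free_mod E m)" unfolding Fm.submodule_iff
  proof (intro conjI ballI)
    show "Z \<subseteq> carrier (free_mod E m)" unfolding Z_def free_mod_simps using vecJE by blast
    show "\<zero>\<^bsub>free_mod E m\<^esub> \<in> Z" unfolding Z_def free_mod_simps
    proof (intro CollectI conjI ballI impI J0)
      fix w assume w: "w \<in> ?W"
      show "dot m w (\<lambda>i\<in>{..<m}. \<zero>) = \<zero>"
        using dot_zero[OF vec_A_E[OF w]] dot_comm[OF vec_A_E[OF w] vecJE[OF J0]] by simp
    qed
    fix u assume u: "u \<in> Z"
    then have uJ: "u \<in> {..<m} \<rightarrow>\<^sub>E J" and uk: "\<And>w. w \<in> ?W \<Longrightarrow> d w = (\<lambda>i\<in>{..<n}. \<zero>) \<Longrightarrow> dot m w u = \<zero>"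
      unfolding Z_def by blast+
    show "r \<odot>\<^bsub>free_mod E m\<^esub> u \<in> Z" if r: "r \<in> carrier A" for r
      unfolding Z_def free_mod_simps
    proof (intro CollectI conjI ballI impI Jsm r uJ)
      fix w assume w: "w \<in> ?W" "d w = (\<lambda>i\<in>{..<n}. \<zero>)"
      show "dot m w (\<lambda>i\<in>{..<m}. r \<otimes> u i) = \<zero>"
        unfolding dot_smult2[OF A_sub[OF r] vec_A_E[OF w(1)] vecJE[OF uJ]] uk[OF w] using r by simp
    qed
    fix v assume v: "v \<in> Z"
    then have vJ: "v \<in> {..<m} \<rightarrow>\<^sub>E J" and vk: "\<And>w. w \<in> ?W \<Longrightarrow> d w = (\<lambda>i\<in>{..<n}. \<zero>) \<Longrightarrow> dot m w v = \<zero>"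
      unfolding Z_def by blast+
    show "u \<oplus>\<^bsub>free_mod E m\<^esub> v \<in> Z"
      unfolding Z_def free_mod_simps
    proof (intro CollectI conjI ballI impI Jadd uJ vJ)
      fix w assume w: "w \<in> ?W" "d w = (\<lambda>i\<in>{..<n}. \<zero>)"
      show "dot m w (\<lambda>i\<in>{..<m}. u i \<oplus> v i) = \<zero>"
        unfolding dot_add2[OF vec_A_E[OF w(1)] vecJE[OF uJ] vecJE[OF vJ]] uk[OF w] vk[OF w] by simp
    qed
  qed
  have Bs: "submodule B A (free_mod E m)" unfolding Fm.submodule_iff
  proof (intro conjI ballI)
    show "B \<subseteq> carrier (free_mod E m)" unfolding B_def free_mod_simps using vecJE by blast
    show "\<zero>\<^bsub>free_mod E m\<^esub> \<in> B" unfolding B_def free_mod_simps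
    proof (intro CollectI conjI bexI ballI J0)
      fix w assume w: "w \<in> ?W"
      show "dot m w (\<lambda>i\<in>{..<m}. \<zero>) = dot n (d w) (\<lambda>i\<in>{..<n}. \<zero>)"
        using dot_zero[OF vec_A_E[OF w]] dot_comm[OF vec_A_E[OF w] vecJE[OF J0]]
          dot_zero[OF vec_A_E[OF dE(1)[OF w]]] dot_comm[OF vec_A_E[OF dE(1)[OF w]] vecJE[OF J0]] by simp
    qed (rule J0)
    fix u assume u: "u \<in> B"
    then obtain z where uJ: "u \<in> {..<m} \<rightarrow>\<^sub>E J" and z: "z \<in> {..<n} \<rightarrow>\<^sub>E J" "\<And>w. w \<in> ?W \<Longrightarrow> dot m w u = dot n (d w) z"
      unfolding B_def by blast
    show "r \<odot>\<^bsub>free_mod E m\<^esub> u \<in> B" if r: "r \<in> carrier A" for r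
      unfolding B_def free_mod_simps
    proof (intro CollectI conjI bexI[of _ "\<lambda>i\<in>{..<n}. r \<otimes> z i"] ballI Jsm r uJ z(1))
      fix w assume w: "w \<in> ?W"
      show "dot m w (\<lambda>i\<in>{..<m}. r \<otimes> u i) = dot n (d w) (\<lambda>i\<in>{..<n}. r \<otimes> z i)"
        unfolding dot_smult2[OF A_sub[OF r] vec_A_E[OF w] vecJE[OF uJ]] 
          dot_smult2[OF A_sub[OF r] vec_A_E[OF dE(1)[OF w]] vecJE[OF z(1)]] z(2)[OF w] ..
    qed
    fix v assume v: "v \<in> B"
    then obtain z' where vJ: "v \<in> {..<m} \<rightarrow>\<^sub>E J" and z': "z' \<in> {..<n} \<rightarrow>\<^sub>E J" "\<And>w. w \<in> ?W \<Longrightarrow> dot m w v = dot n (d w) z'"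
      unfolding B_def by blast
    show "u \<oplus>\<^bsub>free_mod E m\<^esub> v \<in> B"
      unfolding B_def free_mod_simps
    proof (intro CollectI conjI bexI[of _ "\<lambda>i\<in>{..<n}. z i \<oplus> z' i"] ballI Jadd uJ vJ z(1) z'(1))
      fix w assume w: "w \<in> ?W"
      show "dot m w (\<lambda>i\<in>{..<m}. u i \<oplus> v i) = dot n (d w) (\<lambda>i\<in>{..<n}. z i \<oplus> z' i)"
        unfolding dot_add2[OF vec_A_E[OF w] vecJE[OF uJ] vecJE[OF vJ]]
          dot_add2[OF vec_A_E[OF dE(1)[OF w]] vecJE[OF z(1)] vecJE[OF z'(1)]] z(2)[OF w] z'(2)[OF w] ..
    qed
  qed
  have BZ: "B \<subseteq> Z"
  proof
    fix u assume u: "u \<in> B"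
    then obtain z where uJ: "u \<in> {..<m} \<rightarrow>\<^sub>E J" and z: "z \<in> {..<n} \<rightarrow>\<^sub>E J" "\<And>w. w \<in> ?W \<Longrightarrow> dot m w u = dot n (d w) z"
      unfolding B_def by blast
    have "dot m w u = \<zero>" if w: "w \<in> ?W" "d w = (\<lambda>i\<in>{..<n}. \<zero>)" for w
      unfolding z(2)[OF w(1)] w(2) by (rule dot_zero[OF vecJE[OF z(1)]])
    then show "u \<in> Z" unfolding Z_def using uJ by blast
  qed
  \<comment> \<open>The image of d is the kernel of d', and a can be cancelled in E; so if av lies
    in the image of d, then v does.\<close>
  have saturated: "\<exists>w\<in>?W. d w = v" if v: "v \<in> ?V" and w: "w \<in> ?W" "d w = (\<lambda>i\<in>{..<n}. a \<otimes> v i)" for v w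
  proof -
    have "d' (d w) = (\<lambda>i\<in>{..<p}. \<zero>)" using exact w(1) by (auto simp: A_zero)
    then have "(\<lambda>i\<in>{..<p}. a \<otimes> d' v i) = (\<lambda>i\<in>{..<p}. \<zero>)" unfolding w(2) d'E(3)[OF a_A(1) v] .
    then have "a \<otimes> d' v i = \<zero>" if "i < p" for i using that by (metis lessThan_iff restrict_apply')
    then have "d' v i = \<zero>" if "i < p" for i
      using that unit_cancel(1)[OF a_unit, of "d' v i"] vec_mem[OF d'E(1)[OF v] that] a_unit by simp
    then have "d' v = (\<lambda>i\<in>{..<p}. \<zero>)" using vec_eqI[OF d'E(1)[OF v], of "\<lambda>i\<in>{..<p}. \<zero>" "carrier E"] by simp
    then have "v \<in> d ` carrier (free_mod A m)" unfolding exact using v by (simp add: A_zero)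
    then show ?thesis by auto
  qed
  have "B = Z"
  proof (rule ccontr)
    assume ne: "B \<noteq> Z"
    obtain H where H: "submodule H A (free_mod E m)" "B \<subseteq> H" "H \<subseteq> Z" "H \<noteq> Z"
      "\<And>r d. r \<in> \<mm> \<Longrightarrow> d \<in> Z \<Longrightarrow> r \<odot>\<^bsub>free_mod E m\<^esub> d \<in> H"
      by (rule nakayama[OF free_module noeth_subset[OF noeth_vec ZA] Zs Bs BZ ne]) (rule that)
    note HS = H(1)[unfolded Fm.submodule_iff]
    have "u \<in> H" if u: "u \<in> Z" for u
    proof -
      have uJ: "u \<in> {..<m} \<rightarrow>\<^sub>E J" and uk: "\<And>w. w \<in> ?W \<Longrightarrow> d w = (\<lambda>i\<in>{..<n}. \<zero>) \<Longrightarrow> dot m w u = \<zero>"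
        using u unfolding Z_def by blast+
      note uE = vecJE[OF uJ]
      let ?aJ = "scal a J"
      have aJ1: "type1 ?aJ" by (rule type1_scal[OF J(1) a_unit])
      have aJf: "frac ?aJ"
      proof -
        obtain k :: nat where k: "a [^] k \<in> J" "\<And>x. x \<in> J \<Longrightarrow> a [^] k \<otimes> x \<in> carrier A"
          using J(2) by (auto simp: frac_def)
        have "a [^] (k + 1) \<in> ?aJ" unfolding scal_def using k(1) by (auto simp: E.m_comm)
        moreover have "a [^] (k + 1) \<otimes> x \<in> carrier A" if "x \<in> ?aJ" for x
          using that J(3) A_closed(1) by (auto simp: scal_def simp del: E.nat_pow_Suc)
        moreover have "smod ?aJ" by (rule smod_scal[OF Js a_A(2)])
        ultimately show ?thesis unfolding frac_def by blast
      qed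
      note aD = smodD[OF smod_scal[OF Js a_A(2)]]
      \<comment> \<open>The assignment of w . u to d w + av, on the submodule im d + aA^n. It is
        single-valued modulo aJ, which is why the extension argument is run with aJ in place of
        J.\<close>
      define \<Gamma> where "\<Gamma> = {((\<lambda>i\<in>{..<n}. d w i \<oplus> a \<otimes> v i), dot m w u) | w v. w \<in> ?W \<and> v \<in> ?V}"
      define D where "D = {x. \<exists>c. (x, c) \<in> \<Gamma>}"
      have DI: "x \<in> D" if "(x, c) \<in> \<Gamma>" for x c unfolding D_def using that by blast
      have DE: "\<exists>c. (x, c) \<in> \<Gamma>" if "x \<in> D" for x using that unfolding D_def by blast
      have \<Gamma>I: "((\<lambda>i\<in>{..<n}. d w i \<oplus> a \<otimes> v i), dot m w u) \<in> \<Gamma>" if "w \<in> ?W" "v \<in> ?V" for w v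
        unfolding \<Gamma>_def using that by blast
      have \<Gamma>E: "\<exists>w v. w \<in> ?W \<and> v \<in> ?V \<and> x = (\<lambda>i\<in>{..<n}. d w i \<oplus> a \<otimes> v i) \<and> c = dot m w u"
        if "(x, c) \<in> \<Gamma>" for x c
        using that unfolding \<Gamma>_def by blast
      have W0: "(\<lambda>i\<in>{..<l}. \<zero>) \<in> {..<l} \<rightarrow>\<^sub>E carrier A" for l using vecJ[OF J0] .
      have d0: "d (\<lambda>i\<in>{..<m}. \<zero>) = (\<lambda>i\<in>{..<n}. \<zero>)"
        using mod_hom_zero[OF AA.free_module AA.free_module d] by (simp only: free_mod_simps A_zero)
      have \<Gamma>add: "((\<lambda>i\<in>{..<n}. x i \<oplus> x' i), c \<oplus> c') \<in> \<Gamma>" if xc: "(x, c) \<in> \<Gamma>" "(x', c') \<in> \<Gamma>" for x c x' c'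
      proof -
        obtain w v where wv: "w \<in> ?W" "v \<in> ?V" "x = (\<lambda>i\<in>{..<n}. d w i \<oplus> a \<otimes> v i)" "c = dot m w u" using \<Gamma>E[OF xc(1)] by blast
        obtain w' v' where wv': "w' \<in> ?W" "v' \<in> ?V" "x' = (\<lambda>i\<in>{..<n}. d w' i \<oplus> a \<otimes> v' i)" "c' = dot m w' u" using \<Gamma>E[OF xc(2)] by blast
        note ii = vec_mem[OF dE(1)[OF wv(1)]] vec_mem[OF wv(2)] vec_mem[OF dE(1)[OF wv'(1)]] vec_mem[OF wv'(2)]
        have e1: "(\<lambda>i\<in>{..<n}. d (\<lambda>i\<in>{..<m}. w i \<oplus> w' i) i \<oplus> a \<otimes> (\<lambda>i\<in>{..<n}. v i \<oplus> v' i) i) = (\<lambda>i\<in>{..<n}. x i \<oplus> x' i)"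
          unfolding dE(2)[OF wv(1) wv'(1)] wv(3) wv'(3)
        proof (rule restrict_ext)
          fix i assume "i \<in> {..<n}"
          then have i: "i < n" by simp
          note c4 = ii[OF i, THEN A_sub]
          have "(d w i \<oplus> d w' i) \<oplus> a \<otimes> (v i \<oplus> v' i) = (d w i \<oplus> a \<otimes> v i) \<oplus> (d w' i \<oplus> a \<otimes> v' i)"
            using c4 a_A(2) by algebra
          then show "(\<lambda>i\<in>{..<n}. d w i \<oplus> d w' i) i \<oplus> a \<otimes> (\<lambda>i\<in>{..<n}. v i \<oplus> v' i) i =
              (\<lambda>i\<in>{..<n}. d w i \<oplus> a \<otimes> v i) i \<oplus> (\<lambda>i\<in>{..<n}. d w' i \<oplus> a \<otimes> v' i) i" using i by simp
        qed
        have e2: "dot m (\<lambda>i\<in>{..<m}. w i \<oplus> w' i) u = c \<oplus> c'"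
          unfolding wv(4) wv'(4) by (rule dot_add1[OF vec_A_E[OF wv(1)] vec_A_E[OF wv'(1)] uE])
        show ?thesis using \<Gamma>I[OF A_vec_closed(1)[OF wv(1) wv'(1)] A_vec_closed(1)[OF wv(2) wv'(2)]] unfolding e1 e2 .
      qed
      have \<Gamma>smult: "((\<lambda>i\<in>{..<n}. s \<otimes> x i), s \<otimes> c) \<in> \<Gamma>" if s: "s \<in> carrier A" and xc: "(x, c) \<in> \<Gamma>" for x c s
      proof -
        obtain w v where wv: "w \<in> ?W" "v \<in> ?V" "x = (\<lambda>i\<in>{..<n}. d w i \<oplus> a \<otimes> v i)" "c = dot m w u" using \<Gamma>E[OF xc] by blast
        note ii = vec_mem[OF dE(1)[OF wv(1)]] vec_mem[OF wv(2)]
        have e1: "(\<lambda>i\<in>{..<n}. d (\<lambda>i\<in>{..<m}. s \<otimes> w i) i \<oplus> a \<otimes> (\<lambda>i\<in>{..<n}. s \<otimes> v i) i) = (\<lambda>i\<in>{..<n}. s \<otimes> x i)"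
          unfolding dE(3)[OF s wv(1)] wv(3)
        proof (rule restrict_ext)
          fix i assume "i \<in> {..<n}"
          then have i: "i < n" by simp
          note c4 = ii[OF i, THEN A_sub]
          have "s \<otimes> d w i \<oplus> a \<otimes> (s \<otimes> v i) = s \<otimes> (d w i \<oplus> a \<otimes> v i)"
            using c4 a_A(2) A_sub[OF s] by algebra
          then show "(\<lambda>i\<in>{..<n}. s \<otimes> d w i) i \<oplus> a \<otimes> (\<lambda>i\<in>{..<n}. s \<otimes> v i) i =
              s \<otimes> (\<lambda>i\<in>{..<n}. d w i \<oplus> a \<otimes> v i) i" using i by simp
        qed
        have e2: "dot m (\<lambda>i\<in>{..<m}. s \<otimes> w i) u = s \<otimes> c"
          unfolding wv(4) by (rule dot_smult1[OF A_sub[OF s] vec_A_E[OF wv(1)] uE])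
        show ?thesis using \<Gamma>I[OF A_vec_closed(2)[OF s wv(1)] A_vec_closed(2)[OF s wv(2)]] unfolding e1 e2 .
      qed
      have \<Gamma>V: "x \<in> ?V \<and> c \<in> carrier E" if xc: "(x, c) \<in> \<Gamma>" for x c
      proof -
        obtain w v where wv: "w \<in> ?W" "v \<in> ?V" "x = (\<lambda>i\<in>{..<n}. d w i \<oplus> a \<otimes> v i)" "c = dot m w u" using \<Gamma>E[OF xc] by blast
        note ii = vec_mem[OF dE(1)[OF wv(1)]] vec_mem[OF wv(2)]
        show ?thesis unfolding wv(3,4) restrict_PiE_iff using dot_closed[OF vec_A_E[OF wv(1)] uE] ii
          by (simp add: A_closed)
      qed
      have a\<Gamma>: "((\<lambda>i\<in>{..<n}. a \<otimes> v i), \<zero>) \<in> \<Gamma>" if v: "v \<in> ?V" for v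
      proof -
        have "(\<lambda>i\<in>{..<n}. d (\<lambda>i\<in>{..<m}. \<zero>) i \<oplus> a \<otimes> v i) = (\<lambda>i\<in>{..<n}. a \<otimes> v i)"
          unfolding d0 by (rule restrict_ext) (simp add: vec_mem[OF v])
        then show ?thesis using \<Gamma>I[OF W0 v] dot_zero[OF uE] by simp
      qed
      have Ds: "submodule D A (free_mod E n)" unfolding Fn.submodule_iff
      proof (intro conjI ballI)
        show "D \<subseteq> carrier (free_mod E n)" 
        proof
          fix x assume "x \<in> D"
          then obtain c where "(x, c) \<in> \<Gamma>" using DE by blast
          then show "x \<in> carrier (free_mod E n)" using vec_A_E[of x n] \<Gamma>V[of x c] by simp
        qed
        have "(\<lambda>i\<in>{..<n}. a \<otimes> (\<lambda>i\<in>{..<n}. \<zero>) i) = \<zero>\<^bsub>free_mod E n\<^esub>"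
          unfolding free_mod_simps by (rule restrict_ext) simp
        then show "\<zero>\<^bsub>free_mod E n\<^esub> \<in> D" using DI[OF a\<Gamma>[OF W0]] by (simp only:)
        fix x assume "x \<in> D"
        then obtain c where xc: "(x, c) \<in> \<Gamma>" using DE by blast
        show "s \<odot>\<^bsub>free_mod E n\<^esub> x \<in> D" if "s \<in> carrier A" for s
          unfolding free_mod_simps by (rule DI[OF \<Gamma>smult[OF that xc]])
        fix x' assume "x' \<in> D"
        then obtain c' where xc': "(x', c') \<in> \<Gamma>" using DE by blast
        show "x \<oplus>\<^bsub>free_mod E n\<^esub> x' \<in> D"
          unfolding free_mod_simps by (rule DI[OF \<Gamma>add[OF xc xc']])
      qed
      \<comment> \<open>If av = d w + av', then d w = a(v - v'), and saturation gives d w = a d w'.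
        So w - aw' is in the kernel of d, on which u vanishes, and w . u = a(w' . u) lies in
        aJ.\<close>
      have \<Gamma>0: "c \<in> ?aJ" if v: "v \<in> ?V" and c: "((\<lambda>i\<in>{..<n}. a \<otimes> v i), c) \<in> \<Gamma>" for v c
      proof -
        obtain w v' where wv: "w \<in> ?W" "v' \<in> ?V" "(\<lambda>i\<in>{..<n}. a \<otimes> v i) = (\<lambda>i\<in>{..<n}. d w i \<oplus> a \<otimes> v' i)" "c = dot m w u"
          using \<Gamma>E[OF c] by blast
        let ?v = "\<lambda>i\<in>{..<n}. v i \<oplus> (\<ominus> \<one>) \<otimes> v' i"
        have vv: "?v \<in> ?V" unfolding restrict_PiE_iff using vec_mem[OF v] vec_mem[OF wv(2)] by (simp add: A_closed)
        have "d w = (\<lambda>i\<in>{..<n}. a \<otimes> ?v i)"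
        proof (rule vec_eqI[OF dE(1)[OF wv(1)]])
          show "(\<lambda>i\<in>{..<n}. a \<otimes> ?v i) \<in> {..<n} \<rightarrow>\<^sub>E carrier A" by (rule A_vec_closed(2)[OF a_A(1) vv])
          fix i assume i: "i < n"
          have c3: "v i \<in> carrier E" "v' i \<in> carrier E" "d w i \<in> carrier E"
            using vec_mem[OF v i] vec_mem[OF wv(2) i] vec_mem[OF dE(1)[OF wv(1)] i] by auto
          have eq: "a \<otimes> v i = d w i \<oplus> a \<otimes> v' i" using fun_cong[OF wv(3), of i] i by simp
          have "a \<otimes> (v i \<oplus> (\<ominus> \<one>) \<otimes> v' i) = a \<otimes> v i \<ominus> a \<otimes> v' i" using c3 a_A(2) by algebra
          also have "\<dots> = d w i" unfolding eq using c3 by (simp add: a_minus_def E.a_assoc E.r_neg)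
          finally show "d w i = (\<lambda>i\<in>{..<n}. a \<otimes> ?v i) i" using i by simp
        qed
        then obtain w' where w': "w' \<in> ?W" "d w' = ?v" using saturated[OF vv wv(1)] by blast
        let ?w = "\<lambda>i\<in>{..<m}. w i \<oplus> (\<lambda>i\<in>{..<m}. (\<ominus> a) \<otimes> w' i) i"
        have na: "\<ominus> a \<in> carrier A" by auto
        note w'c = A_vec_closed(2)[OF na w'(1)]
        have "d ?w = (\<lambda>i\<in>{..<n}. d w i \<oplus> (\<lambda>i\<in>{..<n}. (\<ominus> a) \<otimes> d w' i) i)"
          unfolding dE(2)[OF wv(1) w'c] dE(3)[OF na w'(1)] ..
        also have "\<dots> = (\<lambda>i\<in>{..<n}. \<zero>)"
        proof (rule restrict_ext)
          fix i assume "i \<in> {..<n}"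
          then have i: "i < n" by simp
          have "d w' i \<in> carrier E" using vec_mem[OF dE(1)[OF w'(1)] i] by auto
          then show "d w i \<oplus> (\<lambda>i\<in>{..<n}. (\<ominus> a) \<otimes> d w' i) i = \<zero>"
            unfolding \<open>d w = (\<lambda>i\<in>{..<n}. a \<otimes> ?v i)\<close> w'(2)[symmetric] using i by (simp add: E.l_minus E.r_neg)
        qed
        finally have "dot m ?w u = \<zero>" by (rule uk[OF A_vec_closed(1)[OF wv(1) w'c]])
        then have "dot m w u \<oplus> (\<ominus> a) \<otimes> dot m w' u = \<zero>"
          using dot_add1[OF vec_A_E[OF wv(1)] vec_A_E[OF w'c] uE] dot_smult1[OF A_sub[OF na] vec_A_E[OF w'(1)] uE] by simp
        then have "dot m w u = a \<otimes> dot m w' u"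
          using dot_closed[OF vec_A_E[OF wv(1)] uE] dot_closed[OF vec_A_E[OF w'(1)] uE]
          E.r_right_minus_eq[of "dot m w u" "a \<otimes> dot m w' u"] by (simp add: a_minus_def E.l_minus)
        then show "c \<in> ?aJ" unfolding wv(4) scal_def using dot_smod[OF Js w'(1) uJ] by blast
      qed
      have "\<exists>z\<in>{..<n} \<rightarrow>\<^sub>E carrier E. \<forall>(x, c)\<in>\<Gamma>. c \<ominus> dot n x z \<in> ?aJ"
      proof (rule vec_extension[OF aJ1 aJf Ds])
        show "D \<subseteq> ?V" using DE \<Gamma>V by blast
        show "(\<lambda>i\<in>{..<n}. a \<otimes> v i) \<in> D" if "v \<in> ?V" for v
          by (rule DI[OF a\<Gamma>[OF that]])
        show "x \<in> D \<and> c \<in> carrier E" if "(x, c) \<in> \<Gamma>" for x c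
          using \<Gamma>V[OF that] DI[OF that] by simp
        show "\<exists>c. (x, c) \<in> \<Gamma>" if "x \<in> D" for x by (rule DE[OF that])
      qed (rule \<Gamma>add \<Gamma>smult \<Gamma>0; assumption)+
      then obtain z where z0: "z \<in> {..<n} \<rightarrow>\<^sub>E carrier E" "\<forall>(x, c)\<in>\<Gamma>. c \<ominus> dot n x z \<in> ?aJ" by (elim bexE)
      have z: "z \<in> {..<n} \<rightarrow>\<^sub>E carrier E" "(x, c) \<in> \<Gamma> \<Longrightarrow> c \<ominus> dot n x z \<in> ?aJ" for x c
        using z0(1) bspec[OF z0(2), of "(x, c)"] by simp_all
      \<comment> \<open>The relation \<Gamma> assigns 0 to a e_i, so a z_i lies in aJ; cancelling a
        places z_i in J and not merely in E.\<close>
      have zJ: "z \<in> {..<n} \<rightarrow>\<^sub>E J"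
      proof -
        have "z i \<in> J" if i: "i < n" for i
        proof -
          note ue = unit_vec_closed[of n i]
          have zi: "z i \<in> carrier E" using vec_mem[OF z(1) i] .
          have "dot n (\<lambda>j\<in>{..<n}. a \<otimes> unit_vec E n i j) z = a \<otimes> z i"
            unfolding dot_smult1[OF a_A(2) vec_A_E[OF ue] z(1)] dot_comm[OF vec_A_E[OF ue] z(1)] dot_unit[OF z(1) i] ..
          then have "\<zero> \<ominus> a \<otimes> z i \<in> ?aJ" using z(2)[OF a\<Gamma>[OF ue]] by simp
          then have "\<ominus> (\<zero> \<ominus> a \<otimes> z i) \<in> ?aJ" by (rule aD(5))
          then have "a \<otimes> z i \<in> ?aJ" using zi by (simp add: a_minus_def)
          then obtain j where j: "a \<otimes> z i = a \<otimes> j" "j \<in> J" by (auto simp: scal_def)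
          have "z i = inv a \<otimes> (a \<otimes> z i)" by (rule unit_cancel(1)[OF a_unit zi, symmetric])
          also have "\<dots> = j" unfolding j(1) by (rule unit_cancel(1)[OF a_unit JD(1)[OF j(2)]])
          finally show ?thesis using j(2) by (simp only:)
        qed
        then show ?thesis using z(1) by (auto simp: PiE_iff)
      qed
      \<comment> \<open>The vector of the homomorphism w to d w . z, which factors through d.
        Testing on unit vectors shows that u and \<open>?b\<close> agree modulo aJ.\<close>
      let ?b = "\<lambda>i\<in>{..<m}. dot n (d (unit_vec E m i)) z"
      have bJ: "?b \<in> {..<m} \<rightarrow>\<^sub>E J"
        unfolding restrict_PiE_iff using dot_smod[OF Js dE(1)[OF unit_vec_closed] zJ] by simp
      have dz: "(\<lambda>w. dot n (d w) z) \<in> mod_hom A (free_mod A m) (self_module E)"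
      proof (rule mod_homI)
        note dh = mod_homD[OF dot_hom[OF z(1)]] and dd = mod_homD[OF d]
        fix w assume w: "w \<in> carrier (free_mod A m)"
        show "dot n (d w) z \<in> carrier (self_module E)" by (rule dh(1)[OF dd(1)[OF w]])
        show "dot n (d (s \<odot>\<^bsub>free_mod A m\<^esub> w)) z = s \<odot>\<^bsub>self_module E\<^esub> dot n (d w) z" if "s \<in> carrier A" for s
          unfolding dd(3)[OF that w] by (rule dh(3)[OF that dd(1)[OF w]])
        fix v assume v: "v \<in> carrier (free_mod A m)"
        show "dot n (d (w \<oplus>\<^bsub>free_mod A m\<^esub> v)) z = dot n (d w) z \<oplus>\<^bsub>self_module E\<^esub> dot n (d v) z"
          unfolding dd(2)[OF w v] by (rule dh(2)[OF dd(1)[OF w] dd(1)[OF v]])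
      qed
      have bdot: "dot m w ?b = dot n (d w) z" if "w \<in> ?W" for w
        using hom_eq_dot[OF dz that] by (simp add: unit_vec_A)
      have bB: "?b \<in> B" unfolding B_def using bJ zJ bdot by blast
      have ub: "\<exists>j\<in>J. u i \<ominus> ?b i = a \<otimes> j" if i: "i < m" for i
      proof -
        note ue = unit_vec_closed[of m i]
        have e0: "(\<lambda>j\<in>{..<n}. d (unit_vec E m i) j \<oplus> a \<otimes> (\<lambda>i\<in>{..<n}. \<zero>) j) = d (unit_vec E m i)"
        proof (rule vec_eqI[OF _ dE(1)[OF ue]])
          show "(\<lambda>j\<in>{..<n}. d (unit_vec E m i) j \<oplus> a \<otimes> (\<lambda>i\<in>{..<n}. \<zero>) j) \<in> ?V"
            unfolding restrict_PiE_iff using vec_mem[OF dE(1)[OF ue]] by (simp add: A_closed)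
        qed (use vec_mem[OF dE(1)[OF ue]] in simp)
        have "(d (unit_vec E m i), dot m (unit_vec E m i) u) \<in> \<Gamma>" using \<Gamma>I[OF ue W0] unfolding e0 .
        then have "dot m (unit_vec E m i) u \<ominus> dot n (d (unit_vec E m i)) z \<in> ?aJ" by (rule z(2))
        moreover have "dot m (unit_vec E m i) u = u i" using dot_comm[OF vec_A_E[OF ue] uE] dot_unit[OF uE i] by simp
        ultimately show ?thesis using i by (auto simp: scal_def)
      qed
      then obtain j where j: "\<And>i. i < m \<Longrightarrow> j i \<in> J \<and> u i \<ominus> ?b i = a \<otimes> j i" by metis
      let ?j = "\<lambda>i\<in>{..<m}. j i"
      have jJ: "?j \<in> {..<m} \<rightarrow>\<^sub>E J" unfolding restrict_PiE_iff using j by simp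
      have ueq: "u = (\<lambda>i\<in>{..<m}. ?b i \<oplus> (\<lambda>i\<in>{..<m}. a \<otimes> ?j i) i)"
      proof (rule vec_eqI[OF uJ])
        show "(\<lambda>i\<in>{..<m}. ?b i \<oplus> (\<lambda>i\<in>{..<m}. a \<otimes> ?j i) i) \<in> {..<m} \<rightarrow>\<^sub>E J"
          by (rule Jadd[OF bJ Jsm[OF a_A(1) jJ]])
        fix i assume i: "i < m"
        have c: "u i \<in> carrier E" "?b i \<in> carrier E" using vec_mem[OF uE i] vec_mem[OF vecJE[OF bJ] i] by simp_all
        have "x = y \<oplus> (x \<ominus> y)" if "x \<in> carrier E" "y \<in> carrier E" for x y using that by algebra
        then have "u i = ?b i \<oplus> (u i \<ominus> ?b i)" using c by blast
        then show "u i = (\<lambda>i\<in>{..<m}. ?b i \<oplus> (\<lambda>i\<in>{..<m}. a \<otimes> ?j i) i) i" using j[OF i] i by simp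
      qed
      \<comment> \<open>The vector (u - \<open>?b\<close>)/a also vanishes on the kernel of d, since
        a can be cancelled. Hence u lies in B + aZ, and therefore in H.\<close>
      have "?j \<in> Z" unfolding Z_def
      proof (intro CollectI conjI ballI impI jJ)
        fix w assume w: "w \<in> ?W" "d w = (\<lambda>i\<in>{..<n}. \<zero>)"
        have "dot m w u = dot m w ?b \<oplus> a \<otimes> dot m w ?j"
          by (subst ueq, subst dot_add2[OF vec_A_E[OF w(1)] vecJE[OF bJ] vecJE[OF Jsm[OF a_A(1) jJ]]],
            subst dot_smult2[OF a_A(2) vec_A_E[OF w(1)] vecJE[OF jJ]]) (rule refl)
        moreover have "dot m w ?b = \<zero>" unfolding bdot[OF w(1)] w(2) by (rule dot_zero[OF z(1)])
        ultimately have "a \<otimes> dot m w ?j = \<zero>" using uk[OF w] dot_closed[OF vec_A_E[OF w(1)] vecJE[OF jJ]] by simp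
        then show "dot m w ?j = \<zero>"
          using unit_cancel(1)[OF a_unit dot_closed[OF vec_A_E[OF w(1)] vecJE[OF jJ]]] a_unit by simp
      qed
      then have "a \<odot>\<^bsub>free_mod E m\<^esub> ?j \<in> H" by (rule H(5)[OF a_m])
      then have "?b \<oplus>\<^bsub>free_mod E m\<^esub> (a \<odot>\<^bsub>free_mod E m\<^esub> ?j) \<in> H" using HS H(2) bB by blast
      then show "u \<in> H" by (subst ueq) (simp only: free_mod_simps)
    qed
    then show False using H by blast
  qed
  moreover have "y \<in> Z" unfolding Z_def using y ker by blast
  ultimately show ?thesis unfolding B_def by blast
qed

end

section \<open>Injective dimension and type\<close>

context param_overring
begin

text \<open>In degree at least 2 a cocycle is a vector that vanishes on the kernel of a differential
  whose image is itself a kernel, which is the situation of \<open>ext_core\<close>. The bound is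
  therefore 1.\<close>

lemma type1_finite_injective_dimension:
  assumes J: "type1 J" "frac J" "J \<subseteq> carrier A"
  shows "finite_injective_dimension A (ideal_mod J)"
  unfolding finite_injective_dimension_def
proof (intro exI[of _ 1] allI impI)
  fix i :: nat and N :: "('a, (nat \<Rightarrow> 'a) set) module" and r d e
  assume i: "1 < i" and res: "module A N \<and> fin_gen A N \<and> free_resolution A N r d e"
  then have N: "module A N" and res: "free_resolution A N r d e" by blast+
  have Js: "smod J" using J by (simp add: type1_def)
  note Jm = ideal_mod_module[OF Js J(3)]
  \<comment> \<open>Two successors, because \<open>ext_core\<close> needs the differential out of
    degree i - 1 as well as the one out of degree i.\<close>
  obtain k where k: "i = Suc (Suc k)" using less_imp_Suc_add[OF i] by auto
  have dh: "d j \<in> mod_hom A (free_mod A (r (Suc j))) (free_mod A (r j))" for j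
    using res by (simp add: free_resolution_def)
  have ex: "d (Suc j) ` carrier (free_mod A (r (Suc (Suc j)))) =
      {x \<in> carrier (free_mod A (r (Suc j))). d j x = \<zero>\<^bsub>free_mod A (r j)\<^esub>}" for j
    using res unfolding free_resolution_def by blast
  show "carrier (Ext A r d (ideal_mod J) i) = {\<zero>\<^bsub>Ext A r d (ideal_mod J) i\<^esub>}" unfolding k
  proof (rule Ext_trivial[OF A.is_cring Jm N res], rule subsetI)
    fix f assume "f \<in> Ext_cocycles A r d (ideal_mod J) (Suc (Suc k))"
    then have f: "f \<in> mod_hom A (free_mod A (r (Suc (Suc k)))) (ideal_mod J)"
      "f \<in> extensional (carrier (free_mod A (r (Suc (Suc k)))))"
      and fz: "\<And>w. w \<in> carrier (free_mod A (r (Suc (Suc (Suc k))))) \<Longrightarrow> f (d (Suc (Suc k)) w) = \<zero>\<^bsub>A\<^esub>"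
      unfolding Ext_cocycles_iff[OF A.is_cring Jm N res] hom_module_simps by simp_all
    let ?m = "r (Suc (Suc k))" and ?n = "r (Suc k)"
    have fE: "f \<in> mod_hom A (free_mod A ?m) (self_module E)"
      and fJ: "\<And>x. x \<in> {..<?m} \<rightarrow>\<^sub>E carrier A \<Longrightarrow> f x \<in> J"
      using f(1)[unfolded hom_ideal_iff[OF Js J(3)]] unfolding free_mod_simps by blast+
    let ?y = "\<lambda>i\<in>{..<?m}. f (unit_vec A ?m i)"
    have yJ: "?y \<in> {..<?m} \<rightarrow>\<^sub>E J"
      unfolding restrict_PiE_iff using fJ[OF unit_vec_closed] by (simp add: unit_vec_A)
    have fy: "f w = dot ?m w ?y" if "w \<in> {..<?m} \<rightarrow>\<^sub>E carrier A" for w by (rule hom_eq_dot[OF fE that])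
    have "\<exists>z\<in>{..<?n} \<rightarrow>\<^sub>E J. \<forall>w\<in>{..<?m} \<rightarrow>\<^sub>E carrier A. dot ?m w ?y = dot ?n (d (Suc k) w) z"
    proof (rule ext_core[OF J dh dh ex yJ])
      fix w assume w: "w \<in> {..<?m} \<rightarrow>\<^sub>E carrier A" "d (Suc k) w = (\<lambda>i\<in>{..<?n}. \<zero>)"
      then have "w \<in> d (Suc (Suc k)) ` carrier (free_mod A (r (Suc (Suc (Suc k)))))"
        unfolding ex by (simp add: A_zero)
      then obtain v where v: "v \<in> carrier (free_mod A (r (Suc (Suc (Suc k)))))" "w = d (Suc (Suc k)) v" by blast
      show "dot ?m w ?y = \<zero>" using fz[OF v(1)] fy[OF w(1)] v(2) by (simp add: A_zero)
    qed
    then obtain z where z: "z \<in> {..<?n} \<rightarrow>\<^sub>E J"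
      and zw: "\<And>w. w \<in> {..<?m} \<rightarrow>\<^sub>E carrier A \<Longrightarrow> dot ?m w ?y = dot ?n (d (Suc k) w) z" by blast
    have zE: "z \<in> {..<?n} \<rightarrow>\<^sub>E carrier E"
      using z PiE_mono[of "{..<?n}" "\<lambda>_. J" "\<lambda>_. carrier E"] smodD(1)[OF Js] by blast
    let ?g = "\<lambda>v\<in>carrier (free_mod A ?n). dot ?n v z"
    have gh: "?g \<in> carrier (hom_module A (free_mod A ?n) (ideal_mod J))"
    proof -
      have "(\<lambda>v. dot ?n v z) \<in> mod_hom A (free_mod A ?n) (ideal_mod J)"
        unfolding hom_ideal_iff[OF Js J(3)] using dot_hom[OF zE] dot_smod[OF Js _ z] by simp
      note h = mod_homD[OF this]
      show ?thesis by (rule mod_hom_restrictI[OF AA.free_module]) (rule h; assumption)+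
    qed
    show "f \<in> Ext_coboundaries A r d (ideal_mod J) (Suc (Suc k))"
      unfolding Ext_coboundaries_iff[OF A.is_cring Jm N res]
    proof (intro conjI f(2) bexI[OF _ gh] ballI)
      fix w assume w: "w \<in> carrier (free_mod A (r (Suc (Suc k))))"
      then have w': "w \<in> {..<?m} \<rightarrow>\<^sub>E carrier A" by simp
      show "f w = ?g (d (Suc k) w)"
        using fy[OF w'] zw[OF w'] mod_homD(1)[OF dh w] by simp
    qed
  qed
qed

text \<open>
  A cocycle \<open>f\<close> corresponds to \<open>f(w\<^sub>0)/a\<close> in the socle of \<open>E/J\<close>, where \<open>d(w\<^sub>0) = a v\<^sub>0\<close> and \<open>v\<^sub>0\<close> lifts
  the unit of the residue field.
\<close>

lemma Ext1_length_iff: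
  assumes J: "smod J" "J \<subseteq> carrier A" and res: "free_resolution A resid r d e"
  shows "mod_length A (Ext A r d (ideal_mod J) 1) = 1 \<longleftrightarrow> type1 J"
proof -
  note Jm = ideal_mod_module[OF J]
  note JD = smodD[OF J(1)]
  interpret Q: quotient_module A "self_module A" \<mm> by (rule resid_quotient)
  have N: "module A resid" unfolding residue_module_def by (rule Q.quot_module)
  let ?F0 = "free_mod A (r 0)" and ?F1 = "free_mod A (r (Suc 0))" and ?F2 = "free_mod A (r (Suc (Suc 0)))"
  interpret F0: module A ?F0 by (rule AA.free_module)
  interpret F1: module A ?F1 by (rule AA.free_module)
  let ?cos = "\<lambda>s. \<mm> +>\<^bsub>self_module A\<^esub> s"
  note [simp del] = free_mod_simps
  have eh: "e \<in> mod_hom A ?F0 resid" "e ` carrier ?F0 = carrier resid"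
    and d0h: "d 0 \<in> mod_hom A ?F1 ?F0" and d1h: "d (Suc 0) \<in> mod_hom A ?F2 ?F1"
    and ex0: "d 0 ` carrier ?F1 = {x \<in> carrier ?F0. e x = \<zero>\<^bsub>resid\<^esub>}"
    and ex1: "d (Suc 0) ` carrier ?F2 = {x \<in> carrier ?F1. d 0 x = \<zero>\<^bsub>?F0\<^esub>}"
    using res unfolding free_resolution_def by simp_all
  note eD = mod_homD[OF eh(1)] and d0D = mod_homD[OF d0h] and d1D = mod_homD[OF d1h]
  have cos_add: "?cos s \<oplus>\<^bsub>resid\<^esub> ?cos t = ?cos (s \<oplus> t)" if "s \<in> carrier A" "t \<in> carrier A" for s t
    using Q.quot_add[of s t] that A_ops(2)[OF that] by (simp add: residue_module_def)
  have cos_smult: "s \<odot>\<^bsub>resid\<^esub> ?cos t = ?cos (s \<otimes> t)" if "s \<in> carrier A" "t \<in> carrier A" for s t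
    using Q.quot_smult[of s t] that A_ops(1)[OF that] by (simp add: residue_module_def)
  have cos_zero: "?cos s = \<zero>\<^bsub>resid\<^esub>" if "s \<in> \<mm>" for s
    using Q.N.a_rcos_const[OF that] Q.quot_zero(1) by (simp add: residue_module_def)
  have cos_eq: "s \<ominus> t \<in> \<mm>" if "?cos s = ?cos t" "s \<in> carrier A" "t \<in> carrier A" for s t
  proof -
    have "s \<ominus>\<^bsub>self_module A\<^esub> t \<in> \<mm>" using Q.coset_eq_iff[of s t] that by simp
    moreover have "\<ominus>\<^bsub>self_module A\<^esub> t = \<ominus> t"
      using Q.smult_l_minus[of "\<one>\<^bsub>A\<^esub>" t] that(3) A_ops(1)[OF A_closed(3)[OF A_closed(6)] that(3)]
      by (simp add: A_neg_one E.l_minus)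
    ultimately show ?thesis using A_ops(2)[OF that(2) A_closed(3)[OF that(3)]] by (simp add: a_minus_def)
  qed
  have cos_ex: "\<exists>s\<in>carrier A. X = ?cos s" if "X \<in> carrier resid" for X
    using that unfolding residue_module_def Q.quot_carrier by auto
  obtain v0 where v0: "v0 \<in> carrier ?F0" "e v0 = ?cos \<one>"
  proof -
    have "?cos \<one> \<in> carrier resid" unfolding residue_module_def Q.quot_carrier using A_closed(6) by simp
    then show ?thesis using eh(2) that by (metis imageE)
  qed
  \<comment> \<open>The products of elements of \<open>\<mm>\<close> with F0 are killed by e and
    hence lie in the image of \<open>d 0\<close>; in particular aF0 does.\<close>
  have P1: "\<exists>w\<in>carrier ?F1. d 0 w = s \<odot>\<^bsub>?F0\<^esub> v" if s: "s \<in> \<mm>" and v: "v \<in> carrier ?F0" for s v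
  proof -
    note sA = m_A[OF s]
    obtain t where t: "t \<in> carrier A" "e v = ?cos t" using cos_ex[OF eD(1)[OF v]] by blast
    have "s \<otimes> t \<in> \<mm>" using m.I_r_closed[OF s t(1)] A_ops(1)[OF sA t(1)] by simp
    then have "e (s \<odot>\<^bsub>?F0\<^esub> v) = \<zero>\<^bsub>resid\<^esub>" unfolding eD(3)[OF sA v] t(2) cos_smult[OF sA t(1)] by (rule cos_zero)
    then have "s \<odot>\<^bsub>?F0\<^esub> v \<in> d 0 ` carrier ?F1" unfolding ex0 using v sA by simp
    then show ?thesis by (metis imageE)
  qed
  \<comment> \<open>F0 is spanned by v0 together with the image of \<open>d 0\<close>, because the
    residue field is spanned by the class of 1.\<close>
  have P2: "\<exists>s\<in>carrier A. \<exists>w\<in>carrier ?F1. v = s \<odot>\<^bsub>?F0\<^esub> v0 \<oplus>\<^bsub>?F0\<^esub> d 0 w" if v: "v \<in> carrier ?F0" for v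
  proof -
    obtain s where s: "s \<in> carrier A" "e v = ?cos s" using cos_ex[OF eD(1)[OF v]] by blast
    have ns: "\<ominus> s \<in> carrier A" using s by auto
    let ?u = "(\<ominus> s) \<odot>\<^bsub>?F0\<^esub> v0 \<oplus>\<^bsub>?F0\<^esub> v"
    have uc: "?u \<in> carrier ?F0" using v v0 ns by simp
    have "e ?u = ?cos ((\<ominus> s) \<otimes> \<one> \<oplus> s)"
      using eD(2)[of "(\<ominus> s) \<odot>\<^bsub>?F0\<^esub> v0" v] eD(3)[OF ns v0(1)] v v0 ns s
        cos_smult[OF ns A_closed(6)] cos_add[of "(\<ominus> s) \<otimes> \<one>" s] A_closed(1)[OF ns A_closed(6)] by simp
    also have "(\<ominus> s) \<otimes> \<one> \<oplus> s = \<zero>" using s by (simp add: E.l_neg)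
    also have "?cos \<zero> = \<zero>\<^bsub>resid\<^esub>" using cos_zero m.zero_closed by (simp add: A_zero)
    finally have "?u \<in> d 0 ` carrier ?F1" unfolding ex0 using uc by simp
    then obtain w where w: "w \<in> carrier ?F1" "d 0 w = ?u" by (metis imageE)
    have "s \<odot>\<^bsub>?F0\<^esub> v0 \<oplus>\<^bsub>?F0\<^esub> ?u = v"
    proof -
      have "(\<ominus> s) \<odot>\<^bsub>?F0\<^esub> v0 = \<ominus>\<^bsub>?F0\<^esub> (s \<odot>\<^bsub>?F0\<^esub> v0)"
        using F0.smult_l_minus[OF s(1) v0(1)] A_uminus[OF s(1)] by simp
      then show ?thesis using s v v0 by (simp add: F0.M.a_assoc[symmetric] F0.M.r_neg)
    qed
    then show ?thesis using s w by metis
  qed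
  obtain w0 where w0: "w0 \<in> carrier ?F1" "d 0 w0 = a \<odot>\<^bsub>?F0\<^esub> v0" using P1[OF a_m v0(1)] by blast
  let ?H = "hom_module A ?F1 (ideal_mod J)"
  define Z where "Z = Ext_cocycles A r d (ideal_mod J) (Suc 0)"
  define B where "B = Ext_coboundaries A r d (ideal_mod J) (Suc 0)"
  note sub = Ext_submodules[OF A.is_cring Jm N res, of 0, folded Z_def B_def]
  interpret H: module A ?H by (rule sub(1))
  have Z: "f \<in> mod_hom A ?F1 (self_module E)" "\<And>x. x \<in> carrier ?F1 \<Longrightarrow> f x \<in> J" "f \<in> carrier ?H"
    "\<And>w. w \<in> carrier ?F2 \<Longrightarrow> f (d (Suc 0) w) = \<zero>" if f: "f \<in> Z" for f
  proof -
    have f': "f \<in> carrier ?H" "\<forall>w\<in>carrier ?F2. f (d (Suc 0) w) = \<zero>"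
      using f unfolding Z_def Ext_cocycles_iff[OF A.is_cring Jm N res] by (simp_all add: A_zero)
    have "f \<in> mod_hom A ?F1 (ideal_mod J)" using f'(1) by (simp only: hom_module_simps Int_iff)
    note h = this[unfolded hom_ideal_iff[OF J]]
    show "f \<in> mod_hom A ?F1 (self_module E)" "\<And>x. x \<in> carrier ?F1 \<Longrightarrow> f x \<in> J" using h by blast+
    show "f \<in> carrier ?H" "\<And>w. w \<in> carrier ?F2 \<Longrightarrow> f (d (Suc 0) w) = \<zero>" using f' by blast+
  qed
  have fadd: "f (x \<oplus>\<^bsub>?F1\<^esub> y) = f x \<oplus> f y" if "f \<in> Z" "x \<in> carrier ?F1" "y \<in> carrier ?F1" for f x y
    using mod_homD(2)[OF Z(1)[OF that(1)] that(2,3)] by simp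
  have fsm: "f (s \<odot>\<^bsub>?F1\<^esub> x) = s \<otimes> f x" if "f \<in> Z" "s \<in> carrier A" "x \<in> carrier ?F1" for f s x
    using mod_homD(3)[OF Z(1)[OF that(1)] that(2,3)] by simp
  have fE: "f x \<in> carrier E" if "f \<in> Z" "x \<in> carrier ?F1" for f x using JD(1)[OF Z(2)[OF that]] .
  \<comment> \<open>A cocycle vanishes on the kernel of \<open>d 0\<close>, so its values depend
    only on the image under \<open>d 0\<close>.\<close>
  have P3: "f w = f w'" if f: "f \<in> Z" and w: "w \<in> carrier ?F1" "w' \<in> carrier ?F1" "d 0 w = d 0 w'" for f w w'
  proof -
    have n1: "\<ominus> \<one> \<in> carrier A" by auto
    let ?u = "w \<oplus>\<^bsub>?F1\<^esub> (\<ominus> \<one>) \<odot>\<^bsub>?F1\<^esub> w'"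
    have uc: "?u \<in> carrier ?F1" using w n1 by simp
    have "d 0 ?u = d 0 w \<oplus>\<^bsub>?F0\<^esub> (\<ominus> \<one>) \<odot>\<^bsub>?F0\<^esub> d 0 w'"
      using d0D(2)[of w "(\<ominus> \<one>) \<odot>\<^bsub>?F1\<^esub> w'"] d0D(3)[OF n1 w(2)] w n1 by simp
    also have "\<dots> = \<zero>\<^bsub>?F0\<^esub>"
      unfolding w(3) using F0.smult_l_minus[OF A.one_closed d0D(1)[OF w(2)]] d0D(1)[OF w(2)]
      by (simp add: A_neg_one F0.M.r_neg)
    finally have "?u \<in> d (Suc 0) ` carrier ?F2" unfolding ex1 using uc by simp
    then have "f ?u = \<zero>" using Z(4)[OF f] by auto
    then have "f w \<oplus> (\<ominus> \<one>) \<otimes> f w' = \<zero>" using fadd[OF f w(1), of "(\<ominus> \<one>) \<odot>\<^bsub>?F1\<^esub> w'"] fsm[OF f n1 w(2)] w n1 by simp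
    then show ?thesis using E.r_right_minus_eq[of "f w" "f w'"] fE[OF f w(1)] fE[OF f w(2)]
      by (simp add: a_minus_def E.l_minus)
  qed
  \<comment> \<open>A cocycle f, read as a homomorphism on the image of \<open>d 0\<close>, extends
    to F0 with values in E by v to f(w)/a, where d 0 w = av; \<theta> f is the value of this
    extension at v0.\<close>
  define \<theta> where "\<theta> f = inv a \<otimes> f w0" for f :: "(nat \<Rightarrow> 'a) \<Rightarrow> 'a"
  have ia: "inv a \<in> carrier E" using a_unit by simp
  have \<theta>E: "\<theta> f \<in> carrier E" if "f \<in> Z" for f unfolding \<theta>_def using fE[OF that w0(1)] ia by simp
  have \<theta>soc: "\<theta> f \<in> soc J" if f: "f \<in> Z" for f
  proof -
    have "s \<otimes> \<theta> f \<in> J" if s: "s \<in> \<mm>" for s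
    proof -
      note sA = m_A[OF s]
      obtain w where w: "w \<in> carrier ?F1" "d 0 w = s \<odot>\<^bsub>?F0\<^esub> v0" using P1[OF s v0(1)] by blast
      have "d 0 (a \<odot>\<^bsub>?F1\<^esub> w) = d 0 (s \<odot>\<^bsub>?F1\<^esub> w0)"
        unfolding d0D(3)[OF a_A(1) w(1)] d0D(3)[OF sA w0(1)] w(2) w0(2)
        using F0.smult_assoc1[OF a_A(1) sA v0(1)] F0.smult_assoc1[OF sA a_A(1) v0(1)] A.m_comm[OF sA a_A(1)] by simp
      then have "f (a \<odot>\<^bsub>?F1\<^esub> w) = f (s \<odot>\<^bsub>?F1\<^esub> w0)" using P3[OF f] w w0 sA by simp
      then have e: "a \<otimes> f w = s \<otimes> f w0" using fsm[OF f a_A(1) w(1)] fsm[OF f sA w0(1)] by simp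
      have "s \<otimes> \<theta> f = inv a \<otimes> (s \<otimes> f w0)" unfolding \<theta>_def using ia sA fE[OF f w0(1)] by (simp add: E.m_lcomm)
      also have "\<dots> = f w" unfolding e[symmetric] by (rule unit_cancel(1)[OF a_unit fE[OF f w(1)]])
      finally show ?thesis using Z(2)[OF f w(1)] by simp
    qed
    then show ?thesis using \<theta>E[OF f] by (simp add: soc_def)
  qed
  \<comment> \<open>A cocycle is a coboundary iff its extension to F0 takes values in J. By the
    description of F0 this only has to be tested at v0.\<close>
  have \<theta>B: "f \<in> B \<longleftrightarrow> \<theta> f \<in> J" if f: "f \<in> Z" for f
  proof
    assume "f \<in> B"
    then obtain g where g: "g \<in> mod_hom A ?F0 (ideal_mod J)" "\<forall>w\<in>carrier ?F1. f w = g (d 0 w)"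
      unfolding B_def Ext_coboundaries_iff[OF A.is_cring Jm N res] hom_module_simps by blast
    then have gE: "g \<in> mod_hom A ?F0 (self_module E)" "g v0 \<in> J" using g(1)[unfolded hom_ideal_iff[OF J]] v0 by blast+
    have "f w0 = a \<otimes> g v0" using g(2) w0 mod_homD(3)[OF gE(1) a_A(1) v0(1)] by simp
    then have "\<theta> f = g v0" unfolding \<theta>_def using unit_cancel(1)[OF a_unit JD(1)[OF gE(2)]] by simp
    then show "\<theta> f \<in> J" using gE by simp
  next
    assume \<theta>J: "\<theta> f \<in> J"
    \<comment> \<open>A chosen preimage of av under \<open>d 0\<close>; by \<open>P3\<close> the
      choice does not affect the value of f.\<close>
    define W where "W v = (SOME w. w \<in> carrier ?F1 \<and> d 0 w = a \<odot>\<^bsub>?F0\<^esub> v)" for v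
    have W: "W v \<in> carrier ?F1" "d 0 (W v) = a \<odot>\<^bsub>?F0\<^esub> v" if v: "v \<in> carrier ?F0" for v
      using someI_ex[of "\<lambda>w. w \<in> carrier ?F1 \<and> d 0 w = a \<odot>\<^bsub>?F0\<^esub> v"] P1[OF a_m v] unfolding W_def by blast+
    define g where "g v = inv a \<otimes> f (W v)" for v
    have gval: "g v = inv a \<otimes> f w" if v: "v \<in> carrier ?F0" and w: "w \<in> carrier ?F1" "d 0 w = a \<odot>\<^bsub>?F0\<^esub> v" for v w
      unfolding g_def using P3[OF f W(1)[OF v] w(1)] W(2)[OF v] w(2) by simp
    have gh: "g \<in> mod_hom A ?F0 (self_module E)"
    proof (rule mod_homI)
      fix v assume v: "v \<in> carrier ?F0"
      note Wv = W[OF v]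
      show "g v \<in> carrier (self_module E)" unfolding g_def using ia fE[OF f Wv(1)] by simp
      show "g (s \<odot>\<^bsub>?F0\<^esub> v) = s \<odot>\<^bsub>self_module E\<^esub> g v" if s: "s \<in> carrier A" for s
      proof -
        have "d 0 (s \<odot>\<^bsub>?F1\<^esub> W v) = a \<odot>\<^bsub>?F0\<^esub> (s \<odot>\<^bsub>?F0\<^esub> v)"
          unfolding d0D(3)[OF s Wv(1)] Wv(2)
          using F0.smult_assoc1[OF a_A(1) s v] F0.smult_assoc1[OF s a_A(1) v] A.m_comm[OF s a_A(1)] by simp
        then have "g (s \<odot>\<^bsub>?F0\<^esub> v) = inv a \<otimes> f (s \<odot>\<^bsub>?F1\<^esub> W v)" using gval[of "s \<odot>\<^bsub>?F0\<^esub> v"] s v Wv by simp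
        then show ?thesis unfolding g_def fsm[OF f s Wv(1)] using ia s fE[OF f Wv(1)] by (simp add: E.m_lcomm)
      qed
      fix u assume u: "u \<in> carrier ?F0"
      note Wu = W[OF u]
      have "d 0 (W v \<oplus>\<^bsub>?F1\<^esub> W u) = a \<odot>\<^bsub>?F0\<^esub> (v \<oplus>\<^bsub>?F0\<^esub> u)"
        unfolding d0D(2)[OF Wv(1) Wu(1)] Wv(2) Wu(2) using F0.smult_r_distr[OF a_A(1) v u] by simp
      then have "g (v \<oplus>\<^bsub>?F0\<^esub> u) = inv a \<otimes> f (W v \<oplus>\<^bsub>?F1\<^esub> W u)" using gval[of "v \<oplus>\<^bsub>?F0\<^esub> u"] u v Wv Wu by simp
      then show "g (v \<oplus>\<^bsub>?F0\<^esub> u) = g v \<oplus>\<^bsub>self_module E\<^esub> g u"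
        unfolding g_def fadd[OF f Wv(1) Wu(1)] using ia fE[OF f Wv(1)] fE[OF f Wu(1)] by (simp add: E.r_distr)
    qed
    have gd: "g (d 0 w) = f w" if w: "w \<in> carrier ?F1" for w
    proof -
      have "g (d 0 w) = inv a \<otimes> f (a \<odot>\<^bsub>?F1\<^esub> w)"
        by (rule gval) (use w d0D(1)[OF w] d0D(3)[OF a_A(1) w] in simp_all)
      also have "\<dots> = f w" unfolding fsm[OF f a_A(1) w] by (rule unit_cancel(1)[OF a_unit fE[OF f w]])
      finally show ?thesis .
    qed
    have gJ: "g v \<in> J" if v: "v \<in> carrier ?F0" for v
    proof -
      obtain s w where sw: "s \<in> carrier A" "w \<in> carrier ?F1" "v = s \<odot>\<^bsub>?F0\<^esub> v0 \<oplus>\<^bsub>?F0\<^esub> d 0 w" using P2[OF v] by blast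
      have g0: "g v0 = \<theta> f" unfolding \<theta>_def by (rule gval[OF v0(1) w0])
      have "g v = s \<otimes> g v0 \<oplus> f w"
        unfolding sw(3) using mod_homD(2)[OF gh, of "s \<odot>\<^bsub>?F0\<^esub> v0" "d 0 w"] mod_homD(3)[OF gh sw(1) v0(1)] gd[OF sw(2)] d0D(1)[OF sw(2)] sw(1) v0(1) by simp
      then show ?thesis unfolding g0 using JD(3)[OF JD(4)[OF sw(1) \<theta>J] Z(2)[OF f sw(2)]] by simp
    qed
    have "g \<in> mod_hom A ?F0 (ideal_mod J)" unfolding hom_ideal_iff[OF J] using gh gJ by blast
    note h = mod_homD[OF this]
    have gH: "(\<lambda>v\<in>carrier ?F0. g v) \<in> carrier (hom_module A ?F0 (ideal_mod J))"
      by (rule mod_hom_restrictI[OF AA.free_module]) (rule h; assumption)+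
    show "f \<in> B" unfolding B_def Ext_coboundaries_iff[OF A.is_cring Jm N res]
    proof (intro conjI bexI[OF _ gH] ballI)
      show "f \<in> extensional (carrier ?F1)" using Z(3)[OF f] by (simp add: hom_module_simps)
      show "f w = (\<lambda>v\<in>carrier ?F0. g v) (d 0 w)" if "w \<in> carrier ?F1" for w
        using gd[OF that] d0D(1)[OF that] by simp
    qed
  qed
  \<comment> \<open>A linear form l on F0 lifts e and maps the image of \<open>d 0\<close> into
    \<open>\<mm>\<close>. So w to l(d 0 w) z takes values in J when z is in the socle, and this
    cocycle has \<theta> equal to l(v0) z, where l(v0) is congruent to 1 modulo
    \<open>\<mm>\<close>.\<close>
  have \<theta>surj: "\<exists>f\<in>Z. \<theta> f \<ominus> z \<in> J" if z: "z \<in> soc J" for z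
  proof -
    have zE: "z \<in> carrier E" using z by (simp add: soc_def)
    have "\<exists>s\<in>carrier A. e (unit_vec A (r 0) i) = ?cos s" for i
      using cos_ex[OF eD(1)[of "unit_vec A (r 0) i"]] unit_vec_closed[of "r 0" i] by (simp add: unit_vec_A free_mod_simps(1))
    then obtain s where s: "\<And>i. s i \<in> carrier A" "\<And>i. e (unit_vec A (r 0) i) = ?cos (s i)" by metis
    let ?s = "\<lambda>i\<in>{..<r 0}. s i"
    have sv: "?s \<in> {..<r 0} \<rightarrow>\<^sub>E carrier A" unfolding restrict_PiE_iff using s by simp
    note sE = vec_A_E[OF sv]
    define l where "l v = dot (r 0) v ?s" for v
    have lA: "l v \<in> carrier A" if "v \<in> carrier ?F0" for v
      unfolding l_def using dot_smod[OF smod_A _ sv] that by (simp add: free_mod_simps(1))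
    note lh = dot_hom[OF sE, folded l_def]
    note lD = mod_homD[OF lh, unfolded self_module_simps]
    have el: "e v = ?cos (l v)" if v: "v \<in> carrier ?F0" for v
    proof (rule free_hom_eqI[OF A.is_cring N eh(1)])
      show "(\<lambda>v. ?cos (l v)) \<in> mod_hom A ?F0 resid"
      proof (rule mod_homI)
        fix x assume x: "x \<in> carrier ?F0"
        show "?cos (l x) \<in> carrier resid" unfolding residue_module_def Q.quot_carrier using lA[OF x] by simp
        show "?cos (l (t \<odot>\<^bsub>?F0\<^esub> x)) = t \<odot>\<^bsub>resid\<^esub> ?cos (l x)" if t: "t \<in> carrier A" for t
          unfolding lD(3)[OF t x] cos_smult[OF t lA[OF x]] ..
        fix y assume y: "y \<in> carrier ?F0"
        show "?cos (l (x \<oplus>\<^bsub>?F0\<^esub> y)) = ?cos (l x) \<oplus>\<^bsub>resid\<^esub> ?cos (l y)"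
          unfolding lD(2)[OF x y] cos_add[OF lA[OF x] lA[OF y]] ..
      qed
      show "e (unit_vec A (r 0) i) = ?cos (l (unit_vec A (r 0) i))" if i: "i < r 0" for i
        unfolding s(2) unfolding l_def unit_vec_A using dot_comm[OF vec_A_E[OF unit_vec_closed] sE, of i] dot_unit[OF sE i] i by simp
      show "v \<in> {..<r 0} \<rightarrow>\<^sub>E carrier A" using v by (simp add: free_mod_simps(1))
    qed
    have lm: "l (d 0 w) \<in> \<mm>" if w: "w \<in> carrier ?F1" for w
    proof -
      have "d 0 w \<in> {x \<in> carrier ?F0. e x = \<zero>\<^bsub>resid\<^esub>}" using w unfolding ex0[symmetric] by blast
      then have "?cos (l (d 0 w)) = ?cos \<zero>" using el[OF d0D(1)[OF w]] cos_zero[of \<zero>] m.zero_closed by (simp add: A_zero)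
      then have "l (d 0 w) \<ominus> \<zero> \<in> \<mm>" using cos_eq lA[OF d0D(1)[OF w]] A_closed(5) by blast
      then show ?thesis using lA[OF d0D(1)[OF w]] by (simp add: a_minus_def)
    qed
    define f where "f = (\<lambda>w\<in>carrier ?F1. l (d 0 w) \<otimes> z)"
    have fJ: "l (d 0 w) \<otimes> z \<in> J" if "w \<in> carrier ?F1" for w using z lm[OF that] by (simp add: soc_def)
    have "(\<lambda>w. l (d 0 w) \<otimes> z) \<in> mod_hom A ?F1 (self_module E)"
    proof (rule mod_homI)
      fix x assume x: "x \<in> carrier ?F1"
      note lx = A_sub[OF lA[OF d0D(1)[OF x]]]
      show "l (d 0 x) \<otimes> z \<in> carrier (self_module E)" using lx zE by simp
      show "l (d 0 (t \<odot>\<^bsub>?F1\<^esub> x)) \<otimes> z = t \<odot>\<^bsub>self_module E\<^esub> (l (d 0 x) \<otimes> z)" if t: "t \<in> carrier A" for t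
        unfolding d0D(3)[OF t x] lD(3)[OF t d0D(1)[OF x]] using lx zE t by (simp add: E.m_assoc)
      fix y assume y: "y \<in> carrier ?F1"
      note ly = A_sub[OF lA[OF d0D(1)[OF y]]]
      show "l (d 0 (x \<oplus>\<^bsub>?F1\<^esub> y)) \<otimes> z = l (d 0 x) \<otimes> z \<oplus>\<^bsub>self_module E\<^esub> l (d 0 y) \<otimes> z"
        unfolding d0D(2)[OF x y] lD(2)[OF d0D(1)[OF x] d0D(1)[OF y]] using lx ly zE by (simp add: E.l_distr)
    qed
    then have "(\<lambda>w. l (d 0 w) \<otimes> z) \<in> mod_hom A ?F1 (ideal_mod J)" unfolding hom_ideal_iff[OF J] using fJ by blast
    note h = mod_homD[OF this]
    have fH: "f \<in> carrier ?H" unfolding f_def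
      by (rule mod_hom_restrictI[OF AA.free_module]) (rule h; assumption)+
    have "f (d (Suc 0) w) = \<zero>" if w: "w \<in> carrier ?F2" for w
    proof -
      have "d 0 (d (Suc 0) w) = \<zero>\<^bsub>?F0\<^esub>" by (rule resolution_compl[OF A.is_cring Jm N res w])
      moreover have "l \<zero>\<^bsub>?F0\<^esub> = \<zero>" using mod_hom_zero[OF AA.free_module Emod lh] by simp
      ultimately show ?thesis unfolding f_def using d1D(1)[OF w] zE by simp
    qed
    then have fZ: "f \<in> Z" unfolding Z_def Ext_cocycles_iff[OF A.is_cring Jm N res] using fH by (simp add: A_zero)
    have "l v0 \<ominus> \<one> \<in> \<mm>" using cos_eq[of "l v0" \<one>] el[OF v0(1)] v0(2) lA[OF v0(1)] A_closed(6) by simp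
    then have "(l v0 \<ominus> \<one>) \<otimes> z \<in> J" using z by (simp add: soc_def)
    moreover have "\<theta> f \<ominus> z = (l v0 \<ominus> \<one>) \<otimes> z"
    proof -
      have lv: "l v0 \<in> carrier E" using lA[OF v0(1)] by auto
      have "\<theta> f = inv a \<otimes> ((a \<otimes> l v0) \<otimes> z)" unfolding \<theta>_def f_def using w0 lD(3)[OF a_A(1) v0(1)] by simp
      also have "\<dots> = l v0 \<otimes> z" using unit_cancel(1)[OF a_unit, of "l v0 \<otimes> z"] lv zE by (simp add: E.m_assoc)
      finally show ?thesis using lv zE by (simp add: a_minus_def E.l_distr E.l_minus)
    qed
    ultimately have "\<theta> f \<ominus> z \<in> J" by (simp only:)
    then show ?thesis using fZ by blast
  qed
  have \<theta>diff: "\<theta> (g \<ominus>\<^bsub>?H\<^esub> s \<odot>\<^bsub>?H\<^esub> f) = \<theta> g \<ominus> s \<otimes> \<theta> f" "g \<ominus>\<^bsub>?H\<^esub> s \<odot>\<^bsub>?H\<^esub> f \<in> Z"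
    if f: "f \<in> Z" and g: "g \<in> Z" and s: "s \<in> carrier A" for f g s
  proof -
    note ZS = sub(2)[unfolded H.submodule_iff]
    have n1: "\<ominus> \<one> \<in> carrier A" by auto
    have eq: "g \<ominus>\<^bsub>?H\<^esub> s \<odot>\<^bsub>?H\<^esub> f = g \<oplus>\<^bsub>?H\<^esub> (\<ominus> \<one>) \<odot>\<^bsub>?H\<^esub> (s \<odot>\<^bsub>?H\<^esub> f)"
      using H.smult_l_minus[OF A.one_closed H.smult_closed[OF s Z(3)[OF f]]] H.smult_closed[OF s Z(3)[OF f]]
      by (simp add: a_minus_def A_neg_one)
    show "g \<ominus>\<^bsub>?H\<^esub> s \<odot>\<^bsub>?H\<^esub> f \<in> Z" unfolding eq using ZS f g s n1 by blast
    have sf: "s \<otimes>\<^bsub>A\<^esub> f w0 = s \<otimes> f w0" using A_ops(1)[OF s, of "f w0"] J(2) Z(2)[OF f w0(1)] by auto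
    have sfJ: "s \<otimes> f w0 \<in> J" using JD(4)[OF s Z(2)[OF f w0(1)]] .
    have "\<ominus> \<one> \<otimes>\<^bsub>A\<^esub> (s \<otimes> f w0) = \<ominus> \<one> \<otimes> (s \<otimes> f w0)" using A_ops(1)[OF n1, of "s \<otimes> f w0"] J(2) sfJ by auto
    moreover have "g w0 \<oplus>\<^bsub>A\<^esub> \<ominus> \<one> \<otimes> (s \<otimes> f w0) = g w0 \<oplus> \<ominus> \<one> \<otimes> (s \<otimes> f w0)"
      using A_ops(2)[of "g w0" "\<ominus> \<one> \<otimes> (s \<otimes> f w0)"] J(2) Z(2)[OF g w0(1)] JD(4)[OF n1 sfJ] by auto
    ultimately have "(g \<ominus>\<^bsub>?H\<^esub> s \<odot>\<^bsub>?H\<^esub> f) w0 = g w0 \<oplus> \<ominus> \<one> \<otimes> (s \<otimes> f w0)"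
      unfolding eq unfolding hom_module_simps using w0(1) sf by simp
    then show "\<theta> (g \<ominus>\<^bsub>?H\<^esub> s \<odot>\<^bsub>?H\<^esub> f) = \<theta> g \<ominus> s \<otimes> \<theta> f"
      unfolding \<theta>_def using ia fE[OF f w0(1)] fE[OF g w0(1)] A_sub[OF s]
      by (simp add: a_minus_def E.r_distr E.l_minus E.r_minus E.m_lcomm)
  qed
  have Jdiff: "x \<in> J \<longleftrightarrow> y \<in> J" if "x \<ominus> y \<in> J" "x \<in> carrier E" "y \<in> carrier E" for x y
  proof
    assume "y \<in> J"
    then have "(x \<ominus> y) \<oplus> y \<in> J" using that JD(3) by blast
    then show "x \<in> J" using that by (simp add: a_minus_def E.a_assoc E.l_neg)
  next
    assume "x \<in> J"
    then have "x \<ominus> (x \<ominus> y) \<in> J" using that JD(6) by blast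
    moreover have "x \<ominus> (x \<ominus> y) = y" using that(2,3) by algebra
    ultimately show "y \<in> J" by simp
  qed
  have "mod_length A (Ext A r d (ideal_mod J) 1) = chain_len (between A ?H B Z)"
    using Ext_length[OF A.is_cring Jm N res, of 0] unfolding B_def Z_def by simp
  then have "mod_length A (Ext A r d (ideal_mod J) 1) = 1 \<longleftrightarrow>
      B \<noteq> Z \<and> (\<forall>f\<in>Z. f \<notin> B \<longrightarrow> (\<forall>g\<in>Z. \<exists>s\<in>carrier A. g \<ominus>\<^bsub>?H\<^esub> s \<odot>\<^bsub>?H\<^esub> f \<in> B))"
    using simple_between_iff[OF sub(1,3,4,2)] by simp
  also have "\<dots> \<longleftrightarrow> type1 J"
  proof
    assume *: "B \<noteq> Z \<and> (\<forall>f\<in>Z. f \<notin> B \<longrightarrow> (\<forall>g\<in>Z. \<exists>s\<in>carrier A. g \<ominus>\<^bsub>?H\<^esub> s \<odot>\<^bsub>?H\<^esub> f \<in> B))"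
    show "type1 J" unfolding type1_def
    proof (intro conjI J(1) ballI impI)
      obtain f where "f \<in> Z" "f \<notin> B" using * sub(4) by blast
      then show "\<exists>z\<in>soc J. z \<notin> J" using \<theta>soc \<theta>B by blast
    next
      fix z w assume z: "z \<in> soc J" "z \<notin> J" and w: "w \<in> soc J"
      have c: "z \<in> carrier E" "w \<in> carrier E" using z w by (simp_all add: soc_def)
      obtain f where f: "f \<in> Z" "\<theta> f \<ominus> z \<in> J" using \<theta>surj[OF z(1)] by blast
      obtain g where g: "g \<in> Z" "\<theta> g \<ominus> w \<in> J" using \<theta>surj[OF w] by blast
      have "f \<notin> B" using \<theta>B[OF f(1)] Jdiff[OF f(2) \<theta>E[OF f(1)] c(1)] z(2) by blast
      then obtain s where s: "s \<in> carrier A" "g \<ominus>\<^bsub>?H\<^esub> s \<odot>\<^bsub>?H\<^esub> f \<in> B" using * f g by blast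
      then have 1: "\<theta> g \<ominus> s \<otimes> \<theta> f \<in> J" using \<theta>B[OF \<theta>diff(2)[OF f(1) g(1) s(1)]] \<theta>diff(1)[OF f(1) g(1) s(1)] by simp
      have "(\<theta> g \<ominus> s \<otimes> \<theta> f) \<ominus> (\<theta> g \<ominus> w) \<oplus> s \<otimes> (\<theta> f \<ominus> z) \<in> J"
        by (rule JD(3)[OF JD(6)[OF 1 g(2)] JD(4)[OF s(1) f(2)]])
      moreover have "(\<theta> g \<ominus> s \<otimes> \<theta> f) \<ominus> (\<theta> g \<ominus> w) \<oplus> s \<otimes> (\<theta> f \<ominus> z) = w \<ominus> s \<otimes> z"
      proof -
        have "(tg \<ominus> s \<otimes> tf) \<ominus> (tg \<ominus> w) \<oplus> s \<otimes> (tf \<ominus> z) = w \<ominus> s \<otimes> z" if "tg \<in> carrier E" "tf \<in> carrier E" for tg tf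
          using that c A_sub[OF s(1)] by algebra
        then show ?thesis using \<theta>E[OF f(1)] \<theta>E[OF g(1)] by blast
      qed
      ultimately show "\<exists>s\<in>carrier A. w \<ominus> s \<otimes> z \<in> J" using s(1) by (intro bexI[of _ s]) simp_all
    qed
  next
    assume t: "type1 J"
    show "B \<noteq> Z \<and> (\<forall>f\<in>Z. f \<notin> B \<longrightarrow> (\<forall>g\<in>Z. \<exists>s\<in>carrier A. g \<ominus>\<^bsub>?H\<^esub> s \<odot>\<^bsub>?H\<^esub> f \<in> B))"
    proof (intro conjI ballI impI)
      obtain z where z: "z \<in> soc J" "z \<notin> J" using t by (auto simp: type1_def)
      obtain f where f: "f \<in> Z" "\<theta> f \<ominus> z \<in> J" using \<theta>surj[OF z(1)] by blast
      have "z \<in> carrier E" using z by (simp add: soc_def)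
      then have "f \<notin> B" using \<theta>B[OF f(1)] Jdiff[OF f(2) \<theta>E[OF f(1)]] z(2) by blast
      then show "B \<noteq> Z" using f by blast
    next
      fix f g assume f: "f \<in> Z" "f \<notin> B" and g: "g \<in> Z"
      obtain s where s: "s \<in> carrier A" "\<theta> g \<ominus> s \<otimes> \<theta> f \<in> J"
        using t \<theta>soc[OF f(1)] \<theta>soc[OF g] \<theta>B[OF f(1)] f(2) unfolding type1_def by blast
      then show "\<exists>s\<in>carrier A. g \<ominus>\<^bsub>?H\<^esub> s \<odot>\<^bsub>?H\<^esub> f \<in> B"
        using \<theta>B[OF \<theta>diff(2)[OF f(1) g s(1)]] \<theta>diff(1)[OF f(1) g s(1)] by (intro bexI[of _ s]) simp_all
    qed
  qed
  finally show ?thesis .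
qed

end

lemma mod_span_eqI:
  assumes "submodule S R M" "X \<subseteq> S" "\<And>N. submodule N R M \<Longrightarrow> X \<subseteq> N \<Longrightarrow> S \<subseteq> N"
  shows "mod_span R M X = S"
  using assms unfolding mod_span_def by blast

section \<open>Products and multiples of fractional ideals\<close>

context overring
begin

lemma submodule_ideal_iff:
  assumes "smod J" "J \<subseteq> carrier A"
  shows "submodule N A ((self_module A)\<lparr>carrier := J\<rparr>) \<longleftrightarrow> smod N \<and> N \<subseteq> J"
proof -
  interpret AA: overring A A by unfold_locales (simp add: ring_hom_def)
  have "submodule J A (self_module A)" using assms by (simp add: submodule_A_iff)
  from submodule_restrict_carrier[OF AA.Emod this, of N] show ?thesis
    using assms(2) unfolding submodule_A_iff by blast
qed

text \<open>The set \<open>ideal_prod E X Y\<close> is the closure of the pairwise products under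
  sums, so it makes sense for A-submodules of E that are not ideals of E and serves as their
  product. Minimality is read off from the inductive form.\<close>

lemma prod_subset:
  assumes "smod Z" "\<And>x y. x \<in> X \<Longrightarrow> y \<in> Y \<Longrightarrow> x \<otimes> y \<in> Z"
  shows "ideal_prod E X Y \<subseteq> Z"
proof
  fix z assume "z \<in> ideal_prod E X Y"
  then show "z \<in> Z" by induction (use assms(2) smodD(3)[OF assms(1)] in auto)
qed

lemma prod_carrier:
  assumes "X \<subseteq> carrier E" "Y \<subseteq> carrier E" shows "ideal_prod E X Y \<subseteq> carrier E"
proof
  fix z assume "z \<in> ideal_prod E X Y"
  then show "z \<in> carrier E" by induction (use assms in auto)
qed

lemma smod_prod:
  assumes "smod X" "smod Y" shows "smod (ideal_prod E X Y)"
proof (rule smodI)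
  have c: "X \<subseteq> carrier E" "Y \<subseteq> carrier E" using assms unfolding smod_iff by blast+
  show pc: "ideal_prod E X Y \<subseteq> carrier E" by (rule prod_carrier[OF c])
  have "\<zero> \<otimes> \<zero> \<in> ideal_prod E X Y" by (intro ideal_prod.prod smodD(2) assms)
  then show "\<zero> \<in> ideal_prod E X Y" by simp
  show "x \<oplus> y \<in> ideal_prod E X Y" if "x \<in> ideal_prod E X Y" "y \<in> ideal_prod E X Y" for x y
    using that by (rule ideal_prod.sum)
  fix r x assume r: "r \<in> carrier A" and x: "x \<in> ideal_prod E X Y"
  from x show "r \<otimes> x \<in> ideal_prod E X Y"
  proof induction
    case (prod i j)
    have "r \<otimes> (i \<otimes> j) = (r \<otimes> i) \<otimes> j" using r prod smodD(1)[OF assms(1)] smodD(1)[OF assms(2)] by (simp add: E.m_assoc)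
    moreover have "(r \<otimes> i) \<otimes> j \<in> ideal_prod E X Y" by (intro ideal_prod.prod smodD(4)[OF assms(1)] r prod)
    ultimately show ?case by simp
  next
    case (sum s1 s2)
    have "s1 \<in> carrier E" "s2 \<in> carrier E" using sum(1,2) pc by auto
    then have "r \<otimes> (s1 \<oplus> s2) = r \<otimes> s1 \<oplus> r \<otimes> s2" using r by (simp add: E.r_distr)
    then show ?case using ideal_prod.sum[OF sum(3,4)] by simp
  qed
qed

lemma prod_comm:
  assumes "X \<subseteq> carrier E" "Y \<subseteq> carrier E" shows "ideal_prod E X Y = ideal_prod E Y X"
proof -
  have "ideal_prod E X Y \<subseteq> ideal_prod E Y X" if c: "X \<subseteq> carrier E" "Y \<subseteq> carrier E" for X Y
  proof
    fix z assume "z \<in> ideal_prod E X Y"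
    then show "z \<in> ideal_prod E Y X"
    proof induction
      case (prod i j)
      then have "i \<otimes> j = j \<otimes> i" using c by (intro E.m_comm) auto
      then show ?case using ideal_prod.prod[OF prod(2,1), of E] by simp
    qed (rule ideal_prod.sum)
  qed
  then show ?thesis using assms by blast
qed

lemma prod_carrier_A:
  assumes "smod X" shows "ideal_prod E X (carrier A) = X"
proof (intro subset_antisym prod_subset assms subsetI)
  fix x r assume "x \<in> X" "r \<in> carrier A"
  then show "x \<otimes> r \<in> X" using smodD(4)[OF assms, of r x] smodD(1)[OF assms, of x] E.m_comm[of x r] by simp
next
  fix x assume x: "x \<in> X"
  have "x \<otimes> \<one> \<in> ideal_prod E X (carrier A)" by (intro ideal_prod.prod x A_closed)
  then show "x \<in> ideal_prod E X (carrier A)" using smodD(1)[OF assms x] by simp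
qed

lemma prod_scal_left:
  assumes "smod X" "smod Y" "p \<in> carrier E"
  shows "ideal_prod E (scal p X) Y = scal p (ideal_prod E X Y)"
proof (rule subset_antisym)
  have c: "X \<subseteq> carrier E" "Y \<subseteq> carrier E" using assms unfolding smod_iff by blast+
  show "ideal_prod E (scal p X) Y \<subseteq> scal p (ideal_prod E X Y)"
  proof (rule prod_subset[OF smod_scal[OF smod_prod[OF assms(1,2)] assms(3)]])
    fix x y assume "x \<in> scal p X" and y: "y \<in> Y"
    then obtain x' where x': "x = p \<otimes> x'" "x' \<in> X" by (auto simp: scal_def)
    have "x \<otimes> y = p \<otimes> (x' \<otimes> y)" using x' y c assms(3) by (simp add: E.m_assoc subset_iff)
    moreover have "x' \<otimes> y \<in> ideal_prod E X Y" by (rule ideal_prod.prod[OF x'(2) y])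
    ultimately show "x \<otimes> y \<in> scal p (ideal_prod E X Y)" unfolding scal_def by blast
  qed
  have "p \<otimes> z \<in> ideal_prod E (scal p X) Y" if "z \<in> ideal_prod E X Y" for z
    using that
  proof induction
    case (prod i j)
    have "p \<otimes> (i \<otimes> j) = (p \<otimes> i) \<otimes> j" using prod c assms(3) by (simp add: E.m_assoc subset_iff)
    moreover have "(p \<otimes> i) \<otimes> j \<in> ideal_prod E (scal p X) Y"
      by (intro ideal_prod.prod prod) (use prod in \<open>auto simp: scal_def\<close>)
    ultimately show ?case by simp
  next
    case (sum s1 s2)
    have "s1 \<in> carrier E" "s2 \<in> carrier E" using sum(1,2) prod_carrier[OF c] by auto
    then have "p \<otimes> (s1 \<oplus> s2) = p \<otimes> s1 \<oplus> p \<otimes> s2" using assms(3) by (simp add: E.r_distr)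
    then show ?case using ideal_prod.sum[OF sum(3,4)] by simp
  qed
  then show "scal p (ideal_prod E X Y) \<subseteq> ideal_prod E (scal p X) Y" unfolding scal_def by blast
qed

lemma prod_scal:
  assumes "smod X" "smod Y" "p \<in> carrier E" "q \<in> carrier E"
  shows "ideal_prod E (scal p X) (scal q Y) = scal (p \<otimes> q) (ideal_prod E X Y)"
proof -
  have c: "X \<subseteq> carrier E" "Y \<subseteq> carrier E" "scal q Y \<subseteq> carrier E"
    using assms smod_scal[OF assms(2,4)] unfolding smod_iff by blast+
  have "ideal_prod E (scal p X) (scal q Y) = scal p (ideal_prod E X (scal q Y))"
    by (rule prod_scal_left[OF assms(1) smod_scal[OF assms(2,4)] assms(3)])
  also have "ideal_prod E X (scal q Y) = scal q (ideal_prod E X Y)"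
    unfolding prod_comm[OF c(1,3)] prod_scal_left[OF assms(2,1,4)] prod_comm[OF c(2,1)] ..
  finally show ?thesis using scal_scal[OF assms(3,4) prod_carrier[OF c(1,2)]] by simp
qed

text \<open>The Goto condition forms its products in A, whereas the comparison of fractional ideals
  takes place in E.\<close>

lemma prod_A_eq:
  assumes "X \<subseteq> carrier A" "Y \<subseteq> carrier A" shows "ideal_prod A X Y = ideal_prod E X Y"
proof (rule Set.set_eqI)
  have 1: "z \<in> ideal_prod E X Y \<and> z \<in> carrier A" if "z \<in> ideal_prod A X Y" for z
    using that
  proof induction
    case (prod i j)
    then have "i \<in> carrier A" "j \<in> carrier A" using assms by auto
    then show ?case using ideal_prod.prod[OF prod, of E] A_ops(1)[of i j] A_closed(1)[of i j] by simp
  next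
    case (sum s1 s2)
    then show ?case using ideal_prod.sum[of s1 E X Y s2] A_ops(2)[of s1 s2] A_closed(2)[of s1 s2] by simp
  qed
  have 2: "z \<in> ideal_prod A X Y \<and> z \<in> carrier A" if "z \<in> ideal_prod E X Y" for z
    using that
  proof induction
    case (prod i j)
    then have "i \<in> carrier A" "j \<in> carrier A" using assms by auto
    then show ?case using ideal_prod.prod[OF prod, of A] A_ops(1)[of i j] A_closed(1)[of i j] by simp
  next
    case (sum s1 s2)
    then show ?case using ideal_prod.sum[of s1 A X Y s2] A_ops(2)[of s1 s2] A_closed(2)[of s1 s2] by simp
  qed
  fix z show "z \<in> ideal_prod A X Y \<longleftrightarrow> z \<in> ideal_prod E X Y" using 1 2 by blast
qed

lemma PIdl_eq: "b \<in> carrier A \<Longrightarrow> PIdl\<^bsub>A\<^esub> b = scal b (carrier A)"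
  unfolding cgenideal_def scal_def using A_ops(1) A.m_comm by (auto simp: image_def) metis+

lemma PIdl_prod:
  assumes "b \<in> carrier A" "smod X" "X \<subseteq> carrier A"
  shows "ideal_prod A (PIdl\<^bsub>A\<^esub> b) X = scal b X"
proof -
  have bA: "scal b (carrier A) \<subseteq> carrier A" using assms(1) A_closed(1) by (auto simp: scal_def)
  have c: "X \<subseteq> carrier E" "carrier A \<subseteq> carrier E" using assms(3) by auto
  show ?thesis
    unfolding PIdl_eq[OF assms(1)] prod_A_eq[OF bA assms(3)] prod_scal_left[OF smod_A assms(2) A_sub[OF assms(1)]]
      prod_comm[OF c(2,1)] prod_carrier_A[OF assms(2)] ..
qed

lemma ideal_power_eq:
  assumes "smod X" "X \<subseteq> carrier A"
  shows "ideal_power A X 2 = ideal_prod E X X" "ideal_power A X 3 = ideal_prod E X (ideal_prod E X X)"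
    "ideal_prod E X X \<subseteq> carrier A"
proof -
  have 1: "ideal_prod A X (carrier A) = X" using prod_A_eq[OF assms(2)] prod_carrier_A[OF assms(1)] by simp
  show 2: "ideal_power A X 2 = ideal_prod E X X"
    unfolding numeral_2_eq_2 ideal_power.simps 1 by (rule prod_A_eq[OF assms(2,2)])
  show c: "ideal_prod E X X \<subseteq> carrier A"
    by (rule prod_subset[OF smod_A]) (use assms(2) A_closed(1) in auto)
  have "ideal_power A X 3 = ideal_prod A X (ideal_power A X 2)" unfolding numeral_2_eq_2 numeral_3_eq_3 by simp
  then show "ideal_power A X 3 = ideal_prod E X (ideal_prod E X X)"
    unfolding 2 using prod_A_eq[OF assms(2) c] by simp
qed

lemma between_A_eq:
  assumes "X \<subseteq> carrier A" shows "between A (self_module A) Y X = between A (self_module E) Y X"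
  using assms unfolding between_def submodule_A_iff smod_def by blast

end

section \<open>Depth one and the recognition of canonical ideals\<close>

context param_overring
begin

lemma scal_inv:
  assumes "q \<in> Units E" "X \<subseteq> carrier E" shows "scal (inv q) (scal q X) = X" "scal q (scal (inv q) X) = X"
proof -
  have qc: "q \<in> carrier E" "inv q \<in> carrier E" using assms(1) by auto
  show "scal (inv q) (scal q X) = X" "scal q (scal (inv q) X) = X"
    unfolding scal_scal[OF qc assms(2)] scal_scal[OF qc(2,1) assms(2)]
    using assms by (simp_all add: scal_one)
qed

text \<open>Multiplication by q is an automorphism of the A-module E, inverted by multiplication by
  q^(-1), and so preserves intervals of submodules.\<close>

lemma chain_len_scal:
  assumes q: "q \<in> Units E" and c: "X \<subseteq> carrier E" "Y \<subseteq> carrier E"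
  shows "chain_len (between A (self_module E) (scal q Y) (scal q X)) = chain_len (between A (self_module E) Y X)"
proof (rule chain_len_bij[where f = "scal (inv q)", OF bij_betw_byWitness[where f' = "scal q"]])
  have qc: "q \<in> carrier E" "inv q \<in> carrier E" using q by auto
  have Hc: "H \<subseteq> carrier E" if "smod H" for H using that unfolding smod_iff by blast
  have m: "smod H \<and> scal (inv q) (scal q Y) \<subseteq> scal (inv q) H \<and> scal (inv q) H \<subseteq> scal (inv q) (scal q X) \<and> smod (scal (inv q) H)"
    if "H \<in> between A (self_module E) (scal q Y) (scal q X)" for H
    using that smod_scal[OF _ qc(2), of H] unfolding between_def smod_def[symmetric] by (blast intro: scal_mono[THEN subsetD])
  show "\<forall>H\<in>between A (self_module E) (scal q Y) (scal q X). scal q (scal (inv q) H) = H"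
    using m scal_inv(2)[OF q Hc] by blast
  have m': "smod H \<and> scal q Y \<subseteq> scal q H \<and> scal q H \<subseteq> scal q X \<and> smod (scal q H)"
    if "H \<in> between A (self_module E) Y X" for H
    using that smod_scal[OF _ qc(1), of H] scal_mono[of Y H q] scal_mono[of H X q] unfolding between_def smod_def[symmetric] by blast
  show "\<forall>H\<in>between A (self_module E) Y X. scal (inv q) (scal q H) = H"
    using m' scal_inv(1)[OF q Hc] by blast
  show "scal (inv q) ` between A (self_module E) (scal q Y) (scal q X) \<subseteq> between A (self_module E) Y X"
    using m scal_inv(1)[OF q] c unfolding between_def smod_def[symmetric] by auto
  show "scal q ` between A (self_module E) Y X \<subseteq> between A (self_module E) (scal q Y) (scal q X)"
    using m' unfolding between_def smod_def[symmetric] by auto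
  fix H H' assume H: "H \<in> between A (self_module E) (scal q Y) (scal q X)" "H' \<in> between A (self_module E) (scal q Y) (scal q X)"
  show "scal (inv q) H \<subseteq> scal (inv q) H' \<longleftrightarrow> H \<subseteq> H'"
    using scal_mono[of H H' "inv q"] scal_mono[of "scal (inv q) H" "scal (inv q) H'" q]
      scal_inv(2)[OF q Hc, of H] scal_inv(2)[OF q Hc, of H'] m[OF H(1)] m[OF H(2)] by auto
qed

text \<open>If xJ = J with x in \<open>\<mm>\<close>, then J = \<open>\<mm>\<close>J, and Nakayama's
  lemma above the zero submodule is contradicted.\<close>

lemma scal_neq:
  assumes J: "smod J" "J \<subseteq> carrier A" "J \<noteq> {\<zero>}" and x: "x \<in> \<mm>"
  shows "scal x J \<noteq> J"
proof
  assume eq: "scal x J = J"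
  have z: "smod {\<zero>}" by (rule smodI) auto
  have nJ: "noeth A (self_module E) J"
    by (rule noeth_bounded[where k = 0]) (use J(2) in auto)
  obtain H where H: "submodule H A (self_module E)" "{\<zero>} \<subseteq> H" "H \<subseteq> J" "H \<noteq> J"
    "\<And>r d. r \<in> \<mm> \<Longrightarrow> d \<in> J \<Longrightarrow> r \<odot>\<^bsub>self_module E\<^esub> d \<in> H"
    by (rule nakayama[OF Emod nJ J(1)[unfolded smod_def] z[unfolded smod_def]]) (use smodD(2)[OF J(1)] J(3) in auto)
  have "scal x J \<subseteq> H" unfolding scal_def using H(5)[OF x] by auto
  then show False using H(3,4) eq by auto
qed

text \<open>The element a alone is a regular sequence. Two terms x, y are impossible: a power of y
  is a multiple of a, so a is regular on J/xJ; exchanging the order makes x regular on J/aJ; but a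
  power of x is a multiple of a and annihilates J/aJ, so J = aJ.\<close>

lemma depth_one:
  assumes J: "smod J" "J \<subseteq> carrier A" "J \<noteq> {\<zero>}"
  shows "depth A (ideal_mod J) = 1"
proof -
  note JD = smodD[OF J(1)]
  have c: "v \<in> carrier A" if "v \<in> J" for v using that J(2) by blast
  have L0: "list_smult A [] (ideal_mod J) = {\<zero>}" unfolding list_smult_def
  proof (rule mod_span_eqI)
    have "smod {\<zero>}" by (rule smodI) auto
    then show "submodule {\<zero>} A (ideal_mod J)" unfolding submodule_ideal_iff[OF J(1,2)] using JD(2) by simp
    show "{\<zero>} \<subseteq> N" if "submodule N A (ideal_mod J)" for N
      using that smodD(2)[of N] unfolding submodule_ideal_iff[OF J(1,2)] by simp
  qed simp
  have L1: "list_smult A [x] (ideal_mod J) = scal x J" if x: "x \<in> carrier A" for x unfolding list_smult_def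
  proof (rule mod_span_eqI)
    have e: "x \<otimes>\<^bsub>A\<^esub> v = x \<otimes> v" if "v \<in> J" for v using A_ops(1)[OF x c[OF that]] .
    have eq: "{y \<odot>\<^bsub>ideal_mod J\<^esub> v | y v. y \<in> set [x] \<and> v \<in> carrier (ideal_mod J)} = scal x J"
    proof -
      have "{y \<odot>\<^bsub>ideal_mod J\<^esub> v | y v. y \<in> set [x] \<and> v \<in> carrier (ideal_mod J)} = (\<lambda>v. x \<otimes>\<^bsub>A\<^esub> v) ` J" by auto
      also have "\<dots> = scal x J" unfolding scal_def by (rule image_cong[OF refl e])
      finally show ?thesis .
    qed
    show "submodule (scal x J) A (ideal_mod J)" unfolding submodule_ideal_iff[OF J(1,2)]
      using smod_scal[OF J(1) A_sub[OF x]] JD(4)[OF x] by (auto simp: scal_def)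
    show "{y \<odot>\<^bsub>ideal_mod J\<^esub> v | y v. y \<in> set [x] \<and> v \<in> carrier (ideal_mod J)} \<subseteq> scal x J" unfolding eq ..
    show "scal x J \<subseteq> N" if "{y \<odot>\<^bsub>ideal_mod J\<^esub> v | y v. y \<in> set [x] \<and> v \<in> carrier (ideal_mod J)} \<subseteq> N" for N
      using that unfolding eq .
  qed
  have "regular_sequence A (ideal_mod J) [a]" unfolding regular_sequence_def
  proof (intro conjI allI impI ballI)
    show "set [a] \<subseteq> carrier A" by simp
    show "list_smult A [a] (ideal_mod J) \<noteq> carrier (ideal_mod J)"
      using L1[OF a_A(1)] scal_neq[OF J a_m] by simp
    fix k v assume k: "k < length [a]" and v: "v \<in> carrier (ideal_mod J)"
      and av: "[a] ! k \<odot>\<^bsub>ideal_mod J\<^esub> v \<in> list_smult A (take k [a]) (ideal_mod J)"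
    have k0: "k = 0" using k by simp
    have vJ: "v \<in> J" using v by simp
    have "a \<otimes> v = \<zero>" using av A_ops(1)[OF a_A(1) c[OF vJ]] unfolding k0 by (simp add: L0)
    then have "v = \<zero>" using unit_cancel(1)[OF a_unit JD(1)[OF vJ]] a_unit by simp
    then show "v \<in> list_smult A (take k [a]) (ideal_mod J)" unfolding k0 by (simp add: L0)
  qed
  then have ge: "enat (length [a]) \<le> depth A (ideal_mod J)"
    unfolding depth_def using a_m by (intro Sup_upper CollectI exI[of _ "[a]"]) simp
  have "length xs \<le> 1" if xs: "set xs \<subseteq> \<mm>" "regular_sequence A (ideal_mod J) xs" for xs
  proof (rule ccontr)
    assume "\<not> length xs \<le> 1"
    then obtain x y ys where xy: "xs = x # y # ys" by (cases xs; cases "tl xs") auto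
    have xm: "x \<in> \<mm>" "y \<in> \<mm>" using xs(1) xy by auto
    note xA = m_A[OF xm(1)] and yA = m_A[OF xm(2)]
    have reg: "(xs ! k) \<odot>\<^bsub>ideal_mod J\<^esub> v \<in> list_smult A (take k xs) (ideal_mod J) \<Longrightarrow> v \<in> list_smult A (take k xs) (ideal_mod J)"
      if "k < length xs" "v \<in> carrier (ideal_mod J)" for k v
      using xs(2) that unfolding regular_sequence_def by blast
    have r1: "v = \<zero>" if "v \<in> J" "x \<otimes> v = \<zero>" for v
      using reg[of 0 v] that L0 A_ops(1)[OF xA c[OF that(1)]] by (simp add: xy)
    have r2: "v \<in> scal x J" if "v \<in> J" "y \<otimes> v \<in> scal x J" for v
      using reg[of 1 v] that L1[OF xA] A_ops(1)[OF yA c[OF that(1)]] by (simp add: xy)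
    have pw: "s \<otimes> (s [^] (k::nat) \<otimes> v) = s [^] Suc k \<otimes> v" if "s \<in> carrier A" "v \<in> J" for s v k
      using JD(1)[OF that(2)] that(1) by (simp add: E.m_ac)
    have r2': "v \<in> J \<Longrightarrow> y [^] k \<otimes> v \<in> scal x J \<Longrightarrow> v \<in> scal x J" for k :: nat and v
    proof (induction k)
      case 0 then show ?case using JD(1) by simp
    next
      case (Suc k)
      have "y [^] k \<otimes> v \<in> scal x J"
        by (rule r2) (use pw[OF yA Suc.prems(1)] Suc.prems JD(4)[OF A_pow_closed[OF yA]] in simp_all)
      then show ?case by (rule Suc.IH[OF Suc.prems(1)])
    qed
    have par: "\<exists>k::nat. \<exists>t\<in>carrier A. s [^] k = t \<otimes> a" if s: "s \<in> \<mm>" for s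
    proof -
      obtain k :: nat where "s [^]\<^bsub>A\<^esub> k \<in> PIdl\<^bsub>A\<^esub> a" using a_param[OF s] by blast
      then obtain t where "t \<in> carrier A" "s [^] k = t \<otimes>\<^bsub>A\<^esub> a" using A_pow[OF m_A[OF s]] by (auto simp: cgenideal_def)
      then show ?thesis using A_ops(1)[OF _ a_A(1)] by auto
    qed
    have r3: "v \<in> scal x J" if v: "v \<in> J" and av: "a \<otimes> v \<in> scal x J" for v
    proof -
      obtain k :: nat and t where t: "t \<in> carrier A" "y [^] k = t \<otimes> a" using par[OF xm(2)] by blast
      have "y [^] k \<otimes> v = t \<otimes> (a \<otimes> v)" unfolding t(2) using t(1) JD(1)[OF v] by (simp add: E.m_assoc)
      also have "\<dots> \<in> scal x J" by (rule smodD(4)[OF smod_scal[OF J(1) A_sub[OF xA]] t(1) av])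
      finally show ?thesis by (rule r2'[OF v])
    qed
    \<comment> \<open>The exchange of x and a: if xv = aw, then w = xu because a is regular modulo
      xJ, and x(v - au) = 0 gives v = au.\<close>
    have r4: "v \<in> scal a J" if v: "v \<in> J" and xv: "x \<otimes> v \<in> scal a J" for v
    proof -
      obtain w where w: "w \<in> J" "x \<otimes> v = a \<otimes> w" using xv by (auto simp: scal_def)
      have "x \<otimes> v \<in> scal x J" unfolding scal_def using v by blast
      then have "w \<in> scal x J" using r3[OF w(1)] w(2) by simp
      then obtain u where u: "u \<in> J" "w = x \<otimes> u" by (auto simp: scal_def)
      have cE: "v \<in> carrier E" "u \<in> carrier E" "x \<in> carrier E" using JD(1) v u xA by auto
      have "x \<otimes> (v \<ominus> a \<otimes> u) = x \<otimes> v \<ominus> a \<otimes> w" unfolding u(2) using cE a_A(2) by algebra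
      also have "\<dots> = \<zero>" unfolding w(2) using w JD(1) by simp
      finally have "v \<ominus> a \<otimes> u = \<zero>" by (rule r1[OF JD(6)[OF v JD(4)[OF a_A(1) u(1)]]])
      then have "v = a \<otimes> u" using cE a_A(2) E.r_right_minus_eq[of v "a \<otimes> u"] by simp
      then show ?thesis unfolding scal_def using u by blast
    qed
    have r4': "v \<in> J \<Longrightarrow> x [^] k \<otimes> v \<in> scal a J \<Longrightarrow> v \<in> scal a J" for k :: nat and v
    proof (induction k)
      case 0 then show ?case using JD(1) by simp
    next
      case (Suc k)
      have "x [^] k \<otimes> v \<in> scal a J"
        by (rule r4) (use pw[OF xA Suc.prems(1)] Suc.prems JD(4)[OF A_pow_closed[OF xA]] in simp_all)
      then show ?case by (rule Suc.IH[OF Suc.prems(1)])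
    qed
    obtain k :: nat and t where t: "t \<in> carrier A" "x [^] k = t \<otimes> a" using par[OF xm(1)] by blast
    have "v \<in> scal a J" if v: "v \<in> J" for v
    proof (rule r4'[OF v, of k])
      have "x [^] k \<otimes> v = a \<otimes> (t \<otimes> v)" unfolding t(2) using t(1) JD(1)[OF v] by (simp add: E.m_ac)
      then show "x [^] k \<otimes> v \<in> scal a J" unfolding scal_def using JD(4)[OF t(1) v] by blast
    qed
    moreover have "scal a J \<subseteq> J" using JD(4)[OF a_A(1)] by (auto simp: scal_def)
    ultimately show False using scal_neq[OF J a_m] by blast
  qed
  then have "depth A (ideal_mod J) \<le> 1" unfolding depth_def by (intro Sup_least) (auto simp: one_enat_def)
  with ge show ?thesis by (simp add: one_enat_def)
qed

lemma ideal_fin_gen: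
  assumes "smod J" "J \<subseteq> carrier A" shows "fin_gen A (ideal_mod J)"
proof -
  interpret noetherian_ring A using local by (simp add: noetherian_local_ring_def)
  have id: "ideal J A" using assms by (simp add: ideal_iff)
  obtain X where X: "X \<subseteq> carrier A" "finite X" "J = Idl\<^bsub>A\<^esub> X" using finetely_gen[OF id] by blast
  have XJ: "X \<subseteq> J" unfolding X(3) by (rule A.genideal_self[OF X(1)])
  have "mod_span A (ideal_mod J) X = J"
  proof (rule mod_span_eqI[OF _ XJ])
    show "submodule J A (ideal_mod J)" unfolding submodule_ideal_iff[OF assms] using assms by simp
    fix N assume N: "submodule N A (ideal_mod J)" "X \<subseteq> N"
    then have "ideal N A" unfolding submodule_ideal_iff[OF assms] ideal_iff using assms(2) by blast
    then show "J \<subseteq> N" unfolding X(3) using N(2) by (rule A.genideal_minimal)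
  qed
  then show ?thesis unfolding fin_gen_def using X(2) XJ by auto
qed

text \<open>Finite generation and depth one hold for every nonzero ideal, and J is nonzero because
  it contains a power of a. The type is one exactly when \<open>type1 J\<close> holds, by
  \<open>Ext1_length_iff\<close> and the existence of a resolution, and finite injective dimension
  then follows.\<close>

lemma canonical_ideal_iff:
  assumes CM: "cohen_macaulay_local A" "krull_dim A = 1"
    and J: "smod J" "J \<subseteq> carrier A" "J \<noteq> carrier A" "frac J"
  shows "canonical_ideal A J \<longleftrightarrow> type1 J"
proof -
  have "a [^] k \<noteq> \<zero>" for k :: nat
  proof
    assume z: "a [^] k = \<zero>"
    have "inv (a [^] k) \<otimes> a [^] k = inv (a [^] k) \<otimes> \<zero>" by (rule arg_cong[OF z])
    then have "\<one> = \<zero>" using E.Units_l_inv[OF pow_unit[of k]] by simp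
    then show False using one_notin_m A_ops(3) A_zero m.zero_closed by simp
  qed
  then have ne: "J \<noteq> {\<zero>}" using J(4) by (auto simp: frac_def)
  have depth: "depth A (ideal_mod J) = 1" by (rule depth_one[OF J(1,2) ne])
  have ht: "has_type A (ideal_mod J) 1 \<longleftrightarrow> type1 J"
    unfolding has_type_def depth using Ext1_length_iff[OF J(1,2)] residue_resolution_exists
    by (simp add: one_enat_def)
  show ?thesis
  proof
    assume "canonical_ideal A J"
    then show "type1 J" using ht by (simp add: canonical_ideal_def canonical_module_def)
  next
    assume t: "type1 J"
    show "canonical_ideal A J" unfolding canonical_ideal_def canonical_module_def
      using CM J t ht depth ideal_iff[of J] ideal_mod_module[OF J(1,2)] ideal_fin_gen[OF J(1,2)]
        type1_finite_injective_dimension[OF t J(4,2)] by simp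
  qed
qed

end

section \<open>A criterion for \<open>n\<close>-Goto rings\<close>

context param_overring
begin

lemma frac_scal:
  assumes X: "frac X" and q: "q \<in> Units E"
    and b: "a [^] (l::nat) \<otimes> q \<in> carrier A" "a [^] l \<otimes> inv q \<in> carrier A"
  shows "frac (scal q X)"
proof -
  have Xs: "smod X" using X by (simp add: frac_def)
  have qc: "q \<in> carrier E" "inv q \<in> carrier E" using q by auto
  obtain k :: nat where k: "a [^] k \<in> X" "\<And>x. x \<in> X \<Longrightarrow> a [^] k \<otimes> x \<in> carrier A"
    using X by (auto simp: frac_def)
  have "a [^] (k + l) = q \<otimes> ((a [^] l \<otimes> inv q) \<otimes> a [^] k)"
    using unit_cancel(2)[OF q, of "a [^] l \<otimes> a [^] k"] qc by (simp add: pow_add E.m_ac)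
  then have 1: "a [^] (k + l) \<in> scal q X"
    using smodD(4)[OF Xs b(2) k(1)] unfolding scal_def by blast
  have 2: "a [^] (k + l) \<otimes> x \<in> carrier A" if x: "x \<in> scal q X" for x
  proof -
    obtain y where y: "x = q \<otimes> y" "y \<in> X" using x by (auto simp: scal_def)
    have "a [^] (k + l) \<otimes> x = (a [^] l \<otimes> q) \<otimes> (a [^] k \<otimes> y)"
      unfolding y(1) pow_add using qc smodD(1)[OF Xs y(2)] by (simp add: E.m_ac)
    then show ?thesis using A_closed(1)[OF b(1) k(2)[OF y(2)]] by simp
  qed
  show ?thesis unfolding frac_def by (intro conjI smod_scal[OF Xs qc(1)] exI[of _ "k + l"] 1 ballI 2)
qed

text \<open>Some a^k is a multiple rb of b, so b divides a unit of E; the same equation shows that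
  a^k clears the denominator of b^(-1).\<close>

lemma parameter_unit:
  assumes "is_parameter A b"
  shows "b \<in> Units E" "\<exists>k::nat. a [^] k \<otimes> inv b \<in> carrier A" "b \<in> carrier A"
proof -
  have bm: "b \<in> \<mm>" using assms by (simp add: is_parameter_def)
  note bA = m_A[OF bm]
  show "b \<in> carrier A" by (rule bA)
  obtain k :: nat where "a [^]\<^bsub>A\<^esub> k \<in> PIdl\<^bsub>A\<^esub> b" using assms a_m unfolding is_parameter_def by blast
  then obtain r where r: "r \<in> carrier A" "a [^] k = r \<otimes> b"
    using A_pow[OF a_A(1)] A_ops(1)[OF _ bA] by (auto simp: cgenideal_def)
  have rc: "r \<in> carrier E" "b \<in> carrier E" using r bA by auto
  have "b \<otimes> (p \<otimes> r) = p \<otimes> (r \<otimes> b)" if "p \<in> carrier E" for p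
    using that rc by (simp add: E.m_ac)
  then have "b \<otimes> (inv (a [^] k) \<otimes> r) = inv (a [^] k) \<otimes> (r \<otimes> b)" by simp
  then have 1: "b \<otimes> (inv (a [^] k) \<otimes> r) = \<one>"
    unfolding r(2)[symmetric] using E.Units_l_inv[OF pow_unit[of k]] by simp
  have ic: "inv (a [^] k) \<otimes> r \<in> carrier E" using rc by simp
  show bu: "b \<in> Units E" unfolding Units_def using 1 ic rc E.m_comm[OF rc(2) ic] by (intro CollectI conjI bexI[of _ "inv (a [^] k) \<otimes> r"]) simp_all
  have "a [^] k \<otimes> inv b = r" unfolding r(2) using rc bu by (simp add: E.m_assoc)
  then show "\<exists>k::nat. a [^] k \<otimes> inv b \<in> carrier A" using r(1) by (intro exI[of _ k]) simp
qed

text \<open>The submodules X, q^(-1) X, q^(-2) X and so on ascend inside a bounded set. Two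
  consecutive ones agree, and multiplying back by a power of q yields the claim.\<close>

lemma unit_chain_stable:
  assumes X: "smod X" and q: "q \<in> Units E" and qX: "scal q X \<subseteq> X"
    and b: "\<And>j x. x \<in> X \<Longrightarrow> a [^] (l::nat) \<otimes> (inv q [^] (j::nat) \<otimes> x) \<in> carrier A"
  shows "scal q X = X"
proof -
  have Xc: "X \<subseteq> carrier E" using X unfolding smod_iff by blast
  have qc: "q \<in> carrier E" "inv q \<in> carrier E" using q by auto
  define f where "f j = scal (inv q [^] j) X" for j :: nat
  have fS: "f (Suc j) = scal (inv q) (f j)" for j
    unfolding f_def using scal_scal[OF qc(2) E.nat_pow_closed[OF qc(2), of j] Xc] E.m_comm[of "inv q" "inv q [^] j"] qc by simp
  have fc: "f j \<subseteq> carrier E" for j unfolding f_def scal_def using Xc qc by auto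
  have X1: "X \<subseteq> scal (inv q) X"
    using scal_mono[OF qX, of "inv q"] scal_inv(1)[OF q Xc] by simp
  have mono: "f j \<subseteq> f (Suc j)" for j
  proof (induction j)
    case 0 show ?case unfolding f_def using X1 scal_one[OF Xc] qc by simp
  next
    case (Suc j) then show ?case using scal_mono[OF Suc, of "inv q"] unfolding fS by simp
  qed
  have "\<exists>T. \<forall>t\<ge>T. f t = f T"
  proof (rule noethD[OF noeth_bounded[where k = l and X = "\<Union>j. f j"]])
    show "(\<Union>j. f j) \<subseteq> carrier E" using fc by blast
    show "a [^] l \<otimes> x \<in> carrier A" if "x \<in> (\<Union>j. f j)" for x using that b unfolding f_def scal_def by auto
    show "submodule (f t) A (self_module E)" for t
      unfolding f_def smod_def[symmetric] by (rule smod_scal[OF X]) (simp add: qc)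
  qed (use mono in auto)
  then obtain T where T: "\<forall>t\<ge>T. f t = f T" by blast
  have iq: "inv q \<in> Units E" using q by (rule E.Units_inv_Units)
  have "scal (inv q) (f T) = f T" using T[rule_format, of "Suc T"] unfolding fS by simp
  then have "scal (inv q [^] T) (scal (inv q) X) = scal (inv q [^] T) X"
    unfolding f_def using scal_scal[OF qc(2) E.nat_pow_closed[OF qc(2), of T] Xc]
      scal_scal[OF E.nat_pow_closed[OF qc(2), of T] qc(2) Xc] E.m_comm[of "inv q" "inv q [^] T"] qc by simp
  then have "scal (inv (inv q [^] T)) (scal (inv q [^] T) (scal (inv q) X)) = scal (inv (inv q [^] T)) (scal (inv q [^] T) X)"
    by simp
  moreover have "scal (inv q) X \<subseteq> carrier E" using fc[of 1] fS[of 0] unfolding f_def using scal_one[OF Xc] by simp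
  ultimately have "scal (inv q) X = X"
    using scal_inv(1)[OF E.Units_pow_closed[OF iq, of T]] Xc by simp
  then show ?thesis using scal_inv(2)[OF q Xc] by simp
qed

text \<open>A pair (I, b) gives K' = b^(-1) I, which has type one and contains 1, so K' = qK with q
  in K' and q^(-1) in K. Multiplication by q maps S' = K'^2 into itself, and the chain argument
  turns this into qS' = S' because all powers of q^(-1) lie in the bounded set T. Hence K^2 = K'^2,
  and the two subquotients differ by a unit.\<close>

theorem n_goto_iff:
  assumes CM: "cohen_macaulay_local A" "krull_dim A = 1"
    and K: "type1 K" "frac K" "\<one> \<in> K"
    and T: "K \<subseteq> T" "T \<subseteq> carrier E" "\<And>x y. x \<in> T \<Longrightarrow> y \<in> T \<Longrightarrow> x \<otimes> y \<in> T"
      "\<And>x. x \<in> T \<Longrightarrow> a [^] (N::nat) \<otimes> x \<in> carrier A"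
  shows "n_goto n A \<longleftrightarrow>
     ideal_prod E K (ideal_prod E K K) = ideal_prod E K K \<and>
     chain_len (between A (self_module E) K (ideal_prod E K K)) = enat n"
proof
  have Ks: "smod K" using K by (simp add: frac_def)
  have Kc: "K \<subseteq> carrier E" using Ks unfolding smod_iff by blast
  note K2s = smod_prod[OF Ks Ks]
  let ?K2 = "ideal_prod E K K"
  have K2c: "?K2 \<subseteq> carrier E" by (rule prod_carrier[OF Kc Kc])
  {
    assume "n_goto n A"
    then obtain I b where I: "canonical_ideal A I" and b: "is_parameter A b" "b \<in> I"
      and I3: "ideal_power A I 3 = ideal_prod A (PIdl\<^bsub>A\<^esub> b) (ideal_power A I 2)"
      and len: "mod_length A (subquot A (ideal_power A I 2) (ideal_prod A (PIdl\<^bsub>A\<^esub> b) I)) = enat n"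
      unfolding n_goto_def by blast
    note bu = parameter_unit[OF b(1)]
    have bc: "b \<in> carrier E" "inv b \<in> carrier E" using bu by auto
    have Iid: "smod I" "I \<subseteq> carrier A" "I \<noteq> carrier A"
      using I unfolding canonical_ideal_def ideal_iff by blast+
    obtain k0 :: nat where k0: "a [^] k0 \<otimes> inv b \<in> carrier A" using bu(2) by blast
    have If: "frac I" unfolding frac_def
    proof (intro conjI Iid(1) exI[of _ k0] ballI)
      have "a [^] k0 = (a [^] k0 \<otimes> inv b) \<otimes> b" using bu(1) bc by (simp add: E.m_assoc)
      then show "a [^] k0 \<in> I" using smodD(4)[OF Iid(1) k0 b(2)] by simp
      show "a [^] k0 \<otimes> x \<in> carrier A" if "x \<in> I" for x using Iid(2) that A_closed(1)[OF pow_A(1)] by blast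
    qed
    have I1: "type1 I" using canonical_ideal_iff[OF CM Iid If] I by simp
    obtain q0 where q0: "q0 \<in> Units E" "I = scal q0 K" using type1_unique[OF K(1,2) I1 If] by blast
    define q where "q = inv b \<otimes> q0"
    have qu: "q \<in> Units E" unfolding q_def using bu(1) q0(1) by (intro E.Units_m_closed E.Units_inv_Units)
    have qc: "q \<in> carrier E" "inv q \<in> carrier E" using qu by auto
    define K' where "K' = scal q K"
    have K's: "smod K'" unfolding K'_def by (rule smod_scal[OF Ks qc(1)])
    have K'c: "K' \<subseteq> carrier E" using K's unfolding smod_iff by blast
    have IK': "I = scal b K'"
      unfolding K'_def scal_scal[OF bc(1) qc(1) Kc]
      unfolding q_def unit_cancel(2)[OF bu(1) E.Units_closed[OF q0(1)]] by (rule q0(2))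
    have K'I: "K' = scal (inv b) I" unfolding IK' by (rule scal_inv(1)[OF bu(1) K'c, symmetric])
    have oneK': "\<one> \<in> K'" unfolding K'I scal_def using b(2) bu(1) by (intro image_eqI[of _ _ b]) simp_all
    have qK': "q \<in> K'" unfolding K'_def scal_def using K(3) qc by (intro image_eqI[of _ _ \<one>]) simp_all
    have iqK: "inv q \<in> K"
    proof -
      obtain x where x: "\<one> = q \<otimes> x" "x \<in> K" using oneK' unfolding K'_def scal_def by blast
      have "inv q = inv q \<otimes> (q \<otimes> x)" unfolding x(1)[symmetric] using qc by simp
      also have "\<dots> = x" using unit_cancel(1)[OF qu] x(2) Kc by blast
      finally show ?thesis using x(2) by simp
    qed
    define S' where "S' = ideal_prod E K' K'"
    have S's: "smod S'" unfolding S'_def by (rule smod_prod[OF K's K's])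
    have S'c: "S' \<subseteq> carrier E" using S's unfolding smod_iff by blast
    have I2: "ideal_prod E I I = scal (b \<otimes> b) S'"
      unfolding S'_def IK' by (rule prod_scal[OF K's K's bc(1) bc(1)])
    note ip = ideal_power_eq[OF Iid(1,2)]
    have "ideal_prod E I (ideal_prod E I I) = scal b (ideal_prod E I I)"
      using I3 unfolding ip(1,2) PIdl_prod[OF bu(3) smod_prod[OF Iid(1,1)] ip(3)] .
    then have "scal (b \<otimes> (b \<otimes> b)) (ideal_prod E K' S') = scal (b \<otimes> (b \<otimes> b)) S'"
      unfolding I2 using prod_scal[OF K's S's bc(1), of "b \<otimes> b"] scal_scal[OF bc(1) _ S'c, of "b \<otimes> b"] bc
      unfolding IK'[symmetric] by simp
    moreover have b3: "b \<otimes> (b \<otimes> b) \<in> Units E" using bu(1) by (intro E.Units_m_closed)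
    ultimately have K'S': "ideal_prod E K' S' = S'"
      using scal_inv(1)[OF b3 S'c] scal_inv(1)[OF b3 prod_carrier[OF K'c S'c]] by simp
    have b2: "b \<otimes> b \<in> Units E" using bu(1) by (intro E.Units_m_closed)
    \<comment> \<open>The equation K'S' = S' is I^3 = bI^2 divided by b^3, and q is an element of
      K'.\<close>
    have qS'sub: "scal q S' \<subseteq> S'"
      using ideal_prod.prod[OF qK', of _ S' E] unfolding K'S' scal_def by blast
    \<comment> \<open>Here a^N clears the denominators of the powers of q^(-1), which lie in T, and
      a^(2 k0) those of S' = b^(-2) I^2.\<close>
    have qS': "scal q S' = S'"
    proof (rule unit_chain_stable[OF S's qu qS'sub, where l = "N + (k0 + k0)"])
      fix j :: nat and x assume x: "x \<in> S'"
      have ijT: "inv q [^] j \<in> T" 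
      proof (induction j)
        case 0 show ?case using K(3) T(1) by auto
      next
        case (Suc j) then show ?case using T(3)[OF Suc] iqK T(1) by auto
      qed
      have xc: "x \<in> carrier E" using x S'c by blast
      have "a [^] (k0 + k0) \<otimes> x \<in> carrier A"
      proof -
        let ?r = "a [^] k0 \<otimes> inv b"
        have "b \<otimes> b \<otimes> x \<in> ideal_prod E I I" unfolding I2 scal_def using x by blast
        then have bx: "b \<otimes> b \<otimes> x \<in> carrier A" using ip(3) by blast
        have "a [^] (k0 + k0) \<otimes> x = (?r \<otimes> ?r) \<otimes> (b \<otimes> b \<otimes> x)"
        proof -
          have "(a [^] k0 \<otimes> ib) \<otimes> (a [^] k0 \<otimes> ib) \<otimes> (b \<otimes> b \<otimes> x) = (b \<otimes> ib) \<otimes> ((b \<otimes> ib) \<otimes> (a [^] (k0 + k0) \<otimes> x))"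
            if "ib \<in> carrier E" for ib using that bc xc unfolding pow_add by (simp add: E.m_ac)
          from this[OF bc(2)] show ?thesis using bu(1) xc by simp
        qed
        then show ?thesis using A_closed(1)[OF A_closed(1)[OF k0 k0] bx] by simp
      qed
      then have "(a [^] N \<otimes> inv q [^] j) \<otimes> (a [^] (k0 + k0) \<otimes> x) \<in> carrier A"
        by (rule A_closed(1)[OF T(4)[OF ijT]])
      moreover have "a [^] (N + (k0 + k0)) \<otimes> (inv q [^] j \<otimes> x) = (a [^] N \<otimes> inv q [^] j) \<otimes> (a [^] (k0 + k0) \<otimes> x)"
        unfolding pow_add[of N "k0 + k0"] using xc qc by (simp add: E.m_ac)
      ultimately show "a [^] (N + (k0 + k0)) \<otimes> (inv q [^] j \<otimes> x) \<in> carrier A" by simp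
    qed
    have iqS': "scal (inv q) S' = S'" using scal_inv(1)[OF qu S'c] unfolding qS' .
    have KK': "K = scal (inv q) K'" unfolding K'_def by (rule scal_inv(1)[OF qu Kc, symmetric])
    have "?K2 = scal (inv q) (scal (inv q) S')"
      unfolding KK' prod_scal[OF K's K's qc(2,2)] scal_scal[OF qc(2,2) S'c] unfolding S'_def ..
    then have K2S': "?K2 = S'" unfolding iqS' .
    have K3: "ideal_prod E K ?K2 = ?K2"
      unfolding K2S' unfolding KK' prod_scal_left[OF K's S's qc(2)] K'S' iqS' ..
    have "chain_len (between A (self_module E) (scal b I) (ideal_prod E I I)) = enat n"
    proof -
      have Im: "submodule (ideal_prod E I I) A (self_module A)"
        unfolding submodule_A_iff using smod_prod[OF Iid(1,1)] ip(3) by blast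
      have bI: "scal b I \<subseteq> ideal_prod E I I"
        unfolding scal_def using ideal_prod.prod[OF b(2), of _ I E] by blast
      have bIm: "submodule (scal b I) A (self_module A)"
        unfolding submodule_A_iff using smod_scal[OF Iid(1) bc(1)] bI ip(3) by blast
      show ?thesis
        using len mod_length_quot_restrict[OF AA.Emod Im bIm bI]
        unfolding subquot_def ip(1) PIdl_prod[OF bu(3) Iid(1,2)] between_A_eq[OF ip(3)] by simp
    qed
    \<comment> \<open>The subquotient I^2/bI is b^2 q times K^2/K: indeed bI = b^2 qK, and I^2 = b^2
      S' = b^2 qS' = b^2 qK^2.\<close>
    moreover have "scal b I = scal (b \<otimes> b \<otimes> q) K"
      unfolding IK' scal_scal[OF bc(1,1) K'c] unfolding K'_def using scal_scal[of "b \<otimes> b" q K] bc qc Kc by simp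
    moreover have "ideal_prod E I I = scal (b \<otimes> b \<otimes> q) ?K2"
      unfolding I2 K2S' using scal_scal[of "b \<otimes> b" q S'] bc qc S'c qS' by simp
    moreover have "b \<otimes> b \<otimes> q \<in> Units E" using b2 qu by (rule E.Units_m_closed)
    ultimately have "chain_len (between A (self_module E) K ?K2) = enat n"
      using chain_len_scal[OF _ K2c Kc, of "b \<otimes> b \<otimes> q"] by simp
    then show "ideal_prod E K ?K2 = ?K2 \<and> chain_len (between A (self_module E) K ?K2) = enat n"
      using K3 by simp
  }
  {
    assume *: "ideal_prod E K ?K2 = ?K2 \<and> chain_len (between A (self_module E) K ?K2) = enat n"
    obtain k :: nat where k: "a [^] k \<in> K" "\<And>x. x \<in> K \<Longrightarrow> a [^] k \<otimes> x \<in> carrier A"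
      using K(2) by (auto simp: frac_def)
    \<comment> \<open>The factor a^k moves K into A; the additional factor a moves bK into
      \<open>\<mm>\<close>, so that I = bK is a proper ideal.\<close>
    define b where "b = a [^] (k + 1)"
    have bu: "b \<in> Units E" unfolding b_def by (rule pow_unit)
    have bc: "b \<in> carrier E" "inv b \<in> carrier E" using bu by auto
    have b_eq: "b = a \<otimes> a [^] k" unfolding b_def by (simp add: E.m_comm)
    have bm: "b \<in> \<mm>"
      using m.I_r_closed[OF a_m pow_A(1)[of k]] A_ops(1)[OF a_A(1) pow_A(1)[of k]] unfolding b_eq by simp
    have bA: "b \<in> carrier A" by (rule m_A[OF bm])
    define I where "I = scal b K"
    have Is: "smod I" unfolding I_def by (rule smod_scal[OF Ks bc(1)])
    have Im: "I \<subseteq> \<mm>"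
    proof
      fix x assume "x \<in> I"
      then obtain y where y: "x = b \<otimes> y" "y \<in> K" unfolding I_def scal_def by blast
      have "x = a \<otimes> (a [^] k \<otimes> y)" unfolding y(1) b_eq using y(2) Kc by (simp add: E.m_assoc subset_iff)
      then show "x \<in> \<mm>" using m.I_r_closed[OF a_m k(2)[OF y(2)]] A_ops(1)[OF a_A(1) k(2)[OF y(2)]] by simp
    qed
    have IA: "I \<subseteq> carrier A" using Im m_A by blast
    have Ine: "I \<noteq> carrier A" using Im m.I_notcarr m.a_subset by blast
    have If: "frac I" unfolding I_def
    proof (rule frac_scal[OF K(2) bu, where l = "k + 1"])
      show "a [^] (k + 1) \<otimes> b \<in> carrier A" by (rule A_closed(1)[OF pow_A(1) bA])
      have "a [^] (k + 1) \<otimes> inv b = \<one>" unfolding b_def[symmetric] using bu by simp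
      then show "a [^] (k + 1) \<otimes> inv b \<in> carrier A" using A_closed(6) by simp
    qed
    have can: "canonical_ideal A I"
      unfolding canonical_ideal_iff[OF CM Is IA Ine If] unfolding I_def by (rule type1_scal[OF K(1) bu])
    have bI: "b \<in> I" unfolding I_def scal_def using K(3) bc by (intro image_eqI[of _ _ \<one>]) simp_all
    have par: "is_parameter A b" unfolding is_parameter_def
    proof (intro conjI bm ballI)
      fix x assume x: "x \<in> \<mm>"
      have P: "submodule (PIdl\<^bsub>A\<^esub> b) A (self_module A)"
        unfolding PIdl_eq[OF bA] submodule_A_iff using smod_scal[OF smod_A bc(1)] A_closed(1)[OF bA] by (auto simp: scal_def)
      have "\<exists>j::nat. (x [^]\<^bsub>A\<^esub> j) \<odot>\<^bsub>self_module A\<^esub> \<one>\<^bsub>A\<^esub> \<in> PIdl\<^bsub>A\<^esub> b"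
      proof (rule nilpotent_mod[OF AA.Emod P _ _ x, of _ "k + 1"])
        show "a [^]\<^bsub>A\<^esub> (k + 1) \<odot>\<^bsub>self_module A\<^esub> \<one>\<^bsub>A\<^esub> \<in> PIdl\<^bsub>A\<^esub> b"
          using A_pow[OF a_A(1), of "k + 1"] A.cgenideal_self[OF bA] bA by (simp add: b_def del: E.nat_pow_Suc A.nat_pow_Suc)
      qed simp
      then show "\<exists>j::nat. x [^]\<^bsub>A\<^esub> j \<in> PIdl\<^bsub>A\<^esub> b" using m_A[OF x] by simp
    qed
    note ip = ideal_power_eq[OF Is IA]
    have I2: "ideal_prod E I I = scal (b \<otimes> b) ?K2" unfolding I_def by (rule prod_scal[OF Ks Ks bc(1,1)])
    have bbc: "b \<otimes> b \<in> carrier E" using bc by simp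
    have "ideal_prod E I (ideal_prod E I I) = scal (b \<otimes> (b \<otimes> b)) ?K2"
      unfolding I2 unfolding I_def prod_scal[OF Ks K2s bc(1) bbc] using * by simp
    also have "\<dots> = scal b (ideal_prod E I I)" unfolding I2 by (rule scal_scal[OF bc(1) bbc K2c, symmetric])
    finally have I3: "ideal_power A I 3 = ideal_prod A (PIdl\<^bsub>A\<^esub> b) (ideal_power A I 2)"
      unfolding ip(1,2) PIdl_prod[OF bA smod_prod[OF Is Is] ip(3)] .
    have len: "mod_length A (subquot A (ideal_power A I 2) (ideal_prod A (PIdl\<^bsub>A\<^esub> b) I)) = enat n"
    proof -
      have Im: "submodule (ideal_prod E I I) A (self_module A)"
        unfolding submodule_A_iff using smod_prod[OF Is Is] ip(3) by blast
      have bI': "scal b I \<subseteq> ideal_prod E I I"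
        unfolding scal_def using ideal_prod.prod[OF bI, of _ I E] by blast
      have bIm: "submodule (scal b I) A (self_module A)"
        unfolding submodule_A_iff using smod_scal[OF Is bc(1)] bI' ip(3) by blast
      have e: "scal b I = scal (b \<otimes> b) K" unfolding I_def by (rule scal_scal[OF bc(1,1) Kc])
      have "mod_length A (subquot A (ideal_power A I 2) (ideal_prod A (PIdl\<^bsub>A\<^esub> b) I)) =
          chain_len (between A (self_module E) (scal b I) (ideal_prod E I I))"
        unfolding subquot_def ip(1) PIdl_prod[OF bA Is IA] mod_length_quot_restrict[OF AA.Emod Im bIm bI'] between_A_eq[OF ip(3)] ..
      also have "\<dots> = chain_len (between A (self_module E) K ?K2)"
        unfolding e I2 by (rule chain_len_scal[OF E.Units_m_closed[OF bu bu] K2c Kc])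
      finally show ?thesis using * by simp
    qed
    show "n_goto n A" unfolding n_goto_def using CM can par bI I3 len by blast
  }
qed

end

section \<open>Quasi-trivial extensions\<close>

lemma noeth_imp_noetherian_ring:
  assumes "cring R" "noeth R (self_module R) (carrier R)"
  shows "noetherian_ring R"
proof -
  interpret cring R by fact
  interpret RR: overring R R by unfold_locales (simp add: ring_hom_def)
  show ?thesis
  proof (rule trivial_ideal_chain_imp_noetherian)
    fix C assume C: "C \<noteq> {}" "subset.chain {I. ideal I R} C"
    have Cs: "submodule X R (self_module R) \<and> X \<subseteq> carrier R" if "X \<in> C" for X
      using C(2) that RR.ideal_iff[of X] RR.submodule_A_iff[of X] by (auto simp: subset_chain_def)
    obtain X where X: "X \<in> C" "\<And>Y. Y \<in> C \<Longrightarrow> X \<subseteq> Y \<Longrightarrow> Y = X"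
      using noeth_maximal[OF assms(2) C(1) Cs] by blast
    have "Y \<subseteq> X" if "Y \<in> C" for Y
    proof -
      have "Y \<subseteq> X \<or> X \<subseteq> Y" using C(2) X(1) that by (auto simp: subset_chain_def)
      then show ?thesis using X(2)[OF that] by blast
    qed
    then have "\<Union>C = X" using X(1) by blast
    then show "\<Union>C \<in> C" using X(1) by simp
  qed
qed

text \<open>A proper ideal outside of which every element is a unit contains every proper
  ideal.\<close>

lemma (in cring) unique_maximalideal:
  assumes M: "ideal M R" "M \<noteq> carrier R" and u: "\<And>x. x \<in> carrier R \<Longrightarrow> x \<notin> M \<Longrightarrow> x \<in> Units R"
  shows "maximalideal M R" "\<And>J. maximalideal J R \<Longrightarrow> J = M"
proof -
  have sub: "J \<subseteq> M" if J: "ideal J R" "J \<noteq> carrier R" for J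
  proof
    interpret J: ideal J R by (rule J(1))
    fix x assume x: "x \<in> J"
    show "x \<in> M"
    proof (rule ccontr)
      assume "x \<notin> M"
      then have ux: "x \<in> Units R" using u[of x] J.Icarr[OF x] by blast
      then have "inv x \<otimes> x \<in> J" using J.I_l_closed[OF x, of "inv x"] by simp
      then have "\<one> \<in> J" using ux by simp
      then show False using J.one_imp_carrier J(2) by simp
    qed
  qed
  show mM: "maximalideal M R"
  proof (rule maximalidealI[OF M(1)])
    show "carrier R \<noteq> M" using M(2) by simp
    fix J assume "ideal J R" "M \<subseteq> J" "J \<subseteq> carrier R"
    then show "J = M \<or> J = carrier R" using sub[of J] by blast
  qed
  fix J assume J: "maximalideal J R"
  interpret J: maximalideal J R by (rule J)
  have "J \<subseteq> M" using sub[OF J.is_ideal] J.I_notcarr by auto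
  then show "J = M" using J.I_maximal[OF M(1)] M(2) ideal.Icarr[OF M(1)] by blast
qed

context overring
begin

lemma smod_colon:
  assumes X: "smod X" and Y: "Y \<subseteq> carrier E" shows "smod {z \<in> carrier E. \<forall>s\<in>Y. z \<otimes> s \<in> X}"
proof (rule smodI)
  have Yc: "s \<in> carrier E" if "s \<in> Y" for s using that Y by blast
  show "\<zero> \<in> {z \<in> carrier E. \<forall>s\<in>Y. z \<otimes> s \<in> X}" using smodD(2)[OF X] Yc by simp
  show "x \<oplus> y \<in> {z \<in> carrier E. \<forall>s\<in>Y. z \<otimes> s \<in> X}"
    if "x \<in> {z \<in> carrier E. \<forall>s\<in>Y. z \<otimes> s \<in> X}" "y \<in> {z \<in> carrier E. \<forall>s\<in>Y. z \<otimes> s \<in> X}" for x y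
    using that smodD(3)[OF X] Yc by (simp add: E.l_distr)
  show "r \<otimes> x \<in> {z \<in> carrier E. \<forall>s\<in>Y. z \<otimes> s \<in> X}"
    if "r \<in> carrier A" "x \<in> {z \<in> carrier E. \<forall>s\<in>Y. z \<otimes> s \<in> X}" for r x
    using that smodD(4)[OF X that(1)] Yc by (simp add: E.m_assoc)
qed blast

end

context noeth_local
begin

text \<open>An ideal P maximal among those that contain I and no power of y is prime: if uv were in
  P but neither u nor v, then adjoining u and adjoining v would capture powers y^k and y^l, and y^(k
  + l) would lie in P.\<close>

lemma prime_avoiding:
  assumes I: "ideal I A" and y: "y \<in> carrier A" "\<And>k::nat. y [^] k \<notin> I"
  shows "\<exists>P. primeideal P A \<and> I \<subseteq> P \<and> y \<notin> P"
proof -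
  define F where "F = {J. ideal J A \<and> I \<subseteq> J \<and> (\<forall>k::nat. y [^] k \<notin> J)}"
  have "\<exists>P\<in>F. \<forall>P'\<in>F. P \<subseteq> P' \<longrightarrow> P' = P"
  proof (rule noeth_maximal[OF noeth_A])
    show "F \<noteq> {}" using I y by (auto simp: F_def)
  qed (auto simp: F_def AA.ideal_iff AA.smod_def)
  then obtain P where PF: "P \<in> F" and mx: "\<And>P'. P' \<in> F \<Longrightarrow> P \<subseteq> P' \<Longrightarrow> P' = P" by blast
  have P: "ideal P A" "I \<subseteq> P" "\<And>k::nat. y [^] k \<notin> P" using PF by (auto simp: F_def)
  interpret P: ideal P A by (rule P(1))
  have Ps: "AA.smod P" using P(1) AA.ideal_iff by blast
  have big: "\<exists>k::nat. \<exists>p\<in>P. \<exists>r\<in>carrier A. y [^] k = p \<oplus> r \<otimes> u" if u: "u \<in> carrier A" "u \<notin> P" for u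
  proof -
    let ?N = "{n \<oplus> r \<otimes> u | n r. n \<in> P \<and> r \<in> carrier A}"
    note ad = AA.smod_adjoin[OF Ps u(1)]
    have "?N \<subseteq> carrier A" using ad(1) unfolding AA.smod_iff by blast
    then have "ideal ?N A" using ad(1) AA.ideal_iff by blast
    moreover have "?N \<noteq> P" using ad(3) u(2) by blast
    ultimately have "?N \<notin> F" using mx[of ?N] ad(2) by blast
    then obtain k :: nat where "y [^] k \<in> ?N" using \<open>ideal ?N A\<close> ad(2) P(2) unfolding F_def by blast
    then show ?thesis by blast
  qed
  have "primeideal P A"
  proof (rule primeidealI[OF P(1) A.is_cring])
    show "carrier A \<noteq> P" using P(3)[of 0] by auto
    fix u v assume uv: "u \<in> carrier A" "v \<in> carrier A" "u \<otimes> v \<in> P"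
    show "u \<in> P \<or> v \<in> P"
    proof (rule ccontr)
      assume "\<not> ?thesis"
      then have n: "u \<notin> P" "v \<notin> P" by auto
      obtain k p r where 1: "p \<in> P" "r \<in> carrier A" "y [^] (k::nat) = p \<oplus> r \<otimes> u" using big[OF uv(1) n(1)] by blast
      obtain l p' r' where 2: "p' \<in> P" "r' \<in> carrier A" "y [^] (l::nat) = p' \<oplus> r' \<otimes> v" using big[OF uv(2) n(2)] by blast
      have c: "p \<in> carrier A" "p' \<in> carrier A" using 1 2 P.Icarr by auto
      have "y [^] (k + l) = (p \<oplus> r \<otimes> u) \<otimes> (p' \<oplus> r' \<otimes> v)"
        unfolding 1(3)[symmetric] 2(3)[symmetric] using y(1) by (simp add: A.nat_pow_mult)
      also have "\<dots> = (p' \<oplus> r' \<otimes> v) \<otimes> p \<oplus> ((r \<otimes> u) \<otimes> p' \<oplus> (r \<otimes> r') \<otimes> (u \<otimes> v))"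
        using c 1(2) 2(2) uv(1,2) by algebra
      also have "\<dots> \<in> P"
      proof (intro P.a_closed)
        show "(p' \<oplus> r' \<otimes> v) \<otimes> p \<in> P" by (rule P.I_l_closed[OF 1(1)]) (use c(2) 2(2) uv(2) in simp)
        show "(r \<otimes> u) \<otimes> p' \<in> P" by (rule P.I_l_closed[OF 2(1)]) (use 1(2) uv(1) in simp)
        show "(r \<otimes> r') \<otimes> (u \<otimes> v) \<in> P" by (rule P.I_l_closed[OF uv(3)]) (use 1(2) 2(2) in simp)
      qed
      finally show False using P(3) by blast
    qed
  qed
  then show ?thesis using P(2) P(3)[of 1] y(1) by auto
qed

end

text \<open>Elements of B and F are written \<open>h x y\<close> with coordinates in Q that multiply
  as in a quasi-trivial extension. Leaving h open covers both presentations: h is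
  \<open>Pair\<close> for the quasi-trivial extensions, and \<open>h x y\<close> is (x, x + y) for
  the fiber product inside Q x Q. The exponent N clears the denominators of S.\<close>

locale quasi_extension = param_overring R Q a
  for R :: "('a, 'm) ring_scheme" and Q :: "('a, 'n) ring_scheme" (structure) and a +
  fixes K S \<cc> :: "'a set" and \<alpha> :: 'a and N :: nat
    and B F :: "('b, 'k) ring_scheme" and h :: "'a \<Rightarrow> 'a \<Rightarrow> 'b"
  assumes CM_R: "krull_dim R = 1"
    and K: "type1 K" "frac K" "\<one> \<in> K"
    and S: "smod S" "K \<subseteq> S" "\<And>x y. x \<in> S \<Longrightarrow> y \<in> S \<Longrightarrow> x \<otimes> y \<in> S" "\<And>x. x \<in> S \<Longrightarrow> a [^] N \<otimes> x \<in> carrier R"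
    and c: "\<cc> = {z \<in> carrier Q. \<forall>s\<in>S. z \<otimes> s \<in> carrier R}"
    and \<alpha>: "\<alpha> \<in> {\<zero>, \<one>}"
    and B: "cring B" and F: "cring F" and BF: "id \<in> ring_hom B F"
    and B_carrier: "carrier B = (\<lambda>(x, y). h x y) ` (carrier R \<times> \<cc>)"
    and F_carrier: "carrier F = (\<lambda>(x, y). h x y) ` (carrier Q \<times> carrier Q)"
    and h_eq: "\<And>x y x' y'. x \<in> carrier Q \<Longrightarrow> y \<in> carrier Q \<Longrightarrow> x' \<in> carrier Q \<Longrightarrow> y' \<in> carrier Q \<Longrightarrow>
      h x y = h x' y' \<longleftrightarrow> x = x' \<and> y = y'"
    and h_add: "\<And>x y x' y'. x \<in> carrier Q \<Longrightarrow> y \<in> carrier Q \<Longrightarrow> x' \<in> carrier Q \<Longrightarrow> y' \<in> carrier Q \<Longrightarrow>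
      h x y \<oplus>\<^bsub>F\<^esub> h x' y' = h (x \<oplus> x') (y \<oplus> y')"
    and h_mult: "\<And>x y x' y'. x \<in> carrier Q \<Longrightarrow> y \<in> carrier Q \<Longrightarrow> x' \<in> carrier Q \<Longrightarrow> y' \<in> carrier Q \<Longrightarrow>
      h x y \<otimes>\<^bsub>F\<^esub> h x' y' = h (x \<otimes> x') (x \<otimes> y' \<oplus> x' \<otimes> y \<oplus> \<alpha> \<otimes> (y \<otimes> y'))"
    and h_one: "\<one>\<^bsub>F\<^esub> = h \<one> \<zero>"
begin

lemma \<alpha>R: "\<alpha> \<in> carrier R" "\<alpha> \<in> carrier Q" using \<alpha> A_closed(5,6) by auto

sublocale BF: overring B F
  by (intro overring.intro B F overring_axioms.intro BF)

lemma Sc: "s \<in> S \<Longrightarrow> s \<in> carrier Q" using smodD(1)[OF S(1)] .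
lemma Kc: "x \<in> K \<Longrightarrow> x \<in> carrier Q" using S(2) Sc by blast
lemma Ks: "smod K" using K by (simp add: frac_def)
lemma RK: "r \<in> carrier R \<Longrightarrow> r \<in> K" using smodD(4)[OF Ks _ K(3), of r] by simp
lemma oneS: "\<one> \<in> S" using K(3) S(2) by blast

lemma cI: "z \<in> carrier Q \<Longrightarrow> (\<And>s. s \<in> S \<Longrightarrow> z \<otimes> s \<in> carrier R) \<Longrightarrow> z \<in> \<cc>"
  unfolding c by blast

lemma cD: "z \<in> \<cc> \<Longrightarrow> s \<in> S \<Longrightarrow> z \<otimes> s \<in> carrier R" "z \<in> \<cc> \<Longrightarrow> z \<in> carrier R"
proof -
  show 1: "z \<in> \<cc> \<Longrightarrow> s \<in> S \<Longrightarrow> z \<otimes> s \<in> carrier R" for s unfolding c by blast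
  show "z \<in> \<cc> \<Longrightarrow> z \<in> carrier R" using 1[OF _ oneS] unfolding c by simp
qed

lemma cQ: "z \<in> \<cc> \<Longrightarrow> z \<in> carrier Q" using cD(2) by blast

lemma c_smod: "smod \<cc>"
  unfolding c by (rule smod_colon[OF smod_A]) (use Sc in blast)

lemma c_S: assumes "z \<in> \<cc>" "s \<in> S" shows "z \<otimes> s \<in> \<cc>"
proof (rule cI)
  show "z \<otimes> s \<in> carrier Q" using cQ[OF assms(1)] Sc[OF assms(2)] by simp
  fix t assume t: "t \<in> S"
  have "z \<otimes> s \<otimes> t = z \<otimes> (s \<otimes> t)" using cQ[OF assms(1)] Sc[OF assms(2)] Sc[OF t] by (simp add: E.m_assoc)
  then show "z \<otimes> s \<otimes> t \<in> carrier R" using cD(1)[OF assms(1) S(3)[OF assms(2) t]] by simp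
qed

lemma aN_c: assumes "s \<in> S" shows "a [^] N \<otimes> s \<in> \<cc>"
proof (rule cI)
  show "a [^] N \<otimes> s \<in> carrier Q" using Sc[OF assms] by simp
  fix t assume t: "t \<in> S"
  have "a [^] N \<otimes> s \<otimes> t = a [^] N \<otimes> (s \<otimes> t)" using Sc[OF assms] Sc[OF t] by (simp add: E.m_assoc)
  then show "a [^] N \<otimes> s \<otimes> t \<in> carrier R" using S(4)[OF S(3)[OF assms t]] by simp
qed

lemma cK: "z \<in> \<cc> \<Longrightarrow> z \<in> K" using cD(2) RK by blast

lemma Sf: "frac S" unfolding frac_def
  by (intro conjI S(1) exI[of _ N] ballI S(4)) (use RK[OF pow_A(1)] S(2) in auto)

lemma Rf: "frac (carrier R)" unfolding frac_def
  by (intro conjI smod_A exI[of _ 0] ballI) (auto simp: A_closed)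

text \<open>Since K : R = K, duality gives K : K = K : (K : R) = R.\<close>

lemma K_colon_K: assumes p: "p \<in> carrier Q" "\<And>x. x \<in> K \<Longrightarrow> p \<otimes> x \<in> K" shows "p \<in> carrier R"
proof (rule double_dual[OF K(1,2) Rf p(1)])
  fix y assume y: "y \<in> carrier Q" "\<And>x. x \<in> carrier R \<Longrightarrow> x \<otimes> y \<in> K"
  have "y \<in> K" using y(2)[OF A_closed(6)] y(1) by simp
  then show "p \<otimes> y \<in> K" by (rule p(2))
qed

text \<open>If yS lies in K, then for s in S also ysK lies in yS and hence in K, so ys is in K : K =
  R. Thus K : S = R : S.\<close>

lemma K_colon_S: assumes y: "y \<in> carrier Q" "\<And>s. s \<in> S \<Longrightarrow> s \<otimes> y \<in> K" shows "y \<in> \<cc>"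
proof (rule cI[OF y(1)])
  fix s assume s: "s \<in> S"
  show "y \<otimes> s \<in> carrier R"
  proof (rule K_colon_K)
    show "y \<otimes> s \<in> carrier Q" using y(1) Sc[OF s] by simp
    fix x assume x: "x \<in> K"
    have "s \<otimes> x \<in> S" using S(2,3) s x by blast
    then have "(s \<otimes> x) \<otimes> y \<in> K" by (rule y(2))
    then show "y \<otimes> s \<otimes> x \<in> K" using y(1) Sc[OF s] Kc[OF x] by (simp add: E.m_ac)
  qed
qed

text \<open>Dualizing K : S = \<open>\<cc>\<close> gives K : \<open>\<cc>\<close> = S.\<close>

lemma K_colon_c: assumes p: "p \<in> carrier Q" "\<And>x. x \<in> \<cc> \<Longrightarrow> p \<otimes> x \<in> K" shows "p \<in> S"
  by (rule double_dual[OF K(1,2) Sf p(1)]) (use K_colon_S p(2) in blast)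

lemma hF [intro]: "x \<in> carrier Q \<Longrightarrow> y \<in> carrier Q \<Longrightarrow> h x y \<in> carrier F"
  unfolding F_carrier by force

lemma hB: "x \<in> carrier Q \<Longrightarrow> y \<in> carrier Q \<Longrightarrow> h x y \<in> carrier B \<longleftrightarrow> x \<in> carrier R \<and> y \<in> \<cc>"
  unfolding B_carrier using h_eq cQ by fastforce

lemma BE: assumes "z \<in> carrier B" obtains x y where "z = h x y" "x \<in> carrier R" "y \<in> \<cc>" "x \<in> carrier Q" "y \<in> carrier Q"
  using assms unfolding B_carrier using cQ by force

lemma FE: assumes "z \<in> carrier F" obtains x y where "z = h x y" "x \<in> carrier Q" "y \<in> carrier Q"
  using assms unfolding F_carrier by force

lemma h_zero: "\<zero>\<^bsub>F\<^esub> = h \<zero> \<zero>"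
proof -
  have z: "h \<zero> \<zero> \<in> carrier F" by (rule hF) auto
  have "h \<zero> \<zero> \<oplus>\<^bsub>F\<^esub> h \<zero> \<zero> = h \<zero> \<zero>" using h_add[of \<zero> \<zero> \<zero> \<zero>] by simp
  then show ?thesis using BF.E.add.l_cancel_one'[OF z z] by simp
qed

lemma h_uminus: "x \<in> carrier Q \<Longrightarrow> y \<in> carrier Q \<Longrightarrow> \<ominus>\<^bsub>F\<^esub> h x y = h (\<ominus> x) (\<ominus> y)"
  by (rule BF.E.minus_equality) (use h_add[of "\<ominus> x" "\<ominus> y" x y] in \<open>auto simp: h_zero E.l_neg\<close>)

lemma h_minus: "x \<in> carrier Q \<Longrightarrow> y \<in> carrier Q \<Longrightarrow> x' \<in> carrier Q \<Longrightarrow> y' \<in> carrier Q \<Longrightarrow>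
    h x y \<ominus>\<^bsub>F\<^esub> h x' y' = h (x \<ominus> x') (y \<ominus> y')"
  unfolding a_minus_def by (simp add: h_uminus h_add)

lemma h_scalar: "r \<in> carrier Q \<Longrightarrow> x \<in> carrier Q \<Longrightarrow> y \<in> carrier Q \<Longrightarrow> h r \<zero> \<otimes>\<^bsub>F\<^esub> h x y = h (r \<otimes> x) (r \<otimes> y)"
  using h_mult[of r \<zero> x y] \<alpha>R by simp

lemma h_scalar_B: "r \<in> carrier R \<Longrightarrow> h r \<zero> \<in> carrier B"
  using hB[of r \<zero>] smodD(2)[OF c_smod] by auto

lemma h_pow: "r \<in> carrier Q \<Longrightarrow> h r \<zero> [^]\<^bsub>F\<^esub> (k::nat) = h (r [^] k) \<zero>"
proof (induction k)
  case (Suc k)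
  then show ?case using h_scalar[of "r [^] k" r \<zero>] by simp
qed (simp add: h_one)

text \<open>In these coordinates \<open>ext K\<close> is the module L, and \<open>ext S\<close>
  turns out to be L^2.\<close>

definition ext :: "'a set \<Rightarrow> 'b set" where "ext X = (\<lambda>(x, y). h x y) ` (S \<times> X)"

lemma ext_iff: "x \<in> carrier Q \<Longrightarrow> y \<in> carrier Q \<Longrightarrow> X \<subseteq> carrier Q \<Longrightarrow> h x y \<in> ext X \<longleftrightarrow> x \<in> S \<and> y \<in> X"
  unfolding ext_def using h_eq Sc by fastforce

lemma extE: assumes "z \<in> ext X" "X \<subseteq> carrier Q" obtains s x where "z = h s x" "s \<in> S" "x \<in> X" "s \<in> carrier Q" "x \<in> carrier Q"
  using assms unfolding ext_def using Sc by force

text \<open>The terms of a product that involve the \<open>\<cc>\<close>-coordinate of the scalar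
  land in \<open>\<cc>\<close>S = \<open>\<cc>\<close>, which lies in R and hence in K and in
  X.\<close>

lemma ext_smod:
  assumes X: "smod X" "K \<subseteq> X" "X \<subseteq> S" shows "BF.smod (ext X)"
proof -
  note XD = smodD[OF X(1)] and SD = smodD[OF S(1)]
  have Xc: "X \<subseteq> carrier Q" using XD(1) by blast
  show ?thesis
  proof (rule BF.smodI)
    show "ext X \<subseteq> carrier F" unfolding ext_def using Sc Xc by auto
    show "\<zero>\<^bsub>F\<^esub> \<in> ext X" unfolding h_zero using ext_iff[OF _ _ Xc] SD(2) XD(2) by simp
    fix z w assume zw: "z \<in> ext X" "w \<in> ext X"
    obtain s x where z: "z = h s x" "s \<in> S" "x \<in> X" "s \<in> carrier Q" "x \<in> carrier Q" using zw(1) Xc by (rule extE)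
    obtain s' x' where w: "w = h s' x'" "s' \<in> S" "x' \<in> X" "s' \<in> carrier Q" "x' \<in> carrier Q" using zw(2) Xc by (rule extE)
    show "z \<oplus>\<^bsub>F\<^esub> w \<in> ext X" using z w h_add ext_iff[OF _ _ Xc] SD(3) XD(3) by simp
  next
    fix r z assume rz: "r \<in> carrier B" "z \<in> ext X"
    obtain b y where r: "r = h b y" "b \<in> carrier R" "y \<in> \<cc>" "b \<in> carrier Q" "y \<in> carrier Q" using rz(1) by (rule BE)
    obtain s x where z: "z = h s x" "s \<in> S" "x \<in> X" "s \<in> carrier Q" "x \<in> carrier Q" using rz(2) Xc by (rule extE)
    have cX: "u \<in> X" if "u \<in> \<cc>" for u using cK[OF that] X(2) by blast
    have 1: "b \<otimes> x \<in> X" by (rule XD(4)[OF r(2) z(3)])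
    have 2: "s \<otimes> y \<in> X" using cX[OF c_S[OF r(3) z(2)]] E.m_comm[OF z(4) r(5)] by simp
    have 3: "\<alpha> \<otimes> (y \<otimes> x) \<in> X" using cX[OF smodD(4)[OF c_smod \<alpha>R(1) c_S[OF r(3)]]] z(3) X(3) by blast
    have "h b y \<otimes>\<^bsub>F\<^esub> h s x = h (b \<otimes> s) (b \<otimes> x \<oplus> s \<otimes> y \<oplus> \<alpha> \<otimes> (y \<otimes> x))" by (rule h_mult[OF r(4,5) z(4,5)])
    then show "r \<otimes>\<^bsub>F\<^esub> z \<in> ext X"
      unfolding r(1) z(1) using ext_iff[OF _ _ Xc] SD(4)[OF r(2) z(2)] XD(3)[OF XD(3)[OF 1 2] 3] r z \<alpha>R by simp
  qed
qed

lemma ext_bounded: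
  assumes "X \<subseteq> S" "z \<in> ext X" shows "h a \<zero> [^]\<^bsub>F\<^esub> N \<otimes>\<^bsub>F\<^esub> z \<in> carrier B"
proof -
  have Xc: "X \<subseteq> carrier Q" using assms(1) Sc by blast
  obtain s x where z: "z = h s x" "s \<in> S" "x \<in> X" "s \<in> carrier Q" "x \<in> carrier Q" using assms(2) Xc by (rule extE)
  have "a [^] N \<otimes> x \<in> \<cc>" using aN_c assms(1) z(3) by blast
  then show ?thesis unfolding z(1) h_pow[OF a_A(2)] using h_scalar[of "a [^] N" s x] hB S(4)[OF z(2)] z by simp
qed

lemma ext_mult: assumes "z \<in> ext S" "w \<in> ext S" shows "z \<otimes>\<^bsub>F\<^esub> w \<in> ext S"
proof -
  have Sq: "S \<subseteq> carrier Q" using Sc by blast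
  obtain s x where z: "z = h s x" "s \<in> S" "x \<in> S" "s \<in> carrier Q" "x \<in> carrier Q" using assms(1) Sq by (rule extE)
  obtain s' x' where w: "w = h s' x'" "s' \<in> S" "x' \<in> S" "s' \<in> carrier Q" "x' \<in> carrier Q" using assms(2) Sq by (rule extE)
  have "s \<otimes> x' \<oplus> s' \<otimes> x \<oplus> \<alpha> \<otimes> (x \<otimes> x') \<in> S"
    by (intro smodD(3)[OF S(1)] smodD(4)[OF S(1)] S(3) \<alpha>R z w)
  then show ?thesis unfolding z(1) w(1) h_mult[OF z(4,5) w(4,5)] using ext_iff[OF _ _ Sq] S(3)[OF z(2) w(2)] z w \<alpha>R by simp
qed

lemma ext_KS: "ext K \<subseteq> ext S" unfolding ext_def using S(2) by blast

lemma ext_S_smod: "BF.smod (ext S)" by (rule ext_smod[OF S(1,2) order_refl])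

lemma one_ext: "\<one>\<^bsub>F\<^esub> \<in> ext K"
  unfolding h_one using ext_iff[of \<one> \<zero> K] Kc oneS smodD(2)[OF Ks] by blast

text \<open>S x S contains L and is closed under multiplication. Conversely (s, x) = (s, 0)(1, 0) +
  (x, 0)(0, 1), where all four factors lie in L because 1 is in K; the twist \<alpha> does not
  affect these products.\<close>

lemma ext_prod: "ideal_prod F (ext K) (ext K) = ext S" "ideal_prod F (ext K) (ext S) = ext S"
proof -
  have Kq: "K \<subseteq> carrier Q" and Sq: "S \<subseteq> carrier Q" using Kc Sc by blast+
  show "ideal_prod F (ext K) (ext K) = ext S"
  proof
    show "ideal_prod F (ext K) (ext K) \<subseteq> ext S"
      by (rule BF.prod_subset[OF ext_S_smod ext_mult]) (use ext_KS in blast)+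
    show "ext S \<subseteq> ideal_prod F (ext K) (ext K)"
    proof
      fix z assume "z \<in> ext S"
      then obtain s x where z: "z = h s x" "s \<in> S" "x \<in> S" "s \<in> carrier Q" "x \<in> carrier Q" using Sq by (rule extE)
      have L: "h s \<zero> \<in> ext K" "h x \<zero> \<in> ext K" "h \<zero> \<one> \<in> ext K"
        using ext_iff[OF _ _ Kq] z smodD(2)[OF Ks] smodD(2)[OF S(1)] K(3) by simp_all
      have "h s \<zero> \<otimes>\<^bsub>F\<^esub> \<one>\<^bsub>F\<^esub> \<oplus>\<^bsub>F\<^esub> h x \<zero> \<otimes>\<^bsub>F\<^esub> h \<zero> \<one> \<in> ideal_prod F (ext K) (ext K)"
        by (intro ideal_prod.sum ideal_prod.prod L one_ext)
      moreover have "h s \<zero> \<otimes>\<^bsub>F\<^esub> \<one>\<^bsub>F\<^esub> \<oplus>\<^bsub>F\<^esub> h x \<zero> \<otimes>\<^bsub>F\<^esub> h \<zero> \<one> = z"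
        unfolding h_one z(1) using h_scalar[of s \<one> \<zero>] h_scalar[of x \<zero> \<one>] h_add[of s \<zero> \<zero> x] z(4,5) by simp
      ultimately show "z \<in> ideal_prod F (ext K) (ext K)" by simp
    qed
  qed
  show "ideal_prod F (ext K) (ext S) = ext S"
  proof
    show "ideal_prod F (ext K) (ext S) \<subseteq> ext S"
      by (rule BF.prod_subset[OF ext_S_smod ext_mult]) (use ext_KS in blast)+
    show "ext S \<subseteq> ideal_prod F (ext K) (ext S)"
    proof
      fix z assume z: "z \<in> ext S"
      then have "\<one>\<^bsub>F\<^esub> \<otimes>\<^bsub>F\<^esub> z \<in> ideal_prod F (ext K) (ext S)" by (intro ideal_prod.prod one_ext)
      then show "z \<in> ideal_prod F (ext K) (ext S)" using BF.smodD(1)[OF ext_S_smod z] by simp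
    qed
  qed
qed

text \<open>A submodule H above L contains (s, 0) for every s in S, so membership of (s, x) in H
  depends on x alone.\<close>

lemma between_ext: "between B (self_module F) (ext K) (ext S) = ext ` between R (self_module Q) K S"
proof (rule Set.set_eqI, rule iffI)
  have Kq: "K \<subseteq> carrier Q" and Sq: "S \<subseteq> carrier Q" using Kc Sc by blast+
  fix H
  {
    assume "H \<in> ext ` between R (self_module Q) K S"
    then obtain X where X: "H = ext X" "smod X" "K \<subseteq> X" "X \<subseteq> S" unfolding between_def smod_def by blast
    then show "H \<in> between B (self_module F) (ext K) (ext S)"
      unfolding between_def using ext_smod[OF X(2-4)] unfolding BF.smod_def by (auto simp: ext_def)
  }
  assume "H \<in> between B (self_module F) (ext K) (ext S)"
  then have H: "BF.smod H" "ext K \<subseteq> H" "H \<subseteq> ext S" unfolding between_def BF.smod_def by blast+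
  note HD = BF.smodD[OF H(1)]
  define X where "X = {x \<in> S. h \<zero> x \<in> H}"
  have "smod X"
  proof (rule smodI)
    show "X \<subseteq> carrier Q" unfolding X_def using Sq by blast
    show "\<zero> \<in> X" unfolding X_def using HD(2) smodD(2)[OF S(1)] by (simp add: h_zero)
    show "x \<oplus> y \<in> X" if "x \<in> X" "y \<in> X" for x y
      using that HD(3)[of "h \<zero> x" "h \<zero> y"] h_add[of \<zero> x \<zero> y] smodD(3)[OF S(1), of x y] Sc unfolding X_def by auto
    show "r \<otimes> x \<in> X" if "r \<in> carrier R" "x \<in> X" for r x
      using that HD(4)[OF h_scalar_B, of r "h \<zero> x"] h_scalar[of r \<zero> x] smodD(4)[OF S(1), of r x] Sc unfolding X_def by auto
  qed
  moreover have "K \<subseteq> X"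
  proof
    fix x assume x: "x \<in> K"
    have "h \<zero> x \<in> ext K" using ext_iff[of \<zero> x, OF _ _ Kq] x Kc smodD(2)[OF S(1)] by simp
    then show "x \<in> X" unfolding X_def using H(2) x S(2) by blast
  qed
  moreover have XS: "X \<subseteq> S" unfolding X_def by blast
  moreover have "H = ext X"
  proof (rule Set.set_eqI)
    fix z
    have eq: "z \<in> H \<longleftrightarrow> h \<zero> x \<in> H" if z: "z = h s x" "s \<in> S" "x \<in> carrier Q" for s x
    proof -
      have sq: "s \<in> carrier Q" using Sc z by blast
      have s0: "h s \<zero> \<in> H" using H(2) ext_iff[OF sq _ Kq, of \<zero>] z smodD(2)[OF Ks] by auto
      have e1: "h \<zero> x \<oplus>\<^bsub>F\<^esub> h s \<zero> = z" unfolding z(1) using h_add[of \<zero> x s \<zero>] sq z by simp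
      have e2: "z \<ominus>\<^bsub>F\<^esub> h s \<zero> = h \<zero> x" unfolding z(1) using h_minus[of s x s \<zero>] sq z by (simp add: a_minus_def E.r_neg)
      show ?thesis using HD(3)[OF _ s0, of "h \<zero> x"] HD(6)[OF _ s0, of z] e1 e2 by auto
    qed
    show "z \<in> H \<longleftrightarrow> z \<in> ext X"
    proof
      assume zH: "z \<in> H"
      then have "z \<in> ext S" using H(3) by blast
      then obtain s x where z: "z = h s x" "s \<in> S" "x \<in> S" "s \<in> carrier Q" "x \<in> carrier Q" using Sq by (rule extE)
      then have "x \<in> X" unfolding X_def using eq[OF z(1,2,5)] zH by blast
      then show "z \<in> ext X" unfolding ext_def z(1) using z(2) by blast
    next
      assume "z \<in> ext X"
      then obtain s x where z: "z = h s x" "s \<in> S" "x \<in> X" "s \<in> carrier Q" "x \<in> carrier Q"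
        using XS Sq by (metis extE subset_trans)
      then show "z \<in> H" using eq[OF z(1,2,5)] unfolding X_def by blast
    qed
  qed
  ultimately show "H \<in> ext ` between R (self_module Q) K S" unfolding between_def smod_def by blast
qed

lemma ext_subset_iff: "X \<subseteq> S \<Longrightarrow> Y \<subseteq> S \<Longrightarrow> ext X \<subseteq> ext Y \<longleftrightarrow> X \<subseteq> Y"
proof
  assume X: "X \<subseteq> S" and Y: "Y \<subseteq> S" and sub: "ext X \<subseteq> ext Y"
  have Xq: "X \<subseteq> carrier Q" and Yq: "Y \<subseteq> carrier Q" using X Y Sc by blast+
  show "X \<subseteq> Y"
  proof
    fix x assume x: "x \<in> X"
    then have "h \<zero> x \<in> ext X" using ext_iff[of \<zero> x, OF _ _ Xq] Xq smodD(2)[OF S(1)] by auto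
    then have "h \<zero> x \<in> ext Y" using sub by blast
    then show "x \<in> Y" using ext_iff[of \<zero> x, OF _ _ Yq] Xq x by auto
  qed
qed (auto simp: ext_def)
text \<open>Since (s, 0) lies in L, a generator (s, x) of L^2/L may be replaced by (0, x); so
  generators of L^2/L over B correspond to generators of S/K over R.\<close>

lemma min_gens_ext:
  "min_gens B (subquot F (ideal_prod F (ext K) (ext K)) (ext K)) = 1 \<longleftrightarrow>
     S \<noteq> K \<and> cyclic_over (between R (self_module Q) K S) S"
proof -
  have Kq: "K \<subseteq> carrier Q" and Sq: "S \<subseteq> carrier Q" using Kc Sc by blast+
  have sub: "X \<subseteq> S" if "X \<in> between R (self_module Q) K S" for X using that unfolding between_def by blast
  have eq: "ext X = ext S \<longleftrightarrow> X = S" if "X \<subseteq> S" for X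
    using ext_subset_iff[OF that order_refl] ext_subset_iff[OF order_refl that] by blast
  have "cyclic_over (ext ` between R (self_module Q) K S) (ext S) \<longleftrightarrow> cyclic_over (between R (self_module Q) K S) S"
  proof
    assume "cyclic_over (ext ` between R (self_module Q) K S) (ext S)"
    then obtain z where z: "z \<in> ext S" "\<And>X. X \<in> between R (self_module Q) K S \<Longrightarrow> z \<in> ext X \<Longrightarrow> ext X = ext S"
      unfolding cyclic_over_def by blast
    obtain s x where sx: "z = h s x" "s \<in> S" "x \<in> S" "s \<in> carrier Q" "x \<in> carrier Q" using z(1) Sq by (rule extE)
    show "cyclic_over (between R (self_module Q) K S) S" unfolding cyclic_over_def
    proof (intro bexI[OF _ sx(3)] ballI impI)
      fix X assume X: "X \<in> between R (self_module Q) K S" "x \<in> X"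
      have "z \<in> ext X" unfolding ext_def sx(1) using sx(2) X(2) by blast
      then show "X = S" using z(2)[OF X(1)] eq[OF sub[OF X(1)]] by blast
    qed
  next
    assume "cyclic_over (between R (self_module Q) K S) S"
    then obtain x where x: "x \<in> S" "\<And>X. X \<in> between R (self_module Q) K S \<Longrightarrow> x \<in> X \<Longrightarrow> X = S"
      unfolding cyclic_over_def by blast
    have z: "h \<zero> x \<in> ext X \<longleftrightarrow> x \<in> X" if "X \<subseteq> S" for X
      using ext_iff[of \<zero> x X] that Sq Sc[OF x(1)] smodD(2)[OF S(1)] by auto
    show "cyclic_over (ext ` between R (self_module Q) K S) (ext S)" unfolding cyclic_over_def
    proof (intro bexI[of _ "h \<zero> x"] ballI impI)
      show "h \<zero> x \<in> ext S" using z[OF order_refl] x(1) by blast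
      fix H assume "H \<in> ext ` between R (self_module Q) K S" "h \<zero> x \<in> H"
      then obtain X where X: "H = ext X" "X \<in> between R (self_module Q) K S" "x \<in> X" using z sub by blast
      show "H = ext S" unfolding X(1) x(2)[OF X(2,3)] ..
    qed
  qed
  moreover have "min_gens B (subquot F (ext S) (ext K)) = 1 \<longleftrightarrow>
      ext K \<noteq> ext S \<and> cyclic_over (between B (self_module F) (ext K) (ext S)) (ext S)"
    unfolding subquot_def
    by (rule min_gens_quot_restrict[OF BF.Emod ext_S_smod[unfolded BF.smod_def] _ ext_KS])
      (use ext_smod[OF Ks order_refl S(2)] in \<open>simp add: BF.smod_def\<close>)
  ultimately show ?thesis unfolding ext_prod between_ext using eq[OF S(2)] by blast
qed

end

section \<open>The extension as a one-dimensional Cohen-Macaulay local ring\<close>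

locale proper_quasi_extension = quasi_extension R Q a K S \<cc> \<alpha> N B F h
  for R :: "('a, 'm) ring_scheme" and Q :: "('a, 'n) ring_scheme" (structure) and a
    and K S \<cc> :: "'a set" and \<alpha> :: 'a and N :: nat
    and B F :: "('b, 'k) ring_scheme" and h :: "'a \<Rightarrow> 'a \<Rightarrow> 'b" +
  assumes SK: "S \<noteq> K"
begin

text \<open>If 1 were in \<open>\<cc>\<close>, then S would lie in R and hence in K. So the proper
  inclusion of K in S makes \<open>\<cc>\<close> a proper ideal; the unit criterion for B and the
  inclusion of the socle in S both rest on this.\<close>

lemma cm: "z \<in> \<cc> \<Longrightarrow> z \<in> \<mm>"
proof -
  assume z: "z \<in> \<cc>"
  have "\<one> \<notin> \<cc>"
  proof
    assume "\<one> \<in> \<cc>"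
    have "s \<in> K" if "s \<in> S" for s using cD(1)[OF \<open>\<one> \<in> \<cc>\<close> that] Sc[OF that] RK by simp
    then show False using SK S(2) by blast
  qed
  then have "\<cc> \<noteq> carrier R" using A_closed(6) by blast
  moreover have "ideal \<cc> R" unfolding ideal_iff using c_smod cD(2) by blast
  ultimately show ?thesis using proper_ideal_le_m[of \<cc>] z by blast
qed

text \<open>As \<open>\<cc>\<close> lies in \<open>\<mm>\<close>, the colon K : \<open>\<mm>\<close>
  lies in K : \<open>\<cc>\<close> = S.\<close>

lemma soc_K_S: assumes z: "z \<in> soc K" shows "z \<in> S"
proof (rule K_colon_c)
  show zc: "z \<in> carrier Q" using z by (simp add: soc_def)
  fix x assume x: "x \<in> \<cc>"
  have "x \<otimes> z \<in> K" using z cm[OF x] by (simp add: soc_def)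
  then show "z \<otimes> x \<in> K" using E.m_comm[OF zc cQ[OF x]] by simp
qed

definition \<mm>\<^sub>B :: "'b set" where "\<mm>\<^sub>B = (\<lambda>(x, y). h x y) ` (\<mm> \<times> \<cc>)"

lemma mB_iff: "x \<in> carrier Q \<Longrightarrow> y \<in> carrier Q \<Longrightarrow> h x y \<in> \<mm>\<^sub>B \<longleftrightarrow> x \<in> \<mm> \<and> y \<in> \<cc>"
  unfolding \<mm>\<^sub>B_def using h_eq cQ m_A by fastforce

lemma mBE: assumes "z \<in> \<mm>\<^sub>B" obtains x y where "z = h x y" "x \<in> \<mm>" "y \<in> \<cc>" "x \<in> carrier Q" "y \<in> carrier Q"
  using assms unfolding \<mm>\<^sub>B_def using cQ m_A by force

lemma R_smod_m: "smod \<mm>" using m.is_ideal unfolding ideal_iff by blast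

lemma mB_ideal: "ideal \<mm>\<^sub>B B" unfolding BF.ideal_iff
proof (intro conjI BF.smodI subsetI)
  note mD = smodD[OF R_smod_m] and cc = smodD[OF c_smod]
  show 1: "z \<in> carrier B" if "z \<in> \<mm>\<^sub>B" for z using that by (rule mBE) (use hB m_A in auto)
  show "z \<in> carrier F" if "z \<in> \<mm>\<^sub>B" for z using 1[OF that] by blast
  show "\<zero>\<^bsub>F\<^esub> \<in> \<mm>\<^sub>B" unfolding h_zero using mB_iff mD(2) cc(2) by simp
  show "z \<oplus>\<^bsub>F\<^esub> w \<in> \<mm>\<^sub>B" if zw: "z \<in> \<mm>\<^sub>B" "w \<in> \<mm>\<^sub>B" for z w
  proof -
    obtain x y where z: "z = h x y" "x \<in> \<mm>" "y \<in> \<cc>" "x \<in> carrier Q" "y \<in> carrier Q" using zw(1) by (rule mBE)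
    obtain x' y' where w: "w = h x' y'" "x' \<in> \<mm>" "y' \<in> \<cc>" "x' \<in> carrier Q" "y' \<in> carrier Q" using zw(2) by (rule mBE)
    show ?thesis using h_add z w mB_iff mD(3) cc(3) by simp
  qed
  show "z \<otimes>\<^bsub>F\<^esub> w \<in> \<mm>\<^sub>B" if zw: "z \<in> carrier B" "w \<in> \<mm>\<^sub>B" for z w
  proof -
    obtain x y where z: "z = h x y" "x \<in> carrier R" "y \<in> \<cc>" "x \<in> carrier Q" "y \<in> carrier Q" using zw(1) by (rule BE)
    obtain x' y' where w: "w = h x' y'" "x' \<in> \<mm>" "y' \<in> \<cc>" "x' \<in> carrier Q" "y' \<in> carrier Q" using zw(2) by (rule mBE)
    have "x \<otimes> y' \<oplus> x' \<otimes> y \<oplus> \<alpha> \<otimes> (y \<otimes> y') \<in> \<cc>"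
      using z w \<alpha>R m_A[OF w(2)] cD(2)[OF z(3)] by (intro cc(3) cc(4)) auto
    then show ?thesis using h_mult z w mB_iff mD(4) \<alpha>R by simp
  qed
qed

text \<open>Invertibility of (b, x) amounts to that of b and b + \<alpha> x. The second follows from
  the first, because \<alpha> x lies in \<open>\<mm>\<close>.\<close>

lemma mB_units: assumes z: "z \<in> carrier B" "z \<notin> \<mm>\<^sub>B" shows "z \<in> Units B"
proof -
  obtain b x where zbx: "z = h b x" "b \<in> carrier R" "x \<in> \<cc>" "b \<in> carrier Q" "x \<in> carrier Q" using z(1) by (rule BE)
  have bm: "b \<notin> \<mm>" using z(2) mB_iff zbx by simp
  have bu: "b \<in> Units R" using unit_iff[OF zbx(2)] bm by simp
  have ax: "\<alpha> \<otimes> x \<in> \<mm>" using smodD(4)[OF R_smod_m \<alpha>R(1) cm[OF zbx(3)]] .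
  have uR: "b \<oplus> \<alpha> \<otimes> x \<in> carrier R" using A_closed(2)[OF zbx(2) m_A[OF ax]] .
  have um: "b \<oplus> \<alpha> \<otimes> x \<notin> \<mm>"
  proof
    assume "b \<oplus> \<alpha> \<otimes> x \<in> \<mm>"
    then have "(b \<oplus> \<alpha> \<otimes> x) \<ominus> \<alpha> \<otimes> x \<in> \<mm>" using smodD(6)[OF R_smod_m] ax by blast
    moreover have "(b \<oplus> \<alpha> \<otimes> x) \<ominus> \<alpha> \<otimes> x = b" using zbx \<alpha>R by (simp add: a_minus_def E.a_assoc E.r_neg)
    ultimately show False using bm by simp
  qed
  have uu: "b \<oplus> \<alpha> \<otimes> x \<in> Units R" using unit_iff[OF uR] um by simp
  obtain b' where b': "b' \<in> carrier R" "b \<otimes> b' = \<one>"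
    using bu A_ops(1)[OF zbx(2)] A_ops(3) unfolding Units_def by force
  obtain u' where u': "u' \<in> carrier R" "(b \<oplus> \<alpha> \<otimes> x) \<otimes> u' = \<one>"
    using uu A_ops(1)[OF uR] A_ops(3) unfolding Units_def by force
  have cq: "b' \<in> carrier Q" "u' \<in> carrier Q" using b' u' by auto
  \<comment> \<open>The solution of (b + \<alpha> x) y = -b' x, which makes the second coordinate of
    (b, x)(b', y) vanish.\<close>
  define y where "y = (\<ominus> (b' \<otimes> u')) \<otimes> x"
  have yc: "y \<in> \<cc>" unfolding y_def by (rule smodD(4)[OF c_smod _ zbx(3)]) (use b' u' in auto)
  have yq: "y \<in> carrier Q" by (rule cQ[OF yc])
  have "b \<otimes> y \<oplus> b' \<otimes> x \<oplus> \<alpha> \<otimes> (x \<otimes> y) = (\<ominus> (b' \<otimes> x)) \<otimes> ((b \<oplus> \<alpha> \<otimes> x) \<otimes> u') \<oplus> b' \<otimes> x"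
    unfolding y_def using zbx(4,5) cq \<alpha>R(2) by algebra
  also have "\<dots> = \<zero>" unfolding u'(2) using cq zbx(5) by (simp add: E.l_neg)
  finally have "h b x \<otimes>\<^bsub>F\<^esub> h b' y = \<one>\<^bsub>F\<^esub>" using h_mult[OF zbx(4,5) cq(1) yq] b'(2) by (simp add: h_one)
  moreover have inB: "h b' y \<in> carrier B" using hB[OF cq(1) yq] b'(1) yc by simp
  ultimately have "z \<otimes>\<^bsub>B\<^esub> h b' y = \<one>\<^bsub>B\<^esub>" using BF.A_ops(1)[OF z(1) inB] BF.A_ops(3) zbx(1) by simp
  then show ?thesis unfolding Units_def using z(1) inB BF.A.m_comm[OF z(1) inB] by force
qed

text \<open>As an R-module, B is an extension of R by \<open>\<cc>\<close>. A chain of ideals of B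
  is controlled by its image under the first projection and by its part with first coordinate zero,
  both of which are chains of ideals of R.\<close>

lemma noeth_B: "noeth B (self_module B) (carrier B)"
  unfolding noeth_def
proof (intro allI impI)
  fix f :: "nat \<Rightarrow> 'b set"
  assume f: "\<forall>t. submodule (f t) B (self_module B) \<and> f t \<subseteq> carrier B \<and> f t \<subseteq> f (Suc t)"
  have fs: "BF.smod (f t)" "f t \<subseteq> carrier B" for t using f unfolding BF.submodule_A_iff by blast+
  note fD = BF.smodD[OF fs(1)]
  have mono: "mono f" using f by (intro incseq_SucI) auto
  define I1 where "I1 t = {x \<in> carrier R. \<exists>y\<in>\<cc>. h x y \<in> f t}" for t
  define I2 where "I2 t = {y \<in> \<cc>. h \<zero> y \<in> f t}" for t
  have "smod (I1 t)" for t
  proof (rule smodI)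
    show "I1 t \<subseteq> carrier Q" unfolding I1_def by auto
    show "\<zero> \<in> I1 t" unfolding I1_def using fD(2) smodD(2)[OF c_smod] h_zero A_closed(5) by auto
    fix x x' assume "x \<in> I1 t" "x' \<in> I1 t"
    then obtain y y' where *: "x \<in> carrier R" "x' \<in> carrier R" "y \<in> \<cc>" "y' \<in> \<cc>" "h x y \<in> f t" "h x' y' \<in> f t"
      unfolding I1_def by blast
    then have "h (x \<oplus> x') (y \<oplus> y') \<in> f t" using fD(3)[OF *(5,6)] h_add cQ by simp
    then show "x \<oplus> x' \<in> I1 t" unfolding I1_def using A_closed(2)[OF *(1,2)] smodD(3)[OF c_smod *(3,4)] by blast
  next
    fix r x assume r: "r \<in> carrier R" and "x \<in> I1 t"
    then obtain y where *: "x \<in> carrier R" "y \<in> \<cc>" "h x y \<in> f t" unfolding I1_def by blast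
    then have "h (r \<otimes> x) (r \<otimes> y) \<in> f t" using fD(4)[OF h_scalar_B[OF r] *(3)] h_scalar cQ r by simp
    then show "r \<otimes> x \<in> I1 t" unfolding I1_def using A_closed(1)[OF r *(1)] smodD(4)[OF c_smod r *(2)] by blast
  qed
  moreover have I1R: "I1 t \<subseteq> carrier R" for t unfolding I1_def by blast
  ultimately have s1: "submodule (I1 t) R (self_module R)" for t unfolding submodule_A_iff by blast
  have "smod (I2 t)" for t
  proof (rule smodI)
    show "I2 t \<subseteq> carrier Q" unfolding I2_def using cQ by auto
    show "\<zero> \<in> I2 t" unfolding I2_def using fD(2) smodD(2)[OF c_smod] h_zero by auto
    fix y y' assume "y \<in> I2 t" "y' \<in> I2 t"
    then have *: "y \<in> \<cc>" "y' \<in> \<cc>" "h \<zero> y \<in> f t" "h \<zero> y' \<in> f t" unfolding I2_def by blast+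
    then have "h \<zero> (y \<oplus> y') \<in> f t" using fD(3)[OF *(3,4)] h_add[of \<zero> y \<zero> y'] cQ by simp
    then show "y \<oplus> y' \<in> I2 t" unfolding I2_def using smodD(3)[OF c_smod *(1,2)] by blast
  next
    fix r y assume r: "r \<in> carrier R" and "y \<in> I2 t"
    then have *: "y \<in> \<cc>" "h \<zero> y \<in> f t" unfolding I2_def by blast+
    then have "h \<zero> (r \<otimes> y) \<in> f t" using fD(4)[OF h_scalar_B[OF r] *(2)] h_scalar[of r \<zero> y] cQ r by simp
    then show "r \<otimes> y \<in> I2 t" unfolding I2_def using smodD(4)[OF c_smod r *(1)] by blast
  qed
  moreover have I2R: "I2 t \<subseteq> carrier R" for t unfolding I2_def using cD(2) by blast
  ultimately have s2: "submodule (I2 t) R (self_module R)" for t unfolding submodule_A_iff by blast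
  have "\<exists>T. \<forall>t\<ge>T. I1 t = I1 T"
    by (rule noethD[OF noeth_A s1 I1R]) (use f in \<open>unfold I1_def, blast\<close>)
  then obtain T1 where T1: "\<forall>t\<ge>T1. I1 t = I1 T1" by blast
  have "\<exists>T. \<forall>t\<ge>T. I2 t = I2 T"
    by (rule noethD[OF noeth_A s2 I2R]) (use f in \<open>unfold I2_def, blast\<close>)
  then obtain T2 where T2: "\<forall>t\<ge>T2. I2 t = I2 T2" by blast
  have "f t = f (T1 + T2)" if t: "t \<ge> T1 + T2" for t
  proof (rule subset_antisym[OF subsetI])
    have e1: "I1 t = I1 (T1 + T2)" using T1[rule_format, of t] T1[rule_format, of "T1 + T2"] t by simp
    have e2: "I2 t = I2 (T1 + T2)" using T2[rule_format, of t] T2[rule_format, of "T1 + T2"] t by simp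
    show sub: "f (T1 + T2) \<subseteq> f t" using monoD[OF mono t] .
    fix z assume z: "z \<in> f t"
    then have "z \<in> carrier B" using fs(2) by blast
    then obtain x y where zxy: "z = h x y" "x \<in> carrier R" "y \<in> \<cc>" "x \<in> carrier Q" "y \<in> carrier Q" by (rule BE)
    have "x \<in> I1 t" unfolding I1_def using z zxy by blast
    then obtain y' where y': "y' \<in> \<cc>" "h x y' \<in> f (T1 + T2)" unfolding e1 unfolding I1_def by blast
    have "h x y \<ominus>\<^bsub>F\<^esub> h x y' \<in> f t" using fD(6) z y'(2) sub zxy(1) by blast
    then have "h \<zero> (y \<ominus> y') \<in> f t" using h_minus[OF zxy(4,5) zxy(4) cQ[OF y'(1)]] zxy(4) by (simp add: a_minus_def E.r_neg)
    then have "y \<ominus> y' \<in> I2 t" unfolding I2_def using smodD(6)[OF c_smod zxy(3) y'(1)] by blast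
    then have "h \<zero> (y \<ominus> y') \<in> f (T1 + T2)" unfolding e2 unfolding I2_def by blast
    then have "h \<zero> (y \<ominus> y') \<oplus>\<^bsub>F\<^esub> h x y' \<in> f (T1 + T2)" using fD(3) y'(2) by blast
    moreover have "h \<zero> (y \<ominus> y') \<oplus>\<^bsub>F\<^esub> h x y' = h x y"
      using h_add[of \<zero> "y \<ominus> y'" x y'] zxy cQ[OF y'(1)] by (simp add: a_minus_def E.a_assoc E.l_neg)
    ultimately show "z \<in> f (T1 + T2)" using zxy(1) by simp
  qed
  then show "\<exists>T. \<forall>t\<ge>T. f t = f T" by blast
qed

lemma mB_proper: "\<mm>\<^sub>B \<noteq> carrier B"
proof -
  have "h \<one> \<zero> \<notin> \<mm>\<^sub>B" using mB_iff[of \<one> \<zero>] one_notin_m A_ops(3) by simp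
  then show ?thesis using h_scalar_B[OF A_closed(6)] by blast
qed

lemma B_local: "noetherian_local_ring B" "max_ideal B = \<mm>\<^sub>B"
proof -
  note um = cring.unique_maximalideal[OF B mB_ideal mB_proper mB_units]
  show "noetherian_local_ring B" unfolding noetherian_local_ring_def
    using B noeth_imp_noetherian_ring[OF B noeth_B] um by blast
  show "max_ideal B = \<mm>\<^sub>B" unfolding max_ideal_def by (rule the_equality) (use um in blast)+
qed

sublocale BL: noeth_local B
  by (intro noeth_local.intro B noeth_local_axioms.intro B_local(1))

text \<open>The characteristic equation y^2 - ty + n = 0 of y = (b, x), with trace t = 2b + \<alpha>
  x and norm n = b(b + \<alpha> x). It shows that B is integral over R and is the tool for comparing
  the prime ideals of the two rings.\<close>

lemma h_quadratic:
  assumes "b \<in> carrier Q" "x \<in> carrier Q"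
  shows "h b x \<otimes>\<^bsub>F\<^esub> h b x \<oplus>\<^bsub>F\<^esub> h (b \<otimes> (b \<oplus> \<alpha> \<otimes> x)) \<zero> = h (b \<oplus> b \<oplus> \<alpha> \<otimes> x) \<zero> \<otimes>\<^bsub>F\<^esub> h b x"
proof -
  have "h (b \<otimes> b \<oplus> b \<otimes> (b \<oplus> \<alpha> \<otimes> x)) (b \<otimes> x \<oplus> b \<otimes> x \<oplus> \<alpha> \<otimes> (x \<otimes> x) \<oplus> \<zero>) =
      h ((b \<oplus> b \<oplus> \<alpha> \<otimes> x) \<otimes> b) ((b \<oplus> b \<oplus> \<alpha> \<otimes> x) \<otimes> x)"
    by (rule arg_cong2[where f = h]) (use assms \<alpha>R(2) in algebra)+
  then show ?thesis using assms \<alpha>R(2) by (simp add: h_mult[of b x b x] h_add h_scalar)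
qed

lemma F_cancel:
  assumes "u \<in> carrier F" "v \<in> carrier F"
  shows "(u \<oplus>\<^bsub>F\<^esub> v) \<ominus>\<^bsub>F\<^esub> u = v" "(u \<oplus>\<^bsub>F\<^esub> v) \<ominus>\<^bsub>F\<^esub> v = u" "u \<ominus>\<^bsub>F\<^esub> (u \<ominus>\<^bsub>F\<^esub> v) = v"
  using assms by algebra+

definition contract :: "'b set \<Rightarrow> 'a set" where "contract P = {r \<in> carrier R. h r \<zero> \<in> P}"

lemma contract_prime:
  assumes P: "primeideal P B" shows "primeideal (contract P) R"
proof -
  interpret P: primeideal P B by (rule P)
  have Ps: "BF.smod P" "P \<subseteq> carrier B" using P.is_ideal unfolding BF.ideal_iff by blast+
  note PD = BF.smodD[OF Ps(1)]
  have id: "ideal (contract P) R" unfolding ideal_iff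
  proof (intro conjI smodI)
    show cR: "contract P \<subseteq> carrier R" unfolding contract_def by blast
    then show "contract P \<subseteq> carrier Q" by auto
    show "\<zero> \<in> contract P" unfolding contract_def using PD(2) h_zero A_closed(5) by simp
    show "x \<oplus> y \<in> contract P" if "x \<in> contract P" "y \<in> contract P" for x y
      using that PD(3)[of "h x \<zero>" "h y \<zero>"] h_add[of x \<zero> y \<zero>] A_closed(2)[of x y] unfolding contract_def by auto
    show "r \<otimes> x \<in> contract P" if "r \<in> carrier R" "x \<in> contract P" for r x
      using that PD(4)[OF h_scalar_B, of r "h x \<zero>"] h_scalar[of r x \<zero>] A_closed(1)[of r x] unfolding contract_def by auto
  qed
  show ?thesis
  proof (rule primeidealI[OF id A.is_cring])
    have "h \<one> \<zero> \<notin> P" using P.one_imp_carrier P.I_notcarr BF.A_ops(3) h_one by metis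
    then have "\<one> \<notin> contract P" unfolding contract_def by blast
    then show "carrier R \<noteq> contract P" using A_closed(6) by blast
    fix x y assume xy: "x \<in> carrier R" "y \<in> carrier R" "x \<otimes>\<^bsub>R\<^esub> y \<in> contract P"
    then have "h x \<zero> \<otimes>\<^bsub>B\<^esub> h y \<zero> \<in> P"
      using A_ops(1)[OF xy(1,2)] BF.A_ops(1)[OF h_scalar_B[OF xy(1)] h_scalar_B[OF xy(2)]] h_scalar[of x y \<zero>]
      unfolding contract_def by auto
    then show "x \<in> contract P \<or> y \<in> contract P"
      using P.I_prime[OF h_scalar_B[OF xy(1)] h_scalar_B[OF xy(2)]] xy(1,2) unfolding contract_def by blast
  qed
qed

text \<open>Incomparability: suppose P and P' have the same contraction, and let y be in P' but not
  in P. The norm n = y(t - y) is in P' and comes from R, hence is in P, so t - y is in P. Then t =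
  (t - y) + y is in P' and comes from R, hence is in P, and y would be in P.\<close>

lemma contract_mono_strict:
  assumes P: "primeideal P B" "primeideal P' B" "P \<subset> P'" shows "contract P \<subset> contract P'"
proof -
  interpret P: primeideal P B by (rule P(1))
  interpret P': primeideal P' B by (rule P(2))
  have Ps: "BF.smod P" "P \<subseteq> carrier B" using P.is_ideal unfolding BF.ideal_iff by blast+
  have Ps': "BF.smod P'" "P' \<subseteq> carrier B" using P'.is_ideal unfolding BF.ideal_iff by blast+
  note PD = BF.smodD[OF Ps(1)] and PD' = BF.smodD[OF Ps'(1)]
  have "contract P \<subseteq> contract P'" using P(3) unfolding contract_def by blast
  moreover have "contract P \<noteq> contract P'"
  proof
    assume eq: "contract P = contract P'"
    obtain y where y: "y \<in> P'" "y \<notin> P" using P(3) by blast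
    have yB: "y \<in> carrier B" using y Ps' by blast
    then obtain b x where bx: "y = h b x" "b \<in> carrier R" "x \<in> \<cc>" "b \<in> carrier Q" "x \<in> carrier Q" by (rule BE)
    let ?t = "b \<oplus> b \<oplus> \<alpha> \<otimes> x" and ?n = "b \<otimes> (b \<oplus> \<alpha> \<otimes> x)"
    have axR: "\<alpha> \<otimes> x \<in> carrier R" using A_closed(1)[OF \<alpha>R(1) cD(2)[OF bx(3)]] .
    have tR: "?t \<in> carrier R" by (intro A_closed(2) bx(2) axR)
    have nR: "?n \<in> carrier R" by (intro A_closed(1,2) bx(2) axR)
    have tnF: "h ?t \<zero> \<in> carrier F" "h ?n \<zero> \<in> carrier F" "y \<in> carrier F" using tR nR yB by (auto intro: hF)
    have quad: "y \<otimes>\<^bsub>F\<^esub> y \<oplus>\<^bsub>F\<^esub> h ?n \<zero> = h ?t \<zero> \<otimes>\<^bsub>F\<^esub> y" using h_quadratic[OF bx(4,5)] bx(1) by simp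
    have "h ?n \<zero> = (h ?t \<zero> \<otimes>\<^bsub>F\<^esub> y) \<ominus>\<^bsub>F\<^esub> (y \<otimes>\<^bsub>F\<^esub> y)"
      unfolding quad[symmetric] using tnF by (simp add: F_cancel)
    moreover have "h ?t \<zero> \<otimes>\<^bsub>F\<^esub> y \<in> P'" by (rule PD'(4)[OF h_scalar_B[OF tR] y(1)])
    moreover have "y \<otimes>\<^bsub>F\<^esub> y \<in> P'" by (rule PD'(4)[OF yB y(1)])
    ultimately have "h ?n \<zero> \<in> P'" using PD'(6) by simp
    then have nP: "h ?n \<zero> \<in> P" using eq nR unfolding contract_def by blast
    have "y \<otimes>\<^bsub>F\<^esub> (h ?t \<zero> \<ominus>\<^bsub>F\<^esub> y) = h ?n \<zero>"
    proof -
      have "y \<otimes>\<^bsub>F\<^esub> (h ?t \<zero> \<ominus>\<^bsub>F\<^esub> y) = h ?t \<zero> \<otimes>\<^bsub>F\<^esub> y \<ominus>\<^bsub>F\<^esub> y \<otimes>\<^bsub>F\<^esub> y"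
        using tnF by (simp add: a_minus_def BF.E.r_distr BF.E.r_minus BF.E.m_comm)
      also have "\<dots> = h ?n \<zero>" unfolding quad[symmetric] using tnF by (simp add: F_cancel)
      finally show ?thesis .
    qed
    moreover have tyB: "h ?t \<zero> \<ominus>\<^bsub>F\<^esub> y \<in> carrier B" by (rule BF.A_closed(4)[OF h_scalar_B[OF tR] yB])
    ultimately have "y \<otimes>\<^bsub>B\<^esub> (h ?t \<zero> \<ominus>\<^bsub>F\<^esub> y) \<in> P" using BF.A_ops(1)[OF yB tyB] nP by simp
    then have ty: "h ?t \<zero> \<ominus>\<^bsub>F\<^esub> y \<in> P" using P.I_prime[OF yB tyB] y(2) by blast
    then have "(h ?t \<zero> \<ominus>\<^bsub>F\<^esub> y) \<oplus>\<^bsub>F\<^esub> y \<in> P'" using PD'(3) P(3) y(1) by blast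
    then have "h ?t \<zero> \<in> P'" using tnF by (simp add: a_minus_def BF.E.a_assoc BF.E.l_neg)
    then have "h ?t \<zero> \<in> P" using eq tR unfolding contract_def by blast
    then have "h ?t \<zero> \<ominus>\<^bsub>F\<^esub> (h ?t \<zero> \<ominus>\<^bsub>F\<^esub> y) \<in> P" using PD(6) ty by blast
    moreover have "t \<ominus>\<^bsub>F\<^esub> (t \<ominus>\<^bsub>F\<^esub> y) = y" if "t \<in> carrier F" for t
      using that tnF(3) by algebra
    ultimately show False using tnF(1) y(2) by simp
  qed
  ultimately show ?thesis by blast
qed

lemma aB_unit: "h a \<zero> \<in> Units F"
proof -
  have ia: "inv a \<in> carrier Q" "a \<in> carrier Q" using a_unit by auto
  have "h a \<zero> \<otimes>\<^bsub>F\<^esub> h (inv a) \<zero> = \<one>\<^bsub>F\<^esub>" using h_scalar[of a "inv a" \<zero>] ia a_unit by (simp add: h_one)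
  moreover have "h a \<zero> \<in> carrier F" "h (inv a) \<zero> \<in> carrier F" using ia by auto
  ultimately show ?thesis unfolding Units_def using BF.E.m_comm by force
qed

lemma aB_m: "h a \<zero> \<in> max_ideal B"
  unfolding B_local(2) using mB_iff a_m smodD(2)[OF c_smod] by simp

text \<open>If no power of y were a multiple of a, some prime P containing a would avoid y. The
  contraction of P contains a and hence \<open>\<mm>\<close>, so the trace and norm of y, which lie
  in \<open>\<mm>\<close>, give elements of P; then y^2 = ty - n puts y into P.\<close>

sublocale BP: param_overring B F "h a \<zero>"
proof (intro param_overring.intro param_overring_axioms.intro BF.overring_axioms BL.noeth_local_axioms aB_m aB_unit)
  fix y assume y: "y \<in> max_ideal B"
  have aB: "h a \<zero> \<in> carrier B" by (rule h_scalar_B) simp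
  have yB: "y \<in> carrier B" using y BL.m.Icarr by blast
  show "\<exists>k::nat. y [^]\<^bsub>B\<^esub> k \<in> PIdl\<^bsub>B\<^esub> (h a \<zero>)"
  proof (rule ccontr)
    assume "\<not> ?thesis"
    then obtain P where P: "primeideal P B" "PIdl\<^bsub>B\<^esub> (h a \<zero>) \<subseteq> P" "y \<notin> P"
      using BL.prime_avoiding[OF BF.A.cgenideal_ideal[OF aB] yB] by blast
    interpret P: primeideal P B by (rule P(1))
    interpret p: primeideal "contract P" R by (rule contract_prime[OF P(1)])
    have Ps: "BF.smod P" "P \<subseteq> carrier B" using P.is_ideal unfolding BF.ideal_iff by blast+
    note PD = BF.smodD[OF Ps(1)]
    have "h a \<zero> \<in> P" using P(2) BF.A.cgenideal_self[OF aB] by blast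
    then have ac: "a \<in> contract P" unfolding contract_def by simp
    have mc: "r \<in> contract P" if r: "r \<in> \<mm>" for r
    proof -
      obtain k :: nat where "r [^]\<^bsub>R\<^esub> k \<in> PIdl\<^bsub>R\<^esub> a" using a_param[OF r] by blast
      then have "r [^]\<^bsub>R\<^esub> k \<in> contract P" using A.cgenideal_minimal[OF p.is_ideal ac] by blast
      then show ?thesis
      proof (induction k)
        case 0 then show ?case using p.one_imp_carrier p.I_notcarr by simp
      next
        case (Suc k) then show ?case using p.I_prime[of "r [^]\<^bsub>R\<^esub> k" r] m_A[OF r] by auto
      qed
    qed
    obtain b x where bx: "y = h b x" "b \<in> \<mm>" "x \<in> \<cc>" "b \<in> carrier Q" "x \<in> carrier Q"
      using y unfolding B_local(2) by (rule mBE)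
    note mD = smodD[OF R_smod_m]
    let ?t = "b \<oplus> b \<oplus> \<alpha> \<otimes> x" and ?n = "b \<otimes> (b \<oplus> \<alpha> \<otimes> x)"
    have axm: "\<alpha> \<otimes> x \<in> \<mm>" using mD(4)[OF \<alpha>R(1) cm[OF bx(3)]] .
    have tm: "?t \<in> \<mm>" by (intro mD(3) bx(2) axm)
    have nm: "?n \<in> \<mm>" by (rule mD(4)[OF m_A[OF bx(2)] mD(3)[OF bx(2) axm]])
    have tP: "h ?t \<zero> \<in> P" "h ?n \<zero> \<in> P" using mc[OF tm] mc[OF nm] unfolding contract_def by blast+
    have tnF: "h ?t \<zero> \<in> carrier F" "h ?n \<zero> \<in> carrier F" "y \<in> carrier F" using tP yB PD(1) by auto
    have quad: "y \<otimes>\<^bsub>F\<^esub> y \<oplus>\<^bsub>F\<^esub> h ?n \<zero> = h ?t \<zero> \<otimes>\<^bsub>F\<^esub> y" using h_quadratic[OF bx(4,5)] bx(1) by simp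
    have "y \<otimes>\<^bsub>F\<^esub> h ?t \<zero> \<ominus>\<^bsub>F\<^esub> h ?n \<zero> \<in> P" by (rule PD(6)[OF PD(4)[OF yB tP(1)] tP(2)])
    moreover have "y \<otimes>\<^bsub>F\<^esub> h ?t \<zero> \<ominus>\<^bsub>F\<^esub> h ?n \<zero> = y \<otimes>\<^bsub>F\<^esub> y"
      unfolding BF.E.m_comm[OF tnF(3,1)] quad[symmetric] using tnF by (simp add: a_minus_def BF.E.a_assoc BF.E.r_neg)
    ultimately have "y \<otimes>\<^bsub>B\<^esub> y \<in> P" using BF.A_ops(1)[OF yB yB] by simp
    then show False using P.I_prime[OF yB yB] P(3) by blast
  qed
qed

text \<open>Contraction of primes is strictly monotone, which bounds the dimension by that of R. It
  is positive because a is not nilpotent: a prime that avoids a is strictly below the maximal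
  ideal.\<close>

lemma krull_dim_B: "krull_dim B = 1"
proof (rule antisym)
  have "krull_dim B \<le> krull_dim R" unfolding krull_dim_eq
    by (rule chain_len_mono[where f = contract]) (use contract_prime contract_mono_strict in blast)+
  then show "krull_dim B \<le> 1" using CM_R by simp
  have z: "ideal {\<zero>\<^bsub>B\<^esub>} B" by (rule BF.A.zeroideal)
  have aB: "h a \<zero> \<in> carrier B" by (rule h_scalar_B) simp
  have "h a \<zero> [^]\<^bsub>B\<^esub> k \<notin> {\<zero>\<^bsub>B\<^esub>}" for k :: nat
  proof
    assume "h a \<zero> [^]\<^bsub>B\<^esub> k \<in> {\<zero>\<^bsub>B\<^esub>}"
    then have "h (a [^] k) \<zero> = h \<zero> \<zero>" using BF.A_pow[OF aB] h_pow[of a k] BF.A_zero h_zero by simp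
    then have "a [^] k = \<zero>" using h_eq[of "a [^] k" \<zero> \<zero> \<zero>] by simp
    then have "inv (a [^] k) \<otimes> a [^] k = inv (a [^] k) \<otimes> \<zero>" by (rule arg_cong)
    then have "\<one> = \<zero>" using E.Units_l_inv[OF pow_unit[of k]] pow_inv(3)[of k] by simp
    then show False using one_notin_m A_ops(3) A_zero m.zero_closed by simp
  qed
  then obtain P where P: "primeideal P B" "h a \<zero> \<notin> P" using BL.prime_avoiding[OF z aB] by blast
  interpret P: primeideal P B by (rule P(1))
  have "P \<subset> max_ideal B" using BL.proper_ideal_le_m[OF P.is_ideal] P.I_notcarr P(2) aB_m by blast
  moreover have "primeideal (max_ideal B) B" by (rule cring.maximalideal_prime[OF B BL.maximal])
  ultimately show "1 \<le> krull_dim B" unfolding krull_dim_eq using P(1) by (intro chain_len_ge1[of P _ "max_ideal B"]) auto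
qed

text \<open>The depth is computed by \<open>depth_one\<close>, applied to the unit ideal of
  B.\<close>

lemma CM_B: "cohen_macaulay_local B"
proof -
  have "\<one>\<^bsub>F\<^esub> \<noteq> \<zero>\<^bsub>F\<^esub>"
    using BL.one_notin_m BF.A_ops(3) BF.A_zero BL.m.zero_closed by auto
  then have "carrier B \<noteq> {\<zero>\<^bsub>F\<^esub>}" using BF.A_closed(6) by blast
  from BP.depth_one[OF BF.smod_A order_refl this]
  show ?thesis unfolding cohen_macaulay_local_def using B_local(1) krull_dim_B by (simp add: self_module_carrier)
qed

lemma ext_frac: "BP.frac (ext K)" unfolding BP.frac_def
proof (intro conjI exI[of _ N] ballI)
  have Kq: "K \<subseteq> carrier Q" using Kc by blast
  show "BF.smod (ext K)" by (rule ext_smod[OF Ks order_refl S(2)])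
  show "h a \<zero> [^]\<^bsub>F\<^esub> N \<in> ext K"
    unfolding h_pow[OF a_A(2)] using ext_iff[OF _ _ Kq] RK[OF pow_A(1)] S(2) smodD(2)[OF Ks] by auto
qed (rule ext_bounded[OF S(2)])

text \<open>Multiplying (p, q) by (b, 0) with b in \<open>\<mm>\<close> shows that q is in K :
  \<open>\<mm>\<close>. Multiplying by (0, x) with x in \<open>\<cc>\<close> shows that p + \<alpha>
  q is in K : \<open>\<cc>\<close> = S; as q lies in S by \<open>soc_K_S\<close>, so does p.\<close>

lemma soc_ext:
  assumes z: "p \<in> carrier Q" "q \<in> carrier Q"
  shows "h p q \<in> BP.soc (ext K) \<longleftrightarrow> p \<in> S \<and> q \<in> soc K"
proof
  have Kq: "K \<subseteq> carrier Q" using Kc by blast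
  note KD = smodD[OF Ks]
  {
    assume "h p q \<in> BP.soc (ext K)"
    then have s: "r \<otimes>\<^bsub>F\<^esub> h p q \<in> ext K" if "r \<in> \<mm>\<^sub>B" for r using that unfolding BP.soc_def B_local(2) by blast
    have "b \<otimes> q \<in> K" if b: "b \<in> \<mm>" for b
    proof -
      have bq: "b \<in> carrier Q" using m_A[OF b] by blast
      have "h b \<zero> \<in> \<mm>\<^sub>B" using mB_iff[OF bq] b smodD(2)[OF c_smod] by simp
      from s[OF this] show ?thesis using h_scalar[OF bq z] ext_iff[OF _ _ Kq] bq z by simp
    qed
    then have qs: "q \<in> soc K" using z unfolding soc_def by blast
    have "p \<oplus> \<alpha> \<otimes> q \<in> S"
    proof (rule K_colon_c)
      show "p \<oplus> \<alpha> \<otimes> q \<in> carrier Q" using z \<alpha>R by simp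
      fix x assume x: "x \<in> \<cc>"
      note xq = cQ[OF x]
      have "h \<zero> x \<in> \<mm>\<^sub>B" using mB_iff[of \<zero> x] xq x smodD(2)[OF R_smod_m] by simp
      from s[OF this] have "p \<otimes> x \<oplus> \<alpha> \<otimes> (x \<otimes> q) \<in> K"
        using h_mult[of \<zero> x p q] ext_iff[OF _ _ Kq] xq z \<alpha>R by simp
      moreover have "p \<otimes> x \<oplus> \<alpha> \<otimes> (x \<otimes> q) = (p \<oplus> \<alpha> \<otimes> q) \<otimes> x"
        using xq z \<alpha>R(2) by algebra
      ultimately show "(p \<oplus> \<alpha> \<otimes> q) \<otimes> x \<in> K" by simp
    qed
    then have "(p \<oplus> \<alpha> \<otimes> q) \<ominus> \<alpha> \<otimes> q \<in> S"
      by (rule smodD(6)[OF S(1) _ smodD(4)[OF S(1) \<alpha>R(1) soc_K_S[OF qs]]])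
    moreover have "(p \<oplus> \<alpha> \<otimes> q) \<ominus> \<alpha> \<otimes> q = p" using z \<alpha>R by (simp add: a_minus_def E.a_assoc E.r_neg)
    ultimately show "p \<in> S \<and> q \<in> soc K" using qs by simp
  }
  assume pq: "p \<in> S \<and> q \<in> soc K"
  show "h p q \<in> BP.soc (ext K)" unfolding BP.soc_def B_local(2)
  proof (intro CollectI conjI ballI hF z)
    fix r assume "r \<in> \<mm>\<^sub>B"
    then obtain b x where r: "r = h b x" "b \<in> \<mm>" "x \<in> \<cc>" "b \<in> carrier Q" "x \<in> carrier Q" by (rule mBE)
    have 1: "b \<otimes> q \<in> K" using pq r(2) by (simp add: soc_def)
    have 2: "p \<otimes> x \<in> K" using cK[OF c_S[OF r(3), of p]] pq E.m_comm[OF z(1) r(5)] by simp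
    have 3: "\<alpha> \<otimes> (x \<otimes> q) \<in> K" using cK[OF smodD(4)[OF c_smod \<alpha>R(1) c_S[OF r(3) soc_K_S]]] pq by blast
    show "r \<otimes>\<^bsub>F\<^esub> h p q \<in> ext K"
      unfolding r(1) h_mult[OF r(4,5) z] using ext_iff[OF _ _ Kq] smodD(4)[OF S(1) m_A[OF r(2)], of p] pq
        KD(3)[OF KD(3)[OF 1 2] 3] r z \<alpha>R by simp
  qed
qed

text \<open>By \<open>soc_ext\<close> the socle of F modulo L is the socle of Q/K, placed in the
  second coordinate.\<close>

lemma type1_ext: "BP.type1 (ext K)" unfolding BP.type1_def
proof (intro conjI ballI impI)
  have Kq: "K \<subseteq> carrier Q" using Kc by blast
  show "BF.smod (ext K)" by (rule ext_smod[OF Ks order_refl S(2)])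
  obtain q where q: "q \<in> soc K" "q \<notin> K" using K(1) by (auto simp: type1_def)
  have qc: "q \<in> carrier Q" using q by (simp add: soc_def)
  show "\<exists>z\<in>BP.soc (ext K). z \<notin> ext K"
    using soc_ext[of \<zero> q] ext_iff[of \<zero> q, OF _ _ Kq] q qc smodD(2)[OF S(1)] by (intro bexI[of _ "h \<zero> q"]) simp_all
next
  have Kq: "K \<subseteq> carrier Q" using Kc by blast
  fix z w assume z: "z \<in> BP.soc (ext K)" "z \<notin> ext K" and w: "w \<in> BP.soc (ext K)"
  have "z \<in> carrier F" "w \<in> carrier F" using z w by (simp_all add: BP.soc_def)
  then obtain p q p' q' where zw: "z = h p q" "w = h p' q'" and c4: "p \<in> carrier Q" "q \<in> carrier Q" "p' \<in> carrier Q" "q' \<in> carrier Q"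
    by (metis FE)
  have 1: "p \<in> S" "q \<in> soc K" "p' \<in> S" "q' \<in> soc K" using z w soc_ext c4 unfolding zw by blast+
  have "q \<notin> K" using z(2) ext_iff[OF c4(1,2) Kq] 1 unfolding zw by blast
  then obtain r where r: "r \<in> carrier R" "q' \<ominus> r \<otimes> q \<in> K" using K(1) 1 by (auto simp: type1_def)
  have "p' \<ominus> r \<otimes> p \<in> S" by (rule smodD(6)[OF S(1) 1(3) smodD(4)[OF S(1) r(1) 1(1)]])
  then have "w \<ominus>\<^bsub>F\<^esub> h r \<zero> \<otimes>\<^bsub>F\<^esub> z \<in> ext K"
    unfolding zw using h_scalar[of r p q] h_minus[of p' q' "r \<otimes> p" "r \<otimes> q"] ext_iff[OF _ _ Kq] c4 r by simp
  then show "\<exists>r\<in>carrier B. w \<ominus>\<^bsub>F\<^esub> r \<otimes>\<^bsub>F\<^esub> z \<in> ext K" using h_scalar_B[OF r(1)] by blast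
qed

text \<open>By \<open>ext_prod\<close> the equation L^3 = L^2 holds outright, so the length
  condition decides, and \<open>ext\<close> identifies the two intervals of submodules.\<close>

theorem n_goto_ext_iff:
  "n_goto n B \<longleftrightarrow> chain_len (between R (self_module Q) K S) = enat n"
proof -
  have "n_goto n B \<longleftrightarrow> ideal_prod F (ext K) (ideal_prod F (ext K) (ext K)) = ideal_prod F (ext K) (ext K) \<and>
     chain_len (between B (self_module F) (ext K) (ideal_prod F (ext K) (ext K))) = enat n"
  proof (rule BP.n_goto_iff[OF CM_B krull_dim_B type1_ext ext_frac one_ext, where T = "ext S" and N = N])
    show "ext K \<subseteq> ext S" by (rule ext_KS)
    show "ext S \<subseteq> carrier F" using BF.smodD(1)[OF ext_S_smod] by blast
  qed (rule ext_mult ext_bounded[OF order_refl]; assumption)+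
  also have "\<dots> \<longleftrightarrow> chain_len (between R (self_module Q) K S) = enat n"
  proof -
    have "chain_len (between R (self_module Q) K S) = chain_len (between B (self_module F) (ext K) (ext S))"
    proof (rule chain_len_bij[where f = ext])
      have sub: "X \<subseteq> S" if "X \<in> between R (self_module Q) K S" for X using that unfolding between_def by blast
      show iff: "ext X \<subseteq> ext Y \<longleftrightarrow> X \<subseteq> Y"
        if "X \<in> between R (self_module Q) K S" "Y \<in> between R (self_module Q) K S" for X Y
        by (rule ext_subset_iff) (use sub that in blast)+
      have "inj_on ext (between R (self_module Q) K S)"
        by (rule inj_onI, rule subset_antisym) (use iff in blast)+
      then show "bij_betw ext (between R (self_module Q) K S) (between B (self_module F) (ext K) (ext S))"
        unfolding between_ext by (rule inj_on_imp_bij_betw)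
    qed
    then show ?thesis unfolding ext_prod by simp
  qed
  finally show ?thesis .
qed

end

section \<open>The ring generated by a fractional canonical ideal\<close>

text \<open>Depth one supplies a regular element x of the maximal ideal. A power of x is a multiple
  of a, and a divisor of a regular element is regular.\<close>

lemma regular_parameter:
  fixes R (structure)
  assumes L: "noetherian_local_ring R" and d: "depth R (self_module R) = 1" and a: "is_parameter R a"
  shows "regular_element R a"
proof -
  interpret cring R using L by (simp add: noetherian_local_ring_def)
  interpret L: noeth_local R by unfold_locales (rule L)
  interpret M: module R "self_module R" by (rule L.AA.Emod)
  have "\<exists>xs. set xs \<subseteq> max_ideal R \<and> regular_sequence R (self_module R) xs \<and> xs \<noteq> []"
  proof (rule ccontr)
    assume "\<not> ?thesis"
    then have "depth R (self_module R) \<le> 0" unfolding depth_def by (intro Sup_least) (auto simp: zero_enat_def)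
    then show False using d by simp
  qed
  then obtain xs where xs: "set xs \<subseteq> max_ideal R" "regular_sequence R (self_module R) xs" "0 < length xs"
    by blast
  define x where "x = xs ! 0"
  have xm: "x \<in> max_ideal R" using xs(1,3) unfolding x_def by (meson nth_mem subsetD)
  have xc: "x \<in> carrier R" using xm L.m.Icarr by blast
  have z: "list_smult R [] (self_module R) = {\<zero>}" unfolding list_smult_def
    by (rule mod_span_eqI) (auto simp: M.submodule_iff)
  have xv: "v = \<zero>" if v: "v \<in> carrier R" "x \<otimes> v = \<zero>" for v
  proof -
    have "x \<odot>\<^bsub>self_module R\<^esub> v \<in> list_smult R (take 0 xs) (self_module R)" using v(2) by (simp add: z)
    then have "v \<in> list_smult R (take 0 xs) (self_module R)"
      using xs(2,3) v(1) unfolding regular_sequence_def x_def self_module_simps by blast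
    then show ?thesis by (simp add: z)
  qed
  have xk: "v = \<zero>" if "v \<in> carrier R" "x [^] k \<otimes> v = \<zero>" for v and k :: nat
    using that
  proof (induction k arbitrary: v)
    case (Suc k)
    have "x [^] k \<otimes> (x \<otimes> v) = \<zero>" using Suc.prems xc by (simp add: m_assoc)
    then have "x \<otimes> v = \<zero>" using Suc.IH[of "x \<otimes> v"] xc Suc.prems(1) by simp
    then show ?case by (rule xv[OF Suc.prems(1)])
  qed simp
  have ac: "a \<in> carrier R" using a L.m.Icarr unfolding is_parameter_def by blast
  obtain k :: nat where "x [^] k \<in> PIdl a" using a xm unfolding is_parameter_def by blast
  then obtain r where r: "r \<in> carrier R" "x [^] k = r \<otimes> a" unfolding cgenideal_def by blast
  show ?thesis unfolding regular_element_def
  proof (intro conjI ac ballI impI)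
    fix v assume v: "v \<in> carrier R" "a \<otimes> v = \<zero>"
    have "x [^] k \<otimes> v = r \<otimes> (a \<otimes> v)" unfolding r(2) using r(1) ac v(1) by (rule m_assoc)
    then show "v = \<zero>" using xk[OF v(1)] v(2) r(1) by simp
  qed
qed

lemma param_overring_total:
  assumes "cohen_macaulay_local R" "krull_dim R = 1" "total_ring_of_fractions R Q" "is_parameter R a"
  shows "param_overring R Q a"
proof -
  have L: "noetherian_local_ring R" "depth R (self_module R) = 1"
    using assms(1,2) by (simp_all add: cohen_macaulay_local_def)
  have Q: "cring R" "cring Q" "id \<in> ring_hom R Q" using assms(3) by (simp_all add: total_ring_of_fractions_def)
  have "a \<in> Units Q"
    using regular_parameter[OF L assms(4)] assms(3) by (simp add: total_ring_of_fractions_def)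
  then show ?thesis
    using Q L(1) assms(4)
    by (intro param_overring.intro overring.intro overring_axioms.intro noeth_local.intro
        noeth_local_axioms.intro param_overring_axioms.intro) (simp_all add: is_parameter_def)
qed

context overring
begin

lemma smod_generate_ring:
  assumes "K \<subseteq> carrier E" shows "smod (generate_ring E (carrier A \<union> K))"
proof -
  have c: "carrier A \<union> K \<subseteq> carrier E" using assms by auto
  show ?thesis
    by (rule smodI) (use E.generate_ring_in_carrier[OF c] E.zero_in_generate in
        \<open>auto intro: generate_ring.intros\<close>)
qed

text \<open>The elements of A[K] that map X into itself include A and K and are closed under the
  ring operations.\<close>

lemma generate_ring_stable:
  assumes K: "K \<subseteq> carrier E" and X: "smod X" and KX: "\<And>k x. k \<in> K \<Longrightarrow> x \<in> X \<Longrightarrow> k \<otimes> x \<in> X"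
    and s: "s \<in> generate_ring E (carrier A \<union> K)" and x: "x \<in> X"
  shows "s \<otimes> x \<in> X"
proof -
  have c: "carrier A \<union> K \<subseteq> carrier E" using K by auto
  note gc = E.generate_ring_in_carrier[OF c] and XD = smodD[OF X]
  show ?thesis using s x
  proof (induction arbitrary: x)
    case one
    then show ?case using XD(1) by simp
  next
    case (incl h)
    then show ?case using XD(4) KX by blast
  next
    case (a_inv h)
    then show ?case using XD(5)[OF a_inv.IH[OF a_inv.prems]] gc[OF a_inv.hyps] XD(1)[OF a_inv.prems]
      by (simp add: E.l_minus)
  next
    case (eng_add h1 h2)
    then show ?case using XD(3)[OF eng_add.IH(1)[OF eng_add.prems] eng_add.IH(2)[OF eng_add.prems]]
      gc[OF eng_add.hyps(1)] gc[OF eng_add.hyps(2)] XD(1)[OF eng_add.prems] by (simp add: E.l_distr)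
  next
    case (eng_mult h1 h2)
    then show ?case using eng_mult.IH(1)[OF eng_mult.IH(2)[OF eng_mult.prems]]
      gc[OF eng_mult.hyps(1)] gc[OF eng_mult.hyps(2)] XD(1)[OF eng_mult.prems] by (simp add: E.m_assoc)
  qed
qed

lemma min_gens_subquot:
  assumes "smod X" "smod Y" "Y \<subseteq> X"
  shows "min_gens A (subquot E X Y) = 1 \<longleftrightarrow> Y \<noteq> X \<and> cyclic_over (between A (self_module E) Y X) X"
  unfolding subquot_def
  by (rule min_gens_quot_restrict[OF Emod]) (use assms in \<open>simp_all add: smod_def\<close>)

lemma id_hom_quasi_trivial_extension:
  assumes "N \<subseteq> carrier A" "\<alpha> \<in> carrier A"
  shows "id \<in> ring_hom (quasi_trivial_extension A \<alpha> N) (quasi_trivial_extension E \<alpha> (carrier E))"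
proof -
  have N: "x \<in> carrier A" if "x \<in> N" for x using that assms(1) by blast
  show ?thesis
    by (rule ring_hom_memI) (auto simp: quasi_trivial_extension_def A_ops A_zero N assms(2) A.m_closed[unfolded A_ops]
        A_closed)
qed

end

section \<open>The concrete extension rings and change of scalars\<close>

lemma cring_quasi_trivial_extension:
  fixes C (structure)
  assumes C: "cring C" and N: "ideal N C" and \<alpha>: "\<alpha> \<in> carrier C"
  shows "cring (quasi_trivial_extension C \<alpha> N)" (is "cring ?T")
proof -
  interpret cring C by (rule C)
  interpret N: ideal N C by (rule N)
  note Nc = N.Icarr
  have ops [simp]: "carrier ?T = carrier C \<times> N" "\<one>\<^bsub>?T\<^esub> = (\<one>\<^bsub>C\<^esub>, \<zero>\<^bsub>C\<^esub>)" "\<zero>\<^bsub>?T\<^esub> = (\<zero>\<^bsub>C\<^esub>, \<zero>\<^bsub>C\<^esub>)"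
    "(b, x) \<oplus>\<^bsub>?T\<^esub> (c, y) = (b \<oplus>\<^bsub>C\<^esub> c, x \<oplus>\<^bsub>C\<^esub> y)"
    "(b, x) \<otimes>\<^bsub>?T\<^esub> (c, y) = (b \<otimes>\<^bsub>C\<^esub> c, b \<otimes>\<^bsub>C\<^esub> y \<oplus>\<^bsub>C\<^esub> c \<otimes>\<^bsub>C\<^esub> x \<oplus>\<^bsub>C\<^esub> \<alpha> \<otimes>\<^bsub>C\<^esub> (x \<otimes>\<^bsub>C\<^esub> y))" for b x c y
    by (simp_all add: quasi_trivial_extension_def)
  have assoc: "(b \<otimes> c) \<otimes> z \<oplus> d \<otimes> (b \<otimes> y \<oplus> c \<otimes> x \<oplus> \<alpha> \<otimes> (x \<otimes> y)) \<oplus> \<alpha> \<otimes> ((b \<otimes> y \<oplus> c \<otimes> x \<oplus> \<alpha> \<otimes> (x \<otimes> y)) \<otimes> z) =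
      b \<otimes> (c \<otimes> z \<oplus> d \<otimes> y \<oplus> \<alpha> \<otimes> (y \<otimes> z)) \<oplus> (c \<otimes> d) \<otimes> x \<oplus> \<alpha> \<otimes> (x \<otimes> (c \<otimes> z \<oplus> d \<otimes> y \<oplus> \<alpha> \<otimes> (y \<otimes> z)))"
    if "b \<in> carrier C" "c \<in> carrier C" "d \<in> carrier C" "x \<in> carrier C" "y \<in> carrier C" "z \<in> carrier C" for b c d x y z
    using that \<alpha> by algebra
  have distr: "(b \<oplus> c) \<otimes> z \<oplus> d \<otimes> (x \<oplus> y) \<oplus> \<alpha> \<otimes> ((x \<oplus> y) \<otimes> z) =
      (b \<otimes> z \<oplus> d \<otimes> x \<oplus> \<alpha> \<otimes> (x \<otimes> z)) \<oplus> (c \<otimes> z \<oplus> d \<otimes> y \<oplus> \<alpha> \<otimes> (y \<otimes> z))"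
    if "b \<in> carrier C" "c \<in> carrier C" "d \<in> carrier C" "x \<in> carrier C" "y \<in> carrier C" "z \<in> carrier C" for b c d x y z
    using that \<alpha> by algebra
  have comm: "b \<otimes> y \<oplus> c \<otimes> x \<oplus> \<alpha> \<otimes> (x \<otimes> y) = c \<otimes> x \<oplus> b \<otimes> y \<oplus> \<alpha> \<otimes> (y \<otimes> x)"
    if "b \<in> carrier C" "c \<in> carrier C" "x \<in> carrier C" "y \<in> carrier C" for b c x y
    using that \<alpha> by algebra
  show ?thesis
  proof (rule cringI)
    show "abelian_group ?T"
    proof (rule abelian_groupI)
      fix p assume "p \<in> carrier ?T"
      then obtain b x where p: "p = (b, x)" "b \<in> carrier C" "x \<in> N" by auto
      show "\<exists>q\<in>carrier ?T. q \<oplus>\<^bsub>?T\<^esub> p = \<zero>\<^bsub>?T\<^esub>"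
        by (rule bexI[of _ "(\<ominus> b, \<ominus> x)"]) (use p Nc in \<open>auto simp: l_neg\<close>)
    qed (auto simp: a_ac Nc)
    show "comm_monoid ?T"
    proof (rule comm_monoidI)
      fix p q r assume "p \<in> carrier ?T" "q \<in> carrier ?T" "r \<in> carrier ?T"
      then obtain b x c y d z where "p = (b, x)" "q = (c, y)" "r = (d, z)" "b \<in> carrier C" "c \<in> carrier C"
        "d \<in> carrier C" "x \<in> N" "y \<in> N" "z \<in> N" by (auto simp del: ops(4,5))
      then show "p \<otimes>\<^bsub>?T\<^esub> q \<otimes>\<^bsub>?T\<^esub> r = p \<otimes>\<^bsub>?T\<^esub> (q \<otimes>\<^bsub>?T\<^esub> r)" using assoc[of b c d x y z] by (simp add: Nc m_assoc)
    next
      fix p q assume "p \<in> carrier ?T" "q \<in> carrier ?T"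
      then obtain b x c y where "p = (b, x)" "q = (c, y)" "b \<in> carrier C" "c \<in> carrier C" "x \<in> N" "y \<in> N" by auto
      then show "p \<otimes>\<^bsub>?T\<^esub> q = q \<otimes>\<^bsub>?T\<^esub> p" using comm[of b c x y] by (simp add: Nc m_comm[of b c])
    next
      fix p q assume "p \<in> carrier ?T" "q \<in> carrier ?T"
      then obtain b x c y where "p = (b, x)" "q = (c, y)" "b \<in> carrier C" "c \<in> carrier C" "x \<in> N" "y \<in> N" by auto
      then show "p \<otimes>\<^bsub>?T\<^esub> q \<in> carrier ?T" using \<alpha> by (simp add: Nc N.I_l_closed N.a_closed)
    qed (use \<alpha> in \<open>auto simp: Nc\<close>)
    fix p q r assume "p \<in> carrier ?T" "q \<in> carrier ?T" "r \<in> carrier ?T"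
    then obtain b x c y d z where "p = (b, x)" "q = (c, y)" "r = (d, z)" "b \<in> carrier C" "c \<in> carrier C"
        "d \<in> carrier C" "x \<in> N" "y \<in> N" "z \<in> N" by (auto simp del: ops(4,5))
    then show "(p \<oplus>\<^bsub>?T\<^esub> q) \<otimes>\<^bsub>?T\<^esub> r = p \<otimes>\<^bsub>?T\<^esub> r \<oplus>\<^bsub>?T\<^esub> q \<otimes>\<^bsub>?T\<^esub> r"
      using distr[of b c d x y z] by (simp add: Nc l_distr)
  qed
qed

lemma cring_RDirProd:
  assumes "cring C" "cring D" shows "cring (RDirProd C D)"
proof -
  interpret C: cring C by fact
  interpret D: cring D by fact
  interpret ring "RDirProd C D" by (rule RDirProd_ring) unfold_locales
  show ?thesis
    by unfold_locales (auto simp: RDirProd_def DirProd_def monoid.defs C.m_comm D.m_comm)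
qed

lemma double_fiber_product_carrier:
  assumes "cring C" "ideal N C"
  shows "carrier (double_fiber_product C N) = {(x, y). x \<in> carrier C \<and> y \<in> carrier C \<and> y \<ominus>\<^bsub>C\<^esub> x \<in> N}"
proof -
  interpret C: cring C by fact
  show ?thesis unfolding double_fiber_product_def fiber_product_def
    using C.quotient_eq_iff_same_a_r_cos[OF assms(2)] by (auto; metis)
qed

lemma RDirProd_ops:
  "(x, y) \<otimes>\<^bsub>RDirProd C D\<^esub> (x', y') = (x \<otimes>\<^bsub>C\<^esub> x', y \<otimes>\<^bsub>D\<^esub> y')"
  "(x, y) \<oplus>\<^bsub>RDirProd C D\<^esub> (x', y') = (x \<oplus>\<^bsub>C\<^esub> x', y \<oplus>\<^bsub>D\<^esub> y')"
  "\<one>\<^bsub>RDirProd C D\<^esub> = (\<one>\<^bsub>C\<^esub>, \<one>\<^bsub>D\<^esub>)" "\<zero>\<^bsub>RDirProd C D\<^esub> = (\<zero>\<^bsub>C\<^esub>, \<zero>\<^bsub>D\<^esub>)"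
  by (simp_all add: RDirProd_def DirProd_def monoid.defs)

lemma cring_double_fiber_product:
  assumes C: "cring C" and N: "ideal N C"
  shows "cring (double_fiber_product C N)"
proof -
  interpret C: cring C by fact
  interpret N: ideal N C by fact
  interpret D: cring "RDirProd C C" by (rule cring_RDirProd[OF C C])
  let ?X = "{(x, y). x \<in> carrier C \<and> y \<in> carrier C \<and> y \<ominus>\<^bsub>C\<^esub> x \<in> N}"
  have X: "?X \<subseteq> carrier (RDirProd C C)" by (auto simp: RDirProd_carrier)
  have m: "y \<otimes>\<^bsub>C\<^esub> v \<ominus>\<^bsub>C\<^esub> x \<otimes>\<^bsub>C\<^esub> u = y \<otimes>\<^bsub>C\<^esub> (v \<ominus>\<^bsub>C\<^esub> u) \<oplus>\<^bsub>C\<^esub> u \<otimes>\<^bsub>C\<^esub> (y \<ominus>\<^bsub>C\<^esub> x)"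
    and p: "(y \<oplus>\<^bsub>C\<^esub> v) \<ominus>\<^bsub>C\<^esub> (x \<oplus>\<^bsub>C\<^esub> u) = (y \<ominus>\<^bsub>C\<^esub> x) \<oplus>\<^bsub>C\<^esub> (v \<ominus>\<^bsub>C\<^esub> u)"
    and n: "(\<ominus>\<^bsub>C\<^esub> y) \<ominus>\<^bsub>C\<^esub> (\<ominus>\<^bsub>C\<^esub> x) = \<ominus>\<^bsub>C\<^esub> (y \<ominus>\<^bsub>C\<^esub> x)"
    if "x \<in> carrier C" "y \<in> carrier C" "u \<in> carrier C" "v \<in> carrier C" for x y u v
    using that by algebra+
  have o: "\<one>\<^bsub>C\<^esub> \<ominus>\<^bsub>C\<^esub> \<one>\<^bsub>C\<^esub> = \<zero>\<^bsub>C\<^esub>" by algebra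
  have neg: "\<ominus>\<^bsub>RDirProd C C\<^esub> (x, y) = (\<ominus>\<^bsub>C\<^esub> x, \<ominus>\<^bsub>C\<^esub> y)" if "x \<in> carrier C" "y \<in> carrier C" for x y
    by (rule D.minus_equality) (use that in \<open>auto simp: RDirProd_ops RDirProd_carrier C.l_neg\<close>)
  have "subring ?X (RDirProd C C)"
  proof (rule D.subringI[OF X])
    show "\<one>\<^bsub>RDirProd C C\<^esub> \<in> ?X" by (simp add: RDirProd_ops o)
  qed (auto simp: RDirProd_ops m p n neg N.I_l_closed N.a_closed N.a_inv_closed)
  then have "cring ((RDirProd C C)\<lparr>carrier := ?X\<rparr>)"
    using D.subcringI' D.subcring_iff[OF X] by blast
  moreover have "double_fiber_product C N = (RDirProd C C)\<lparr>carrier := ?X\<rparr>"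
    using double_fiber_product_carrier[OF C N] unfolding double_fiber_product_def fiber_product_def by simp
  ultimately show ?thesis by simp
qed

text \<open>Restriction along a map onto the scalars leaves the set of operators on M, and with it
  the notion of submodule, unchanged.\<close>

lemma submodule_restrict_scalars_iff:
  assumes "\<phi> ` carrier A = carrier B"
  shows "submodule N A (restrict_scalars \<phi> M) \<longleftrightarrow> submodule N B M"
proof -
  have "subgroup N (add_monoid (restrict_scalars \<phi> M)) \<longleftrightarrow> subgroup N (add_monoid M)"
    unfolding subgroup_def by (simp add: restrict_scalars_def m_inv_def)
  moreover have "(\<forall>c x. c \<in> carrier A \<longrightarrow> x \<in> N \<longrightarrow> \<phi> c \<odot>\<^bsub>M\<^esub> x \<in> N) \<longleftrightarrow>
      (\<forall>c x. c \<in> carrier B \<longrightarrow> x \<in> N \<longrightarrow> c \<odot>\<^bsub>M\<^esub> x \<in> N)"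
    unfolding assms[symmetric] by blast
  ultimately show ?thesis
    unfolding submodule_def submodule_axioms_def by (simp add: restrict_scalars_def)
qed

lemma min_gens_restrict_scalars:
  assumes "\<phi> ` carrier A = carrier B"
  shows "min_gens A (restrict_scalars \<phi> M) = min_gens B M"
proof -
  have "carrier (restrict_scalars \<phi> M) = carrier M" by (simp add: restrict_scalars_def)
  then show ?thesis
    unfolding min_gens_def mod_span_def submodule_restrict_scalars_iff[OF assms] by simp
qed

text \<open>The carrier does not enter the inductive definition, so L^2 computed in the extension of
  S by S is the same set as L^2 computed in the extension of Q by Q.\<close>

lemma ideal_prod_carrier_update: "ideal_prod (C\<lparr>carrier := X\<rparr>) I J = ideal_prod C I J"
proof (intro subset_antisym subsetI)
  fix z assume "z \<in> ideal_prod (C\<lparr>carrier := X\<rparr>) I J"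
  then show "z \<in> ideal_prod C I J" by induction (auto intro: ideal_prod.intros)
next
  fix z assume "z \<in> ideal_prod C I J"
  then show "z \<in> ideal_prod (C\<lparr>carrier := X\<rparr>) I J"
  proof induction
    case (prod i j)
    then show ?case using ideal_prod.prod[of i I j J "C\<lparr>carrier := X\<rparr>"] by simp
  next
    case (sum s t)
    then show ?case using ideal_prod.sum[of s "C\<lparr>carrier := X\<rparr>" I J t] by simp
  qed
qed

lemma subquot_carrier_update: "subquot (C\<lparr>carrier := X\<rparr>) Y Z = subquot C Y Z"
  by (simp add: subquot_def self_module_def)

section \<open>Boundedness from a reduction, and the square of K\<close>

context param_overring
begin

lemma ideal_power_props:
  assumes I: "smod I" "I \<subseteq> carrier A" "a \<in> I"
  shows "smod (ideal_power A I r)" "ideal_power A I r \<subseteq> carrier A" "a [^] r \<in> ideal_power A I r"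
proof -
  have "smod (ideal_power A I r) \<and> ideal_power A I r \<subseteq> carrier A \<and> a [^] r \<in> ideal_power A I r"
  proof (induction r)
    case 0
    then show ?case using smod_A A_closed(6) by simp
  next
    case (Suc r)
    then have r: "smod (ideal_power A I r)" "ideal_power A I r \<subseteq> carrier A" "a [^] r \<in> ideal_power A I r" by auto
    have "ideal_prod E I (ideal_power A I r) \<subseteq> carrier A"
      by (rule prod_subset[OF smod_A]) (use I(2) r(2) A_closed(1) in blast)
    moreover have "a [^] Suc r \<in> ideal_prod E I (ideal_power A I r)"
      using ideal_prod.prod[OF I(3) r(3), of E] a_A by (simp add: E.m_comm)
    ultimately show ?case using smod_prod[OF I(1) r(1)] prod_A_eq[OF I(2) r(2)] by simp
  qed
  then show "smod (ideal_power A I r)" "ideal_power A I r \<subseteq> carrier A" "a [^] r \<in> ideal_power A I r" by auto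
qed

text \<open>With P = I^r and K = a^(-1) I, the equation I^(r + 1) = aI^r says KP = P. So A[K] maps P
  into itself, and since a^r lies in P and P lies in A, the power a^r clears all denominators of
  A[K].\<close>

lemma reduction_bounded:
  assumes I: "smod I" "I \<subseteq> carrier A" and red: "is_reduction A a I"
  obtains N :: nat where "\<And>s. s \<in> generate_ring E (carrier A \<union> scal (inv a) I) \<Longrightarrow> a [^] N \<otimes> s \<in> carrier A"
proof -
  have aI: "a \<in> I" using red A.cgenideal_self[OF a_A(1)] unfolding is_reduction_def by blast
  obtain r where r: "ideal_power A I (Suc r) = ideal_prod A (PIdl\<^bsub>A\<^esub> a) (ideal_power A I r)"
    using red unfolding is_reduction_def by blast
  define P where "P = ideal_power A I r"
  note PP = ideal_power_props[OF I aI, of r, folded P_def]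
  have aP: "ideal_prod E I P = scal a P"
    using r PIdl_prod[OF a_A(1) PP(1,2)] prod_A_eq[OF I(2) PP(2)] by (simp add: P_def)
  have Ic: "I \<subseteq> carrier E" using smodD(1)[OF I(1)] by blast
  have K: "scal (inv a) I \<subseteq> carrier E" using smodD(1)[OF smod_scal[OF I(1), of "inv a"]] a_unit by auto
  have stab: "k \<otimes> x \<in> P" if k: "k \<in> scal (inv a) I" and x: "x \<in> P" for k x
  proof -
    obtain i where i: "i \<in> I" "k = inv a \<otimes> i" using k unfolding scal_def by blast
    have "i \<otimes> x \<in> scal a P" unfolding aP[symmetric] by (rule ideal_prod.prod[OF i(1) x])
    then obtain p where p: "p \<in> P" "i \<otimes> x = a \<otimes> p" unfolding scal_def by blast
    have "k \<otimes> x = inv a \<otimes> (i \<otimes> x)"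
      unfolding i(2) using i(1) Ic smodD(1)[OF PP(1) x] a_unit by (intro E.m_assoc) auto
    also have "\<dots> = p" unfolding p(2) by (rule unit_cancel(1)[OF a_unit smodD(1)[OF PP(1) p(1)]])
    finally show ?thesis using p(1) by simp
  qed
  show ?thesis
  proof (rule that[of r])
    fix s assume s: "s \<in> generate_ring E (carrier A \<union> scal (inv a) I)"
    have "s \<otimes> a [^] r \<in> P" by (rule generate_ring_stable[OF K PP(1) stab s PP(3)])
    moreover have "s \<in> carrier E" using smodD(1)[OF smod_generate_ring[OF K] s] .
    ultimately show "a [^] r \<otimes> s \<in> carrier A" using PP(2) by (auto simp: E.m_comm)
  qed
qed

text \<open>
  If \<open>S = A[K]\<close> is \<open>K + Ax\<close> with \<open>x \<notin> K\<close>, then \<open>K\<^sup>2\<close> is not contained in \<open>K + \<mm>x\<close>, as otherwise the latter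
  would be stable under \<open>K\<close> and hence contain \<open>S\<close>. An element of \<open>K\<^sup>2\<close> outside \<open>K + \<mm>x\<close> yields \<open>x \<in> K\<^sup>2\<close>.
\<close>

lemma cyclic_square:
  assumes K: "smod K" "\<one> \<in> K" and S: "S = generate_ring E (carrier A \<union> K)" and SK: "S \<noteq> K"
    and cyc: "cyclic_over (between A (self_module E) K S) S"
  shows "ideal_prod E K K = S"
proof -
  let ?KK = "ideal_prod E K K"
  have Kc: "K \<subseteq> carrier E" using smodD(1)[OF K(1)] by blast
  have Ss: "smod S" unfolding S by (rule smod_generate_ring[OF Kc])
  have KS: "K \<subseteq> S" unfolding S by (auto intro: generate_ring.incl)
  have Sm: "s \<otimes> t \<in> S" if "s \<in> S" "t \<in> S" for s t using that unfolding S by (rule generate_ring.eng_mult)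
  have KKs: "smod ?KK" by (rule smod_prod[OF K(1) K(1)])
  have KKS: "?KK \<subseteq> S" by (rule prod_subset[OF Ss Sm]) (use KS in blast)+
  have K_KK: "K \<subseteq> ?KK"
  proof
    fix k assume k: "k \<in> K"
    have "k \<otimes> \<one> \<in> ?KK" using k K(2) by (rule ideal_prod.prod)
    then show "k \<in> ?KK" using k Kc by auto
  qed
  obtain x where x: "x \<in> S" "\<And>H. H \<in> between A (self_module E) K S \<Longrightarrow> x \<in> H \<Longrightarrow> H = S"
    using cyc unfolding cyclic_over_def by blast
  have xc: "x \<in> carrier E" using smodD(1)[OF Ss x(1)] .
  have btw: "H = S" if "smod H" "K \<subseteq> H" "H \<subseteq> S" "x \<in> H" for H
    using that x(2)[of H] unfolding between_def smod_def by blast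
  define H1 where "H1 = {n \<oplus> r \<otimes> x | n r. n \<in> K \<and> r \<in> \<mm>}"
  have rep: "\<exists>n\<in>K. \<exists>r\<in>carrier A. y = n \<oplus> r \<otimes> x" if "y \<in> S" for y
  proof -
    have "{n \<oplus> r \<otimes> x | n r. n \<in> K \<and> r \<in> carrier A} = S"
      by (rule btw) (use smod_adjoin[OF K(1) xc] x(1) KS smodD(3,4)[OF Ss] in auto)
    then show ?thesis using that by blast
  qed
  note KD = smodD[OF K(1)]
  have xK: "x \<notin> K" using btw[OF K(1) order_refl KS] SK by blast
  have H1s: "smod H1"
  proof (rule smodI)
    show "H1 \<subseteq> carrier E" unfolding H1_def using Kc xc m_A by auto
    have "\<zero> = \<zero> \<oplus> \<zero> \<otimes> x" using xc by simp
    then show "\<zero> \<in> H1" unfolding H1_def using KD(2) m.zero_closed A_zero by fastforce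
    show "u \<oplus> v \<in> H1" if uv: "u \<in> H1" "v \<in> H1" for u v
    proof -
      obtain n r n' r' where 1: "u = n \<oplus> r \<otimes> x" "n \<in> K" "r \<in> \<mm>" "v = n' \<oplus> r' \<otimes> x" "n' \<in> K" "r' \<in> \<mm>"
        using uv unfolding H1_def by blast
      have c: "n \<in> carrier E" "n' \<in> carrier E" "r \<in> carrier E" "r' \<in> carrier E" using 1 Kc m_A by auto
      have "u \<oplus> v = (n \<oplus> n') \<oplus> (r \<oplus> r') \<otimes> x" unfolding 1(1,4) using c xc by algebra
      moreover have "r \<oplus> r' \<in> \<mm>" using m.a_closed[OF 1(3,6)] A_ops(2) m_A 1 by simp
      ultimately show ?thesis unfolding H1_def using KD(3)[OF 1(2,5)] by blast
    qed
    show "s \<otimes> u \<in> H1" if su: "s \<in> carrier A" "u \<in> H1" for s u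
    proof -
      obtain n r where 1: "u = n \<oplus> r \<otimes> x" "n \<in> K" "r \<in> \<mm>" using su(2) unfolding H1_def by blast
      have c: "n \<in> carrier E" "r \<in> carrier E" "s \<in> carrier E" using 1 Kc m_A su by auto
      have "s \<otimes> u = s \<otimes> n \<oplus> (s \<otimes> r) \<otimes> x" unfolding 1(1) using c xc by algebra
      moreover have "s \<otimes> r \<in> \<mm>" using m.I_l_closed[OF 1(3) su(1)] A_ops(1) m_A 1 su by simp
      ultimately show ?thesis unfolding H1_def using KD(4)[OF su(1) 1(2)] by blast
    qed
  qed
  \<comment> \<open>Nakayama's argument for the single element x: from x = n + rx with r in
    \<open>\<mm>\<close> the unit 1 - r can be inverted, which puts x into K.\<close>
  have xH1: "x \<notin> H1"
  proof
    assume "x \<in> H1"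
    then obtain n r where 1: "x = n \<oplus> r \<otimes> x" "n \<in> K" "r \<in> \<mm>" unfolding H1_def by blast
    have c: "n \<in> carrier E" "r \<in> carrier E" "r \<in> carrier A" using 1(2,3) Kc m_A by auto
    have "(\<one> \<ominus> r) \<otimes> x = x \<ominus> r \<otimes> x" using c xc by algebra
    also have "\<dots> = (n \<oplus> r \<otimes> x) \<ominus> r \<otimes> x" using 1(1) by simp
    also have "\<dots> = n" using c xc by algebra
    finally have n: "(\<one> \<ominus> r) \<otimes> x = n" .
    have u: "\<one> \<ominus> r \<in> carrier A" using c A_closed by blast
    have "\<one> \<ominus> r \<notin> \<mm>"
    proof
      assume "\<one> \<ominus> r \<in> \<mm>"
      then have "(\<one> \<ominus> r) \<oplus> r \<in> \<mm>" using m.a_closed[OF _ 1(3), of "\<one> \<ominus> r"] A_ops(2)[OF u c(3)] by simp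
      moreover have "(\<one> \<ominus> r) \<oplus> r = \<one>" using c by algebra
      ultimately show False using one_notin_m by (simp add: A_ops(3))
    qed
    then have "\<one> \<ominus> r \<in> Units A" using unit_iff[OF u] by blast
    then obtain v where v: "v \<in> carrier A" "v \<otimes> (\<one> \<ominus> r) = \<one>"
      using A.Units_inv_closed A.Units_l_inv A_ops u by metis
    have "v \<otimes> n = (v \<otimes> (\<one> \<ominus> r)) \<otimes> x" unfolding n[symmetric] using v(1) u xc by (simp add: E.m_assoc)
    then have "x = v \<otimes> n" using v(2) xc by simp
    then show False using KD(4)[OF v(1) 1(2)] xK by simp
  qed
  have K_H1: "K \<subseteq> H1"
  proof
    fix n assume n: "n \<in> K"
    have "n = n \<oplus> \<zero> \<otimes> x" using xc n Kc by auto
    then show "n \<in> H1" unfolding H1_def using n m.zero_closed A_zero by fastforce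
  qed
  have "\<not> ?KK \<subseteq> H1"
  proof
    assume KKH: "?KK \<subseteq> H1"
    \<comment> \<open>With kx = n' + r'x the product k(n + rx) equals kn + rn' + r'rx. The term kn
      is in K^2, which lies in \<open>H1\<close> by assumption, and r'r is again in
      \<open>\<mm>\<close>.\<close>
    have stab: "k \<otimes> y \<in> H1" if k: "k \<in> K" and y: "y \<in> H1" for k y
    proof -
      obtain n r where 1: "y = n \<oplus> r \<otimes> x" "n \<in> K" "r \<in> \<mm>" using y unfolding H1_def by blast
      have "k \<otimes> x \<in> S" using Sm k KS x(1) by blast
      then obtain n' r' where 2: "n' \<in> K" "r' \<in> carrier A" "k \<otimes> x = n' \<oplus> r' \<otimes> x" using rep by blast
      have c: "k \<in> carrier E" "n \<in> carrier E" "r \<in> carrier E" "n' \<in> carrier E" "r' \<in> carrier E" "r \<in> carrier A"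
        using k 1 2 Kc m_A by auto
      have "k \<otimes> y = k \<otimes> n \<oplus> r \<otimes> (k \<otimes> x)" unfolding 1(1) using c xc by algebra
      also have "\<dots> = k \<otimes> n \<oplus> (r \<otimes> n' \<oplus> (r' \<otimes> r) \<otimes> x)" unfolding 2(3) using c xc by algebra
      also have "\<dots> \<in> H1"
      proof (rule smodD(3)[OF H1s])
        show "k \<otimes> n \<in> H1" using KKH ideal_prod.prod[OF k 1(2)] by blast
        have "r' \<otimes> r \<in> \<mm>" using m.I_l_closed[OF 1(3) 2(2)] A_ops(1)[OF 2(2) c(6)] by simp
        then show "r \<otimes> n' \<oplus> (r' \<otimes> r) \<otimes> x \<in> H1" unfolding H1_def using KD(4)[OF c(6) 2(1)] by blast
      qed
      finally show ?thesis .
    qed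
    have "x \<otimes> \<one> \<in> H1"
      by (rule generate_ring_stable[OF Kc H1s stab]) (use x(1) S K_H1 K(2) in auto)
    then show False using xH1 xc by simp
  qed
  then obtain y where y: "y \<in> ?KK" "y \<notin> H1" by blast
  have "y \<in> S" using y(1) KKS by blast
  then obtain n r where 1: "n \<in> K" "r \<in> carrier A" "y = n \<oplus> r \<otimes> x" using rep by blast
  have "r \<notin> \<mm>" using y(2) 1 unfolding H1_def by blast
  then have "r \<in> Units A" using unit_iff[OF 1(2)] by blast
  then obtain v where v: "v \<in> carrier A" "v \<otimes> r = \<one>"
    using A.Units_inv_closed A.Units_l_inv A_ops 1(2) by metis
  have c: "n \<in> carrier E" "r \<in> carrier E" "v \<in> carrier E" using 1 v Kc by auto
  \<comment> \<open>The coefficient of x in y is a unit, so x is recovered from y and n, both of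
    which lie in K^2.\<close>
  have "v \<otimes> (y \<ominus> n) = (v \<otimes> r) \<otimes> x" unfolding 1(3) using c xc by algebra
  then have "v \<otimes> (y \<ominus> n) = x" using v(2) xc by simp
  moreover have "v \<otimes> (y \<ominus> n) \<in> ?KK"
    using smodD(4)[OF KKs v(1) smodD(6)[OF KKs y(1)]] K_KK 1(1) by blast
  ultimately have "x \<in> ?KK" by simp
  then show ?thesis by (rule btw[OF KKs K_KK KKS])
qed

text \<open>If K^3 = K^2, then K^2 is stable under K, and as it contains 1 it contains S. The
  converse is \<open>cyclic_square\<close>, after which K^3 = KS = S.\<close>

lemma square_iff:
  assumes K: "smod K" "\<one> \<in> K" and S: "S = generate_ring E (carrier A \<union> K)"
  defines "KK \<equiv> ideal_prod E K K"
  shows "ideal_prod E K KK = KK \<and> chain_len (between A (self_module E) K KK) = l \<and>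
      min_gens A (subquot E KK K) = 1 \<longleftrightarrow>
    chain_len (between A (self_module E) K S) = l \<and> S \<noteq> K \<and> cyclic_over (between A (self_module E) K S) S"
    (is "?L \<longleftrightarrow> ?R")
proof -
  have Kc: "K \<subseteq> carrier E" using smodD(1)[OF K(1)] by blast
  have Ss: "smod S" unfolding S by (rule smod_generate_ring[OF Kc])
  have KS: "K \<subseteq> S" unfolding S by (auto intro: generate_ring.incl)
  have Sm: "s \<otimes> t \<in> S" if "s \<in> S" "t \<in> S" for s t using that unfolding S by (rule generate_ring.eng_mult)
  have KKs: "smod KK" unfolding KK_def by (rule smod_prod[OF K(1) K(1)])
  have K_KK: "K \<subseteq> KK"
  proof
    fix k assume k: "k \<in> K"
    have "k \<otimes> \<one> \<in> KK" unfolding KK_def using k K(2) by (rule ideal_prod.prod)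
    then show "k \<in> KK" using k Kc by auto
  qed
  have cyc: "min_gens A (subquot E KK K) = 1 \<longleftrightarrow>
      K \<noteq> KK \<and> cyclic_over (between A (self_module E) K KK) KK"
    by (rule min_gens_subquot[OF KKs K(1) K_KK])
  show ?thesis
  proof
    assume L: ?L
    have "KK = S"
    proof
      show "KK \<subseteq> S" unfolding KK_def by (rule prod_subset[OF Ss Sm]) (use KS in blast)+
      show "S \<subseteq> KK"
      proof
        fix s assume s: "s \<in> S"
        have "s \<otimes> \<one> \<in> KK"
        proof (rule generate_ring_stable[OF Kc KKs])
          show "k \<otimes> x \<in> KK" if "k \<in> K" "x \<in> KK" for k x
            using ideal_prod.prod[OF that, of E] L by simp
          show "s \<in> generate_ring E (carrier A \<union> K)" using s S by simp
          show "\<one> \<in> KK" using K(2) K_KK by blast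
        qed
        then show "s \<in> KK" using smodD(1)[OF Ss s] by simp
      qed
    qed
    then show ?R using L cyc by auto
  next
    assume R: ?R
    have KK: "KK = S" unfolding KK_def using R by (intro cyclic_square[OF K S]) auto
    have "ideal_prod E K S = S"
    proof
      show "ideal_prod E K S \<subseteq> S" by (rule prod_subset[OF Ss Sm]) (use KS in blast)+
      show "S \<subseteq> ideal_prod E K S"
      proof
        fix s assume s: "s \<in> S"
        have "\<one> \<otimes> s \<in> ideal_prod E K S" using K(2) s by (rule ideal_prod.prod)
        then show "s \<in> ideal_prod E K S" using smodD(1)[OF Ss s] by simp
      qed
    qed
    then show ?L using R cyc unfolding KK by auto
  qed
qed

end

text \<open>In the second presentation h inverts \<open>fiber_to_quasi\<close>: the ambient ring is
  E x E with componentwise operations, in which the elements (x, x + y) multiply by the coordinate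
  rule for \<alpha> = 1.\<close>

lemma (in overring) quasi_trivial_extension_instance:
  fixes a K S \<cc> \<alpha> and N :: nat
  assumes P: "param_overring A E a" and dim: "krull_dim A = 1"
    and K: "param_overring.type1 A E K" "param_overring.frac A E a K" "\<one> \<in> K"
    and S: "smod S" "K \<subseteq> S" "\<And>x y. x \<in> S \<Longrightarrow> y \<in> S \<Longrightarrow> x \<otimes> y \<in> S" "\<And>x. x \<in> S \<Longrightarrow> a [^] N \<otimes> x \<in> carrier A"
    and c: "\<cc> = {z \<in> carrier E. \<forall>s\<in>S. z \<otimes> s \<in> carrier A}"
    and \<alpha>: "\<alpha> \<in> {\<zero>, \<one>}"
  shows "quasi_extension A E a K S \<cc> \<alpha> N
      (quasi_trivial_extension A \<alpha> \<cc>) (quasi_trivial_extension E \<alpha> (carrier E)) Pair" (is ?thesis1)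
    and "\<alpha> = \<one> \<Longrightarrow> quasi_extension A E a K S \<cc> \<alpha> N
      (double_fiber_product A \<cc>) (RDirProd E E) (\<lambda>x y. (x, x \<oplus> y))" (is "_ \<Longrightarrow> ?thesis2")
proof -
  interpret P: param_overring A E a by (rule P)
  have oneS: "\<one> \<in> S" using S(2) K(3) by blast
  have cA: "z \<in> carrier A" if "z \<in> \<cc>" for z
    using that oneS unfolding c by (metis (lifting) E.r_one mem_Collect_eq)
  have Sc: "S \<subseteq> carrier E" using smodD(1)[OF S(1)] by blast
  have cs: "smod \<cc>" unfolding c by (rule smod_colon[OF smod_A Sc])
  have ci: "ideal \<cc> A" unfolding ideal_iff using cs cA by blast
  have \<alpha>c: "\<alpha> \<in> carrier A" "\<alpha> \<in> carrier E" using \<alpha> A_closed(5,6) by auto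
  have base: "quasi_extension_axioms A E a K S \<cc> \<alpha> N B F h"
    if "cring B" "cring F" "id \<in> ring_hom B F"
      "carrier B = (\<lambda>(x, y). h x y) ` (carrier A \<times> \<cc>)" "carrier F = (\<lambda>(x, y). h x y) ` (carrier E \<times> carrier E)"
      "\<And>x y x' y'. x \<in> carrier E \<Longrightarrow> y \<in> carrier E \<Longrightarrow> x' \<in> carrier E \<Longrightarrow> y' \<in> carrier E \<Longrightarrow>
        h x y = h x' y' \<longleftrightarrow> x = x' \<and> y = y'"
      "\<And>x y x' y'. x \<in> carrier E \<Longrightarrow> y \<in> carrier E \<Longrightarrow> x' \<in> carrier E \<Longrightarrow> y' \<in> carrier E \<Longrightarrow>
        h x y \<oplus>\<^bsub>F\<^esub> h x' y' = h (x \<oplus> x') (y \<oplus> y')"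
      "\<And>x y x' y'. x \<in> carrier E \<Longrightarrow> y \<in> carrier E \<Longrightarrow> x' \<in> carrier E \<Longrightarrow> y' \<in> carrier E \<Longrightarrow>
        h x y \<otimes>\<^bsub>F\<^esub> h x' y' = h (x \<otimes> x') (x \<otimes> y' \<oplus> x' \<otimes> y \<oplus> \<alpha> \<otimes> (y \<otimes> y'))"
      "\<one>\<^bsub>F\<^esub> = h \<one> \<zero>"
    for B F :: "('a \<times> 'a) ring" and h :: "'a \<Rightarrow> 'a \<Rightarrow> 'a \<times> 'a"
    by (rule quasi_extension_axioms.intro[OF dim K S c \<alpha> that])
  have Ei: "ideal (carrier E) E" by (rule E.oneideal)
  show ?thesis1
  proof (rule quasi_extension.intro[OF P base])
    show "cring (quasi_trivial_extension A \<alpha> \<cc>)"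
      by (rule cring_quasi_trivial_extension[OF A.is_cring ci \<alpha>c(1)])
    show "cring (quasi_trivial_extension E \<alpha> (carrier E))"
      by (rule cring_quasi_trivial_extension[OF E.is_cring Ei \<alpha>c(2)])
    show "id \<in> ring_hom (quasi_trivial_extension A \<alpha> \<cc>) (quasi_trivial_extension E \<alpha> (carrier E))"
      by (rule id_hom_quasi_trivial_extension) (use cA \<alpha>c in auto)
  qed (auto simp: quasi_trivial_extension_def)
  assume \<alpha>1: "\<alpha> = \<one>"
  have dc: "carrier (double_fiber_product A \<cc>) = {(x, y). x \<in> carrier A \<and> y \<in> carrier A \<and> y \<ominus>\<^bsub>A\<^esub> x \<in> \<cc>}"
    by (rule double_fiber_product_carrier[OF A.is_cring ci])
  have sub1: "x \<oplus> (y \<ominus> x) = y" and sub2: "(x \<oplus> y) \<ominus> x = y" if "x \<in> carrier E" "y \<in> carrier E" for x y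
    using that by algebra+
  have minus: "y \<ominus>\<^bsub>A\<^esub> x = y \<ominus> x" if "x \<in> carrier A" "y \<in> carrier A" for x y
    using that by (simp add: a_minus_def A_uminus A_ops A_closed)
  show ?thesis2
  proof (rule quasi_extension.intro[OF P base])
    show "cring (double_fiber_product A \<cc>)" by (rule cring_double_fiber_product[OF A.is_cring ci])
    show "cring (RDirProd E E)" by (rule cring_RDirProd[OF E.is_cring E.is_cring])
    have ops: "p \<otimes>\<^bsub>double_fiber_product A \<cc>\<^esub> q = p \<otimes>\<^bsub>RDirProd A A\<^esub> q"
      "p \<oplus>\<^bsub>double_fiber_product A \<cc>\<^esub> q = p \<oplus>\<^bsub>RDirProd A A\<^esub> q"
      "\<one>\<^bsub>double_fiber_product A \<cc>\<^esub> = \<one>\<^bsub>RDirProd A A\<^esub>" for p q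
      by (simp_all add: double_fiber_product_def fiber_product_def)
    show "id \<in> ring_hom (double_fiber_product A \<cc>) (RDirProd E E)"
      by (rule ring_hom_memI) (auto simp: dc ops RDirProd_ops RDirProd_carrier A_ops)
    show "carrier (double_fiber_product A \<cc>) = (\<lambda>(x, y). (x, x \<oplus> y)) ` (carrier A \<times> \<cc>)"
    proof (intro subset_antisym subsetI)
      fix p assume "p \<in> carrier (double_fiber_product A \<cc>)"
      then obtain x y where p: "p = (x, y)" "x \<in> carrier A" "y \<in> carrier A" "y \<ominus> x \<in> \<cc>"
        unfolding dc using minus by auto
      then have "p = (\<lambda>(x, y). (x, x \<oplus> y)) (x, y \<ominus> x)" using sub1[of x y] by simp
      then show "p \<in> (\<lambda>(x, y). (x, x \<oplus> y)) ` (carrier A \<times> \<cc>)" using p(2,4) by blast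
    next
      fix p assume "p \<in> (\<lambda>(x, y). (x, x \<oplus> y)) ` (carrier A \<times> \<cc>)"
      then obtain x y where p: "p = (x, x \<oplus> y)" "x \<in> carrier A" "y \<in> \<cc>" by auto
      then show "p \<in> carrier (double_fiber_product A \<cc>)"
        unfolding dc using minus[OF p(2) A_closed(2)[OF p(2) cA[OF p(3)]]] sub2[of x y] cA[OF p(3)]
          A_closed(2)[OF p(2) cA[OF p(3)]] by simp
    qed
    show "carrier (RDirProd E E) = (\<lambda>(x, y). (x, x \<oplus> y)) ` (carrier E \<times> carrier E)"
    proof (intro subset_antisym subsetI)
      fix p assume "p \<in> carrier (RDirProd E E)"
      then obtain x y where p: "p = (x, y)" "x \<in> carrier E" "y \<in> carrier E" by (auto simp: RDirProd_carrier)
      then have "p = (\<lambda>(x, y). (x, x \<oplus> y)) (x, y \<ominus> x)" using sub1[of x y] by simp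
      then show "p \<in> (\<lambda>(x, y). (x, x \<oplus> y)) ` (carrier E \<times> carrier E)" using p(2,3) by blast
    qed (auto simp: RDirProd_carrier)
    fix x y x' y' assume xy: "x \<in> carrier E" "y \<in> carrier E" "x' \<in> carrier E" "y' \<in> carrier E"
    show "(x, x \<oplus> y) = (x', x' \<oplus> y') \<longleftrightarrow> x = x' \<and> y = y'"
      using xy by auto
    have "(x \<oplus> y) \<oplus> (x' \<oplus> y') = (x \<oplus> x') \<oplus> (y \<oplus> y')" using xy by algebra
    then show "(x, x \<oplus> y) \<oplus>\<^bsub>RDirProd E E\<^esub> (x', x' \<oplus> y') = (x \<oplus> x', (x \<oplus> x') \<oplus> (y \<oplus> y'))"
      by (simp add: RDirProd_ops)
    have "(x \<oplus> y) \<otimes> (x' \<oplus> y') = x \<otimes> x' \<oplus> (x \<otimes> y' \<oplus> x' \<otimes> y \<oplus> \<one> \<otimes> (y \<otimes> y'))" using xy by algebra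
    then show "(x, x \<oplus> y) \<otimes>\<^bsub>RDirProd E E\<^esub> (x', x' \<oplus> y') =
        (x \<otimes> x', x \<otimes> x' \<oplus> (x \<otimes> y' \<oplus> x' \<otimes> y \<oplus> \<alpha> \<otimes> (y \<otimes> y')))"
      by (simp add: RDirProd_ops \<alpha>1)
  next
    show "\<one>\<^bsub>RDirProd E E\<^esub> = (\<one>, \<one> \<oplus> \<zero>)" by (simp add: RDirProd_ops)
  qed
qed

theorem corollary5p4:
  fixes R Q :: "'a ring" and I K S \<cc> :: "'a set" and a :: 'a and n :: nat
    and L :: "('a \<times> 'a) set"
    and A\<^sub>2 A\<^sub>3 E\<^sub>0 E\<^sub>1 :: "('a \<times> 'a) ring"
  assumes CM: "cohen_macaulay_local R" and dim: "krull_dim R = 1"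
    and Q: "total_ring_of_fractions R Q"
    and I: "canonical_ideal R I"
    and a: "is_parameter R a" "is_reduction R a I"
    and K: "K = {x \<otimes>\<^bsub>Q\<^esub> inv\<^bsub>Q\<^esub> a | x. x \<in> I}"
    and S: "S = generate_ring Q (carrier R \<union> K)"
    and c: "\<cc> = colon Q (carrier R) S"
    and n: "n \<ge> 1"
    and L: "L = S \<times> K"
    and A2: "A\<^sub>2 = double_fiber_product R \<cc>"
    and A3: "A\<^sub>3 = idealization R \<cc>"
    and E1: "E\<^sub>1 = quasi_trivial_extension (Q\<lparr>carrier := S\<rparr>) \<one>\<^bsub>Q\<^esub> S"
    and E0: "E\<^sub>0 = quasi_trivial_extension (Q\<lparr>carrier := S\<rparr>) \<zero>\<^bsub>Q\<^esub> S"
  shows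
    "((n_goto n R \<and> min_gens R (subquot Q (ideal_prod Q K K) K) = 1) \<longleftrightarrow>
      (n_goto n A\<^sub>2 \<and>
       min_gens A\<^sub>2 (restrict_scalars (fiber_to_quasi R) (subquot E\<^sub>1 (ideal_prod E\<^sub>1 L L) L)) = 1)) \<and>
     ((n_goto n A\<^sub>2 \<and>
       min_gens A\<^sub>2 (restrict_scalars (fiber_to_quasi R) (subquot E\<^sub>1 (ideal_prod E\<^sub>1 L L) L)) = 1) \<longleftrightarrow>
      (n_goto n A\<^sub>3 \<and> min_gens A\<^sub>3 (subquot E\<^sub>0 (ideal_prod E\<^sub>0 L L) L) = 1))"
proof -
  interpret P: param_overring R Q a by (rule param_overring_total[OF CM dim Q a(1)])
  have Iid: "ideal I R" "I \<noteq> carrier R" using I by (simp_all add: canonical_ideal_def)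
  have Is: "P.smod I" "I \<subseteq> carrier R" using Iid(1) P.ideal_iff by blast+
  have aI: "a \<in> I" using a(2) P.A.cgenideal_self[OF P.a_A(1)] unfolding is_reduction_def by blast
  \<comment> \<open>The exponent 1 works because a itself lies in I.\<close>
  have Ifrac: "P.frac I" unfolding P.frac_def
    by (intro conjI Is(1) exI[of _ "1::nat"] ballI) (use aI Is(2) P.a_A P.A_closed(1) in auto)
  have It: "P.type1 I" using I P.canonical_ideal_iff[OF CM dim Is Iid(2) Ifrac] by blast
  have inv: "inv\<^bsub>Q\<^esub> a \<in> Units Q" "inv\<^bsub>Q\<^esub> a \<in> carrier Q" "inv\<^bsub>Q\<^esub> (inv\<^bsub>Q\<^esub> a) = a"
    using P.a_unit by (simp_all add: P.E.Units_inv_Units)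
  have "x \<otimes>\<^bsub>Q\<^esub> inv\<^bsub>Q\<^esub> a = inv\<^bsub>Q\<^esub> a \<otimes>\<^bsub>Q\<^esub> x" if "x \<in> I" for x
    using that Is(2) inv(2) by (auto intro: P.E.m_comm)
  then have K': "K = P.scal (inv\<^bsub>Q\<^esub> a) I" unfolding K P.scal_def by force
  have Kt: "P.type1 K" unfolding K' by (rule P.type1_scal[OF It inv(1)])
  have Kf: "P.frac K" unfolding K'
    by (rule P.frac_scal[OF Ifrac inv(1), of 1]) (use P.a_unit P.A_closed(1,6) P.a_A in \<open>auto simp: inv(3)\<close>)
  have K1: "\<one>\<^bsub>Q\<^esub> \<in> K" unfolding K using aI P.E.Units_r_inv[OF P.a_unit, symmetric] by blast
  have Ks: "P.smod K" using Kf unfolding P.frac_def by blast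
  have Kc: "K \<subseteq> carrier Q" using P.smodD(1)[OF Ks] by blast
  have Ss: "P.smod S" unfolding S by (rule P.smod_generate_ring[OF Kc])
  have Sc: "S \<subseteq> carrier Q" using P.smodD(1)[OF Ss] by blast
  have KS: "K \<subseteq> S" unfolding S by (auto intro: generate_ring.incl)
  have Sm: "s \<otimes>\<^bsub>Q\<^esub> t \<in> S" if "s \<in> S" "t \<in> S" for s t using that unfolding S by (rule generate_ring.eng_mult)
  obtain N :: nat where "\<And>s. s \<in> generate_ring Q (carrier R \<union> P.scal (inv\<^bsub>Q\<^esub> a) I) \<Longrightarrow> a [^]\<^bsub>Q\<^esub> N \<otimes>\<^bsub>Q\<^esub> s \<in> carrier R"
    by (rule P.reduction_bounded[OF Is a(2)]) (rule that)
  then have N: "a [^]\<^bsub>Q\<^esub> N \<otimes>\<^bsub>Q\<^esub> s \<in> carrier R" if "s \<in> S" for s using that unfolding S K' by blast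
  have c': "\<cc> = {z \<in> carrier Q. \<forall>s\<in>S. z \<otimes>\<^bsub>Q\<^esub> s \<in> carrier R}" unfolding c colon_def ..
  have cc: "ideal \<cc> R"
  proof -
    have "z \<in> carrier R" if z: "z \<in> \<cc>" for z
    proof -
      have "z \<in> carrier Q" "z \<otimes>\<^bsub>Q\<^esub> \<one>\<^bsub>Q\<^esub> \<in> carrier R" using z K1 KS unfolding c' by blast+
      then show ?thesis by simp
    qed
    then show ?thesis unfolding P.ideal_iff using P.smod_colon[OF P.smod_A Sc] unfolding c'[symmetric] by blast
  qed
  \<comment> \<open>The common form of all three conditions: S/K is nonzero and cyclic
    (\<open>gen\<close>), and its length (\<open>len\<close>) is n.\<close>
  define gen where "gen \<longleftrightarrow> S \<noteq> K \<and> cyclic_over (between R (self_module Q) K S) S"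
  define len where "len = chain_len (between R (self_module Q) K S)"
  have inst1: "quasi_extension R Q a K S \<cc> \<alpha> N
      (quasi_trivial_extension R \<alpha> \<cc>) (quasi_trivial_extension Q \<alpha> (carrier Q)) Pair"
    if "\<alpha> \<in> {\<zero>\<^bsub>Q\<^esub>, \<one>\<^bsub>Q\<^esub>}" for \<alpha>
    by (rule P.quasi_trivial_extension_instance(1)[OF P.param_overring_axioms dim Kt Kf K1 Ss KS _ _ c' that])
      (rule Sm N; assumption)+
  have inst2: "quasi_extension R Q a K S \<cc> \<one>\<^bsub>Q\<^esub> N
      (double_fiber_product R \<cc>) (RDirProd Q Q) (\<lambda>x y. (x, x \<oplus>\<^bsub>Q\<^esub> y))"
    by (rule P.quasi_trivial_extension_instance(2)[OF P.param_overring_axioms dim Kt Kf K1 Ss KS _ _ c' _ refl])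
      (rule Sm N insertI2 singletonI; assumption?)+
  have ext: "quasi_extension.ext S Pair X = S \<times> X"
    if "quasi_extension R Q a K S \<cc> \<alpha> N B F Pair" for X \<alpha> and B F :: "('a \<times> 'a) ring"
    using quasi_extension.ext_def[OF that, of X] by auto
  \<comment> \<open>The presentation by pairs is used for both values of \<alpha>, because (2) lets
    the fiber product act on L through \<open>fiber_to_quasi\<close>, that is, through the
    quasi-trivial extension.\<close>
  have gens: "min_gens (quasi_trivial_extension R \<alpha> \<cc>)
      (subquot T (ideal_prod T L L) L) = 1 \<longleftrightarrow> gen"
    if \<alpha>: "\<alpha> \<in> {\<zero>\<^bsub>Q\<^esub>, \<one>\<^bsub>Q\<^esub>}" and T: "T = quasi_trivial_extension (Q\<lparr>carrier := S\<rparr>) \<alpha> S" for \<alpha> T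
  proof -
    have T': "T = (quasi_trivial_extension Q \<alpha> (carrier Q))\<lparr>carrier := S \<times> S\<rparr>"
      unfolding T by (simp add: quasi_trivial_extension_def)
    show ?thesis
      using quasi_extension.min_gens_ext[OF inst1[OF \<alpha>]]
      unfolding ext[OF inst1[OF \<alpha>]] T' L subquot_carrier_update ideal_prod_carrier_update gen_def
      by blast
  qed
  \<comment> \<open>In (2) this is applied to the fiber product in its own presentation inside Q x
    Q, so the Goto property stays on the ring for which it is asserted. The assumption that S
    differs from K is supplied by \<open>gen\<close>.\<close>
  have goto: "n_goto n B \<longleftrightarrow> len = enat n"
    if "S \<noteq> K" "quasi_extension R Q a K S \<cc> \<alpha> N B F h" for \<alpha> h and B F :: "('a \<times> 'a) ring"
    unfolding len_def
    by (rule proper_quasi_extension.n_goto_ext_iff[OF proper_quasi_extension.intro[OF that(2)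
        proper_quasi_extension_axioms.intro[OF that(1)]]])
  have 1: "n_goto n R \<and> min_gens R (subquot Q (ideal_prod Q K K) K) = 1 \<longleftrightarrow> len = enat n \<and> gen"
    using P.n_goto_iff[OF CM dim Kt Kf K1 KS Sc Sm N, of n] P.square_iff[OF Ks K1 S, of "enat n"]
    unfolding len_def gen_def by blast
  have img: "fiber_to_quasi R ` carrier A\<^sub>2 = carrier (quasi_trivial_extension R \<one>\<^bsub>Q\<^esub> \<cc>)"
    using fiber_to_quasi_iso[OF P.A.is_cring cc] unfolding A2 ring_iso_def bij_betw_def P.A_ops(3) by blast
  have 2: "n_goto n A\<^sub>2 \<and>
       min_gens A\<^sub>2 (restrict_scalars (fiber_to_quasi R) (subquot E\<^sub>1 (ideal_prod E\<^sub>1 L L) L)) = 1 \<longleftrightarrow>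
     len = enat n \<and> gen"
    unfolding min_gens_restrict_scalars[OF img] gens[OF _ E1, simplified]
    using goto[OF _ inst2] unfolding A2 gen_def by auto
  have A3': "A\<^sub>3 = quasi_trivial_extension R \<zero>\<^bsub>Q\<^esub> \<cc>" unfolding A3 idealization_def P.A_zero ..
  have 3: "n_goto n A\<^sub>3 \<and> min_gens A\<^sub>3 (subquot E\<^sub>0 (ideal_prod E\<^sub>0 L L) L) = 1 \<longleftrightarrow> len = enat n \<and> gen"
    unfolding A3' gens[OF _ E0, simplified]
    using goto[OF _ inst1[of "\<zero>\<^bsub>Q\<^esub>"]] unfolding gen_def by auto
  show ?thesis unfolding 1 2 3 by simp
qed

end
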